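(* Let $V:\mathbb{R}\to\mathbb{R}$ be measurable, locally bounded and bounded from below. Let $\alpha,\beta\in\mathbb{R}$ with $\alpha\neq0$, and suppose that it is not the case that both $\beta=0$ and $\alpha\neq1$. Then there exist real-valued compactly supported functions $\phi_1,\phi_2\in L_2(\mathbb{R})$ with zero means and a real-valued, measurable, bounded, compactly supported function $q$ such that the operators $$S_\varepsilon=S_0+\varepsilon^{-3}B_\varepsilon+\varepsilon^{-1}q\left(\tfrac{x}{\varepsilon}\right)$$ converge, as $\varepsilon\to0^+$, in the norm resolvent sense in $L_2(\mathbb{R})$ to the operator $S_{\alpha\beta}$.
   Context: $S_0=-\frac{d^2}{dx^2}+V$ is the self-adjoint Schrödinger operator in $L_2(\mathbb{R})$, with domain $\operatorname{dom}S_0=\{f\in L_2(\mathbb{R}): f,f' \text{ locally absolutely continuous},\ -f''+Vf\in L_2(\mathbb{R})\}$. For $\varepsilon>0$, $$(B_\varepsilon v)(x)=\phi_1\left(\tfrac{x}{\varepsilon}\right)\int_{\mathbb{R}}\phi_2\left(\tfrac{s}{\varepsilon}\right)v(s)\,ds+\phi_2\left(\tfrac{x}{\varepsilon}\right)\int_{\mathbb{R}}\phi_1\left(\tfrac{s}{\varepsilon}\right)v(s)\,ds,$$ and $q(x/\varepsilon)$ acts as a multiplication operator; $S_\varepsilon$ is self-adjoint with $\operatorname{dom}S_\varepsilon=\operatorname{dom}S_0$. $\mathcal{V}$ is the space of $f\in L_2(\mathbb{R})$ such that $f=f_-$ on $(-\infty,0)$ and $f=f_+$ on $(0,\infty)$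 for some $f_-,f_+\in\operatorname{dom}S_0$. For real $\alpha\ne0$ and $\beta$, $S_{\alpha\beta}f=-f''+Vf$ on $\mathbb{R}\setminus\{0\}$ with $$\operatorname{dom}S_{\alpha\beta}=\{f\in\mathcal{V}: f(+0)=\alpha f(-0)+\beta f'(-0),\ f'(+0)=\alpha^{-1}f'(-0)\}.$$ Norm resolvent convergence $S_\varepsilon\to S_{\alpha\beta}$ means $\|(S_\varepsilon-\zeta)^{-1}-(S_{\alpha\beta}-\zeta)^{-1}\|\to0$ in operator norm for $\zeta\in\mathbb{C}\setminus\mathbb{R}$. *)

theory Defs
  imports "HOL-Analysis.Analysis"
begin

section \<open>Square-integrable functions\<close>

text \<open>
  Elements of L_2 are handled through representatives, identified when they agree almost
  everywhere. A class belongs to the domain of an operator below if it has a representative in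
  the given set of functions.
\<close>

definition L2 :: "(real \<Rightarrow> 'b::real_normed_vector) set" where
  "L2 = {f. f \<in> borel_measurable lebesgue \<and> integrable lebesgue (\<lambda>x. (norm (f x))\<^sup>2)}"

definition L2norm :: "(real \<Rightarrow> 'b::real_normed_vector) \<Rightarrow> real" where
  "L2norm f = sqrt (LINT x|lebesgue. (norm (f x))\<^sup>2)"

definition compactly_supported :: "(real \<Rightarrow> 'b::zero) \<Rightarrow> bool" where
  "compactly_supported f \<longleftrightarrow> compact (closure {x. f x \<noteq> 0})"

definition zero_mean :: "(real \<Rightarrow> real) \<Rightarrow> bool" where
  "zero_mean f \<longleftrightarrow> (LINT x|lebesgue. f x) = 0"

definition locally_bounded :: "(real \<Rightarrow> real) \<Rightarrow> bool" where
  "locally_bounded V \<longleftrightarrow> (\<forall>K. compact K \<longrightarrow> bounded (V ` K))"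


section \<open>Absolute continuity\<close>

definition absolutely_continuous_on_interval ::
  "real \<Rightarrow> real \<Rightarrow> (real \<Rightarrow> 'b::real_normed_vector) \<Rightarrow> bool" where
  "absolutely_continuous_on_interval a b f \<longleftrightarrow>
     (\<forall>e>0. \<exists>d>0. \<forall>(n::nat) u v.
        (\<forall>i<n. a \<le> u i \<and> u i \<le> v i \<and> v i \<le> b) \<and>
        disjoint_family_on (\<lambda>i. {u i<..<v i}) {..<n} \<and>
        (\<Sum>i<n. v i - u i) < d \<longrightarrow>
        (\<Sum>i<n. norm (f (v i) - f (u i))) < e)"

definition locally_absolutely_continuous :: "(real \<Rightarrow> 'b::real_normed_vector) \<Rightarrow> bool" where
  "locally_absolutely_continuous f \<longleftrightarrow> (\<forall>a b. absolutely_continuous_on_interval a b f)"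


section \<open>Unbounded operators, resolvents, norm resolvent convergence\<close>

text \<open>
  An operator in L_2 is a pair of a domain (given by representatives) and an action. The
  action matters only on the domain, and its values only up to null sets.
\<close>

type_synonym L2_operator = "(real \<Rightarrow> complex) set \<times> ((real \<Rightarrow> complex) \<Rightarrow> real \<Rightarrow> complex)"

definition solves_resolvent_eq ::
  "L2_operator \<Rightarrow> complex \<Rightarrow> (real \<Rightarrow> complex) \<Rightarrow> (real \<Rightarrow> complex) \<Rightarrow> bool" where
  "solves_resolvent_eq A z g f \<longleftrightarrow> f \<in> fst A \<and> (AE x in lebesgue. snd A f x - z * f x = g x)"

text \<open>
  On the resolvent set (below) solutions are unique up to null sets, so that there the choice
  only selects a representative.
\<close>

definition resolvent :: "L2_operator \<Rightarrow> complex \<Rightarrow> (real \<Rightarrow> complex) \<Rightarrow> real \<Rightarrow> complex" where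
  "resolvent A z g = (SOME f. solves_resolvent_eq A z g f)"

definition resolvent_set :: "L2_operator \<Rightarrow> complex set" where
  "resolvent_set A =
     {z. (\<forall>g\<in>L2. (\<exists>f. solves_resolvent_eq A z g f) \<and>
            (\<forall>f1 f2. solves_resolvent_eq A z g f1 \<and> solves_resolvent_eq A z g f2 \<longrightarrow>
               (AE x in lebesgue. f1 x = f2 x))) \<and>
         (\<exists>C. \<forall>g\<in>L2. L2norm (resolvent A z g) \<le> C * L2norm g)}"

definition L2_opnorm :: "((real \<Rightarrow> complex) \<Rightarrow> real \<Rightarrow> complex) \<Rightarrow> real" where
  "L2_opnorm R = (SUP g\<in>{g \<in> L2. L2norm g \<le> 1}. L2norm (R g))"

text \<open>
  The requirement that all nonreal points belong to the resolvent sets holds automatically for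
  self-adjoint operators. It makes the resolvents below well defined and bounded, and the
  supremum in the operator norm finite.
\<close>

definition norm_resolvent_convergence ::
  "('i \<Rightarrow> L2_operator) \<Rightarrow> L2_operator \<Rightarrow> 'i filter \<Rightarrow> bool" where
  "norm_resolvent_convergence S A F \<longleftrightarrow>
     - \<real> \<subseteq> resolvent_set A \<and>
     (\<forall>\<^sub>F i in F. - \<real> \<subseteq> resolvent_set (S i)) \<and>
     (\<forall>z. z \<notin> \<real> \<longrightarrow>
        ((\<lambda>i. L2_opnorm (\<lambda>g x. resolvent (S i) z g x - resolvent A z g x)) \<longlongrightarrow> 0) F)"


section \<open>The Schroedinger operators\<close>

definition deriv1 :: "(real \<Rightarrow> complex) \<Rightarrow> real \<Rightarrow> complex" where
  "deriv1 f x = vector_derivative f (at x)"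

text \<open>
  The second derivative is only meant almost everywhere; elsewhere its value is irrelevant.
\<close>

definition schroedinger_expr ::
  "(real \<Rightarrow> real) \<Rightarrow> (real \<Rightarrow> complex) \<Rightarrow> real \<Rightarrow> complex" where
  "schroedinger_expr V f x = - deriv1 (deriv1 f) x + complex_of_real (V x) * f x"

definition dom_S0 :: "(real \<Rightarrow> real) \<Rightarrow> (real \<Rightarrow> complex) set" where
  "dom_S0 V = {f \<in> L2. (\<forall>x. f differentiable (at x)) \<and>
     locally_absolutely_continuous f \<and> locally_absolutely_continuous (deriv1 f) \<and>
     schroedinger_expr V f \<in> L2}"

definition B_pert ::
  "(real \<Rightarrow> real) \<Rightarrow> (real \<Rightarrow> real) \<Rightarrow> real \<Rightarrow> (real \<Rightarrow> complex) \<Rightarrow> real \<Rightarrow> complex" where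
  "B_pert \<phi>1 \<phi>2 \<epsilon> v x =
     complex_of_real (\<phi>1 (x / \<epsilon>)) * (LINT s|lebesgue. complex_of_real (\<phi>2 (s / \<epsilon>)) * v s) +
     complex_of_real (\<phi>2 (x / \<epsilon>)) * (LINT s|lebesgue. complex_of_real (\<phi>1 (s / \<epsilon>)) * v s)"

definition S_eps ::
  "(real \<Rightarrow> real) \<Rightarrow> (real \<Rightarrow> real) \<Rightarrow> (real \<Rightarrow> real) \<Rightarrow> (real \<Rightarrow> real) \<Rightarrow> real \<Rightarrow> L2_operator" where
  "S_eps V \<phi>1 \<phi>2 q \<epsilon> =
     (dom_S0 V,
      \<lambda>f x. schroedinger_expr V f x
             + complex_of_real (1 / \<epsilon> ^ 3) * B_pert \<phi>1 \<phi>2 \<epsilon> f x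
             + complex_of_real (1 / \<epsilon> * q (x / \<epsilon>)) * f x)"

definition V_space :: "(real \<Rightarrow> real) \<Rightarrow> (real \<Rightarrow> complex) set" where
  "V_space V = {f \<in> L2. \<exists>fm\<in>dom_S0 V. \<exists>fp\<in>dom_S0 V.
     (\<forall>x<0. f x = fm x) \<and> (\<forall>x>0. f x = fp x)}"

text \<open>For elements of \<^const>\<open>V_space\<close> the one-sided limits below exist.\<close>

definition S_ab :: "(real \<Rightarrow> real) \<Rightarrow> real \<Rightarrow> real \<Rightarrow> L2_operator" where
  "S_ab V \<alpha> \<beta> =
     ({f \<in> V_space V.
         Lim (at_right 0) f = complex_of_real \<alpha> * Lim (at_left 0) f
                              + complex_of_real \<beta> * Lim (at_left 0) (deriv1 f) \<and>
         Lim (at_right 0) (deriv1 f) = complex_of_real (1 / \<alpha>) * Lim (at_left 0) (deriv1 f)},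
      schroedinger_expr V)"

end

(*
  Take phi_1 = phi equal to 1 on (-1,0] and -1 on (0,1], and phi_2 = -(3/4) phi. Then
  -d^2/dx^2 + B_1 has the half-bound state h with h'' = phi, h = 0 on the left and h = 1 on the
  right, so that the solution f of (S_eps - z) f = g behaves on [-2 eps, 2 eps] like
  f(-2 eps) + (f(2 eps) - f(-2 eps)) h(x / eps). Testing the equation against 1 and h gives
  the jump relations
    f'(2 eps) - f'(-2 eps) = q_0 f(-2 eps) + q_1 (f(2 eps) - f(-2 eps)),
    f'(2 eps)              = q_1 f(-2 eps) + q_2 (f(2 eps) - f(-2 eps))
  up to O(sqrt eps) |g|, where q_j is the integral of q h^j. They are the coupling conditions of
  S_{alpha beta} precisely for
    q_0 = (1 - alpha)^2 / (alpha beta), q_1 = (1 - alpha) / (alpha beta), q_2 = 1 / (alpha beta),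
  and three free values of a step function q suffice to prescribe q_0, q_1, q_2.

  Outside [-2 eps, 2 eps] the difference of the two resolvent solutions solves the homogeneous
  equation. The imaginary part of the energy identity expresses its norm through the Lagrange
  brackets at the endpoints, and these are small because the coupling conditions hold
  approximately. Hence the squared norm of the difference is O(sqrt eps) |g|^2.

  Nonreal points are in the resolvent set of S_{alpha beta} because the coupled Dirichlet problems
  on [-n, n] are uniquely solvable with norm bounds uniform in n, and in that of S_eps because it
  is a rank-one perturbation of a Schroedinger operator.
*)

theory Submission
  imports Defs
begin

section \<open>Indefinite integrals and absolute continuity\<close>

text \<open>The values of \<open>q_j\<close> result from solving the jump relations. With
  \<open>a\<close>, \<open>b\<close> the values of \<open>f\<close> at the left and right end, the
  second relation reads \<open>f'(2 eps) = (b - \<alpha> a) / (\<alpha> \<beta>)\<close>; the first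
  then becomes \<open>f'(2 eps) - f'(-2 eps) = (1 - \<alpha>) f'(2 eps)\<close>, so that
  \<open>f'(-2 eps) = \<alpha> f'(2 eps)\<close> and
  \<open>b - \<alpha> a = \<beta> f'(-2 eps)\<close>. Testing against \<open>h\<close> leaves no
  term of negative order in \<open>eps\<close>, because the rank-one term cancels against
  \<open>h''\<close> exactly. The error is a square root because \<open>g\<close>, being only square
  integrable, has an integral of that order over a zone of length \<open>4 eps\<close>.

  Division by \<beta> restricts this to nonzero \<beta>. For \<beta> = 0 and \<alpha> = 1 the zero
  perturbation serves, since \<open>S_ab\<close> then extends \<open>S_0\<close>.

  Two obstacles shape the proof. Domains are described by absolute continuity, so every integration
  by parts rests on identifying locally absolutely continuous functions with indefinite integrals.
  And nothing is assumed about derivatives at infinity: that the boundary terms vanish there has to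
  be extracted from square integrability and the lower bound of \<open>V\<close>.\<close>

definition prim :: "(real \<Rightarrow> 'b::euclidean_space) \<Rightarrow> (real \<Rightarrow> 'b) \<Rightarrow> bool" where
  "prim F w \<longleftrightarrow> (\<forall>x y. x \<le> y \<longrightarrow>
     w absolutely_integrable_on {x..y} \<and> (w has_integral (F y - F x)) {x..y})"

section \<open>Lebesgue differentiation of indefinite integrals\<close>

lemma measure_Un_cball_le:
  fixes c r :: "'i \<Rightarrow> real"
  assumes "finite I" "\<And>i. i \<in> I \<Longrightarrow> r i \<ge> 0"
  shows "measure lebesgue (\<Union>i\<in>I. cball (c i) (5 * r i)) \<le> 5 * (\<Sum>i\<in>I. 2 * r i)"
proof -
  have "measure lebesgue (\<Union>i\<in>I. cball (c i) (5 * r i)) \<le> (\<Sum>i\<in>I. measure lebesgue (cball (c i) (5 * r i)))"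
    by (rule measure_UNION_le) (use assms in auto)
  also have "\<dots> = (\<Sum>i\<in>I. 10 * r i)"
    by (rule sum.cong) (use assms in \<open>auto simp: cball_eq_atLeastAtMost\<close>)
  finally show ?thesis by (simp add: sum_distrib_left)
qed

text \<open>
  By Henstock's lemma the errors over a fine partial division are small in sum, and Vitali's
  covering argument extracts from the bad points a disjoint family controlling their measure.
\<close>

lemma negligible_bad_derivative_points:
  fixes F :: "real \<Rightarrow> 'b::euclidean_space"
  assumes P: "prim F w" and k: "k > 0"
  shows "negligible {x\<in>{a<..<b}. \<forall>d>0. \<exists>y. 0 < \<bar>y - x\<bar> \<and> \<bar>y - x\<bar> < d \<and>
            \<bar>y - x\<bar> < k * norm (F y - F x - (y - x) *\<^sub>R w x)}" (is "negligible ?E")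
  unfolding negligible_outer_le
proof (intro allI impI)
  fix e :: real assume e: "e > 0"
  have wab: "w integrable_on cbox a b"
  proof (cases "a \<le> b")
    case True then show ?thesis using P by (auto simp: prim_def has_integral_integrable_integral)
  qed auto
  \<comment> \<open>The 5 is the enlargement factor in Vitali's covering lemma; \<open>k\<close>
    converts Henstock errors into lengths.\<close>
  define e' where "e' = e / (5 * k)"
  have e': "e' > 0" using e k by (simp add: e'_def)
  obtain \<gamma> where g: "gauge \<gamma>" and H: "\<And>p. \<lbrakk>p tagged_partial_division_of (cbox a b); \<gamma> fine p\<rbrakk> \<Longrightarrow>
             sum (\<lambda>(x,k). norm(measure lborel k *\<^sub>R w x - integral k w)) p < e'"
  proof (rule Henstock_lemma[OF wab e'])
    fix \<gamma> :: "real \<Rightarrow> real set"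
    assume 1: "gauge \<gamma>" and 2: "\<And>p. \<lbrakk>p tagged_partial_division_of (cbox a b); \<gamma> fine p\<rbrakk> \<Longrightarrow>
             sum (\<lambda>(x,k). norm(measure lborel k *\<^sub>R w x - integral k w)) p < e'"
    show thesis by (rule that[OF 1 2])
  qed
  define seg where "seg = (\<lambda>i::real\<times>real. {min (fst i) (snd i)..max (fst i) (snd i)})"
  define c where "c = (\<lambda>i::real\<times>real. (fst i + snd i) / 2)"
  define r where "r = (\<lambda>i::real\<times>real. \<bar>snd i - fst i\<bar> / 2)"
  \<comment> \<open>An index pairs a point with a nearby point witnessing that it is bad. The
    segment between them has its tag at an endpoint, so it can belong to a tagged partial division,
    and its length is less than \<open>k\<close> times its Henstock error.\<close>
  define K where "K = {i. fst i \<noteq> snd i \<and> seg i \<subseteq> \<gamma> (fst i) \<and> seg i \<subseteq> {a<..<b} \<and>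
     \<bar>snd i - fst i\<bar> < k * norm (F (snd i) - F (fst i) - (snd i - fst i) *\<^sub>R w (fst i))}"
  have segc: "cball (c i) (r i) = seg i" for i
    by (auto simp: c_def r_def seg_def cball_eq_atLeastAtMost min_def max_def field_simps)
  have cov: "?E \<subseteq> (\<Union>i\<in>K. cball (c i) (r i))"
  proof
    fix x assume x: "x \<in> ?E"
    have "open (\<gamma> x \<inter> {a<..<b})" "x \<in> \<gamma> x \<inter> {a<..<b}"
      using g x by (auto simp: gauge_def)
    then obtain d where d: "d > 0" "ball x d \<subseteq> \<gamma> x \<inter> {a<..<b}"
      by (meson open_contains_ball)
    obtain y where y: "0 < \<bar>y - x\<bar>" "\<bar>y - x\<bar> < d" "\<bar>y - x\<bar> < k * norm (F y - F x - (y - x) *\<^sub>R w x)"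
      using x d(1) by blast
    have "seg (x, y) \<subseteq> ball x d" using y by (auto simp: seg_def dist_real_def)
    then have "(x, y) \<in> K" using y d unfolding K_def by auto
    moreover have "x \<in> seg (x, y)" by (auto simp: seg_def)
    ultimately show "x \<in> (\<Union>i\<in>K. cball (c i) (r i))" using segc by blast
  qed
  have rK: "0 < r i \<and> r i \<le> \<bar>b - a\<bar>" if "i \<in> K" for i
  proof -
    have "fst i \<in> seg i" "snd i \<in> seg i" by (auto simp: seg_def)
    then have "fst i \<in> {a<..<b}" "snd i \<in> {a<..<b}" using that unfolding K_def by auto
    then show ?thesis using that by (auto simp: r_def K_def)
  qed
  obtain C where C: "countable C" "C \<subseteq> K"
     "pairwise (\<lambda>i j. disjnt (cball (c i) (r i)) (cball (c j) (r j))) C"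
     "?E \<subseteq> (\<Union>i\<in>C. cball (c i) (5 * r i))"
    by (rule Vitali_covering_lemma_cballs[OF cov rK])
  have fin: "5 * (\<Sum>i\<in>I. 2 * r i) \<le> e" if I: "finite I" "I \<subseteq> C" for I
  proof -
    define p where "p = (\<lambda>i. (fst i, seg i)) ` I"
    have disj: "seg i \<inter> seg j = {}" if "i \<in> I" "j \<in> I" "i \<noteq> j" for i j
    proof -
      have "i \<in> C" "j \<in> C" using that I by auto
      then have "disjnt (cball (c i) (r i)) (cball (c j) (r j))"
        using C(3) \<open>i \<noteq> j\<close> by (simp add: pairwise_def)
      then show ?thesis by (simp add: segc disjnt_def)
    qed
    have ne: "seg i \<noteq> {}" for i by (auto simp: seg_def min_def max_def)
    have inj: "inj_on (\<lambda>i. (fst i, seg i)) I"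
    proof (rule inj_onI)
      fix i j assume ij: "i \<in> I" "j \<in> I" "(fst i, seg i) = (fst j, seg j)"
      show "i = j"
      proof (rule ccontr)
        assume "i \<noteq> j"
        from disj[OF ij(1,2) this] ij(3) ne[of i] show False by simp
      qed
    qed
    have part: "p tagged_partial_division_of (cbox a b)"
      unfolding tagged_partial_division_of_def
    proof (intro conjI allI impI)
      show "finite p" using I by (simp add: p_def)
    next
      fix x1 k1 assume "(x1, k1) \<in> p"
      then obtain i where i: "i \<in> I" "x1 = fst i" "k1 = seg i" by (auto simp: p_def)
      then have "i \<in> K" using C I by auto
      then have "seg i \<subseteq> {a<..<b}" by (simp add: K_def)
      then show "k1 \<subseteq> cbox a b" using i by auto
      show "x1 \<in> k1" using i by (auto simp: seg_def)
      show "\<exists>a b. k1 = cbox a b" using i by (auto simp: seg_def)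
    next
      fix x1 k1 x2 k2
      assume "(x1, k1) \<in> p \<and> (x2, k2) \<in> p \<and> (x1, k1) \<noteq> (x2, k2)"
      then obtain i j where "i \<in> I" "k1 = seg i" "j \<in> I" "k2 = seg j" "i \<noteq> j"
        by (auto simp: p_def)
      then have "k1 \<inter> k2 = {}" using disj by auto
      then show "interior k1 \<inter> interior k2 = {}" using interior_subset by blast
    qed
    have "\<gamma> fine p"
      unfolding fine_def
    proof clarify
      fix x k y assume "(x, k) \<in> p" "y \<in> k"
      then obtain i where i: "i \<in> I" "x = fst i" "k = seg i" by (auto simp: p_def)
      then have "i \<in> K" using C(2) I by auto
      then show "y \<in> \<gamma> x" using i \<open>y \<in> k\<close> by (auto simp: K_def)
    qed
    from H[OF part this] have "(\<Sum>(x,k)\<in>p. norm (measure lborel k *\<^sub>R w x - integral k w)) < e'" .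
    then have s: "(\<Sum>i\<in>I. norm (measure lborel (seg i) *\<^sub>R w (fst i) - integral (seg i) w)) < e'"
      unfolding p_def by (subst (asm) sum.reindex[OF inj]) (simp add: o_def)
    have le: "2 * r i \<le> k * norm (measure lborel (seg i) *\<^sub>R w (fst i) - integral (seg i) w)" if "i \<in> I" for i
    proof -
      have iK: "i \<in> K" using that C I by auto
      have "norm (F (snd i) - F (fst i) - (snd i - fst i) *\<^sub>R w (fst i)) =
          norm (measure lborel (seg i) *\<^sub>R w (fst i) - integral (seg i) w)"
      proof (cases "fst i \<le> snd i")
        case True
        then have "(w has_integral F (snd i) - F (fst i)) (seg i)" using P by (simp add: prim_def seg_def)
        then have "integral (seg i) w = F (snd i) - F (fst i)" by (simp add: integral_unique)
        then show ?thesis using True by (simp add: seg_def norm_minus_commute)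
      next
        case False
        then have "(w has_integral F (fst i) - F (snd i)) (seg i)" using P by (simp add: prim_def seg_def)
        then have "F (snd i) - F (fst i) - (snd i - fst i) *\<^sub>R w (fst i) =
            (fst i - snd i) *\<^sub>R w (fst i) - integral (seg i) w"
          by (simp add: integral_unique scaleR_left_diff_distrib)
        then show ?thesis using False by (simp add: seg_def)
      qed
      then show ?thesis using iK by (simp add: K_def r_def)
    qed
    have "5 * (\<Sum>i\<in>I. 2 * r i) \<le> 5 * (\<Sum>i\<in>I. k * norm (measure lborel (seg i) *\<^sub>R w (fst i) - integral (seg i) w))"
      using sum_mono[of I "\<lambda>i. 2 * r i", OF le] by simp
    also have "\<dots> \<le> 5 * (k * e')" using s k by (simp add: sum_distrib_left[symmetric])
    also have "\<dots> = e" using k by (simp add: e'_def)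
    finally show ?thesis .
  qed
  have meas: "measure lebesgue (\<Union>i\<in>I. cball (c i) (5 * r i)) \<le> e" if "I \<subseteq> C" "finite I" for I
  proof -
    have "r i \<ge> 0" for i by (simp add: r_def)
    then have "measure lebesgue (\<Union>i\<in>I. cball (c i) (5 * r i)) \<le> 5 * (\<Sum>i\<in>I. 2 * r i)"
      by (intro measure_Un_cball_le) (use that in auto)
    with fin[of I] that show ?thesis by linarith
  qed
  show "\<exists>T. ?E \<subseteq> T \<and> T \<in> lmeasurable \<and> measure lebesgue T \<le> e"
  proof (intro exI conjI)
    show "?E \<subseteq> (\<Union>i\<in>C. cball (c i) (5 * r i))" by (fact C(4))
    show "(\<Union>i\<in>C. cball (c i) (5 * r i)) \<in> lmeasurable"
      by (rule fmeasurable_UN_bound[OF C(1) _ meas]) auto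
    show "measure lebesgue (\<Union>i\<in>C. cball (c i) (5 * r i)) \<le> e"
      by (rule measure_UN_bound[OF C(1) _ meas]) auto
  qed
qed

text \<open>Where the derivative is not \<open>w x\<close>, the linearisation error exceeds a fixed
  fraction of the increment at arbitrarily small scales. The fractions \<open>1 / (m + 1)\<close>
  and the intervals from \<open>-n\<close> to \<open>n\<close> exhaust these points by countably
  many null sets.\<close>

theorem prim_has_vector_derivative_AE:
  fixes F :: "real \<Rightarrow> 'b::euclidean_space"
  assumes "prim F w"
  shows "AE x in lebesgue. (F has_vector_derivative w x) (at x)"
proof -
  define E where "E = (\<lambda>a b k. {x\<in>{a<..<b}. \<forall>d>0. \<exists>y. 0 < \<bar>y - x\<bar> \<and> \<bar>y - x\<bar> < d \<and>
            \<bar>y - x\<bar> < k * norm (F y - F x - (y - x) *\<^sub>R w x)})"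
  have "negligible (\<Union>n::nat. \<Union>m::nat. E (- real n) (real n) (real (Suc m)))"
    unfolding E_def
    by (intro negligible_Union_nat negligible_bad_derivative_points[OF assms]) simp
  moreover have "{x. \<not> (F has_vector_derivative w x) (at x)} \<subseteq> (\<Union>n::nat. \<Union>m::nat. E (- real n) (real n) (real (Suc m)))"
  proof
    fix x assume "x \<in> {x. \<not> (F has_vector_derivative w x) (at x)}"
    then obtain e where e: "e > 0" "\<And>d. d > 0 \<Longrightarrow> \<exists>y. norm (y - x) < d \<and>
        \<not> norm (F y - F x - (y - x) *\<^sub>R w x) \<le> e * norm (y - x)"
      unfolding has_vector_derivative_def has_derivative_within_alt
      by (auto simp: bounded_linear_scaleR_left)
    obtain m where m: "inverse (real (Suc m)) < e" using e(1) reals_Archimedean by blast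
    obtain n :: nat where n: "\<bar>x\<bar> < real n" using reals_Archimedean2 by blast
    have "\<exists>y. 0 < \<bar>y - x\<bar> \<and> \<bar>y - x\<bar> < d \<and>
            \<bar>y - x\<bar> < real (Suc m) * norm (F y - F x - (y - x) *\<^sub>R w x)" if d: "d > 0" for d
    proof -
      obtain y where y: "norm (y - x) < d" "norm (F y - F x - (y - x) *\<^sub>R w x) > e * norm (y - x)"
        using e(2)[OF d] by force
      have "y \<noteq> x" using y(2) by auto
      have "\<bar>y - x\<bar> = real (Suc m) * (inverse (real (Suc m)) * \<bar>y - x\<bar>)" by simp
      also have "\<dots> < real (Suc m) * norm (F y - F x - (y - x) *\<^sub>R w x)"
      proof (rule mult_strict_left_mono)
        show "inverse (real (Suc m)) * \<bar>y - x\<bar> < norm (F y - F x - (y - x) *\<^sub>R w x)"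
          using y(2) m mult_right_mono[of "inverse (real (Suc m))" e "\<bar>y - x\<bar>"] by simp
      qed simp
      finally show ?thesis using \<open>y \<noteq> x\<close> y(1) by (intro exI[of _ y]) simp
    qed
    then have "x \<in> E (- real n) (real n) (real (Suc m))"
      using n by (simp add: E_def abs_less_iff minus_less_iff)
    then show "x \<in> (\<Union>n::nat. \<Union>m::nat. E (- real n) (real n) (real (Suc m)))"
      by blast
  qed
  ultimately have "negligible {x. \<not> (F has_vector_derivative w x) (at x)}"
    using negligible_subset by blast
  then show ?thesis
    by (simp add: AE_iff_null_sets negligible_iff_null_sets completion.AE_iff_null_sets)
qed

section \<open>Variation of absolutely continuous functions\<close>

text \<open>Sets of nondegenerate intervals replace indexed families: disjoint nonempty intervals
  are automatically distinct, so families can be united, cut and mapped without reindexing.\<close>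

definition interval_family :: "real \<Rightarrow> real \<Rightarrow> (real \<times> real) set \<Rightarrow> bool" where
  "interval_family a b P \<longleftrightarrow> finite P \<and>
     (\<forall>p\<in>P. a \<le> fst p \<and> fst p < snd p \<and> snd p \<le> b) \<and>
     disjoint_family_on (\<lambda>p. {fst p<..<snd p}) P"

definition family_variation :: "(real \<Rightarrow> 'b::real_normed_vector) \<Rightarrow> (real \<times> real) set \<Rightarrow> real" where
  "family_variation F P = (\<Sum>p\<in>P. norm (F (snd p) - F (fst p)))"

definition variation :: "(real \<Rightarrow> 'b::real_normed_vector) \<Rightarrow> real \<Rightarrow> real \<Rightarrow> real" where
  "variation F a b = (SUP P\<in>Collect (interval_family a b). family_variation F P)"

lemma interval_family_empty [simp]: "interval_family a b {}"
  by (simp add: interval_family_def disjoint_family_on_def)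

lemma interval_family_mono:
  "interval_family a b P \<Longrightarrow> a' \<le> a \<Longrightarrow> b \<le> b' \<Longrightarrow> interval_family a' b' P"
  unfolding interval_family_def by force

lemma absolutely_continuous_interval_familyD:
  assumes "absolutely_continuous_on_interval a b F" and "e > 0"
  shows "\<exists>d>0. \<forall>P. interval_family a b P \<longrightarrow> (\<Sum>p\<in>P. snd p - fst p) < d \<longrightarrow> family_variation F P < e"
proof -
  obtain d where d: "d > 0" and D: "\<And>(n::nat) u v.
        (\<forall>i<n. a \<le> u i \<and> u i \<le> v i \<and> v i \<le> b) \<and>
        disjoint_family_on (\<lambda>i. {u i<..<v i}) {..<n} \<and>
        (\<Sum>i<n. v i - u i) < d \<Longrightarrow>
        (\<Sum>i<n. norm (F (v i) - F (u i))) < e"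
    using assms unfolding absolutely_continuous_on_interval_def by blast
  have "family_variation F P < e" if P: "interval_family a b P" and s: "(\<Sum>p\<in>P. snd p - fst p) < d" for P
  proof -
    obtain h where h: "bij_betw h {..<card P} P"
      using P ex_bij_betw_nat_finite[of P] by (auto simp: interval_family_def atLeast0LessThan)
    have hP: "h i \<in> P" if "i < card P" for i
      using h that by (auto simp: bij_betw_def)
    have "disjoint_family_on (\<lambda>i. {fst (h i)<..<snd (h i)}) {..<card P}"
      unfolding disjoint_family_on_def
    proof (intro ballI impI)
      fix i j assume ij: "i \<in> {..<card P}" "j \<in> {..<card P}" "i \<noteq> j"
      then have "h i \<noteq> h j" using h by (auto simp: bij_betw_def inj_on_def)
      moreover have "h i \<in> P" "h j \<in> P" using ij hP by auto
      ultimately show "{fst (h i)<..<snd (h i)} \<inter> {fst (h j)<..<snd (h j)} = {}"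
        using P unfolding interval_family_def disjoint_family_on_def by blast
    qed
    moreover have "\<forall>i<card P. a \<le> fst (h i) \<and> fst (h i) \<le> snd (h i) \<and> snd (h i) \<le> b"
      using P hP by (force simp: interval_family_def)
    moreover have "(\<Sum>i<card P. snd (h i) - fst (h i)) = (\<Sum>p\<in>P. snd p - fst p)"
      by (rule sum.reindex_bij_betw[OF h])
    ultimately have "(\<Sum>i<card P. norm (F (snd (h i)) - F (fst (h i)))) < e"
      using D[of "card P" "fst \<circ> h" "snd \<circ> h"] s by simp
    moreover have "(\<Sum>i<card P. norm (F (snd (h i)) - F (fst (h i)))) = family_variation F P"
      unfolding family_variation_def by (rule sum.reindex_bij_betw[OF h])
    ultimately show ?thesis by simp
  qed
  with d show ?thesis by blast
qed

lemma interval_family_length_le: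
  assumes P: "interval_family a b P" and ab: "a \<le> b"
  shows "(\<Sum>p\<in>P. snd p - fst p) \<le> b - a"
proof -
  have "(\<Sum>p\<in>P. snd p - fst p) = (\<Sum>p\<in>P. measure lebesgue {fst p<..<snd p})"
    by (rule sum.cong) (use P in \<open>auto simp: interval_family_def\<close>)
  also have "\<dots> = measure lebesgue (\<Union>p\<in>P. {fst p<..<snd p})"
    by (rule measure_finite_Union[symmetric]) (use P in \<open>auto simp: interval_family_def\<close>)
  also have "\<dots> \<le> measure lebesgue {a..b}"
  proof (rule measure_mono_fmeasurable)
    have "{fst p<..<snd p} \<subseteq> {a..b}" if "p \<in> P" for p
      using P that by (auto simp: interval_family_def)
    then show "(\<Union>p\<in>P. {fst p<..<snd p}) \<subseteq> {a..b}" by blast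
    show "(\<Union>p\<in>P. {fst p<..<snd p}) \<in> sets lebesgue"
    proof -
      have "open (\<Union>p\<in>P. {fst p<..<snd p})" by auto
      then show ?thesis by (metis borel_open sets_completionI_sets sets_lborel)
    qed
  qed simp
  finally show ?thesis using ab by simp
qed

lemma interval_family_Un:
  assumes P: "interval_family a c P" and Q: "interval_family c b Q" and "a \<le> c" "c \<le> b"
  shows "interval_family a b (P \<union> Q)" "family_variation F (P \<union> Q) = family_variation F P + family_variation F Q"
proof -
  have P1: "a \<le> fst p" "fst p < snd p" "snd p \<le> c" if "p \<in> P" for p
    using P that by (auto simp: interval_family_def)
  have Q1: "c \<le> fst p" "fst p < snd p" "snd p \<le> b" if "p \<in> Q" for p
    using Q that by (auto simp: interval_family_def)
  have disj: "{fst p<..<snd p} \<inter> {fst q<..<snd q} = {}" if "p \<in> P" "q \<in> Q" for p q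
    using P1[OF that(1)] Q1[OF that(2)] by auto
  show "interval_family a b (P \<union> Q)"
    unfolding interval_family_def
  proof (intro conjI)
    show "finite (P \<union> Q)" using P Q by (simp add: interval_family_def)
    show "\<forall>p\<in>P \<union> Q. a \<le> fst p \<and> fst p < snd p \<and> snd p \<le> b"
    proof
      fix p assume "p \<in> P \<union> Q"
      then show "a \<le> fst p \<and> fst p < snd p \<and> snd p \<le> b"
      proof
        assume "p \<in> P" from P1[OF this] show ?thesis using assms(4) by linarith
      next
        assume "p \<in> Q" from Q1[OF this] show ?thesis using assms(3) by linarith
      qed
    qed
    show "disjoint_family_on (\<lambda>p. {fst p<..<snd p}) (P \<union> Q)"
      unfolding disjoint_family_on_def
    proof (intro ballI impI)
      fix p q assume "p \<in> P \<union> Q" "q \<in> P \<union> Q" "p \<noteq> q"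
      then consider "p \<in> P" "q \<in> P" | "p \<in> P" "q \<in> Q" | "p \<in> Q" "q \<in> P" | "p \<in> Q" "q \<in> Q"
        by blast
      then show "{fst p<..<snd p} \<inter> {fst q<..<snd q} = {}"
      proof cases
        case 1 then show ?thesis using P \<open>p \<noteq> q\<close> unfolding interval_family_def disjoint_family_on_def by blast
      next
        case 2 then show ?thesis by (rule disj)
      next
        case 3 then show ?thesis using disj by blast
      next
        case 4 then show ?thesis using Q \<open>p \<noteq> q\<close> unfolding interval_family_def disjoint_family_on_def by blast
      qed
    qed
  qed
  have "P \<inter> Q = {}"
  proof (rule ccontr)
    assume "P \<inter> Q \<noteq> {}"
    then obtain p where p: "p \<in> P" "p \<in> Q" by blast
    show False using P1[OF p(1)] Q1[OF p(2)] by linarith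
  qed
  then show "family_variation F (P \<union> Q) = family_variation F P + family_variation F Q"
    using P Q unfolding family_variation_def interval_family_def by (intro sum.union_disjoint) auto
qed

text \<open>Shrinking every interval preserves disjointness, and since the shrunken intervals stay
  nonempty the shrinking map is injective, which allows sums over the image to be pulled
  back.\<close>

lemma interval_family_image:
  assumes P: "interval_family a b P" and Q: "Q \<subseteq> P"
    and g: "\<And>p. p \<in> Q \<Longrightarrow> fst p \<le> fst (g p) \<and> fst (g p) < snd (g p) \<and> snd (g p) \<le> snd p \<and> a' \<le> fst (g p) \<and> snd (g p) \<le> b'"
  shows "interval_family a' b' (g ` Q)"
    "family_variation F (g ` Q) = (\<Sum>p\<in>Q. norm (F (snd (g p)) - F (fst (g p))))"
proof -
  have sub: "{fst (g p)<..<snd (g p)} \<subseteq> {fst p<..<snd p}" "{fst (g p)<..<snd (g p)} \<noteq> {}" if "p \<in> Q" for p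
    using g[OF that] dense[of "fst (g p)" "snd (g p)"] by auto
  have disj: "{fst (g p)<..<snd (g p)} \<inter> {fst (g q)<..<snd (g q)} = {}" if "p \<in> Q" "q \<in> Q" "p \<noteq> q" for p q
  proof -
    have "{fst p<..<snd p} \<inter> {fst q<..<snd q} = {}"
      using P Q that unfolding interval_family_def disjoint_family_on_def by blast
    then show ?thesis using sub(1)[OF that(1)] sub(1)[OF that(2)] by blast
  qed
  have inj: "inj_on g Q"
  proof (rule inj_onI, rule ccontr)
    fix p q assume pq: "p \<in> Q" "q \<in> Q" "g p = g q" "p \<noteq> q"
    show False using disj[OF pq(1,2,4)] sub(2)[OF pq(1)] pq(3) by simp
  qed
  show "interval_family a' b' (g ` Q)"
    unfolding interval_family_def
  proof (intro conjI)
    show "finite (g ` Q)" using P Q by (auto simp: interval_family_def intro: finite_subset)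
    show "\<forall>p\<in>g ` Q. a' \<le> fst p \<and> fst p < snd p \<and> snd p \<le> b'" using g by auto
    show "disjoint_family_on (\<lambda>p. {fst p<..<snd p}) (g ` Q)"
      unfolding disjoint_family_on_def using disj by auto
  qed
  show "family_variation F (g ` Q) = (\<Sum>p\<in>Q. norm (F (snd (g p)) - F (fst (g p))))"
    unfolding family_variation_def by (simp add: sum.reindex[OF inj])
qed

text \<open>At most one interval contains \<open>c\<close> in its interior; cutting it there can
  only increase the variation, by the triangle inequality.\<close>

lemma interval_family_split:
  fixes F :: "real \<Rightarrow> 'b::real_normed_vector"
  assumes P: "interval_family a b P"
  obtains P1 P2 where "interval_family a c P1" "interval_family c b P2"
    "family_variation F P \<le> family_variation F P1 + family_variation F P2"
proof -
  define L where "L = (\<lambda>p::real\<times>real. (fst p, min (snd p) c))"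
  define R where "R = (\<lambda>p::real\<times>real. (max (fst p) c, snd p))"
  define PL where "PL = {p\<in>P. fst p < c}"
  define PR where "PR = {p\<in>P. snd p > c}"
  have fin: "finite P" and P1: "\<And>p. p \<in> P \<Longrightarrow> a \<le> fst p \<and> fst p < snd p \<and> snd p \<le> b"
    using P by (auto simp: interval_family_def)
  have l: "interval_family a c (L ` PL)"
    "family_variation F (L ` PL) = (\<Sum>p\<in>PL. norm (F (snd (L p)) - F (fst (L p))))"
    by (rule interval_family_image[OF P, where Q = PL and g = L and a' = a and b' = c];
      use P1 in \<open>force simp: PL_def L_def\<close>)+
  have r: "interval_family c b (R ` PR)"
    "family_variation F (R ` PR) = (\<Sum>p\<in>PR. norm (F (snd (R p)) - F (fst (R p))))"
    by (rule interval_family_image[OF P, where Q = PR and g = R and a' = c and b' = b];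
      use P1 in \<open>force simp: PR_def R_def\<close>)+
  have "family_variation F P \<le> (\<Sum>p\<in>P. (if fst p < c then norm (F (snd (L p)) - F (fst (L p))) else 0)
      + (if snd p > c then norm (F (snd (R p)) - F (fst (R p))) else 0))"
    unfolding family_variation_def
  proof (rule sum_mono)
    fix p assume "p \<in> P"
    then have "fst p < snd p" using P1 by auto
    then show "norm (F (snd p) - F (fst p)) \<le> (if fst p < c then norm (F (snd (L p)) - F (fst (L p))) else 0)
      + (if snd p > c then norm (F (snd (R p)) - F (fst (R p))) else 0)"
      using norm_triangle_ineq[of "F (snd p) - F c" "F c - F (fst p)"]
      by (auto simp: L_def R_def min_def max_def)
  qed
  also have "\<dots> = family_variation F (L ` PL) + family_variation F (R ` PR)"
    unfolding l(2) r(2) sum.distrib using fin by (simp add: sum.inter_filter PL_def PR_def)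
  finally show ?thesis using that l r by blast
qed

text \<open>Absolute continuity with tolerance 1 provides a length \<open>d\<close> on which every
  family has variation below 1, and finitely many pieces of length \<open>d/2\<close> cover the
  interval.\<close>

lemma variation_bounded:
  assumes ac: "absolutely_continuous_on_interval a b F"
  shows "bdd_above (family_variation F ` Collect (interval_family a b))"
proof (cases "a \<le> b")
  case False
  then have "Collect (interval_family a b) = {{}}"
    by (auto simp: interval_family_def disjoint_family_on_def) (metis less_le_not_le order_less_le_trans prod.collapse order_trans)
  then show ?thesis by simp
next
  case ab: True
  obtain d where d: "d > 0" and D: "\<And>P. interval_family a b P \<Longrightarrow> (\<Sum>p\<in>P. snd p - fst p) < d \<Longrightarrow> family_variation F P < 1"
    using absolutely_continuous_interval_familyD[OF ac, of 1] by fastforce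
  \<comment> \<open>Induction on the number of pieces, cutting off the last one. Pieces of length
    \<open>d/2\<close> rather than \<open>d\<close> keep the total length strictly below
    \<open>d\<close>.\<close>
  have main: "family_variation F P \<le> real n"
    if "interval_family a c P" "c \<le> b" "a \<le> c" "c - a < real n * (d / 2)" for c P n
    using that
  proof (induction n arbitrary: c P)
    case 0 then show ?case by simp
  next
    case (Suc n)
    show ?case
    proof (cases "c - a < real n * (d/2)")
      case True
      then have "family_variation F P \<le> real n" using Suc by auto
      then show ?thesis by simp
    next
      case False
      define c' where "c' = max a (c - d/2)"
      obtain P1 P2 where P12: "interval_family a c' P1" "interval_family c' c P2"
        "family_variation F P \<le> family_variation F P1 + family_variation F P2"
        by (rule interval_family_split[OF Suc.prems(1)])
      have "c' \<le> c" "a \<le> c'" "c - c' \<le> d/2" using Suc.prems d by (auto simp: c'_def max_def)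
      have 2: "family_variation F P2 \<le> 1"
      proof (rule less_imp_le, rule D)
        show "interval_family a b P2"
          using P12(2) by (rule interval_family_mono) (use \<open>a \<le> c'\<close> Suc.prems in auto)
        show "(\<Sum>p\<in>P2. snd p - fst p) < d"
          using interval_family_length_le[OF P12(2) \<open>c' \<le> c\<close>] \<open>c - c' \<le> d/2\<close> d by linarith
      qed
      have "family_variation F P1 \<le> real n"
      proof (cases "n = 0")
        case True
        then have "c' = a" using Suc.prems d by (auto simp: c'_def max_def)
        then have "P1 = {}" using P12(1) by (force simp: interval_family_def)
        then show ?thesis by (simp add: family_variation_def)
      next
        case n: False
        show ?thesis
        proof (rule Suc.IH[OF P12(1)])
          show "c' \<le> b" using \<open>c' \<le> c\<close> Suc.prems by auto
          have "0 < real n * (d/2)" using n d by simp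
          then show "c' - a < real n * (d / 2)"
            using Suc.prems(4) d by (auto simp: c'_def max_def algebra_simps)
        qed fact
      qed
      then show ?thesis using 2 P12(3) by simp
    qed
  qed
  obtain n where n: "b - a < real n * (d/2)"
    using d reals_Archimedean3[of "d/2"] by (meson half_gt_zero)
  show ?thesis
    by (rule bdd_aboveI[of _ "real n"]) (use main[OF _ _ ab n] in auto)
qed

context
  fixes F :: "real \<Rightarrow> real"
  assumes ac: "locally_absolutely_continuous F"
begin

lemma family_variation_le_variation:
  "interval_family a b P \<Longrightarrow> family_variation F P \<le> variation F a b"
  unfolding variation_def
proof (rule cSUP_upper)
  show "bdd_above (family_variation F ` Collect (interval_family a b))"
    using ac by (intro variation_bounded) (simp add: locally_absolutely_continuous_def)
qed simp

lemma variation_le: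
  "(\<And>P. interval_family a b P \<Longrightarrow> family_variation F P \<le> B) \<Longrightarrow> variation F a b \<le> B"
  unfolding variation_def by (rule cSUP_least) (auto intro: interval_family_empty)

lemma variation_add:
  assumes "a \<le> c" "c \<le> b"
  shows "variation F a b = variation F a c + variation F c b"
proof (rule antisym)
  show "variation F a b \<le> variation F a c + variation F c b"
  proof (rule variation_le)
    fix P assume "interval_family a b P"
    then obtain P1 P2 where "interval_family a c P1" "interval_family c b P2"
      "family_variation F P \<le> family_variation F P1 + family_variation F P2"
      by (rule interval_family_split)
    then show "family_variation F P \<le> variation F a c + variation F c b"
      using family_variation_le_variation[of a c P1] family_variation_le_variation[of c b P2] by linarith
  qed
  have "family_variation F P + family_variation F Q \<le> variation F a b"
    if "interval_family a c P" "interval_family c b Q" for P Q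
    using interval_family_Un[OF that assms] family_variation_le_variation by metis
  then have "variation F a c \<le> variation F a b - family_variation F Q" if "interval_family c b Q" for Q
    using that by (intro variation_le) (simp add: algebra_simps)
  then have "variation F c b \<le> variation F a b - variation F a c"
    by (intro variation_le) (simp add: algebra_simps)
  then show "variation F a c + variation F c b \<le> variation F a b" by simp
qed

lemma abs_diff_le_variation:
  assumes "a \<le> b"
  shows "\<bar>F b - F a\<bar> \<le> variation F a b"
proof (cases "a < b")
  case True
  then have "interval_family a b {(a, b)}" by (simp add: interval_family_def disjoint_family_on_def)
  then show ?thesis using family_variation_le_variation[of a b "{(a, b)}"] by (simp add: family_variation_def)
next
  case False
  then show ?thesis using assms family_variation_le_variation[of a b "{}"] by (simp add: family_variation_def)
qed

text \<open>Each variation is nearly attained by a family inside its interval. The union of these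
  families is again a family, of no greater total length, to which absolute continuity of
  \<open>F\<close> applies.\<close>

lemma variation_absolutely_continuous:
  assumes "e > 0"
  shows "\<exists>d>0. \<forall>P. interval_family a b P \<longrightarrow> (\<Sum>p\<in>P. snd p - fst p) < d \<longrightarrow>
      (\<Sum>p\<in>P. variation F (fst p) (snd p)) \<le> e"
proof -
  have "absolutely_continuous_on_interval a b F" using ac by (simp add: locally_absolutely_continuous_def)
  then obtain d where d: "d > 0" and D: "\<And>P. interval_family a b P \<Longrightarrow> (\<Sum>p\<in>P. snd p - fst p) < d \<Longrightarrow> family_variation F P < e"
    using absolutely_continuous_interval_familyD[OF _ assms] by blast
  have "(\<Sum>p\<in>P. variation F (fst p) (snd p)) \<le> e" if P: "interval_family a b P" and s: "(\<Sum>p\<in>P. snd p - fst p) < d" for P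
  proof (rule field_le_epsilon)
    fix \<eta> :: real assume "\<eta> > 0"
    \<comment> \<open>Each of the \<open>card P\<close> approximations may lose \<open>t\<close>,
      together at most \<open>\<eta>\<close>; the added 1 covers the empty family.\<close>
    define t where "t = \<eta> / (real (card P) + 1)"
    have t: "t > 0" using \<open>\<eta> > 0\<close> by (simp add: t_def)
    have P1: "finite P" "\<And>p. p \<in> P \<Longrightarrow> a \<le> fst p \<and> fst p < snd p \<and> snd p \<le> b"
      using P by (auto simp: interval_family_def)
    have "\<exists>Q. interval_family (fst p) (snd p) Q \<and> variation F (fst p) (snd p) \<le> family_variation F Q + t" for p :: "real \<times> real"
    proof (rule ccontr)
      assume "\<not> ?thesis"
      then have "variation F (fst p) (snd p) \<le> variation F (fst p) (snd p) - t"
        by (intro variation_le) force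
      then show False using t by simp
    qed
    then obtain Q where Q: "\<And>p. interval_family (fst p) (snd p) (Q p)"
      "\<And>p. variation F (fst p) (snd p) \<le> family_variation F (Q p) + t" by metis
    have Q1: "fst p \<le> fst q" "fst q < snd q" "snd q \<le> snd p" if "q \<in> Q p" for p q
      using Q(1)[of p] that by (auto simp: interval_family_def)
    have disj: "{fst q<..<snd q} \<inter> {fst q'<..<snd q'} = {}"
      if "p \<in> P" "p' \<in> P" "p \<noteq> p'" "q \<in> Q p" "q' \<in> Q p'" for p p' q q'
    proof -
      have "{fst p<..<snd p} \<inter> {fst p'<..<snd p'} = {}"
        using P that unfolding interval_family_def disjoint_family_on_def by blast
      moreover have "{fst q<..<snd q} \<subseteq> {fst p<..<snd p}" "{fst q'<..<snd q'} \<subseteq> {fst p'<..<snd p'}"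
        using Q1[OF that(4)] Q1[OF that(5)] by auto
      ultimately show ?thesis by blast
    qed
    have fin: "finite (Q p)" for p using Q(1) by (simp add: interval_family_def)
    have dj: "Q p \<inter> Q p' = {}" if "p \<in> P" "p' \<in> P" "p \<noteq> p'" for p p'
    proof (rule ccontr)
      assume "Q p \<inter> Q p' \<noteq> {}"
      then obtain q where q: "q \<in> Q p" "q \<in> Q p'" by blast
      then have "{fst q<..<snd q} = {}" using disj[OF that q] by simp
      then show False using Q1(2)[OF q(1)] dense[of "fst q" "snd q"] by auto
    qed
    have U: "interval_family a b (\<Union>p\<in>P. Q p)"
      unfolding interval_family_def
    proof (intro conjI)
      show "finite (\<Union>p\<in>P. Q p)" using P1 fin by auto
      show "\<forall>p\<in>\<Union> (Q ` P). a \<le> fst p \<and> fst p < snd p \<and> snd p \<le> b"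
      proof
        fix q assume "q \<in> \<Union> (Q ` P)"
        then obtain p where p: "p \<in> P" "q \<in> Q p" by auto
        show "a \<le> fst q \<and> fst q < snd q \<and> snd q \<le> b"
          using Q1[OF p(2)] P1(2)[OF p(1)] by linarith
      qed
      show "disjoint_family_on (\<lambda>p. {fst p<..<snd p}) (\<Union> (Q ` P))"
        unfolding disjoint_family_on_def
      proof (intro ballI impI)
        fix q q' assume qq: "q \<in> \<Union> (Q ` P)" "q' \<in> \<Union> (Q ` P)" "q \<noteq> q'"
        then obtain p p' where p: "p \<in> P" "q \<in> Q p" "p' \<in> P" "q' \<in> Q p'" by auto
        show "{fst q<..<snd q} \<inter> {fst q'<..<snd q'} = {}"
        proof (cases "p = p'")
          case True
          then show ?thesis using Q(1)[of p] p qq(3) unfolding interval_family_def disjoint_family_on_def by blast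
        next
          case False
          then show ?thesis using disj p by blast
        qed
      qed
    qed
    have sumU: "sum f (\<Union>p\<in>P. Q p) = (\<Sum>p\<in>P. sum f (Q p))" for f :: "real \<times> real \<Rightarrow> real"
      by (rule sum.UNION_disjoint) (use P1 fin dj in auto)
    have "(\<Sum>q\<in>(\<Union>p\<in>P. Q p). snd q - fst q) \<le> (\<Sum>p\<in>P. snd p - fst p)"
      unfolding sumU using interval_family_length_le[OF Q(1)] P1 by (intro sum_mono) force
    then have "family_variation F (\<Union>p\<in>P. Q p) < e" using D[OF U] s by linarith
    then have *: "(\<Sum>p\<in>P. family_variation F (Q p)) < e" by (simp add: family_variation_def sumU)
    have "(\<Sum>p\<in>P. variation F (fst p) (snd p)) \<le> (\<Sum>p\<in>P. family_variation F (Q p) + t)"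
      by (rule sum_mono) (rule Q)
    also have "\<dots> = (\<Sum>p\<in>P. family_variation F (Q p)) + card P * t" by (simp add: sum.distrib)
    also have "card P * t \<le> \<eta>" using \<open>\<eta> > 0\<close> by (simp add: t_def field_simps)
    finally show "(\<Sum>p\<in>P. variation F (fst p) (snd p)) \<le> e + \<eta>" using * by simp
  qed
  with d show ?thesis by blast
qed

end

section \<open>From absolute continuity to an integrable derivative\<close>

text \<open>A bounded null set has a cover by countably many nonoverlapping intervals of total
  length below \<open>d\<close>. Absolute continuity bounds the Stieltjes measure of every finite
  part of the cover by \<open>e\<close>, and continuity from below extends the bound to the whole
  cover.\<close>

lemma interval_measure_null_sets:
  fixes G :: "real \<Rightarrow> real"
  assumes mono: "\<And>x y. x \<le> y \<Longrightarrow> G x \<le> G y" and cont: "continuous_on UNIV G"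
    and ac: "\<And>a b e. e > 0 \<Longrightarrow> \<exists>d>0. \<forall>P. interval_family a b P \<longrightarrow> (\<Sum>p\<in>P. snd p - fst p) < d \<longrightarrow>
        (\<Sum>p\<in>P. G (snd p) - G (fst p)) \<le> e"
    and N: "N \<in> null_sets lborel"
  shows "N \<in> null_sets (interval_measure G)"
proof -
  let ?\<mu> = "interval_measure G"
  have Nb: "N \<in> sets borel" using N by auto
  have main: "emeasure ?\<mu> (N \<inter> cbox (- real (Suc m)) (real (Suc m))) = 0" for m
  proof -
    define r where "r = real (Suc m)"
    have r: "r > 0" by (simp add: r_def)
    let ?S = "N \<inter> cbox (- r) r"
    have "emeasure ?\<mu> ?S \<le> 0 + ennreal e" if e: "e > 0" for e
    proof -
      obtain d where d: "d > 0" and D: "\<And>P. interval_family (-r) r P \<Longrightarrow> (\<Sum>p\<in>P. snd p - fst p) < d \<Longrightarrow>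
        (\<Sum>p\<in>P. G (snd p) - G (fst p)) \<le> e"
        using ac[OF e] by blast
      have "?S \<in> null_sets lborel" using N by (intro null_set_Int2) auto
      then have neg: "negligible ?S" by (simp add: negligible_iff_null_sets null_sets_completionI)
      then have Sl: "?S \<in> lmeasurable" and Sm: "measure lebesgue ?S = 0"
        by (auto simp: negligible_imp_measurable negligible_imp_measure0)
      have d2: "d/2 > 0" using d by simp
      have "\<exists>\<D>. countable \<D> \<and>
        (\<forall>K\<in>\<D>. K \<subseteq> cbox (-r) r \<and> K \<noteq> {} \<and> (\<exists>c d. K = cbox c d) \<and> interior K \<noteq> {}) \<and>
        pairwise (\<lambda>A B. interior A \<inter> interior B = {}) \<D> \<and>
        ?S \<subseteq> \<Union>\<D> \<and> \<Union>\<D> \<in> lmeasurable \<and> measure lebesgue (\<Union>\<D>) \<le> measure lebesgue ?S + d/2"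
      proof (rule measurable_outer_intervals_bounded[OF Sl Int_lower2 d2])
        fix \<D> :: "real set set"
        assume a: "countable \<D>" and b: "\<And>K. K \<in> \<D> \<Longrightarrow> K \<subseteq> cbox (-r) r \<and> K \<noteq> {} \<and> (\<exists>c d. K = cbox c d)"
          and c: "pairwise (\<lambda>A B. interior A \<inter> interior B = {}) \<D>"
          and d: "\<And>K. \<lbrakk>K \<in> \<D>; box (-r) r \<noteq> {}\<rbrakk> \<Longrightarrow> interior K \<noteq> {}"
          and e: "?S \<subseteq> \<Union>\<D>" "\<Union>\<D> \<in> lmeasurable" "measure lebesgue (\<Union>\<D>) \<le> measure lebesgue ?S + d/2"
        have ne: "box (-r) r \<noteq> {}" using r by simp
        have f: "\<forall>K\<in>\<D>. K \<subseteq> cbox (-r) r \<and> K \<noteq> {} \<and> (\<exists>c d. K = cbox c d) \<and> interior K \<noteq> {}"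
        proof
          fix K assume K: "K \<in> \<D>"
          show "K \<subseteq> cbox (-r) r \<and> K \<noteq> {} \<and> (\<exists>c d. K = cbox c d) \<and> interior K \<noteq> {}"
            by (intro conjI b[OF K, THEN conjunct1] b[OF K, THEN conjunct2, THEN conjunct1]
              b[OF K, THEN conjunct2, THEN conjunct2] d[OF K ne])
        qed
        show ?thesis by (intro exI[of _ \<D>] conjI a c e f)
      qed
      then obtain \<D> where D0: "countable \<D> \<and>
        (\<forall>K\<in>\<D>. K \<subseteq> cbox (-r) r \<and> K \<noteq> {} \<and> (\<exists>c d. K = cbox c d) \<and> interior K \<noteq> {}) \<and>
        pairwise (\<lambda>A B. interior A \<inter> interior B = {}) \<D> \<and>
        ?S \<subseteq> \<Union>\<D> \<and> \<Union>\<D> \<in> lmeasurable \<and> measure lebesgue (\<Union>\<D>) \<le> measure lebesgue ?S + d/2"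
        by (rule exE)
      have D2: "\<forall>K\<in>\<D>. K \<subseteq> cbox (-r) r \<and> K \<noteq> {} \<and> (\<exists>c d. K = cbox c d) \<and> interior K \<noteq> {}"
        by (rule D0[THEN conjunct2, THEN conjunct1])
      note DD = D0[THEN conjunct1] bspec[OF D2] D0[THEN conjunct2, THEN conjunct2, THEN conjunct1]
        D0[THEN conjunct2, THEN conjunct2, THEN conjunct2, THEN conjunct1]
        D0[THEN conjunct2, THEN conjunct2, THEN conjunct2, THEN conjunct2, THEN conjunct1]
        D0[THEN conjunct2, THEN conjunct2, THEN conjunct2, THEN conjunct2, THEN conjunct2]
      \<comment> \<open>The intervals have disjoint interiors, so their lengths add up to at most
        the measure of the union of the cover; hence each finite part is an interval family of
        length below \<open>d\<close>.\<close>
      have fin: "emeasure ?\<mu> (\<Union>\<F>) \<le> ennreal e" if F: "finite \<F>" "\<F> \<subseteq> \<D>" for \<F>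
      proof -
        have "\<exists>p. K = {fst p..snd p} \<and> fst p < snd p \<and> -r \<le> fst p \<and> snd p \<le> r" if "K \<in> \<F>" for K
        proof -
          have K: "K \<in> \<D>" using that F by auto
          obtain u v where uv: "K = cbox u v" using DD(2)[OF K] by blast
          have "interior K \<noteq> {}" using DD(2)[OF K] by simp
          then have "u < v" using uv by (simp add: interior_cbox)
          moreover have "u \<in> K" "v \<in> K" using uv \<open>u < v\<close> by auto
          then have "-r \<le> u" "v \<le> r" using DD(2)[OF K] by auto
          ultimately show ?thesis using uv by (intro exI[of _ "(u, v)"]) auto
        qed
        then obtain p where p: "\<And>K. K \<in> \<F> \<Longrightarrow> K = {fst (p K)..snd (p K)} \<and> fst (p K) < snd (p K) \<and> -r \<le> fst (p K) \<and> snd (p K) \<le> r"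
          by metis
        have inj: "inj_on p \<F>" by (rule inj_onI) (metis p)
        have intK: "interior K = {fst (p K)<..<snd (p K)}" if "K \<in> \<F>" for K
          using p[OF that] by (metis box_real(1) cbox_interval interior_cbox)
        have dis: "{fst (p K)<..<snd (p K)} \<inter> {fst (p L)<..<snd (p L)} = {}" if "K \<in> \<F>" "L \<in> \<F>" "K \<noteq> L" for K L
        proof -
          have "K \<in> \<D>" "L \<in> \<D>" using that F by auto
          then have "interior K \<inter> interior L = {}" using DD(3) that(3) by (simp add: pairwise_def)
          then show ?thesis using intK that by simp
        qed
        have fam: "interval_family (-r) r (p ` \<F>)"
          unfolding interval_family_def
        proof (intro conjI)
          show "finite (p ` \<F>)" using F by simp
          show "\<forall>pa\<in>p ` \<F>. - r \<le> fst pa \<and> fst pa < snd pa \<and> snd pa \<le> r" using p by blast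
          show "disjoint_family_on (\<lambda>p. {fst p<..<snd p}) (p ` \<F>)"
            unfolding disjoint_family_on_def using dis by blast
        qed
        have len: "(\<Sum>q\<in>p ` \<F>. snd q - fst q) < d"
        proof -
          have "(\<Sum>q\<in>p ` \<F>. snd q - fst q) = (\<Sum>K\<in>\<F>. snd (p K) - fst (p K))"
            by (simp add: sum.reindex[OF inj])
          also have "\<dots> = (\<Sum>K\<in>\<F>. measure lebesgue {fst (p K)<..<snd (p K)})"
            by (rule sum.cong) (use p in \<open>auto simp: less_imp_le\<close>)
          also have "\<dots> = measure lebesgue (\<Union>K\<in>\<F>. {fst (p K)<..<snd (p K)})"
          proof (rule measure_finite_Union[symmetric])
            show "disjoint_family_on (\<lambda>K. {fst (p K)<..<snd (p K)}) \<F>"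
              unfolding disjoint_family_on_def using dis by blast
            show "emeasure lebesgue {fst (p K)<..<snd (p K)} \<noteq> \<infinity>" if "K \<in> \<F>" for K
              using p[OF that] by simp
          qed (use F in auto)
          also have "\<dots> \<le> measure lebesgue (\<Union>\<D>)"
          proof (rule measure_mono_fmeasurable[OF _ _ DD(5)])
            have "{fst (p K)<..<snd (p K)} \<subseteq> K" if "K \<in> \<F>" for K
              using intK[OF that] interior_subset by metis
            then show "(\<Union>K\<in>\<F>. {fst (p K)<..<snd (p K)}) \<subseteq> \<Union> \<D>" using F by blast
            have "open (\<Union>K\<in>\<F>. {fst (p K)<..<snd (p K)})" by auto
            then show "(\<Union>K\<in>\<F>. {fst (p K)<..<snd (p K)}) \<in> sets lebesgue"
              by (metis borel_open sets_completionI_sets sets_lborel)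
          qed
          also have "\<dots> < d" using DD(6) Sm d by simp
          finally show ?thesis .
        qed
        have "emeasure ?\<mu> (\<Union>K\<in>\<F>. K) \<le> (\<Sum>K\<in>\<F>. emeasure ?\<mu> K)"
        proof (rule emeasure_subadditive_finite[OF F(1)])
          show "(\<lambda>K. K) ` \<F> \<subseteq> sets ?\<mu>"
          proof clarify
            fix K assume "K \<in> \<F>"
            then obtain u v where "K = {u..v}" using p by blast
            then show "K \<in> sets ?\<mu>" by simp
          qed
        qed
        also have "\<dots> = (\<Sum>K\<in>\<F>. ennreal (G (snd (p K)) - G (fst (p K))))"
        proof (rule sum.cong)
          fix K assume "K \<in> \<F>"
          from p[OF this] show "emeasure ?\<mu> K = ennreal (G (snd (p K)) - G (fst (p K)))"
            using emeasure_interval_measure_Icc[OF _ mono cont, of "fst (p K)" "snd (p K)"] by simp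
        qed simp
        also have "\<dots> = ennreal (\<Sum>K\<in>\<F>. G (snd (p K)) - G (fst (p K)))"
          by (rule sum_ennreal) (use p mono in \<open>force simp: less_imp_le\<close>)
        also have "(\<Sum>K\<in>\<F>. G (snd (p K)) - G (fst (p K))) = (\<Sum>q\<in>p ` \<F>. G (snd q) - G (fst q))"
          by (simp add: sum.reindex[OF inj])
        also have "ennreal \<dots> \<le> ennreal e"
          by (rule ennreal_leI) (rule D[OF fam len])
        finally show ?thesis by simp
      qed
      show "emeasure ?\<mu> ?S \<le> 0 + ennreal e"
      proof (cases "\<D> = {}")
        case True
        then have "?S = {}" using DD(4) by simp
        then show ?thesis by simp
      next
        case False
        \<comment> \<open>Finite unions along an enumeration of the cover, possibly with
          repetitions, increasing to its union.\<close>
        define A where "A = (\<lambda>n. \<Union> (from_nat_into \<D> ` {..n}))"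
        have Dn: "from_nat_into \<D> n \<in> \<D>" for n using False by (rule from_nat_into)
        have DS: "K \<in> sets ?\<mu>" if K: "K \<in> \<D>" for K
        proof -
          obtain u v where "K = cbox u v" using DD(2)[OF K] by blast
          then show ?thesis by simp
        qed
        have An: "A n \<in> sets ?\<mu>" for n
          unfolding A_def using DS Dn by (intro sets.finite_Union) auto
        have UA: "(\<Union>n. A n) = \<Union>\<D>"
        proof -
          have "\<Union>\<D> = \<Union> (range (from_nat_into \<D>))" using range_from_nat_into[OF False DD(1)] by simp
          then show ?thesis unfolding A_def by blast
        qed
        have inc: "incseq A" unfolding A_def by (rule incseq_SucI) (force simp: atMost_Suc)
        have "emeasure ?\<mu> ?S \<le> emeasure ?\<mu> (\<Union>n. A n)"
        proof (rule emeasure_mono)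
          show "?S \<subseteq> (\<Union>n. A n)" using DD(4) UA by simp
          show "(\<Union>n. A n) \<in> sets ?\<mu>" by (rule sets.countable_UN) (use An in auto)
        qed
        also have "\<dots> = (SUP n. emeasure ?\<mu> (A n))"
          by (rule SUP_emeasure_incseq[symmetric, OF _ inc]) (use An in blast)
        also have "\<dots> \<le> ennreal e"
        proof (rule SUP_least)
          fix n
          show "emeasure ?\<mu> (A n) \<le> ennreal e"
            unfolding A_def by (rule fin) (use Dn in auto)
        qed
        finally show ?thesis by simp
      qed
    qed
    then have "emeasure ?\<mu> ?S \<le> 0" by (rule ennreal_le_epsilon)
    then show ?thesis by (simp add: r_def)
  qed
  have "N = (\<Union>m. N \<inter> cbox (- real (Suc m)) (real (Suc m)))"
  proof -
    have "\<exists>m. x \<in> cbox (- real (Suc m)) (real (Suc m))" for x :: real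
    proof -
      obtain m where "\<bar>x\<bar> < real m" using reals_Archimedean2 by blast
      then show ?thesis by (intro exI[of _ m]) auto
    qed
    then show ?thesis by blast
  qed
  moreover have "(\<Union>m. N \<inter> cbox (- real (Suc m)) (real (Suc m))) \<in> null_sets ?\<mu>"
  proof (rule null_sets_UN)
    fix m
    show "N \<inter> cbox (- real (Suc m)) (real (Suc m)) \<in> null_sets ?\<mu>"
      using main[of m] Nb by (intro null_setsI) auto
  qed
  ultimately show ?thesis by simp
qed

text \<open>Radon--Nikodym, applied to the Stieltjes measure of \<open>G\<close>.\<close>

lemma mono_absolutely_continuous_imp_prim:
  fixes G :: "real \<Rightarrow> real"
  assumes mono: "\<And>x y. x \<le> y \<Longrightarrow> G x \<le> G y" and cont: "continuous_on UNIV G"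
    and ac: "\<And>a b e. e > 0 \<Longrightarrow> \<exists>d>0. \<forall>P. interval_family a b P \<longrightarrow> (\<Sum>p\<in>P. snd p - fst p) < d \<longrightarrow>
        (\<Sum>p\<in>P. G (snd p) - G (fst p)) \<le> e"
  shows "\<exists>w. prim G w"
proof -
  let ?\<mu> = "interval_measure G"
  have "absolutely_continuous lborel ?\<mu>"
    unfolding absolutely_continuous_def using interval_measure_null_sets[OF assms] by blast
  then obtain f where f: "f \<in> borel_measurable lborel" "density lborel f = ?\<mu>"
    using sigma_finite_measure.Radon_Nikodym[OF sigma_finite_lborel, of ?\<mu>] by auto
  \<comment> \<open>The density has finite integral over every bounded interval, so it is finite
    almost everywhere there and the conversion to real values changes no integral.\<close>
  define w where "w = (\<lambda>x. enn2real (f x))"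
  have fb: "f \<in> borel_measurable borel" using f(1) by simp
  have I: "(\<integral>\<^sup>+x. f x * indicator {x1..x2} x \<partial>lborel) = ennreal (G x2 - G x1)" if "x1 \<le> x2" for x1 x2
  proof -
    have "(\<integral>\<^sup>+x. f x * indicator {x1..x2} x \<partial>lborel) = emeasure (density lborel f) {x1..x2}"
      using f(1) by (simp add: emeasure_density)
    also have "\<dots> = ennreal (G x2 - G x1)"
      unfolding f(2) using that mono cont by (rule emeasure_interval_measure_Icc)
    finally show ?thesis .
  qed
  have hi: "(w has_integral (G y - G x)) {x..y}" if xy: "x \<le> y" for x y
  proof -
    have "AE t in lborel. f t * indicator {x..y} t \<noteq> \<infinity>"
      by (rule nn_integral_noteq_infinite) (use fb I[OF xy] in auto)
    then have "AE t in lborel. ennreal (w t * indicator {x..y} t) = f t * indicator {x..y} t"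
      by eventually_elim (auto simp: w_def indicator_def less_top split: if_splits)
    then have "(\<integral>\<^sup>+t. ennreal (w t * indicator {x..y} t) \<partial>lborel) = ennreal (G y - G x)"
      using I[OF xy] by (simp cong: nn_integral_cong_AE)
    then have "((\<lambda>t. w t * indicator {x..y} t) has_integral (G y - G x)) UNIV"
      by (intro nn_integral_has_integral) (use fb mono[OF xy] in \<open>auto simp: w_def\<close>)
    then have "((\<lambda>t. if t \<in> {x..y} then w t else 0) has_integral (G y - G x)) UNIV"
      by (rule has_integral_eq[rotated]) (auto simp: indicator_def)
    then show ?thesis by (simp only: has_integral_restrict_UNIV)
  qed
  have "prim G w"
    unfolding prim_def
  proof (intro allI impI conjI)
    fix x y :: real assume xy: "x \<le> y"
    show "(w has_integral (G y - G x)) {x..y}" by (rule hi[OF xy])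
    then show "w absolutely_integrable_on {x..y}"
      by (intro nonnegative_absolutely_integrable_1) (auto simp: w_def)
  qed
  then show ?thesis by blast
qed

lemma prim_diff:
  "prim F v \<Longrightarrow> prim G w \<Longrightarrow> prim (\<lambda>x. F x - G x) (\<lambda>x. v x - w x)"
  unfolding prim_def
proof (intro allI impI conjI)
  fix x y :: real
  assume P: "\<forall>x y. x \<le> y \<longrightarrow> v absolutely_integrable_on {x..y} \<and> (v has_integral F y - F x) {x..y}"
    "\<forall>x y. x \<le> y \<longrightarrow> w absolutely_integrable_on {x..y} \<and> (w has_integral G y - G x) {x..y}" and "x \<le> y"
  then have 1: "v absolutely_integrable_on {x..y}" "w absolutely_integrable_on {x..y}"
    and 2: "(v has_integral F y - F x) {x..y}" "(w has_integral G y - G x) {x..y}" by auto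
  show "(\<lambda>x. v x - w x) absolutely_integrable_on {x..y}" using 1 by (rule set_integral_diff)
  show "((\<lambda>x. v x - w x) has_integral F y - G y - (F x - G x)) {x..y}"
    using has_integral_diff[OF 2] by (simp add: algebra_simps)
qed

text \<open>Jordan decomposition: \<open>F\<close> is the difference of its variation function
  \<open>V\<close> and \<open>V - F\<close>, both monotone and absolutely continuous, so the
  monotone case applies to each.\<close>

lemma real_absolutely_continuous_imp_prim:
  fixes F :: "real \<Rightarrow> real"
  assumes ac: "locally_absolutely_continuous F"
  shows "\<exists>w. prim F w"
proof -
  define V where "V = (\<lambda>x. if 0 \<le> x then variation F 0 x else - variation F x 0)"
  have Vd: "V y - V x = variation F x y" if "x \<le> y" for x y
  proof -
    consider "0 \<le> x" | "x < 0" "0 \<le> y" | "y < 0" by linarith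
    then show ?thesis
    proof cases
      case 1 then show ?thesis using that variation_add[OF ac, of 0 x y] by (simp add: V_def)
    next
      case 2 then show ?thesis using that variation_add[OF ac, of x 0 y] by (simp add: V_def)
    next
      case 3 then show ?thesis using that variation_add[OF ac, of x y 0] by (simp add: V_def)
    qed
  qed
  \<comment> \<open>The factor 2 is needed for \<open>V - F\<close>, whose increments are at most
    those of \<open>V\<close> plus the modulus of those of \<open>F\<close>.\<close>
  have main: "\<exists>w. prim G w" if G: "\<And>x y. x \<le> y \<Longrightarrow> 0 \<le> G y - G x \<and> G y - G x \<le> 2 * variation F x y" for G
  proof (rule mono_absolutely_continuous_imp_prim)
    show mono: "G x \<le> G y" if "x \<le> y" for x y using G[OF that] by simp
    show *: "\<exists>d>0. \<forall>P. interval_family a b P \<longrightarrow> (\<Sum>p\<in>P. snd p - fst p) < d \<longrightarrow>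
        (\<Sum>p\<in>P. G (snd p) - G (fst p)) \<le> e" if e: "e > 0" for a b e
    proof -
      have "e / 2 > 0" using e by simp
      from variation_absolutely_continuous[OF ac this, of a b]
      obtain d where d: "d > 0" and D: "\<And>P. interval_family a b P \<Longrightarrow> (\<Sum>p\<in>P. snd p - fst p) < d \<Longrightarrow>
         (\<Sum>p\<in>P. variation F (fst p) (snd p)) \<le> e/2" by blast
      have "(\<Sum>p\<in>P. G (snd p) - G (fst p)) \<le> e"
        if "interval_family a b P" "(\<Sum>p\<in>P. snd p - fst p) < d" for P
      proof -
        have "(\<Sum>p\<in>P. G (snd p) - G (fst p)) \<le> (\<Sum>p\<in>P. 2 * variation F (fst p) (snd p))"
          by (rule sum_mono) (use G that(1) in \<open>auto simp: interval_family_def less_imp_le\<close>)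
        also have "\<dots> = 2 * (\<Sum>p\<in>P. variation F (fst p) (snd p))" by (simp add: sum_distrib_left)
        finally show ?thesis using D[OF that] by simp
      qed
      with d show ?thesis by blast
    qed
    show "continuous_on UNIV G"
      unfolding continuous_on_iff
    proof (intro ballI allI impI)
      fix x e :: real assume "e > 0"
      then have "e/2 > 0" by simp
      from *[OF this, of "x - 1" "x + 1"] obtain d where d: "d > 0"
        and D: "\<And>P. interval_family (x-1) (x+1) P \<Longrightarrow> (\<Sum>p\<in>P. snd p - fst p) < d \<Longrightarrow>
         (\<Sum>p\<in>P. G (snd p) - G (fst p)) \<le> e/2" by blast
      have D1: "G v - G u \<le> e/2" if "x - 1 \<le> u" "u < v" "v \<le> x + 1" "v - u < d" for u v
        using D[of "{(u,v)}"] that by (simp add: interval_family_def disjoint_family_on_def)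
      show "\<exists>d>0. \<forall>x'\<in>UNIV. dist x' x < d \<longrightarrow> dist (G x') (G x) < e"
      proof (intro exI[of _ "min d 1"] conjI ballI impI)
        fix y assume "dist y x < min d 1"
        then have y: "\<bar>y - x\<bar> < d" "\<bar>y - x\<bar> < 1" by (auto simp: dist_real_def)
        consider "y = x" | "y < x" | "x < y" by linarith
        then show "dist (G y) (G x) < e"
        proof cases
          case 2 then show ?thesis using D1[of y x] mono[of y x] y \<open>e > 0\<close> by (auto simp: dist_real_def)
        next
          case 3 then show ?thesis using D1[of x y] mono[of x y] y \<open>e > 0\<close> by (auto simp: dist_real_def)
        qed (use \<open>e > 0\<close> in simp)
      qed (use d in auto)
    qed
  qed
  have ab: "\<bar>F y - F x\<bar> \<le> variation F x y" if "x \<le> y" for x y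
    using abs_diff_le_variation[OF ac that] .
  have "0 \<le> V y - V x \<and> V y - V x \<le> 2 * variation F x y" if "x \<le> y" for x y
    using Vd[OF that] ab[OF that] by (simp add: abs_le_iff)
  from main[OF this] obtain w1 where w1: "prim V w1" by blast
  obtain w2 where w2: "prim (\<lambda>x. V x - F x) w2"
  proof -
    have "0 \<le> (V y - F y) - (V x - F x) \<and> (V y - F y) - (V x - F x) \<le> 2 * variation F x y" if "x \<le> y" for x y
      using Vd[OF that] ab[OF that] by (simp add: abs_le_iff)
    from main[OF this] that show ?thesis by blast
  qed
  from prim_diff[OF w1 w2] have "prim F (\<lambda>x. w1 x - w2 x)" by simp
  then show ?thesis by (rule exI[where x = "\<lambda>x. w1 x - w2 x"])
qed

lemma locally_absolutely_continuous_dominated: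
  assumes "locally_absolutely_continuous F"
    and "\<And>x y. norm (G y - G x) \<le> norm (F y - F x)"
  shows "locally_absolutely_continuous G"
  unfolding locally_absolutely_continuous_def absolutely_continuous_on_interval_def
proof (intro allI impI)
  fix a b e :: real assume "e > 0"
  then obtain d where d: "d > 0" and D: "\<And>(n::nat) u v.
        (\<forall>i<n. a \<le> u i \<and> u i \<le> v i \<and> v i \<le> b) \<and>
        disjoint_family_on (\<lambda>i. {u i<..<v i}) {..<n} \<and>
        (\<Sum>i<n. v i - u i) < d \<Longrightarrow>
        (\<Sum>i<n. norm (F (v i) - F (u i))) < e"
    using assms(1) unfolding locally_absolutely_continuous_def absolutely_continuous_on_interval_def by blast
  show "\<exists>d>0. \<forall>(n::nat) u v. (\<forall>i<n. a \<le> u i \<and> u i \<le> v i \<and> v i \<le> b) \<and>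
        disjoint_family_on (\<lambda>i. {u i<..<v i}) {..<n} \<and> (\<Sum>i<n. v i - u i) < d \<longrightarrow>
        (\<Sum>i<n. norm (G (v i) - G (u i))) < e"
  proof (intro exI[of _ d] conjI allI impI)
    fix n :: nat and u v :: "nat \<Rightarrow> real"
    assume *: "(\<forall>i<n. a \<le> u i \<and> u i \<le> v i \<and> v i \<le> b) \<and>
        disjoint_family_on (\<lambda>i. {u i<..<v i}) {..<n} \<and> (\<Sum>i<n. v i - u i) < d"
    have "(\<Sum>i<n. norm (G (v i) - G (u i))) \<le> (\<Sum>i<n. norm (F (v i) - F (u i)))"
      by (rule sum_mono) (rule assms(2))
    also have "\<dots> < e" by (rule D[OF *])
    finally show "(\<Sum>i<n. norm (G (v i) - G (u i))) < e" .
  qed (rule d)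
qed

lemma absolutely_continuous_imp_prim:
  fixes F :: "real \<Rightarrow> complex"
  assumes "locally_absolutely_continuous F"
  shows "\<exists>w. prim F w"
proof -
  have "locally_absolutely_continuous (\<lambda>x. Re (F x))" "locally_absolutely_continuous (\<lambda>x. Im (F x))"
    by (rule locally_absolutely_continuous_dominated[OF assms];
        simp flip: minus_complex.simps add: abs_Re_le_cmod abs_Im_le_cmod)+
  then obtain v w where vw: "prim (\<lambda>x. Re (F x)) v" "prim (\<lambda>x. Im (F x)) w"
    using real_absolutely_continuous_imp_prim by blast
  have "prim F (\<lambda>x. complex_of_real (v x) + \<i> * complex_of_real (w x))"
    unfolding prim_def
  proof (intro allI impI conjI)
    fix x y :: real assume "x \<le> y"
    then have v: "v absolutely_integrable_on {x..y}" "(v has_integral Re (F y) - Re (F x)) {x..y}"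
      and w: "w absolutely_integrable_on {x..y}" "(w has_integral Im (F y) - Im (F x)) {x..y}"
      using vw by (auto simp: prim_def)
    have bl0: "bounded_linear complex_of_real" by (rule bounded_linear_of_real)
    have bl: "bounded_linear (\<lambda>x. \<i> * complex_of_real x)"
      by (rule bounded_linear_compose[OF bounded_linear_mult_right bounded_linear_of_real])
    show "(\<lambda>x. complex_of_real (v x) + \<i> * complex_of_real (w x)) absolutely_integrable_on {x..y}"
      using absolutely_integrable_linear[OF v(1) bl0]
        absolutely_integrable_linear[OF w(1) bl] by (intro set_integral_add(1)) (auto simp: o_def)
    have "((\<lambda>x. complex_of_real (v x) + \<i> * complex_of_real (w x)) has_integral
        complex_of_real (Re (F y) - Re (F x)) + \<i> * complex_of_real (Im (F y) - Im (F x))) {x..y}"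
      using has_integral_linear[OF v(2) bl0]
        has_integral_linear[OF w(2) bl] by (intro has_integral_add) (auto simp: o_def)
    then show "((\<lambda>x. complex_of_real (v x) + \<i> * complex_of_real (w x)) has_integral F y - F x) {x..y}"
      by (rule back_subst[where P = "\<lambda>c. (_ has_integral c) _"]) (simp add: complex_eq_iff)
  qed
  then show ?thesis by blast
qed

lemma prim_cong_AE:
  assumes "prim F v" and AE: "AE x in lebesgue. v x = w x"
  shows "prim F w"
proof -
  have neg: "negligible {x. v x \<noteq> w x}"
    using AE by (simp add: completion.AE_iff_null_sets AE_iff_null_sets negligible_iff_null_sets)
  show ?thesis
    unfolding prim_def
  proof (intro allI impI conjI)
    fix x y :: real assume "x \<le> y"
    then have v: "v absolutely_integrable_on {x..y}" "(v has_integral F y - F x) {x..y}"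
      using assms(1) by (auto simp: prim_def)
    show "w absolutely_integrable_on {x..y}" by (rule absolutely_integrable_spike[OF v(1) neg]) auto
    show "(w has_integral F y - F x) {x..y}" by (rule has_integral_spike[OF neg _ v(2)]) auto
  qed
qed

text \<open>Some integrand exists by Radon-Nikodym, and differentiation identifies it almost
  everywhere with \<open>vector_derivative\<close>. Thus the concrete derivatives occurring in
  \<open>dom_S0\<close> may be integrated back.\<close>

theorem absolutely_continuous_FTC:
  fixes F :: "real \<Rightarrow> complex"
  assumes "locally_absolutely_continuous F"
  shows "AE x in lebesgue. (F has_vector_derivative vector_derivative F (at x)) (at x)"
    and "prim F (\<lambda>x. vector_derivative F (at x))"
proof -
  obtain w where w: "prim F w" using absolutely_continuous_imp_prim[OF assms] by blast
  have AE: "AE x in lebesgue. (F has_vector_derivative w x) (at x)"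
    by (rule prim_has_vector_derivative_AE[OF w])
  then show "AE x in lebesgue. (F has_vector_derivative vector_derivative F (at x)) (at x)"
    by eventually_elim (simp add: vector_derivative_at)
  have "AE x in lebesgue. w x = vector_derivative F (at x)"
    using AE by eventually_elim (simp add: vector_derivative_at)
  then show "prim F (\<lambda>x. vector_derivative F (at x))" by (rule prim_cong_AE[OF w])
qed

section \<open>Absolute continuity and calculus of indefinite integrals\<close>

lemma prim_integral_norm_le:
  fixes F :: "real \<Rightarrow> 'b::euclidean_space"
  assumes "prim F w" "x \<le> y"
  shows "norm (F y - F x) \<le> (LINT t:{x..y}|lebesgue. norm (w t))"
proof -
  have w: "w absolutely_integrable_on {x..y}" "(w has_integral F y - F x) {x..y}"
    using assms by (auto simp: prim_def)
  have "F y - F x = (LINT t:{x..y}|lebesgue. w t)"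
    using set_lebesgue_integral_eq_integral(2)[OF w(1)] w(2) by (simp add: integral_unique)
  then show ?thesis using set_integral_norm_bound[OF w(1)] by simp
qed

text \<open>Truncate \<open>norm (w x)\<close> at a height \<open>N\<close> so large that the excess
  has integral below \<open>e/2\<close>. What lies below the height contributes at most
  \<open>N\<close> times the total length of the intervals.\<close>

theorem prim_imp_absolutely_continuous:
  fixes F :: "real \<Rightarrow> 'b::euclidean_space"
  assumes "prim F w"
  shows "locally_absolutely_continuous F"
  unfolding locally_absolutely_continuous_def absolutely_continuous_on_interval_def
proof (intro allI impI)
  fix a b e :: real assume e: "e > 0"
  define H where "H = (\<lambda>x. indicator {a..b} x * norm (w x))"
  have Hi: "integrable lebesgue H"
  proof (cases "a \<le> b")
    case True
    then have "w absolutely_integrable_on {a..b}" using assms by (auto simp: prim_def)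
    then have "(\<lambda>x. norm (w x)) absolutely_integrable_on {a..b}" by (rule set_integrable_norm)
    then show ?thesis by (simp add: H_def set_integrable_def)
  qed (simp add: H_def)
  have H0: "H x \<ge> 0" for x by (simp add: H_def)
  \<comment> \<open>The excess over the truncation height; it vanishes at each point once
    \<open>N\<close> is large, so dominated convergence makes its integral small.\<close>
  define K where "K = (\<lambda>N x. max (H x - real N) 0)"
  have KH: "0 \<le> K N x" "K N x \<le> H x" "H x \<le> K N x + N" for N x using H0 by (auto simp: K_def max_def)
  have Hm: "H \<in> borel_measurable lebesgue" using Hi by auto
  have Km: "K N \<in> borel_measurable lebesgue" for N unfolding K_def using Hm by measurable
  have Ki: "integrable lebesgue (K N)" for N
  proof (rule Bochner_Integration.integrable_bound[OF Hi Km], rule AE_I2)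
    fix x show "norm (K N x) \<le> norm (H x)" using KH(1)[where N = N and x = x] KH(2)[where N = N and x = x] by simp
  qed
  have "(\<lambda>N. LINT x|lebesgue. K N x) \<longlonglongrightarrow> (LINT x::real|lebesgue. (0::real))"
  proof (rule integral_dominated_convergence[where w = H])
    show "AE x in lebesgue. (\<lambda>N. K N x) \<longlonglongrightarrow> 0"
    proof (rule AE_I2)
      fix x :: real
      obtain M where "H x < real M" using reals_Archimedean2 by blast
      then have "eventually (\<lambda>N. K N x = 0) sequentially"
        by (intro eventually_sequentiallyI[of M]) (simp add: K_def)
      then show "(\<lambda>N. K N x) \<longlonglongrightarrow> 0" by (rule tendsto_eventually)
    qed
  qed (use Km Hi KH in auto)
  then have "(\<lambda>N. LINT x|lebesgue. K N x) \<longlonglongrightarrow> 0" by simp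
  then have "eventually (\<lambda>N. (LINT x|lebesgue. K N x) < e/2) sequentially"
    by (rule order_tendstoD) (use e in simp)
  then obtain N where N: "(LINT x|lebesgue. K N x) < e/2"
    by (auto simp: eventually_sequentially)
  define d where "d = e / (2 * (real N + 1))"
  have d: "d > 0" using e by (simp add: d_def)
  show "\<exists>d>0. \<forall>(n::nat) u v. (\<forall>i<n. a \<le> u i \<and> u i \<le> v i \<and> v i \<le> b) \<and>
        disjoint_family_on (\<lambda>i. {u i<..<v i}) {..<n} \<and> (\<Sum>i<n. v i - u i) < d \<longrightarrow>
        (\<Sum>i<n. norm (F (v i) - F (u i))) < e"
  proof (intro exI[of _ d] conjI allI impI)
    fix n :: nat and u v :: "nat \<Rightarrow> real"
    assume *: "(\<forall>i<n. a \<le> u i \<and> u i \<le> v i \<and> v i \<le> b) \<and>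
        disjoint_family_on (\<lambda>i. {u i<..<v i}) {..<n} \<and> (\<Sum>i<n. v i - u i) < d"
    define I where "I = (\<lambda>i. indicat_real {u i<..<v i})"
    have Ii: "integrable lebesgue (I i)" for i
      unfolding I_def by (rule integrable_real_indicator; cases "u i \<le> v i") auto
    have IG: "integrable lebesgue (\<lambda>x. I i x * G x)" if "integrable lebesgue G" for i and G :: "real \<Rightarrow> real"
      unfolding I_def using integrable_real_mult_indicator[OF _ that, of "{u i<..<v i}"] by (simp add: mult.commute)
    \<comment> \<open>By disjointness the sum of the indicators is the indicator of the
      union.\<close>
    have S1: "0 \<le> (\<Sum>i<n. I i x)" "(\<Sum>i<n. I i x) \<le> 1" for x
      unfolding I_def using * by (subst indicator_UN_disjoint[symmetric]; auto simp: indicator_def)+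
    have i: "norm (F (v i) - F (u i)) \<le> (LINT x|lebesgue. I i x * H x)" if "i < n" for i
    proof -
      have uv: "a \<le> u i" "u i \<le> v i" "v i \<le> b" using * that by auto
      have "norm (F (v i) - F (u i)) \<le> (LINT t:{u i..v i}|lebesgue. norm (w t))"
        by (rule prim_integral_norm_le[OF assms uv(2)])
      also have "\<dots> = (LINT x|lebesgue. I i x * H x)"
        unfolding set_lebesgue_integral_def
      proof (rule integral_cong_AE)
        have "AE x in lebesgue. x \<notin> {u i, v i}"
          by (rule AE_not_in) (simp add: negligible_iff_null_sets[symmetric])
        then show "AE x in lebesgue. indicator {u i..v i} x *\<^sub>R norm (w x) = I i x * H x"
          by eventually_elim (use uv in \<open>auto simp: I_def H_def indicator_def\<close>)
        have "(\<lambda>t. norm (w t)) absolutely_integrable_on {u i..v i}"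
          using assms uv by (intro set_integrable_norm) (auto simp: prim_def)
        then show "(\<lambda>x. indicat_real {u i..v i} x *\<^sub>R norm (w x)) \<in> borel_measurable lebesgue"
          by (simp add: set_integrable_def)
        show "(\<lambda>x. I i x * H x) \<in> borel_measurable lebesgue" using IG[OF Hi] by auto
      qed
      finally show ?thesis .
    qed
    have "(\<Sum>i<n. norm (F (v i) - F (u i))) \<le> (\<Sum>i<n. LINT x|lebesgue. I i x * H x)"
      by (rule sum_mono) (use i in simp)
    also have "\<dots> = (LINT x|lebesgue. (\<Sum>i<n. I i x * H x))"
      by (rule Bochner_Integration.integral_sum[symmetric]) (rule IG[OF Hi])
    also have "\<dots> \<le> (LINT x|lebesgue. K N x + N * (\<Sum>i<n. I i x))"
    proof (rule integral_mono)
      show "integrable lebesgue (\<lambda>x. \<Sum>i<n. I i x * H x)" by (rule Bochner_Integration.integrable_sum) (rule IG[OF Hi])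
      show "integrable lebesgue (\<lambda>x. K N x + N * (\<Sum>i<n. I i x))" using Ki Ii by auto
      fix x
      have "(\<Sum>i<n. I i x * H x) = (\<Sum>i<n. I i x) * H x" by (simp add: sum_distrib_right)
      also have "\<dots> \<le> (\<Sum>i<n. I i x) * (K N x + N)" by (rule mult_left_mono) (use KH S1 in auto)
      also have "\<dots> \<le> K N x + N * (\<Sum>i<n. I i x)"
        using mult_right_mono[OF S1(2)[of x] KH(1)[of N x]] by (simp add: algebra_simps)
      finally show "(\<Sum>i<n. I i x * H x) \<le> K N x + N * (\<Sum>i<n. I i x)" .
    qed
    also have "\<dots> = (LINT x|lebesgue. K N x) + N * (\<Sum>i<n. LINT x|lebesgue. I i x)"
      using Ki Ii by simp
    also have "(\<Sum>i<n. LINT x|lebesgue. I i x) = (\<Sum>i<n. v i - u i)"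
      by (rule sum.cong) (use * in \<open>auto simp: I_def\<close>)
    also have "(LINT x|lebesgue. K N x) + N * (\<Sum>i<n. v i - u i) < e/2 + e/2"
    proof (rule add_less_le_mono[OF N])
      have "N * (\<Sum>i<n. v i - u i) \<le> N * d" using * by (intro mult_left_mono) auto
      also have "\<dots> \<le> e/2" using e by (simp add: d_def field_simps)
      finally show "N * (\<Sum>i<n. v i - u i) \<le> e/2" .
    qed
    finally show "(\<Sum>i<n. norm (F (v i) - F (u i))) < e" by simp
  qed (rule d)
qed

lemma locally_absolutely_continuous_isCont:
  assumes "locally_absolutely_continuous F"
  shows "isCont F x"
  unfolding continuous_at_eps_delta
proof (intro allI impI)
  fix e :: real assume e0: "e > 0"
  then obtain d where d: "d > 0" and D: "\<And>(n::nat) u v.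
        (\<forall>i<n. x - 1 \<le> u i \<and> u i \<le> v i \<and> v i \<le> x + 1) \<and>
        disjoint_family_on (\<lambda>i. {u i<..<v i}) {..<n} \<and>
        (\<Sum>i<n. v i - u i) < d \<Longrightarrow>
        (\<Sum>i<n. norm (F (v i) - F (u i))) < e"
    using assms unfolding locally_absolutely_continuous_def absolutely_continuous_on_interval_def by blast
  show "\<exists>d>0. \<forall>x'. dist x' x < d \<longrightarrow> dist (F x') (F x) < e"
    unfolding dist_norm
  proof (intro exI[of _ "min d 1"] conjI allI impI)
    show "0 < min d 1" using d by simp
    fix y assume "norm (y - x) < min d 1"
    then have y: "\<bar>y - x\<bar> < d" "\<bar>y - x\<bar> < 1" by auto
    have "norm (F (max x y) - F (min x y)) < e"
      using D[of 1 "\<lambda>_. min x y" "\<lambda>_. max x y"] y by (auto simp: disjoint_family_on_def min_def max_def)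
    then show "norm (F y - F x) < e" by (cases "x \<le> y") (auto simp: min_def max_def norm_minus_commute)
  qed
qed

lemma locally_absolutely_continuous_continuous_on:
  "locally_absolutely_continuous F \<Longrightarrow> continuous_on S F"
  by (simp add: continuous_at_imp_continuous_on locally_absolutely_continuous_isCont)

lemma locally_absolutely_continuous_mult:
  fixes F G :: "real \<Rightarrow> complex"
  assumes F: "locally_absolutely_continuous F" and G: "locally_absolutely_continuous G"
  shows "locally_absolutely_continuous (\<lambda>x. F x * G x)"
  unfolding locally_absolutely_continuous_def absolutely_continuous_on_interval_def
proof (intro allI impI)
  fix a b e :: real assume e: "e > 0"
  have "compact (F ` {a..b})" "compact (G ` {a..b})"
    using F G by (auto intro!: compact_continuous_image locally_absolutely_continuous_continuous_on)
  then have "bounded (F ` {a..b})" "bounded (G ` {a..b})" by (auto dest: compact_imp_bounded)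
  then obtain A B where A: "\<And>x. x \<in> {a..b} \<Longrightarrow> norm (F x) \<le> A" and B: "\<And>x. x \<in> {a..b} \<Longrightarrow> norm (G x) \<le> B"
    unfolding bounded_iff by blast
  define M where "M = \<bar>A\<bar> + \<bar>B\<bar> + 1"
  have M: "M > 0" "A \<le> M" "B \<le> M" by (auto simp: M_def)
  have "e / (2 * M) > 0" using e M by simp
  then obtain d1 where d1: "d1 > 0" and D1: "\<And>(n::nat) u v.
        (\<forall>i<n. a \<le> u i \<and> u i \<le> v i \<and> v i \<le> b) \<and>
        disjoint_family_on (\<lambda>i. {u i<..<v i}) {..<n} \<and>
        (\<Sum>i<n. v i - u i) < d1 \<Longrightarrow>
        (\<Sum>i<n. norm (F (v i) - F (u i))) < e / (2 * M)"
    using F unfolding locally_absolutely_continuous_def absolutely_continuous_on_interval_def by meson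
  from \<open>e / (2 * M) > 0\<close> obtain d2 where d2: "d2 > 0" and D2: "\<And>(n::nat) u v.
        (\<forall>i<n. a \<le> u i \<and> u i \<le> v i \<and> v i \<le> b) \<and>
        disjoint_family_on (\<lambda>i. {u i<..<v i}) {..<n} \<and>
        (\<Sum>i<n. v i - u i) < d2 \<Longrightarrow>
        (\<Sum>i<n. norm (G (v i) - G (u i))) < e / (2 * M)"
    using G unfolding locally_absolutely_continuous_def absolutely_continuous_on_interval_def by meson
  show "\<exists>d>0. \<forall>(n::nat) u v. (\<forall>i<n. a \<le> u i \<and> u i \<le> v i \<and> v i \<le> b) \<and>
        disjoint_family_on (\<lambda>i. {u i<..<v i}) {..<n} \<and> (\<Sum>i<n. v i - u i) < d \<longrightarrow>
        (\<Sum>i<n. norm (F (v i) * G (v i) - F (u i) * G (u i))) < e"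
  proof (intro exI[of _ "min d1 d2"] conjI allI impI)
    fix n :: nat and u v :: "nat \<Rightarrow> real"
    assume *: "(\<forall>i<n. a \<le> u i \<and> u i \<le> v i \<and> v i \<le> b) \<and>
        disjoint_family_on (\<lambda>i. {u i<..<v i}) {..<n} \<and> (\<Sum>i<n. v i - u i) < min d1 d2"
    have "(\<Sum>i<n. norm (F (v i) * G (v i) - F (u i) * G (u i)))
        \<le> (\<Sum>i<n. M * norm (F (v i) - F (u i)) + M * norm (G (v i) - G (u i)))"
    proof (rule sum_mono)
      fix i assume "i \<in> {..<n}"
      then have "u i \<in> {a..b}" "v i \<in> {a..b}" using * by force+
      then have "norm (F (u i)) \<le> M" "norm (G (v i)) \<le> M" using A B M by (meson order_trans)+
      have "F (v i) * G (v i) - F (u i) * G (u i) = G (v i) * (F (v i) - F (u i)) + F (u i) * (G (v i) - G (u i))"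
        by (simp add: algebra_simps)
      also have "norm \<dots> \<le> norm (G (v i)) * norm (F (v i) - F (u i)) + norm (F (u i)) * norm (G (v i) - G (u i))"
        by (metis norm_mult norm_triangle_ineq)
      also have "\<dots> \<le> M * norm (F (v i) - F (u i)) + M * norm (G (v i) - G (u i))"
        by (intro add_mono mult_right_mono) (fact | simp)+
      finally show "norm (F (v i) * G (v i) - F (u i) * G (u i))
          \<le> M * norm (F (v i) - F (u i)) + M * norm (G (v i) - G (u i))" .
    qed
    also have "\<dots> = M * (\<Sum>i<n. norm (F (v i) - F (u i))) + M * (\<Sum>i<n. norm (G (v i) - G (u i)))"
      by (simp add: sum.distrib sum_distrib_left)
    also have "\<dots> < M * (e / (2 * M)) + M * (e / (2 * M))"
      using D1[of n u v] D2[of n u v] * M by (intro add_strict_mono mult_strict_left_mono) auto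
    also have "\<dots> = e" using M by (simp add: field_simps)
    finally show "(\<Sum>i<n. norm (F (v i) * G (v i) - F (u i) * G (u i))) < e" .
  qed (use d1 d2 in auto)
qed

text \<open>Integration by parts without interchanging integrals: the product is absolutely
  continuous, hence an indefinite integral of its derivative, which the product rule identifies
  almost everywhere.\<close>

theorem prim_mult:
  fixes F G :: "real \<Rightarrow> complex"
  assumes F: "prim F v" and G: "prim G w"
  shows "prim (\<lambda>x. F x * G x) (\<lambda>x. F x * w x + v x * G x)"
proof -
  have ac: "locally_absolutely_continuous (\<lambda>x. F x * G x)"
    by (intro locally_absolutely_continuous_mult prim_imp_absolutely_continuous[OF F] prim_imp_absolutely_continuous[OF G])
  have "AE x in lebesgue. vector_derivative (\<lambda>x. F x * G x) (at x) = F x * w x + v x * G x"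
    using prim_has_vector_derivative_AE[OF F] prim_has_vector_derivative_AE[OF G]
    by eventually_elim (intro vector_derivative_at has_vector_derivative_mult)
  from prim_cong_AE[OF absolutely_continuous_FTC(2)[OF ac] this] show ?thesis .
qed

lemma prim_bounded_linear:
  assumes F: "prim F v" and h: "bounded_linear h"
  shows "prim (\<lambda>x. h (F x)) (\<lambda>x. h (v x))"
  unfolding prim_def
proof (intro allI impI conjI)
  fix x y :: real assume "x \<le> y"
  then have v: "v absolutely_integrable_on {x..y}" "(v has_integral F y - F x) {x..y}"
    using F by (auto simp: prim_def)
  show "(\<lambda>x. h (v x)) absolutely_integrable_on {x..y}"
    using absolutely_integrable_linear[OF v(1) h] by (simp add: o_def)
  show "((\<lambda>x. h (v x)) has_integral h (F y) - h (F x)) {x..y}"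
    using has_integral_linear[OF v(2) h] linear_diff[OF bounded_linear.linear[OF h]] by (simp add: o_def)
qed

lemma prim_add:
  assumes "prim F v" "prim G w"
  shows "prim (\<lambda>x. F x + G x) (\<lambda>x. v x + w x)"
  using prim_diff[OF assms(1) prim_bounded_linear[OF assms(2) bounded_linear_minus[OF bounded_linear_ident]]] by simp

lemma prim_cmult:
  fixes F :: "real \<Rightarrow> complex"
  shows "prim F v \<Longrightarrow> prim (\<lambda>x. c * F x) (\<lambda>x. c * v x)"
  by (rule prim_bounded_linear[OF _ bounded_linear_mult_right])

lemma prim_cnj: "prim F v \<Longrightarrow> prim (\<lambda>x. cnj (F x)) (\<lambda>x. cnj (v x))"
  by (rule prim_bounded_linear[OF _ bounded_linear_cnj])

lemma prim_of_continuous_derivative: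
  fixes F :: "real \<Rightarrow> 'b::euclidean_space"
  assumes "\<And>x. (F has_vector_derivative v x) (at x)" and "continuous_on UNIV v"
  shows "prim F v"
  unfolding prim_def
proof (intro allI impI conjI)
  fix x y :: real assume xy: "x \<le> y"
  show "v absolutely_integrable_on {x..y}"
    by (rule absolutely_integrable_continuous_real) (use assms(2) continuous_on_subset in blast)
  show "(v has_integral F y - F x) {x..y}"
    by (rule fundamental_theorem_of_calculus[OF xy]) (use assms(1) has_vector_derivative_at_within in blast)
qed

section \<open>The initial value problem\<close>

text \<open>The first derivative is classical, the second only exists almost everywhere; carrying a
  chosen representative \<open>w\<close> of it lets equations be stated for that
  representative.\<close>

definition twice_prim :: "(real \<Rightarrow> complex) \<Rightarrow> (real \<Rightarrow> complex) \<Rightarrow> (real \<Rightarrow> complex) \<Rightarrow> bool" where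
  "twice_prim f f1 w \<longleftrightarrow> (\<forall>x. (f has_vector_derivative f1 x) (at x)) \<and> prim f1 w"

definition loc_integrable :: "(real \<Rightarrow> complex) \<Rightarrow> bool" where
  "loc_integrable g \<longleftrightarrow> (\<forall>x y. g absolutely_integrable_on {x..y})"

definition loc_bounded_coeff :: "(real \<Rightarrow> complex) \<Rightarrow> bool" where
  "loc_bounded_coeff Q \<longleftrightarrow> Q \<in> borel_measurable lebesgue \<and>
     (\<forall>K. \<exists>M. \<forall>x. \<bar>x\<bar> \<le> K \<longrightarrow> norm (Q x) \<le> M)"

text \<open>The signed integral from 0 to \<open>x\<close>: of the two intervals at least one is
  empty or a point and contributes 0.\<close>

definition oriented_integral :: "(real \<Rightarrow> complex) \<Rightarrow> real \<Rightarrow> complex" where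
  "oriented_integral w x = integral {0..x} w - integral {x..0} w"

lemma prim_continuous_on:
  fixes F :: "real \<Rightarrow> 'b::euclidean_space"
  shows "prim F w \<Longrightarrow> continuous_on S F"
  using prim_imp_absolutely_continuous locally_absolutely_continuous_continuous_on by blast

lemma loc_integrable_integrable_on:
  assumes "loc_integrable w" shows "w integrable_on {x..y}"
proof -
  have "w absolutely_integrable_on {x..y}" using assms by (simp add: loc_integrable_def)
  then show ?thesis by (rule set_lebesgue_integral_eq_integral(1))
qed

lemma prim_oriented_integral:
  assumes "loc_integrable w"
  shows "prim (oriented_integral w) w"
  unfolding prim_def
proof (intro allI impI conjI)
  fix x y :: real assume xy: "x \<le> y"
  show "w absolutely_integrable_on {x..y}" using assms by (simp add: loc_integrable_def)
  have io: "w integrable_on {a..b}" for a b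
    using assms by (simp_all add: loc_integrable_integrable_on)
  have c: "integral {a..c} w + integral {c..b} w = integral {a..b} w" if "a \<le> c" "c \<le> b" for a b c
    using that by (rule Henstock_Kurzweil_Integration.integral_combine) (rule io)
  have z: "integral {a..b} w = 0" if "b \<le> a" for a b
    using that by (cases "a = b") auto
  consider "0 \<le> x" | "x \<le> 0" "0 \<le> y" | "y \<le> 0" by linarith
  then have "oriented_integral w y - oriented_integral w x = integral {x..y} w"
  proof cases
    case 1 then show ?thesis using c[of 0 x y] xy z[of 0 x] z[of 0 y] by (simp add: oriented_integral_def algebra_simps)
  next
    case 2 then show ?thesis using c[of x 0 y] z[of 0 y] z[of x 0] by (simp add: oriented_integral_def algebra_simps)
  next
    case 3 then show ?thesis using c[of x y 0] xy z[of x 0] z[of y 0] by (simp add: oriented_integral_def algebra_simps)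
  qed
  then show "(w has_integral oriented_integral w y - oriented_integral w x) {x..y}"
    using io by (simp add: integrable_integral)
qed

lemma oriented_integral_0 [simp]: "oriented_integral w 0 = 0"
  by (simp add: oriented_integral_def)

lemma continuous_loc_integrable: "continuous_on UNIV F \<Longrightarrow> loc_integrable F"
  unfolding loc_integrable_def
  using absolutely_integrable_continuous_real continuous_on_subset by blast

lemma oriented_integral_has_vector_derivative:
  assumes F: "continuous_on UNIV F"
  shows "(oriented_integral F has_vector_derivative F x) (at x)"
proof -
  have P: "prim (oriented_integral F) F" by (rule prim_oriented_integral[OF continuous_loc_integrable[OF F]])
  have "((\<lambda>u. integral {x-1..u} F) has_vector_derivative F x) (at x within {x-1..x+1})"
    by (rule integral_has_vector_derivative) (use F continuous_on_subset in auto)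
  then have "((\<lambda>u. oriented_integral F (x - 1) + integral {x-1..u} F) has_vector_derivative F x) (at x within {x-1..x+1})"
    using has_vector_derivative_add[OF has_vector_derivative_const] by fastforce
  then have "(oriented_integral F has_vector_derivative F x) (at x within {x-1..x+1})"
  proof (rule has_vector_derivative_transform[rotated 2])
    fix u assume "u \<in> {x-1..x+1}"
    then have "(F has_integral (oriented_integral F u - oriented_integral F (x - 1))) {x-1..u}"
      using P by (simp add: prim_def)
    then show "oriented_integral F u = oriented_integral F (x - 1) + integral {x-1..u} F"
      by (simp add: integral_unique)
  qed simp
  then show ?thesis by (simp add: at_within_Icc_at)
qed

lemma twice_prim_oriented_integral:
  assumes "loc_integrable w"
  shows "twice_prim (oriented_integral (oriented_integral w)) (oriented_integral w) w"
  unfolding twice_prim_def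
  using prim_oriented_integral[OF assms] oriented_integral_has_vector_derivative prim_continuous_on by blast

lemma twice_prim_add:
  "twice_prim f f1 v \<Longrightarrow> twice_prim g g1 w \<Longrightarrow> twice_prim (\<lambda>x. f x + g x) (\<lambda>x. f1 x + g1 x) (\<lambda>x. v x + w x)"
  unfolding twice_prim_def by (auto intro: prim_add has_vector_derivative_add)

lemma twice_prim_diff:
  "twice_prim f f1 v \<Longrightarrow> twice_prim g g1 w \<Longrightarrow> twice_prim (\<lambda>x. f x - g x) (\<lambda>x. f1 x - g1 x) (\<lambda>x. v x - w x)"
  unfolding twice_prim_def by (auto intro: prim_diff has_vector_derivative_diff)

lemma twice_prim_cmult:
  "twice_prim f f1 v \<Longrightarrow> twice_prim (\<lambda>x. c * f x) (\<lambda>x. c * f1 x) (\<lambda>x. c * v x)"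
  unfolding twice_prim_def by (auto intro!: prim_cmult derivative_eq_intros)

lemma twice_prim_affine: "twice_prim (\<lambda>x. c + d * of_real x) (\<lambda>x. d) (\<lambda>x. 0)"
  unfolding twice_prim_def
proof
  show "\<forall>x. ((\<lambda>x. c + d * of_real x) has_vector_derivative d) (at x)"
    by (auto intro!: derivative_eq_intros)
  show "prim (\<lambda>x. d) (\<lambda>x. 0)" by (simp add: prim_def)
qed

lemma twice_prim_continuous:
  assumes "twice_prim f f1 w"
  shows "continuous_on S f" "continuous_on S f1"
proof -
  show "continuous_on S f1" using assms prim_continuous_on by (auto simp: twice_prim_def)
  show "continuous_on S f"
    using assms by (intro continuous_at_imp_continuous_on ballI has_vector_derivative_continuous)
      (auto simp: twice_prim_def)
qed

lemma twice_prim_prim: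
  assumes "twice_prim f f1 w" shows "prim f f1" "prim f1 w"
  using assms twice_prim_continuous[OF assms] prim_of_continuous_derivative
  by (auto simp: twice_prim_def)

lemma loc_bounded_coeff_mult_loc_integrable:
  assumes Q: "loc_bounded_coeff Q" and u: "continuous_on UNIV u"
  shows "loc_integrable (\<lambda>x. Q x * u x)"
  unfolding loc_integrable_def
proof (intro allI)
  fix x y :: real
  obtain M where M: "\<And>t. \<bar>t\<bar> \<le> max \<bar>x\<bar> \<bar>y\<bar> \<Longrightarrow> norm (Q t) \<le> M"
    using Q by (auto simp: loc_bounded_coeff_def)
  have uc: "continuous_on {x..y} u" using u continuous_on_subset by blast
  have um: "u \<in> borel_measurable lebesgue"
    using u by (intro measurable_completion) (simp add: borel_measurable_continuous_onI)
  show "(\<lambda>x. Q x * u x) absolutely_integrable_on {x..y}"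
  proof (rule measurable_bounded_by_integrable_imp_absolutely_integrable)
    show "(\<lambda>x. Q x * u x) \<in> borel_measurable (lebesgue_on {x..y})"
      using Q um by (intro measurable_restrict_space1 borel_measurable_times) (auto simp: loc_bounded_coeff_def)
    show "(\<lambda>t. M * norm (u t)) integrable_on {x..y}"
      by (intro integrable_continuous_real continuous_intros uc)
    fix t assume "t \<in> {x..y}"
    then have "norm (Q t) \<le> M" by (intro M) auto
    then show "norm (Q t * u t) \<le> M * norm (u t)" by (simp add: norm_mult mult_right_mono)
  qed simp
qed

text \<open>Integration raises the exponent of a monomial bound and supplies a factor
  \<open>1 / (n + 1)\<close>, from which the factorials of the Picard iteration are built.\<close>

lemma oriented_integral_power_bound:
  assumes w: "loc_integrable w" and le: "\<And>s. \<bar>s\<bar> \<le> \<bar>x\<bar> \<Longrightarrow> norm (w s) \<le> C * \<bar>s\<bar> ^ n"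
  shows "norm (oriented_integral w x) \<le> C * \<bar>x\<bar> ^ Suc n / real (Suc n)"
proof -
  have pos: "norm (integral {0..y} v) \<le> C * y ^ Suc n / real (Suc n)"
    if v: "loc_integrable v" and vl: "\<And>s. 0 \<le> s \<Longrightarrow> s \<le> y \<Longrightarrow> norm (v s) \<le> C * s ^ n" and y: "0 \<le> y" for y v
  proof -
    have "((\<lambda>s. C * s ^ n) has_integral (C * y ^ Suc n / real (Suc n) - C * 0 ^ Suc n / real (Suc n))) {0..y}"
    proof (rule fundamental_theorem_of_calculus[OF y])
      fix s assume "s \<in> {0..y}"
      have "((\<lambda>s. C / real (Suc n) * s ^ Suc n) has_real_derivative C / real (Suc n) * (real (Suc n) * s ^ (Suc n - Suc 0))) (at s)"
        by (rule DERIV_cmult[OF DERIV_pow])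
      then have "((\<lambda>s. C * s ^ Suc n / real (Suc n)) has_real_derivative C * s ^ n) (at s within {0..y})"
        by (simp add: has_field_derivative_at_within)
      then show "((\<lambda>s. C * s ^ Suc n / real (Suc n)) has_vector_derivative C * s ^ n) (at s within {0..y})"
        by (simp add: has_real_derivative_iff_has_vector_derivative)
    qed
    then have I: "((\<lambda>s. C * s ^ n) has_integral (C * y ^ Suc n / real (Suc n))) {0..y}" by simp
    have "norm (integral {0..y} v) \<le> integral {0..y} (\<lambda>s. C * s ^ n)"
    proof (rule Henstock_Kurzweil_Integration.integral_norm_bound_integral)
      show "v integrable_on {0..y}"
        using v by (rule loc_integrable_integrable_on)
    qed (use I vl in auto)
    also have "\<dots> = C * y ^ Suc n / real (Suc n)" using I by (rule integral_unique)
    finally show ?thesis .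
  qed
  show ?thesis
  proof (cases "0 \<le> x")
    case True
    then have "integral {x..0} w = 0" by (cases "x = 0") auto
    moreover have "norm (integral {0..x} w) \<le> C * x ^ Suc n / real (Suc n)"
    proof (rule pos[OF w _ True])
      fix s assume "0 \<le> s" "s \<le> x"
      then show "norm (w s) \<le> C * s ^ n" using le[of s] by simp
    qed
    ultimately show ?thesis using True by (simp add: oriented_integral_def)
  next
    case False
    have "loc_integrable (\<lambda>s. w (- s))"
      unfolding loc_integrable_def
    proof (intro allI)
      fix a b :: real
      have "w absolutely_integrable_on {- b..- a}" using w by (simp add: loc_integrable_def)
      then show "(\<lambda>s. w (- s)) absolutely_integrable_on {a..b}"
        using absolutely_integrable_reflect_real[where f = w and a = "- b" and b = "- a"] by simp
    qed
    then have "norm (integral {0..-x} (\<lambda>s. w (- s))) \<le> C * (-x) ^ Suc n / real (Suc n)"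
    proof (rule pos)
      fix s assume "0 \<le> s" "s \<le> - x"
      then show "norm (w (- s)) \<le> C * s ^ n" using le[of "-s"] by simp
    qed (use False in simp)
    moreover have "integral {0..-x} (\<lambda>s. w (- s)) = integral {x..0} w"
      using Henstock_Kurzweil_Integration.integral_reflect_real[where a = x and b = 0 and f = w] by simp
    moreover have "oriented_integral w x = - integral {x..0} w" using False by (simp add: oriented_integral_def)
    ultimately show ?thesis using False by simp
  qed
qed

lemma oriented_integral_linear:
  assumes "loc_integrable v" "loc_integrable w"
  shows "oriented_integral (\<lambda>x. v x + w x) x = oriented_integral v x + oriented_integral w x"
    "oriented_integral (\<lambda>x. v x - w x) x = oriented_integral v x - oriented_integral w x"
proof -
  have "v integrable_on {a..b}" "w integrable_on {a..b}" for a b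
    using assms by (simp_all add: loc_integrable_integrable_on)
  then show "oriented_integral (\<lambda>x. v x + w x) x = oriented_integral v x + oriented_integral w x"
    "oriented_integral (\<lambda>x. v x - w x) x = oriented_integral v x - oriented_integral w x"
    unfolding oriented_integral_def
    by (simp_all add: Henstock_Kurzweil_Integration.integral_add Henstock_Kurzweil_Integration.integral_diff)
qed

section \<open>Picard iteration\<close>

text \<open>Integrating \<open>u'' = Q u\<close> twice from the origin gives
  \<open>u = h + volterra Q u\<close>, with \<open>h\<close> carrying the initial data and the
  inhomogeneity.\<close>

definition volterra :: "(real \<Rightarrow> complex) \<Rightarrow> (real \<Rightarrow> complex) \<Rightarrow> real \<Rightarrow> complex" where
  "volterra Q u = oriented_integral (oriented_integral (\<lambda>x. Q x * u x))"

context
  fixes Q :: "real \<Rightarrow> complex"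
  assumes Q: "loc_bounded_coeff Q"
begin

lemma volterra_continuous:
  assumes "continuous_on UNIV u"
  shows "continuous_on UNIV (volterra Q u)"
  unfolding volterra_def
  using twice_prim_continuous[OF twice_prim_oriented_integral[OF loc_bounded_coeff_mult_loc_integrable[OF Q assms]]] by blast

lemma volterra_linear:
  assumes "continuous_on UNIV u" "continuous_on UNIV v"
  shows "volterra Q (\<lambda>x. u x + v x) = (\<lambda>x. volterra Q u x + volterra Q v x)"
    "volterra Q (\<lambda>x. u x - v x) = (\<lambda>x. volterra Q u x - volterra Q v x)"
proof -
  note l = loc_bounded_coeff_mult_loc_integrable[OF Q assms(1)] loc_bounded_coeff_mult_loc_integrable[OF Q assms(2)]
  note l2 = l[THEN prim_oriented_integral, THEN prim_continuous_on[where S = UNIV], THEN continuous_loc_integrable]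
  show "volterra Q (\<lambda>x. u x + v x) = (\<lambda>x. volterra Q u x + volterra Q v x)"
    unfolding volterra_def distrib_left oriented_integral_linear(1)[OF l]
    by (rule ext) (rule oriented_integral_linear(1)[OF l2])
  show "volterra Q (\<lambda>x. u x - v x) = (\<lambda>x. volterra Q u x - volterra Q v x)"
    unfolding volterra_def right_diff_distrib oriented_integral_linear(2)[OF l]
    by (rule ext) (rule oriented_integral_linear(2)[OF l2])
qed

text \<open>Of the two integrations only the outer one is used to gain \<open>1 / (n + 1)\<close>;
  the inner one is estimated by the factor \<open>K\<close>. One factorial already makes the
  iteration converge.\<close>

lemma volterra_bound:
  assumes u: "continuous_on UNIV u" and M: "\<And>x. \<bar>x\<bar> \<le> K \<Longrightarrow> norm (Q x) \<le> M" and "M \<ge> 0" "C \<ge> 0"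
    and le: "\<And>s. \<bar>s\<bar> \<le> K \<Longrightarrow> norm (u s) \<le> C * \<bar>s\<bar> ^ n" and x: "\<bar>x\<bar> \<le> K"
  shows "norm (volterra Q u x) \<le> (M * K * C / real (Suc n)) * \<bar>x\<bar> ^ Suc n"
proof -
  note l = loc_bounded_coeff_mult_loc_integrable[OF Q u]
  have 1: "norm (oriented_integral (\<lambda>x. Q x * u x) s) \<le> (M * K * C) * \<bar>s\<bar> ^ n" if s: "\<bar>s\<bar> \<le> K" for s
  proof -
    have "norm (oriented_integral (\<lambda>x. Q x * u x) s) \<le> (M * C) * \<bar>s\<bar> ^ Suc n / real (Suc n)"
    proof (rule oriented_integral_power_bound[OF l])
      fix t assume "\<bar>t\<bar> \<le> \<bar>s\<bar>"
      then have "\<bar>t\<bar> \<le> K" using s by simp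
      then show "norm (Q t * u t) \<le> M * C * \<bar>t\<bar> ^ n"
        using mult_mono[OF M[of t] le[of t]] assms(3) by (simp add: norm_mult mult_ac)
    qed
    also have "\<dots> \<le> (M * C) * \<bar>s\<bar> ^ Suc n / 1"
      by (rule divide_left_mono) (use assms(3,4) in auto)
    also have "\<dots> = (M * C) * \<bar>s\<bar> ^ n * \<bar>s\<bar>" by simp
    also have "\<dots> \<le> (M * C) * \<bar>s\<bar> ^ n * K"
      by (rule mult_left_mono) (use s assms(3,4) in auto)
    finally show ?thesis by (simp add: mult_ac)
  qed
  have "norm (volterra Q u x) \<le> (M * K * C) * \<bar>x\<bar> ^ Suc n / real (Suc n)"
    unfolding volterra_def
    by (rule oriented_integral_power_bound[OF continuous_loc_integrable[OF prim_continuous_on[OF prim_oriented_integral[OF l]]]])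
      (use 1 x in auto)
  then show ?thesis by simp
qed

text \<open>The Neumann series of iterates of \<open>h\<close> converges uniformly on every
  \<open>{-K..K}\<close>, being dominated there by an exponential series; uniformity lets the limit
  pass through \<open>volterra\<close>.\<close>

lemma volterra_equation:
  assumes h: "continuous_on UNIV h"
  shows "\<exists>u. continuous_on UNIV u \<and> (\<forall>x. u x = h x + volterra Q u x)"
proof -
  define T where "T = (\<lambda>n. (volterra Q ^^ n) h)"
  have T0: "T 0 = h" and TS: "T (Suc n) = volterra Q (T n)" for n by (simp_all add: T_def)
  have Tc: "continuous_on UNIV (T n)" for n
    by (induction n) (use h volterra_continuous in \<open>auto simp: T0 TS\<close>)
  have bound: "\<exists>b. summable b \<and> (\<forall>n x. \<bar>x\<bar> \<le> K \<longrightarrow> norm (T n x) \<le> b n)" for K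
  proof -
    obtain M0 where M0: "\<And>x. \<bar>x\<bar> \<le> K \<Longrightarrow> norm (Q x) \<le> M0"
      using Q by (auto simp: loc_bounded_coeff_def)
    define M where "M = max M0 0"
    have M: "\<And>x. \<bar>x\<bar> \<le> K \<Longrightarrow> norm (Q x) \<le> M" "M \<ge> 0" using M0 by (force simp: M_def)+
    have "compact (h ` {-K..K})"
      by (rule compact_continuous_image[OF continuous_on_subset[OF h]]) auto
    then have "bounded (h ` {-K..K})" by (rule compact_imp_bounded)
    then obtain C0 where C0: "\<And>x. x \<in> {-K..K} \<Longrightarrow> norm (h x) \<le> C0"
      unfolding bounded_iff by blast
    define C where "C = max C0 0"
    have C: "\<And>x. \<bar>x\<bar> \<le> K \<Longrightarrow> norm (h x) \<le> C" "C \<ge> 0"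
    proof -
      fix x assume "\<bar>x\<bar> \<le> K" then have "x \<in> {-K..K}" by auto
      from C0[OF this] show "norm (h x) \<le> C" by (simp add: C_def)
    qed (simp add: C_def)
    show ?thesis
    proof (cases "K \<ge> 0")
      case False
      then show ?thesis by (intro exI[of _ "\<lambda>_. 0"]) auto
    next
      case K: True
      have *: "norm (T n x) \<le> (C * (M * K) ^ n / fact n) * \<bar>x\<bar> ^ n" if "\<bar>x\<bar> \<le> K" for n x
        using that
      proof (induction n arbitrary: x)
        case 0 then show ?case using C by (simp add: T0)
      next
        case (Suc n)
        have "norm (T (Suc n) x) \<le> (M * K * (C * (M * K) ^ n / fact n) / real (Suc n)) * \<bar>x\<bar> ^ Suc n"
          unfolding TS by (rule volterra_bound[OF Tc M]) (use Suc C M K in auto)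
        also have "M * K * (C * (M * K) ^ n / fact n) / real (Suc n) = C * (M * K) ^ Suc n / fact (Suc n)"
          by (simp add: field_simps)
        finally show ?case .
      qed
      have "summable (\<lambda>n. C * (inverse (fact n) * (M * K * K) ^ n))"
        by (intro summable_mult summable_exp)
      moreover have "norm (T n x) \<le> C * (inverse (fact n) * (M * K * K) ^ n)" if x: "\<bar>x\<bar> \<le> K" for n x
      proof -
        have "norm (T n x) \<le> (C * (M * K) ^ n / fact n) * \<bar>x\<bar> ^ n" by (rule *[OF x])
        also have "\<dots> \<le> (C * (M * K) ^ n / fact n) * K ^ n"
          by (intro mult_left_mono power_mono) (use x C M K in auto)
        also have "\<dots> = C * (inverse (fact n) * (M * K * K) ^ n)"
          by (simp add: power_mult_distrib field_simps)
        finally show ?thesis .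
      qed
      ultimately show ?thesis by blast
    qed
  qed
  define u where "u = (\<lambda>x. \<Sum>n. T n x)"
  define S where "S = (\<lambda>N x. \<Sum>n<N. T n x)"
  have Sc: "continuous_on UNIV (S N)" for N
    unfolding S_def by (intro continuous_on_sum Tc)
  have ul: "uniform_limit {-K..K} S u sequentially" for K
  proof -
    obtain b where b: "summable b" "\<And>n x. \<bar>x\<bar> \<le> K \<Longrightarrow> norm (T n x) \<le> b n" using bound[of K] by blast
    show ?thesis unfolding S_def u_def
      by (rule Weierstrass_m_test[OF _ b(1)]) (rule b(2), auto)
  qed
  have uK: "continuous_on {-K..K} u" for K
    by (rule uniform_limit_theorem[OF _ ul]) (auto intro!: always_eventually continuous_on_subset[OF Sc])
  have uc: "continuous_on UNIV u"
  proof (intro continuous_at_imp_continuous_on ballI)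
    fix x :: real
    have "continuous_on {-(\<bar>x\<bar>+1)<..<\<bar>x\<bar>+1} u"
      by (rule continuous_on_subset[OF uK[of "\<bar>x\<bar>+1"]]) auto
    then have "\<forall>y\<in>{-(\<bar>x\<bar>+1)<..<\<bar>x\<bar>+1}. isCont u y"
      by (simp add: continuous_on_eq_continuous_at)
    then show "isCont u x" by (rule bspec) (auto simp: abs_if)
  qed
  \<comment> \<open>Partial sums satisfy the equation with a shift of one index, which disappears in
    the limit.\<close>
  have Seq: "S (Suc N) x = h x + volterra Q (S N) x" for N x
  proof (induction N arbitrary: x)
    case 0
    have "oriented_integral (\<lambda>x. 0) = (\<lambda>x. 0)" by (rule ext) (simp add: oriented_integral_def)
    then have "volterra Q (\<lambda>x. 0) x = 0" for x by (simp add: volterra_def)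
    then show ?case by (simp add: S_def T0)
  next
    case (Suc N)
    have "S (Suc (Suc N)) x = S (Suc N) x + T (Suc N) x" by (simp add: S_def)
    also have "\<dots> = h x + (volterra Q (S N) x + volterra Q (T N) x)" by (simp add: Suc TS)
    also have "volterra Q (S N) x + volterra Q (T N) x = volterra Q (\<lambda>x. S N x + T N x) x"
      using volterra_linear(1)[OF Sc Tc] by metis
    also have "(\<lambda>x. S N x + T N x) = S (Suc N)" by (auto simp: S_def)
    finally show ?case .
  qed
  have "u x = h x + volterra Q u x" for x
  proof -
    define K where "K = \<bar>x\<bar>"
    obtain M0 where M0: "\<And>x. \<bar>x\<bar> \<le> K \<Longrightarrow> norm (Q x) \<le> M0"
      using Q by (auto simp: loc_bounded_coeff_def)
    define M where "M = max M0 0"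
    have M: "\<And>x. \<bar>x\<bar> \<le> K \<Longrightarrow> norm (Q x) \<le> M" "M \<ge> 0" using M0 by (force simp: M_def)+
    have lim1: "(\<lambda>N. S N x) \<longlonglongrightarrow> u x"
      by (rule tendsto_uniform_limitI[OF ul[of K]]) (auto simp: K_def)
    have lim2: "(\<lambda>N. volterra Q (S N) x) \<longlonglongrightarrow> volterra Q u x"
      unfolding tendsto_iff
    proof (intro allI impI)
      fix e :: real assume e: "e > 0"
      \<comment> \<open>On the interval considered \<open>volterra\<close> enlarges sup norms at
        most by \<open>M * K * K\<close>; the added 1 avoids a zero denominator and yields a strict
        inequality.\<close>
      define \<eta> where "\<eta> = e / (M * K * K + 1)"
      have den: "M * K * K + 1 > 0" using M by (simp add: K_def add_nonneg_pos)
      have "\<eta> > 0" using e den by (simp add: \<eta>_def)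
      then have "\<forall>\<^sub>F N in sequentially. \<forall>s\<in>{-K..K}. dist (S N s) (u s) < \<eta>"
        using uniform_limitD[OF ul] by blast
      then show "\<forall>\<^sub>F N in sequentially. dist (volterra Q (S N) x) (volterra Q u x) < e"
      proof eventually_elim
        case (elim N)
        have "norm (volterra Q (\<lambda>x. S N x - u x) x) \<le> (M * K * \<eta> / real (Suc 0)) * \<bar>x\<bar> ^ Suc 0"
        proof (rule volterra_bound[OF _ M])
          show "continuous_on UNIV (\<lambda>x. S N x - u x)" by (intro continuous_intros Sc uc)
          fix s assume "\<bar>s\<bar> \<le> K"
          then have "s \<in> {-K..K}" by auto
          from elim[rule_format, OF this] show "norm (S N s - u s) \<le> \<eta> * \<bar>s\<bar> ^ 0" by (simp add: dist_norm)
        qed (use \<open>\<eta> > 0\<close> in \<open>auto simp: K_def\<close>)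
        also have "\<dots> = M * K * K * \<eta>" by (simp add: K_def)
        also have "\<dots> < (M * K * K + 1) * \<eta>" using \<open>\<eta> > 0\<close> by (simp add: algebra_simps)
        also have "\<dots> = e" using den by (simp add: \<eta>_def)
        finally show ?case
          using volterra_linear(2)[OF Sc uc, of N] by (simp add: dist_norm)
      qed
    qed
    have "(\<lambda>N. S (Suc N) x) \<longlonglongrightarrow> h x + volterra Q u x"
      unfolding Seq by (intro tendsto_intros lim2)
    moreover have "(\<lambda>N. S (Suc N) x) \<longlonglongrightarrow> u x" using lim1 by (rule LIMSEQ_Suc)
    ultimately show ?thesis using LIMSEQ_unique by blast
  qed
  with uc show ?thesis by blast
qed

theorem initial_value_problem:
  assumes g: "loc_integrable g"
  obtains f f1 where "twice_prim f f1 (\<lambda>x. Q x * f x - g x)" "f 0 = c" "f1 0 = d"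
proof -
  define h where "h = (\<lambda>x. (c + d * of_real x) - oriented_integral (oriented_integral g) x)"
  have h: "twice_prim h (\<lambda>x. d - oriented_integral g x) (\<lambda>x. 0 - g x)"
    unfolding h_def by (intro twice_prim_diff twice_prim_affine twice_prim_oriented_integral g)
  obtain u where u: "continuous_on UNIV u" "\<And>x. u x = h x + volterra Q u x"
    using volterra_equation[OF twice_prim_continuous(1)[OF h]] by blast
  note l = loc_bounded_coeff_mult_loc_integrable[OF Q u(1)]
  have "twice_prim (\<lambda>x. h x + volterra Q u x) (\<lambda>x. (d - oriented_integral g x) + oriented_integral (\<lambda>x. Q x * u x) x)
      (\<lambda>x. (0 - g x) + Q x * u x)"
    unfolding volterra_def by (intro twice_prim_add h twice_prim_oriented_integral l)
  moreover have "(\<lambda>x. h x + volterra Q u x) = u" using u(2) by (intro ext) simp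
  moreover have "(\<lambda>x. (0 - g x) + Q x * u x) = (\<lambda>x. Q x * u x - g x)" by simp
  ultimately have "twice_prim u (\<lambda>x. (d - oriented_integral g x) + oriented_integral (\<lambda>x. Q x * u x) x)
      (\<lambda>x. Q x * u x - g x)"
    by (simp only:)
  moreover have "u 0 = c" by (subst u(2)) (simp add: h_def volterra_def)
  moreover have "(d - oriented_integral g 0) + oriented_integral (\<lambda>x. Q x * u x) 0 = d" by simp
  ultimately show ?thesis by (rule that)
qed

end

section \<open>Square-integrable functions and the domain of the Schroedinger operator\<close>

abbreviation restr :: "real set \<Rightarrow> (real \<Rightarrow> complex) \<Rightarrow> real \<Rightarrow> complex" where
  "restr S f x \<equiv> indicat_real S x *\<^sub>R f x"

lemma L2D:
  assumes "f \<in> L2"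
  shows "f \<in> borel_measurable lebesgue" "integrable lebesgue (\<lambda>x. (norm (f x))\<^sup>2)"
  using assms by (auto simp: L2_def)

lemma L2norm_nonneg [simp]: "0 \<le> L2norm f"
  by (simp add: L2norm_def)

lemma L2norm_sq: "(L2norm f)\<^sup>2 = (LINT x|lebesgue. (norm (f x))\<^sup>2)"
  by (simp add: L2norm_def)

lemma L2_dominated:
  assumes g: "g \<in> L2" and f: "f \<in> borel_measurable lebesgue" and le: "\<And>x. norm (f x) \<le> norm (g x)"
  shows "f \<in> L2" "L2norm f \<le> L2norm g"
proof -
  have sq: "(norm (f x))\<^sup>2 \<le> (norm (g x))\<^sup>2" for x by (rule power_mono[OF le]) simp
  have i: "integrable lebesgue (\<lambda>x. (norm (f x))\<^sup>2)"
  proof (rule Bochner_Integration.integrable_bound[OF L2D(2)[OF g]], measurable)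
    show "f \<in> borel_measurable lebesgue" by (rule f)
    show "AE x in lebesgue. norm ((norm (f x))\<^sup>2) \<le> norm ((norm (g x))\<^sup>2)"
      by (rule AE_I2) (use sq in simp)
  qed
  then show "f \<in> L2" using f by (simp add: L2_def)
  show "L2norm f \<le> L2norm g"
    unfolding L2norm_def by (intro real_sqrt_le_mono integral_mono i L2D(2)[OF g] sq)
qed

lemma L2_restr:
  assumes "f \<in> L2" "S \<in> sets lebesgue"
  shows "restr S f \<in> L2" "L2norm (restr S f) \<le> L2norm f"
  by (rule L2_dominated[OF assms(1)]; use assms L2D(1)[OF assms(1)] in \<open>auto simp: indicator_def\<close>)+

lemma L2_cmult: "f \<in> L2 \<Longrightarrow> (\<lambda>x. (c::complex) * f x) \<in> L2"
  by (auto simp: L2_def norm_mult power_mult_distrib)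

lemma L2_add:
  fixes f g :: "real \<Rightarrow> 'b::{banach, second_countable_topology}"
  assumes f: "f \<in> L2" and g: "g \<in> L2"
  shows "(\<lambda>x. f x + g x) \<in> L2"
proof -
  have m: "(\<lambda>x. f x + g x) \<in> borel_measurable lebesgue" using L2D(1)[OF f] L2D(1)[OF g] by measurable
  have "integrable lebesgue (\<lambda>x. (norm (f x + g x))\<^sup>2)"
  proof (rule Bochner_Integration.integrable_bound)
    show "integrable lebesgue (\<lambda>x. 2 * (norm (f x))\<^sup>2 + 2 * (norm (g x))\<^sup>2)"
      using L2D(2)[OF f] L2D(2)[OF g] by auto
    show "AE x in lebesgue. norm ((norm (f x + g x))\<^sup>2) \<le> norm (2 * (norm (f x))\<^sup>2 + 2 * (norm (g x))\<^sup>2)"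
    proof (rule AE_I2)
      fix x
      have "(norm (f x + g x))\<^sup>2 \<le> (norm (f x) + norm (g x))\<^sup>2"
        by (intro power_mono norm_triangle_ineq) simp
      also have "\<dots> \<le> 2 * (norm (f x))\<^sup>2 + 2 * (norm (g x))\<^sup>2"
        using zero_le_power2[of "norm (f x) - norm (g x)"] by (simp add: power2_eq_square algebra_simps)
      finally show "norm ((norm (f x + g x))\<^sup>2) \<le> norm (2 * (norm (f x))\<^sup>2 + 2 * (norm (g x))\<^sup>2)" by simp
    qed
  qed (use m in measurable)
  with m show ?thesis by (simp add: L2_def)
qed

lemma L2_diff:
  fixes f g :: "real \<Rightarrow> complex"
  shows "f \<in> L2 \<Longrightarrow> g \<in> L2 \<Longrightarrow> (\<lambda>x. f x - g x) \<in> L2"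
  using L2_add[of f "\<lambda>x. - 1 * g x"] L2_cmult[of g "-1"] by simp

text \<open>Completeness of Lebesgue measure: preimages under the two functions differ by a null
  set.\<close>

lemma borel_measurable_lebesgue_cong_AE:
  fixes f g :: "real \<Rightarrow> 'b::topological_space"
  assumes f: "f \<in> borel_measurable lebesgue" and AE: "AE x in lebesgue. f x = g x"
  shows "g \<in> borel_measurable lebesgue"
proof (rule measurableI)
  fix A :: "'b set" assume A: "A \<in> sets borel"
  have N: "negligible {x. f x \<noteq> g x}"
    using AE by (simp add: completion.AE_iff_null_sets AE_iff_null_sets negligible_iff_null_sets)
  have "f -` A \<in> sets lebesgue" using measurable_sets[OF f A] by simp
  moreover have "negligible ((f -` A - g -` A) \<union> (g -` A - f -` A))"
    by (rule negligible_subset[OF N]) auto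
  ultimately have "g -` A \<in> sets lebesgue" by (rule sets_negligible_symdiff)
  then show "g -` A \<inter> space lebesgue \<in> sets lebesgue" by simp
qed simp

lemma L2_cong_AE:
  assumes f: "f \<in> L2" and AE: "AE x in lebesgue. f x = g x"
  shows "g \<in> L2" "L2norm g = L2norm f"
proof -
  have gm: "g \<in> borel_measurable lebesgue" by (rule borel_measurable_lebesgue_cong_AE[OF L2D(1)[OF f] AE])
  have fm: "f \<in> borel_measurable lebesgue" by (rule L2D(1)[OF f])
  have "integrable lebesgue (\<lambda>x. (norm (g x))\<^sup>2) = integrable lebesgue (\<lambda>x. (norm (f x))\<^sup>2)"
    by (rule integrable_cong_AE) (use gm fm AE in \<open>auto elim: AE_mp\<close>)
  then show "g \<in> L2" using L2D(2)[OF f] gm by (simp add: L2_def)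
  have "(LINT x|lebesgue. (norm (g x))\<^sup>2) = (LINT x|lebesgue. (norm (f x))\<^sup>2)"
    by (rule integral_cong_AE) (use gm fm AE in \<open>auto elim: AE_mp\<close>)
  then show "L2norm g = L2norm f" by (simp add: L2norm_def)
qed

lemma L2_mult_integrable:
  fixes f g :: "real \<Rightarrow> 'b::{banach, real_normed_algebra, second_countable_topology}"
  assumes f: "f \<in> L2" and g: "g \<in> L2"
  shows "integrable lebesgue (\<lambda>x. f x * g x)"
proof (rule Bochner_Integration.integrable_bound)
  show "integrable lebesgue (\<lambda>x. (norm (f x))\<^sup>2 + (norm (g x))\<^sup>2)"
    using L2D(2)[OF f] L2D(2)[OF g] by auto
  show "(\<lambda>x. f x * g x) \<in> borel_measurable lebesgue" using L2D(1)[OF f] L2D(1)[OF g] by measurable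
  show "AE x in lebesgue. norm (f x * g x) \<le> norm ((norm (f x))\<^sup>2 + (norm (g x))\<^sup>2)"
  proof (rule AE_I2)
    fix x
    have "norm (f x * g x) \<le> norm (f x) * norm (g x)" by (rule norm_mult_ineq)
    also have "\<dots> \<le> (norm (f x))\<^sup>2 + (norm (g x))\<^sup>2"
    proof -
      have "(norm (f x))\<^sup>2 + (norm (g x))\<^sup>2 - norm (f x) * norm (g x)
          = (norm (f x) - norm (g x))\<^sup>2 + norm (f x) * norm (g x)"
        by (simp add: power2_eq_square algebra_simps)
      also have "\<dots> \<ge> 0" by simp
      finally show ?thesis by linarith
    qed
    finally show "norm (f x * g x) \<le> norm ((norm (f x))\<^sup>2 + (norm (g x))\<^sup>2)" by simp
  qed
qed

lemma L2_norm: "f \<in> L2 \<Longrightarrow> (\<lambda>x. norm (f x)) \<in> L2"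
  by (auto simp: L2_def)

text \<open>Young's inequality with weight \<open>t\<close>, the ideal weight being the quotient of
  the two norms.\<close>

lemma L2_Cauchy_Schwarz:
  fixes f g :: "real \<Rightarrow> complex"
  assumes f: "f \<in> L2" and g: "g \<in> L2"
  shows "(LINT x|lebesgue. norm (f x) * norm (g x)) \<le> L2norm f * L2norm g"
proof -
  let ?I = "LINT x|lebesgue. norm (f x) * norm (g x)"
  let ?a = "L2norm f" and ?b = "L2norm g"
  have i: "integrable lebesgue (\<lambda>x. norm (f x) * norm (g x))"
    by (rule L2_mult_integrable[OF L2_norm[OF f] L2_norm[OF g]])
  have key: "2 * ?I \<le> t * ?a\<^sup>2 + ?b\<^sup>2 / t" if t: "t > 0" for t
  proof -
    have "2 * ?I = (LINT x|lebesgue. 2 * (norm (f x) * norm (g x)))" by simp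
    also have "\<dots> \<le> (LINT x|lebesgue. t * (norm (f x))\<^sup>2 + (norm (g x))\<^sup>2 / t)"
    proof (rule integral_mono)
      fix x
      have "0 \<le> (t * norm (f x) - norm (g x))\<^sup>2 / t" using t by simp
      also have "\<dots> = t * (norm (f x))\<^sup>2 + (norm (g x))\<^sup>2 / t - 2 * (norm (f x) * norm (g x))"
        using t by (simp add: field_simps power2_eq_square)
      finally show "2 * (norm (f x) * norm (g x)) \<le> t * (norm (f x))\<^sup>2 + (norm (g x))\<^sup>2 / t" by simp
    qed (use i L2D(2)[OF f] L2D(2)[OF g] in auto)
    also have "\<dots> = t * ?a\<^sup>2 + ?b\<^sup>2 / t"
      using L2D(2)[OF f] L2D(2)[OF g] by (simp add: L2norm_sq)
    finally show ?thesis .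
  qed
  show ?thesis
  proof (rule field_le_epsilon)
    fix e :: real assume e: "e > 0"
    define s where "s = e / (?a + ?b + e + 1)"
    have den: "?a + ?b + e + 1 > 0" using e L2norm_nonneg[of f] L2norm_nonneg[of g] by linarith
    have "e < ?a + ?b + e + 1" using L2norm_nonneg[of f] L2norm_nonneg[of g] by linarith
    then have s: "s > 0" "s < 1" using e den by (simp_all add: s_def divide_less_eq)
    have es: "s * (?a + ?b + 1) \<le> e"
    proof -
      have "s * (?a + ?b + 1) \<le> s * (?a + ?b + e + 1)" using s e by (intro mult_left_mono) auto
      also have "\<dots> = e" using den by (simp add: s_def)
      finally show ?thesis .
    qed
    have A: "?a + s > 0" "?b + s > 0" using s L2norm_nonneg[of f] L2norm_nonneg[of g] by linarith+
    \<comment> \<open>Both norms are increased by \<open>s\<close>, so that the ideal weight exists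
      and is positive even when a norm vanishes; \<open>s\<close> is chosen to cost at most
      \<open>e\<close>.\<close>
    define t where "t = (?b + s) / (?a + s)"
    have t: "t > 0" using A by (simp add: t_def)
    have "t * ?a\<^sup>2 \<le> t * (?a + s)\<^sup>2" using t s by (intro mult_left_mono power_mono) auto
    also have "\<dots> = (?a + s) * (?b + s)" using A by (simp add: t_def power2_eq_square)
    finally have 1: "t * ?a\<^sup>2 \<le> (?a + s) * (?b + s)" .
    have "?b\<^sup>2 / t \<le> (?b + s)\<^sup>2 / t" using t s by (intro divide_right_mono power_mono) auto
    also have "\<dots> = (?a + s) * (?b + s)" using A by (simp add: t_def power2_eq_square)
    finally have "?I \<le> (?a + s) * (?b + s)" using 1 key[OF t] by simp
    also have "\<dots> = ?a * ?b + s * (?a + ?b + s)" by (simp add: algebra_simps)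
    also have "s * (?a + ?b + s) \<le> s * (?a + ?b + 1)" using s by (intro mult_left_mono) auto
    finally show "?I \<le> ?a * ?b + e" using es by linarith
  qed
qed

lemma L2_indicator_interval:
  assumes "a \<le> b"
  shows "(\<lambda>x. of_real (indicat_real {a..b} x) :: complex) \<in> L2"
    "L2norm (\<lambda>x. of_real (indicat_real {a..b} x) :: complex) = sqrt (b - a)"
proof -
  have eq: "(\<lambda>x. (norm (of_real (indicat_real {a..b} x) :: complex))\<^sup>2) = indicat_real {a..b}"
    by (auto simp: indicator_def)
  have "integrable lebesgue (indicat_real {a..b})"
    by (rule integrable_real_indicator) (use assms in auto)
  then show "(\<lambda>x. of_real (indicat_real {a..b} x) :: complex) \<in> L2"
    unfolding L2_def mem_Collect_eq eq by simp
  show "L2norm (\<lambda>x. of_real (indicat_real {a..b} x) :: complex) = sqrt (b - a)"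
    unfolding L2norm_def eq using assms by simp
qed

lemma L2_integral_interval_le:
  fixes g :: "real \<Rightarrow> complex"
  assumes g: "g \<in> L2" and ab: "a \<le> b"
  shows "set_integrable lebesgue {a..b} g"
    "(LINT x:{a..b}|lebesgue. norm (g x)) \<le> sqrt (b - a) * L2norm g"
proof -
  note I = L2_indicator_interval[OF ab]
  show "set_integrable lebesgue {a..b} g"
    unfolding set_integrable_def using L2_mult_integrable[OF I(1) g] by (simp add: scaleR_conv_of_real)
  have "(LINT x:{a..b}|lebesgue. norm (g x)) = (LINT x|lebesgue. norm (of_real (indicat_real {a..b} x) :: complex) * norm (g x))"
    unfolding set_lebesgue_integral_def by (rule Bochner_Integration.integral_cong) (auto simp: indicator_def)
  also have "\<dots> \<le> sqrt (b - a) * L2norm g" using L2_Cauchy_Schwarz[OF I(1) g] I(2) by simp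
  finally show "(LINT x:{a..b}|lebesgue. norm (g x)) \<le> sqrt (b - a) * L2norm g" .
qed

lemma L2_loc_integrable:
  fixes g :: "real \<Rightarrow> complex"
  assumes "g \<in> L2" shows "loc_integrable g"
  unfolding loc_integrable_def
proof (intro allI)
  fix x y :: real
  show "g absolutely_integrable_on {x..y}"
    using L2_integral_interval_le(1)[OF assms, of x y] by (cases "x \<le> y") auto
qed

section \<open>The domain of \<open>S_0\<close> in terms of iterated indefinite integrals\<close>

lemma dom_S0_D:
  assumes "f \<in> dom_S0 V"
  shows "f \<in> L2" "twice_prim f (deriv1 f) (deriv1 (deriv1 f))" "schroedinger_expr V f \<in> L2"
proof -
  have f: "\<And>x. f differentiable (at x)" "locally_absolutely_continuous (deriv1 f)"
    using assms by (auto simp: dom_S0_def)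
  have "prim (deriv1 f) (deriv1 (deriv1 f))"
    using absolutely_continuous_FTC(2)[OF f(2)] by (simp add: deriv1_def[abs_def])
  moreover have "(f has_vector_derivative deriv1 f x) (at x)" for x
    using f(1) by (simp add: deriv1_def vector_derivative_works[symmetric])
  ultimately show "twice_prim f (deriv1 f) (deriv1 (deriv1 f))"
    by (simp add: twice_prim_def)
qed (use assms in \<open>auto simp: dom_S0_def\<close>)

text \<open>Membership in the domain from an arbitrary representative \<open>w\<close> of the second
  derivative. The action agrees with \<open>V f - w\<close> almost everywhere only, since
  \<open>deriv1\<close> fixes its own representative.\<close>

lemma dom_S0_I:
  assumes tp: "twice_prim f f1 w" and f: "f \<in> L2" and s: "(\<lambda>x. of_real (V x) * f x - w x) \<in> L2"
  shows "f \<in> dom_S0 V" "deriv1 f = f1"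
    "AE x in lebesgue. schroedinger_expr V f x = of_real (V x) * f x - w x"
proof -
  have d: "(f has_vector_derivative f1 x) (at x)" for x using tp by (simp add: twice_prim_def)
  show f1: "deriv1 f = f1" by (rule ext) (simp add: deriv1_def vector_derivative_at[OF d])
  have "AE x in lebesgue. (f1 has_vector_derivative w x) (at x)"
    using tp by (intro prim_has_vector_derivative_AE) (simp add: twice_prim_def)
  then show AE: "AE x in lebesgue. schroedinger_expr V f x = of_real (V x) * f x - w x"
    by eventually_elim (simp add: schroedinger_expr_def f1, simp add: deriv1_def vector_derivative_at)
  have "schroedinger_expr V f \<in> L2"
    by (rule L2_cong_AE(1)[OF s]) (use AE in \<open>auto elim: AE_mp\<close>)
  moreover have "f differentiable (at x)" for x
    using d by (auto simp: differentiable_def has_vector_derivative_def)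
  ultimately show "f \<in> dom_S0 V"
    using f f1 twice_prim_prim[OF tp] prim_imp_absolutely_continuous by (simp add: dom_S0_def) blast
qed

lemma twice_prim_reflect:
  assumes "twice_prim f f1 w"
  shows "twice_prim (\<lambda>x. f (- x)) (\<lambda>x. - f1 (- x)) (\<lambda>x. w (- x))"
  unfolding twice_prim_def
proof (intro conjI allI)
  fix x
  have "(f has_vector_derivative f1 (- x)) (at (- x))" using assms by (simp add: twice_prim_def)
  moreover have "((\<lambda>x. - x :: real) has_vector_derivative - 1) (at x)"
    by (auto intro!: derivative_eq_intros)
  ultimately have "(f \<circ> (\<lambda>x. - x) has_vector_derivative (- 1) *\<^sub>R f1 (- x)) (at x)"
    by (intro vector_diff_chain_at) simp
  then show "((\<lambda>x. f (- x)) has_vector_derivative - f1 (- x)) (at x)" by (simp add: o_def)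
next
  have P: "prim f1 w" using assms by (simp add: twice_prim_def)
  show "prim (\<lambda>x. - f1 (- x)) (\<lambda>x. w (- x))"
    unfolding prim_def
  proof (intro allI impI conjI)
    fix x y :: real assume "x \<le> y"
    then have "w absolutely_integrable_on {-y..-x}" "(w has_integral f1 (-x) - f1 (-y)) {-y..-x}"
      using P by (auto simp: prim_def)
    then show "(\<lambda>x. w (- x)) absolutely_integrable_on {x..y}"
      "((\<lambda>x. w (- x)) has_integral - f1 (- y) - - f1 (- x)) {x..y}"
      using absolutely_integrable_reflect_real[where f = w and a = "- y" and b = "- x"]
        has_integral_reflect_real[where f = w and a = "- y" and b = "- x"] by simp_all
  qed
qed

section \<open>Energy identities\<close>

lemma energy_identity_aux:
  assumes tp: "twice_prim f f1 w" and xy: "x \<le> y"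
  shows "((\<lambda>t. f1 t * cnj (f1 t) + w t * cnj (f t)) has_integral f1 y * cnj (f y) - f1 x * cnj (f x)) {x..y}"
    "(\<lambda>t. f1 t * cnj (f1 t) + w t * cnj (f t)) absolutely_integrable_on {x..y}"
  using prim_mult[OF twice_prim_prim(2)[OF tp] prim_cnj[OF twice_prim_prim(1)[OF tp]]] xy
  by (auto simp: prim_def)

lemma Im_energy_identity:
  assumes tp: "twice_prim f f1 w" and xy: "x \<le> y"
  shows "((\<lambda>t. Im ((of_real (W t) * f t - w t) * cnj (f t))) has_integral
      Im (f1 x * cnj (f x)) - Im (f1 y * cnj (f y))) {x..y}"
proof -
  have "(Im \<circ> (\<lambda>t. f1 t * cnj (f1 t) + w t * cnj (f t)) has_integral Im (f1 y * cnj (f y) - f1 x * cnj (f x))) {x..y}"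
    by (rule has_integral_linear[OF energy_identity_aux(1)[OF assms] bounded_linear_Im])
  from has_integral_neg[OF this]
  have "((\<lambda>t. - Im (f1 t * cnj (f1 t) + w t * cnj (f t))) has_integral Im (f1 x * cnj (f x)) - Im (f1 y * cnj (f y))) {x..y}"
    by (simp add: o_def)
  moreover have "- Im (f1 t * cnj (f1 t) + w t * cnj (f t)) = Im ((of_real (W t) * f t - w t) * cnj (f t))" for t
    by (simp add: algebra_simps)
  ultimately show ?thesis by simp
qed

lemma set_integrable_restr_mult:
  assumes "restr S f \<in> L2" "restr S g \<in> L2"
  shows "set_integrable lebesgue S (\<lambda>x. f x * cnj (g x))" "set_integrable lebesgue S (\<lambda>x. norm (f x) * norm (g x))"
proof -
  have c: "(\<lambda>x. cnj (restr S g x)) \<in> L2"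
  proof -
    have "cnj \<in> borel_measurable borel" by (rule borel_measurable_continuous_onI) (intro continuous_intros)
    from measurable_compose[OF L2D(1)[OF assms(2)] this] L2D(2)[OF assms(2)] show ?thesis
      unfolding L2_def mem_Collect_eq complex_mod_cnj by blast
  qed
  have "integrable lebesgue (\<lambda>x. restr S f x * cnj (restr S g x))"
    by (rule L2_mult_integrable[OF assms(1) c])
  moreover have "(\<lambda>x. restr S f x * cnj (restr S g x)) = (\<lambda>x. indicat_real S x *\<^sub>R (f x * cnj (g x)))"
    by (auto simp: indicator_def)
  ultimately show "set_integrable lebesgue S (\<lambda>x. f x * cnj (g x))" by (simp add: set_integrable_def)
  have "integrable lebesgue (\<lambda>x. norm (restr S f x) * norm (restr S g x))"
    by (rule L2_mult_integrable[OF L2_norm[OF assms(1)] L2_norm[OF assms(2)]])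
  moreover have "(\<lambda>x. norm (restr S f x) * norm (restr S g x)) = (\<lambda>x. indicat_real S x *\<^sub>R (norm (f x) * norm (g x)))"
    by (auto simp: indicator_def)
  ultimately show "set_integrable lebesgue S (\<lambda>x. norm (f x) * norm (g x))" by (simp add: set_integrable_def)
qed

lemma set_lebesgue_integral_mono_set:
  fixes h :: "real \<Rightarrow> real"
  assumes "set_integrable lebesgue B h" "A \<subseteq> B" "A \<in> sets lebesgue" "\<And>x. x \<in> B \<Longrightarrow> 0 \<le> h x"
  shows "(LINT x:A|lebesgue. h x) \<le> (LINT x:B|lebesgue. h x)"
  unfolding set_lebesgue_integral_def
proof (rule integral_mono)
  show "integrable lebesgue (\<lambda>x. indicat_real A x *\<^sub>R h x)"
    using set_integrable_subset[OF assms(1,3,2)] by (simp add: set_integrable_def)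
qed (use assms in \<open>auto simp: set_integrable_def indicator_def\<close>)

text \<open>Nothing is assumed about \<open>f1\<close> at infinity. If the product of the norms of
  \<open>f1\<close> and \<open>f\<close> stayed above \<open>\<eta>\<close>, the real part of
  \<open>f1 * cnj f\<close> would have a derivative of at least \<open>2 * \<eta> - h\<close> with
  \<open>h\<close> integrable, and would grow without bound. It is half the derivative of the
  squared modulus of \<open>f\<close>, which would then stay above 1, against square integrability.
  The lower bound on \<open>W\<close> enters in the estimate of the derivative.\<close>

lemma boundary_term_small:
  assumes tp: "twice_prim f f1 w" and W: "\<And>x. x \<ge> a \<Longrightarrow> W x \<ge> - c"
    and fL: "restr {a..} f \<in> L2" and sL: "restr {a..} (\<lambda>x. of_real (W x) * f x - w x) \<in> L2"
    and \<eta>: "\<eta> > 0"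
  shows "\<exists>y\<ge>X. norm (f1 y) * norm (f y) < \<eta>"
proof (rule ccontr)
  assume neg: "\<not> ?thesis"
  define b where "b = max X a"
  have big: "norm (f1 y) * norm (f y) \<ge> \<eta>" if "y \<ge> b" for y
    using neg that by (force simp: b_def)
  define s where "s = (\<lambda>x. of_real (W x) * f x - w x)"
  define c0 where "c0 = \<bar>c\<bar>"
  \<comment> \<open>Collects what the derivative of \<open>Re (f1 * cnj f)\<close> may lose:
    \<open>c0\<close> from the potential, 1 from completing the square between \<open>f1\<close> and
    \<open>f\<close>, and the term with \<open>s\<close> from the equation.\<close>
  define h where "h = (\<lambda>x. (1 + c0) * (norm (f x) * norm (f x)) + norm (s x) * norm (f x))"
  have hi: "set_integrable lebesgue {a..} h"
    unfolding h_def using set_integrable_restr_mult(2)[OF fL fL] set_integrable_restr_mult(2)[OF sL fL]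
    by (intro set_integral_add(1) set_integrable_mult_right) (auto simp: s_def)
  have h0: "0 \<le> h x" "norm (f x) * norm (f x) \<le> h x" for x
    by (auto simp: h_def c0_def algebra_simps)
  define H where "H = (LINT x:{a..}|lebesgue. h x)"
  have hint: "h integrable_on {x..y}" "integral {x..y} h \<le> H" if "a \<le> x" for x y
  proof -
    have sub: "set_integrable lebesgue {x..y} h"
      by (rule set_integrable_subset[OF hi]) (use that in auto)
    then show "h integrable_on {x..y}" by (rule set_lebesgue_integral_eq_integral(1))
    have "integral {x..y} h = (LINT x:{x..y}|lebesgue. h x)"
      using set_lebesgue_integral_eq_integral(2)[OF sub] by simp
    also have "\<dots> \<le> H" unfolding H_def
      by (rule set_lebesgue_integral_mono_set[OF hi]) (use that h0 in auto)
    finally show "integral {x..y} h \<le> H" .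
  qed
  define k where "k = (\<lambda>x. f1 x * cnj (f x))"
  have ab: "a \<le> b" by (simp add: b_def)
  have kgrow: "Re (k y) \<ge> Re (k b) + 2 * \<eta> * (y - b) - H" if y: "b \<le> y" for y
  proof -
    have "(Re \<circ> (\<lambda>t. f1 t * cnj (f1 t) + w t * cnj (f t)) has_integral Re (k y - k b)) {b..y}"
      unfolding k_def by (rule has_integral_linear[OF energy_identity_aux(1)[OF tp y] bounded_linear_Re])
    then have 1: "((\<lambda>t. Re (f1 t * cnj (f1 t) + w t * cnj (f t))) has_integral Re (k y) - Re (k b)) {b..y}"
      by (simp add: o_def)
    have 2: "((\<lambda>t. 2 * \<eta> - h t) has_integral (y - b) * (2 * \<eta>) - integral {b..y} h) {b..y}"
      using has_integral_diff[OF has_integral_const_real[of "2 * \<eta>" b y] integrable_integral[OF hint(1)[OF ab, of y]]] y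
      by simp
    have "2 * \<eta> - h t \<le> Re (f1 t * cnj (f1 t) + w t * cnj (f t))" if t: "t \<in> {b..y}" for t
    proof -
      have e: "f t * cnj (f t) = of_real (norm (f t) * norm (f t))"
        using complex_norm_square[of "f t"] by (simp add: power2_eq_square)
      have "w t * cnj (f t) = of_real (W t) * (f t * cnj (f t)) - s t * cnj (f t)"
        by (simp add: s_def algebra_simps)
      then have "Re (w t * cnj (f t)) = W t * (norm (f t) * norm (f t)) - Re (s t * cnj (f t))"
        unfolding e by (simp only: Re_complex_of_real minus_complex.simps of_real_mult[symmetric])
      moreover have "Re (s t * cnj (f t)) \<le> norm (s t) * norm (f t)"
        using complex_Re_le_cmod[of "s t * cnj (f t)"] by (simp add: norm_mult)
      moreover have "W t * (norm (f t) * norm (f t)) \<ge> - c0 * (norm (f t) * norm (f t))"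
        using W[of t] t ab by (intro mult_right_mono) (auto simp: c0_def)
      moreover have "Re (f1 t * cnj (f1 t)) = norm (f1 t) * norm (f1 t)"
        by (simp add: cmod_power2 flip: power2_eq_square)
      moreover have "norm (f1 t) * norm (f1 t) + norm (f t) * norm (f t) \<ge> 2 * (norm (f1 t) * norm (f t))"
        using zero_le_power2[of "norm (f1 t) - norm (f t)"] by (simp add: power2_eq_square algebra_simps)
      moreover have "norm (f1 t) * norm (f t) \<ge> \<eta>" using big t by auto
      ultimately show ?thesis by (simp add: h_def algebra_simps)
    qed
    from has_integral_le[OF 2 1 this] show ?thesis
      using hint(2)[OF ab, of y] by (simp add: algebra_simps)
  qed
  have H0: "H \<ge> 0" using hint(2)[OF ab, of b] by simp
  \<comment> \<open>From here on the linear growth has overcome the initial value and the total loss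
    \<open>H\<close>, so that the real part is at least 1.\<close>
  define Y where "Y = b + (1 + H + \<bar>Re (k b)\<bar>) / (2 * \<eta>)"
  have bY: "b \<le> Y" using \<eta> H0 by (simp add: Y_def)
  have k1: "Re (k y) \<ge> 1" if "y \<ge> Y" for y
  proof -
    have "2 * \<eta> * (y - b) \<ge> 2 * \<eta> * ((1 + H + \<bar>Re (k b)\<bar>) / (2 * \<eta>))"
      using that \<eta> by (intro mult_left_mono) (auto simp: Y_def)
    also have "2 * \<eta> * ((1 + H + \<bar>Re (k b)\<bar>) / (2 * \<eta>)) = 1 + H + \<bar>Re (k b)\<bar>" using \<eta> by simp
    finally show ?thesis using kgrow[of y] that bY by linarith
  qed
  have N: "norm (f y) * norm (f y) \<ge> 1" if y: "y \<ge> Y + 1" for y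
  proof -
    have Yy: "Y \<le> y" using y by simp
    have "prim (\<lambda>x. f x * cnj (f x)) (\<lambda>x. f x * cnj (f1 x) + f1 x * cnj (f x))"
      using twice_prim_prim(1)[OF tp] by (intro prim_mult prim_cnj)
    then have "((\<lambda>x. f x * cnj (f1 x) + f1 x * cnj (f x)) has_integral f y * cnj (f y) - f Y * cnj (f Y)) {Y..y}"
      using Yy by (simp add: prim_def)
    from has_integral_linear[OF this bounded_linear_Re]
    have 1: "((\<lambda>x. 2 * Re (k x)) has_integral norm (f y) * norm (f y) - norm (f Y) * norm (f Y)) {Y..y}"
      by (simp add: o_def k_def cmod_power2 algebra_simps flip: power2_eq_square)
    have 2: "((\<lambda>x. 2) has_integral (y - Y) * 2) {Y..y}"
      using has_integral_const_real[of "2::real" Y y] Yy by simp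
    from has_integral_le[OF 2 1] k1 have "(y - Y) * 2 \<le> norm (f y) * norm (f y) - norm (f Y) * norm (f Y)" by force
    also have "\<dots> \<le> norm (f y) * norm (f y)" by simp
    finally have "(y - Y) * 2 \<le> norm (f y) * norm (f y)" .
    moreover have "1 \<le> (y - Y) * 2" using y by simp
    ultimately show ?thesis by (rule order_trans[rotated])
  qed
  \<comment> \<open>Over a stretch of length \<open>H + 1\<close> a function that is at least 1 has
    integral greater than \<open>H\<close>.\<close>
  define Z where "Z = Y + 1 + (H + 1)"
  have YZ: "Y + 1 \<le> Z" using H0 by (simp add: Z_def)
  have "((\<lambda>x. 1) has_integral (Z - (Y + 1)) * 1) {Y + 1..Z}"
    using has_integral_const_real[of "1::real" "Y + 1" Z] YZ by simp
  moreover have aY: "a \<le> Y + 1" using ab bY by simp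
  note integrable_integral[OF hint(1)[OF aY, of Z]]
  ultimately have "(Z - (Y + 1)) * 1 \<le> integral {Y+1..Z} h"
    by (rule has_integral_le) (use order_trans[OF N h0(2)] in auto)
  also have "\<dots> \<le> H" by (rule hint(2)) (use ab bY in simp)
  finally show False by (simp add: Z_def)
qed

text \<open>The truncated integrals converge, while \<open>boundary_term_small\<close> makes the
  bracket at the upper end small at arbitrarily distant points. The limit can therefore only be the
  bracket at \<open>a\<close>.\<close>

theorem energy_right:
  assumes tp: "twice_prim f f1 w" and W: "\<And>x. x \<ge> a \<Longrightarrow> W x \<ge> - c"
    and fL: "restr {a..} f \<in> L2" and sL: "restr {a..} (\<lambda>x. of_real (W x) * f x - w x) \<in> L2"
  shows "set_integrable lebesgue {a..} (\<lambda>x. Im ((of_real (W x) * f x - w x) * cnj (f x)))"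
    "(LINT x:{a..}|lebesgue. Im ((of_real (W x) * f x - w x) * cnj (f x))) = Im (f1 a * cnj (f a))"
proof -
  define s where "s = (\<lambda>x. of_real (W x) * f x - w x)"
  let ?J = "\<lambda>x. Im (s x * cnj (f x))"
  have "set_integrable lebesgue {a..} (\<lambda>x. s x * cnj (f x))"
    unfolding s_def by (rule set_integrable_restr_mult(1)[OF sL fL])
  then have Ji: "set_integrable lebesgue {a..} ?J"
    using absolutely_integrable_linear[OF _ bounded_linear_Im] by (fastforce simp: o_def)
  then show "set_integrable lebesgue {a..} (\<lambda>x. Im ((of_real (W x) * f x - w x) * cnj (f x)))"
    by (simp add: s_def)
  define L where "L = (LINT x:{a..}|lebesgue. ?J x)"
  have lim: "((\<lambda>y. LINT x:{a..y}|lebesgue. ?J x) \<longlongrightarrow> L) at_top"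
    unfolding L_def by (rule tendsto_set_lebesgue_integral_at_top[OF _ Ji]) auto
  have eq: "(LINT x:{a..y}|lebesgue. ?J x) = Im (f1 a * cnj (f a)) - Im (f1 y * cnj (f y))" if "a \<le> y" for y
  proof -
    have "set_integrable lebesgue {a..y} ?J" by (rule set_integrable_subset[OF Ji]) auto
    then have "(LINT x:{a..y}|lebesgue. ?J x) = integral {a..y} ?J" by (rule set_lebesgue_integral_eq_integral)
    also have "\<dots> = Im (f1 a * cnj (f a)) - Im (f1 y * cnj (f y))"
      unfolding s_def by (rule integral_unique[OF Im_energy_identity[OF tp that]])
    finally show ?thesis .
  qed
  have "L = Im (f1 a * cnj (f a))"
  proof (rule ccontr)
    assume ne: "L \<noteq> Im (f1 a * cnj (f a))"
    define e where "e = \<bar>L - Im (f1 a * cnj (f a))\<bar> / 2"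
    have e: "e > 0" using ne by (simp add: e_def)
    from lim have "\<forall>\<^sub>F y in at_top. dist (LINT x:{a..y}|lebesgue. ?J x) L < e"
      using e by (simp add: tendsto_iff)
    then obtain X where X: "\<And>y. y \<ge> X \<Longrightarrow> dist (LINT x:{a..y}|lebesgue. ?J x) L < e"
      by (auto simp: eventually_at_top_linorder)
    obtain y where y: "y \<ge> max X a" "norm (f1 y) * norm (f y) < e"
      using boundary_term_small[OF tp W fL sL e] by blast
    have "\<bar>Im (f1 y * cnj (f y))\<bar> < e"
      using abs_Im_le_cmod[of "f1 y * cnj (f y)"] y(2) by (simp add: norm_mult)
    moreover have "\<bar>Im (f1 a * cnj (f a)) - Im (f1 y * cnj (f y)) - L\<bar> < e"
      using X[of y] y(1) eq[of y] by (simp add: dist_real_def)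
    moreover have "2 * e = \<bar>L - Im (f1 a * cnj (f a))\<bar>" unfolding e_def by (rule times_divide_eq_right[THEN trans]) (rule nonzero_mult_div_cancel_left, simp)
    ultimately show False by linarith
  qed
  then show "(LINT x:{a..}|lebesgue. Im ((of_real (W x) * f x - w x) * cnj (f x))) = Im (f1 a * cnj (f a))"
    by (simp add: L_def s_def)
qed

lemma set_integral_reflect_lebesgue:
  fixes h :: "real \<Rightarrow> real"
  shows "(LINT x:{a..}|lebesgue. h (- x)) = (LINT x:{..- a}|lebesgue. h x)"
    "set_integrable lebesgue {a..} (\<lambda>x. h (- x)) \<longleftrightarrow> set_integrable lebesgue {..- a} h"
proof -
  have eq: "(\<lambda>x. indicat_real {a..} x *\<^sub>R h (- x)) = (\<lambda>x. (\<lambda>x. indicat_real {..-a} x *\<^sub>R h x) (0 + (- 1) * x))"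
    by (auto simp: indicator_def)
  show "(LINT x:{a..}|lebesgue. h (- x)) = (LINT x:{..- a}|lebesgue. h x)"
    unfolding set_lebesgue_integral_def eq
    using lebesgue_integral_real_affine[of "-1" "\<lambda>x. indicat_real {..-a} x *\<^sub>R h x" 0] by simp
  show "set_integrable lebesgue {a..} (\<lambda>x. h (- x)) \<longleftrightarrow> set_integrable lebesgue {..- a} h"
    unfolding set_integrable_def eq
    using lebesgue_integrable_real_affine_iff[of "-1" "\<lambda>x. indicat_real {..-a} x *\<^sub>R h x" 0] by simp
qed

lemma L2_reflect:
  assumes "f \<in> L2"
  shows "(\<lambda>x. f (- x) :: complex) \<in> L2"
proof -
  have "(\<lambda>x. f (0 + (- 1) * x)) \<in> borel_measurable lebesgue"
    using measurable_compose[OF lebesgue_measurable_scaling[of "-1"] L2D(1)[OF assms]] by simp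
  moreover have "integrable lebesgue (\<lambda>x. (norm (f (0 + (- 1) * x)))\<^sup>2)"
    using lebesgue_integrable_real_affine_iff[of "-1" "\<lambda>x. (norm (f x))\<^sup>2" 0] L2D(2)[OF assms] by simp
  ultimately show ?thesis by (simp add: L2_def)
qed

text \<open>Reflection of \<open>energy_right\<close>; the first derivative changes sign, and with
  it the bracket.\<close>

theorem energy_left:
  assumes tp: "twice_prim f f1 w" and W: "\<And>x. x \<le> a \<Longrightarrow> W x \<ge> - c"
    and fL: "restr {..a} f \<in> L2" and sL: "restr {..a} (\<lambda>x. of_real (W x) * f x - w x) \<in> L2"
  shows "set_integrable lebesgue {..a} (\<lambda>x. Im ((of_real (W x) * f x - w x) * cnj (f x)))"
    "(LINT x:{..a}|lebesgue. Im ((of_real (W x) * f x - w x) * cnj (f x))) = - Im (f1 a * cnj (f a))"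
proof -
  have ind: "indicat_real {..a} (- x) = indicat_real {- a..} x" for x by (auto simp: indicator_def)
  have 1: "restr {-a..} (\<lambda>x. f (- x)) \<in> L2"
    using L2_reflect[OF fL] by (simp add: ind)
  have 2: "restr {-a..} (\<lambda>x. of_real (W (- x)) * f (- x) - w (- x)) \<in> L2"
    using L2_reflect[OF sL] by (simp add: ind)
  have 3: "W (- x) \<ge> - c" if "x \<ge> - a" for x using W[of "-x"] that by simp
  note E = energy_right[where W = "\<lambda>x. W (- x)" and a = "-a", OF twice_prim_reflect[OF tp] 3 1 2]
  show "set_integrable lebesgue {..a} (\<lambda>x. Im ((of_real (W x) * f x - w x) * cnj (f x)))"
    using E(1) set_integral_reflect_lebesgue(2)[of "-a" "\<lambda>x. Im ((of_real (W x) * f x - w x) * cnj (f x))"] by simp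
  show "(LINT x:{..a}|lebesgue. Im ((of_real (W x) * f x - w x) * cnj (f x))) = - Im (f1 a * cnj (f a))"
    using E(2) set_integral_reflect_lebesgue(1)[of "-a" "\<lambda>x. Im ((of_real (W x) * f x - w x) * cnj (f x))"] by simp
qed

section \<open>Local bounds of Sobolev type\<close>

lemma twice_prim_linear_error:
  assumes tp: "twice_prim f f1 w" and xy: "x \<le> y" and B: "\<And>t. t \<in> {x..y} \<Longrightarrow> norm (f1 t - p) \<le> B"
  shows "norm (f y - f x - of_real (y - x) * p) \<le> B * (y - x)"
proof -
  have "norm (f1 x - p) \<le> B" using B[of x] xy by simp
  then have "B \<ge> 0" using norm_ge_zero order_trans by blast
  have "(f1 has_integral f y - f x) {x..y}" using twice_prim_prim(1)[OF tp] xy by (simp add: prim_def)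
  from has_integral_diff[OF this has_integral_const_real[of p x y]]
  have "((\<lambda>t. f1 t - p) has_integral f y - f x - of_real (y - x) * p) {x..y}"
    using xy by (simp add: scaleR_conv_of_real)
  from has_integral_bound_real[OF \<open>B \<ge> 0\<close> _ this, of "{}"] B xy show ?thesis by simp
qed

lemma prim_difference_le:
  fixes F :: "real \<Rightarrow> complex"
  assumes P: "prim F w" and xy: "x \<in> {a..b}" "y \<in> {a..b}"
  shows "norm (F y - F x) \<le> (LINT t:{a..b}|lebesgue. norm (w t))"
proof -
  have ab: "a \<le> b" using xy by auto
  have wi: "set_integrable lebesgue {a..b} (\<lambda>t. norm (w t))"
    using P ab by (intro set_integrable_norm) (simp add: prim_def)
  have main: "norm (F v - F u) \<le> (LINT t:{a..b}|lebesgue. norm (w t))" if "a \<le> u" "u \<le> v" "v \<le> b" for u v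
    using prim_integral_norm_le[OF P that(2)] set_lebesgue_integral_mono_set[OF wi, of "{u..v}"] that
    by (force intro: order_trans)
  show ?thesis
    using main[of x y] main[of y x] xy by (cases "x \<le> y") (auto simp: norm_minus_commute)
qed

lemma exists_le_average:
  fixes f :: "real \<Rightarrow> complex"
  assumes f: "continuous_on {a..b} f" and ab: "a < b"
  shows "\<exists>x\<in>{a..b}. norm (f x) * (b - a) \<le> (LINT t:{a..b}|lebesgue. norm (f t))"
proof -
  have cn: "continuous_on {a..b} (\<lambda>t. norm (f t))" using f by (intro continuous_intros)
  obtain x where x: "x \<in> {a..b}" "\<And>y. y \<in> {a..b} \<Longrightarrow> norm (f x) \<le> norm (f y)"
    using continuous_attains_inf[OF compact_Icc _ cn] ab by auto
  have ai: "(\<lambda>t. norm (f t)) absolutely_integrable_on {a..b}"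
    by (rule absolutely_integrable_continuous_real[OF cn])
  have "((\<lambda>t. norm (f x)) has_integral (b - a) * norm (f x)) {a..b}"
    using has_integral_const_real[of "norm (f x)" a b] ab by simp
  moreover have "((\<lambda>t. norm (f t)) has_integral (LINT t:{a..b}|lebesgue. norm (f t))) {a..b}"
    using has_integral_set_lebesgue[OF ai] .
  ultimately have "(b - a) * norm (f x) \<le> (LINT t:{a..b}|lebesgue. norm (f t))"
    by (rule has_integral_le) (use x in auto)
  then show ?thesis using x(1) by (auto simp: mult.commute)
qed

text \<open>Points in the first and the last third where \<open>f\<close> is at most its average
  give a difference quotient of size \<open>18 * A\<close>, as they are at least \<open>1/3\<close>
  apart. The derivative varies by at most \<open>B\<close>, so it is bounded everywhere, and
  \<open>f\<close> is recovered by integrating from one of the two points.\<close>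

lemma local_Sobolev_bound:
  assumes tp: "twice_prim f f1 w" and y: "y \<in> {a..a+1}"
    and A: "(LINT t:{a..a+1}|lebesgue. norm (f t)) \<le> A"
    and B: "(LINT t:{a..a+1}|lebesgue. norm (w t)) \<le> B"
  shows "norm (f y) \<le> 21 * A + 2 * B" "norm (f1 y) \<le> 18 * A + B"
proof -
  have fc: "continuous_on S f" for S using twice_prim_continuous(1)[OF tp] .
  have P: "prim f1 w" using twice_prim_prim[OF tp] by simp
  have nf: "set_integrable lebesgue {a..a+1} (\<lambda>t. norm (f t))"
    by (rule absolutely_integrable_continuous_real) (intro continuous_intros fc)
  have d1: "norm (f1 t - f1 u) \<le> B" if "t \<in> {a..a+1}" "u \<in> {a..a+1}" for t u
    using prim_difference_le[OF P that(2,1)] B by simp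
  \<comment> \<open>On a third of the interval the smallest value of the modulus is at most three
    times the integral.\<close>
  have pt: "\<exists>x\<in>{u..u+1/3}. norm (f x) \<le> 3 * A" if "a \<le> u" "u + 1/3 \<le> a + 1" for u
  proof -
    obtain x where x: "x \<in> {u..u+1/3}" "norm (f x) * (u + 1/3 - u) \<le> (LINT t:{u..u+1/3}|lebesgue. norm (f t))"
      using exists_le_average[OF fc, of u "u+1/3"] by auto
    moreover have "(LINT t:{u..u+1/3}|lebesgue. norm (f t)) \<le> A"
      using set_lebesgue_integral_mono_set[OF nf, of "{u..u+1/3}"] that A by fastforce
    ultimately show ?thesis by (intro bexI[of _ x]) auto
  qed
  obtain x1 where x1: "x1 \<in> {a..a+1/3}" "norm (f x1) \<le> 3 * A" using pt[of a] by auto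
  obtain x2 where x2: "x2 \<in> {a+2/3..a+2/3+1/3}" "norm (f x2) \<le> 3 * A" using pt[of "a+2/3"] by auto
  have x12: "x1 \<le> x2" "x2 - x1 \<ge> 1/3" using x1 x2 by auto
  have der: "norm (f1 u) \<le> 18 * A + B" if u: "u \<in> {a..a+1}" for u
  proof -
    have "norm (f x2 - f x1 - of_real (x2 - x1) * f1 u) \<le> B * (x2 - x1)"
      by (rule twice_prim_linear_error[OF tp x12(1)], rule d1[OF _ u]) (use x1 x2 in auto)
    moreover have "norm (of_real (x2 - x1) * f1 u) = (x2 - x1) * norm (f1 u)"
      using x12 by (simp add: norm_mult del: of_real_diff)
    moreover have "norm (of_real (x2 - x1) * f1 u) \<le> norm (f x2 - f x1) + norm (f x2 - f x1 - of_real (x2 - x1) * f1 u)"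
      using norm_triangle_sub[of "of_real (x2 - x1) * f1 u" "f x2 - f x1"] by (simp add: norm_minus_commute)
    moreover have "norm (f x2 - f x1) \<le> 6 * A" using norm_triangle_ineq4[of "f x2" "f x1"] x1 x2 by linarith
    ultimately have "(x2 - x1) * norm (f1 u) \<le> 6 * A + B * (x2 - x1)" by linarith
    also have "6 * A \<le> 18 * A * (x2 - x1)"
    proof -
      have "A \<ge> 0" using x1(2) norm_ge_zero[of "f x1"] by linarith
      from mult_left_mono[OF x12(2), of "18 * A"] this show ?thesis by simp
    qed
    finally have "(x2 - x1) * norm (f1 u) \<le> (x2 - x1) * (18 * A + B)" by (simp add: algebra_simps)
    moreover have "x2 - x1 > 0" using x12(2) by linarith
    ultimately show ?thesis by (rule mult_left_le_imp_le)
  qed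
  show "norm (f1 y) \<le> 18 * A + B" by (rule der[OF y])
  have A0: "A \<ge> 0" using x1(2) norm_ge_zero[of "f x1"] by linarith
  have B0: "B \<ge> 0" using d1[OF y y] by simp
  have step: "norm (f v - f u) \<le> 18 * A + 2 * B" if "a \<le> u" "u \<le> v" "v \<le> a + 1" for u v
  proof -
    have "norm (f v - f u - of_real (v - u) * f1 u) \<le> B * (v - u)"
      by (rule twice_prim_linear_error[OF tp that(2)], rule d1) (use that in auto)
    also have "\<dots> \<le> B" using B0 that mult_left_mono[of "v - u" 1 B] by simp
    finally have 1: "norm (f v - f u - of_real (v - u) * f1 u) \<le> B" .
    have "norm (of_real (v - u) * f1 u) = (v - u) * norm (f1 u)" using that by (simp add: norm_mult del: of_real_diff)
    also have "\<dots> \<le> 1 * (18 * A + B)" by (rule mult_mono) (use that der[of u] in auto)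
    finally have 2: "norm (of_real (v - u) * f1 u) \<le> 18 * A + B" by simp
    show ?thesis
      using norm_triangle_ineq[of "f v - f u - of_real (v - u) * f1 u" "of_real (v - u) * f1 u"] 1 2 by simp
  qed
  have "norm (f y - f x1) \<le> 18 * A + 2 * B"
    using step[of x1 y] step[of y x1] x1 y by (cases "x1 \<le> y") (auto simp: norm_minus_commute)
  then show "norm (f y) \<le> 21 * A + 2 * B"
    using norm_triangle_sub[of "f y" "f x1"] x1(2) by linarith
qed

section \<open>Solvability of the coupled problem\<close>

lemma restr_measurable:
  "f \<in> borel_measurable lebesgue \<Longrightarrow> S \<in> sets lebesgue \<Longrightarrow> restr S f \<in> borel_measurable lebesgue"
  by (intro borel_measurable_scaleR borel_measurable_indicator)

lemma restr_continuous_L2: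
  assumes "continuous_on UNIV (f :: real \<Rightarrow> complex)"
  shows "restr {a..b} f \<in> L2"
proof -
  have m: "f \<in> borel_measurable lebesgue"
    using assms by (intro measurable_completion) (simp add: borel_measurable_continuous_onI)
  have "(\<lambda>x. (norm (f x))\<^sup>2) absolutely_integrable_on {a..b}"
    by (rule absolutely_integrable_continuous_real) (intro continuous_intros continuous_on_subset[OF assms], auto)
  then have "integrable lebesgue (\<lambda>x. indicat_real {a..b} x *\<^sub>R (norm (f x))\<^sup>2)" by (simp add: set_integrable_def)
  moreover have "(\<lambda>x. indicat_real {a..b} x *\<^sub>R (norm (f x))\<^sup>2) = (\<lambda>x. (norm (restr {a..b} f x))\<^sup>2)"
    by (auto simp: indicator_def)
  moreover have "restr {a..b} f \<in> borel_measurable lebesgue" by (rule restr_measurable[OF m]) simp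
  ultimately show ?thesis by (simp add: L2_def)
qed

lemma L2norm_sq_restr: "(L2norm (restr S f))\<^sup>2 = (LINT x:S|lebesgue. (norm (f x))\<^sup>2)"
  unfolding L2norm_sq set_lebesgue_integral_def
  by (rule Bochner_Integration.integral_cong) (auto simp: indicator_def)

lemma integral_norm_le_L2norm_restr:
  assumes "restr {a..b} f \<in> L2" "a \<le> b"
  shows "(LINT x:{a..b}|lebesgue. norm (f x)) \<le> sqrt (b - a) * L2norm (restr {a..b} f)"
proof -
  have "(LINT x:{a..b}|lebesgue. norm (f x)) = (LINT x:{a..b}|lebesgue. norm (restr {a..b} f x))"
    by (rule set_lebesgue_integral_cong) auto
  then show ?thesis using L2_integral_interval_le(2)[OF assms] by simp
qed

text \<open>The equation turns bounds for \<open>f\<close> and \<open>g\<close> into one for the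
  second derivative. On an interval of length 1, L1 norms are dominated by L2 norms, so an L2 bound
  of a solution controls its Cauchy data.\<close>

lemma solution_local_bound:
  assumes tp: "twice_prim f f1 w" and y: "y \<in> {a..a+1}"
    and eq: "AE t in lebesgue. t \<in> {a..a+1} \<longrightarrow> w t = Q t * f t - g t"
    and M: "\<And>t. t \<in> {a..a+1} \<Longrightarrow> norm (Q t) \<le> M" and g: "g \<in> L2"
    and N: "L2norm (restr {a..a+1} f) \<le> N"
  shows "norm (f y) \<le> (21 + 2 * M) * N + 2 * L2norm g" "norm (f1 y) \<le> (21 + 2 * M) * N + 2 * L2norm g"
    "(LINT t:{a..a+1}|lebesgue. norm (w t)) \<le> M * N + L2norm g"
proof -
  have fL: "restr {a..a+1} f \<in> L2"
    by (rule restr_continuous_L2[OF twice_prim_continuous(1)[OF tp]])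
  have A: "(LINT t:{a..a+1}|lebesgue. norm (f t)) \<le> N"
    using integral_norm_le_L2norm_restr[OF fL] N by simp
  have M0: "M \<ge> 0" using order_trans[OF norm_ge_zero M[of a]] by simp
  have N0: "N \<ge> 0" using N L2norm_nonneg order_trans by blast
  have fi: "set_integrable lebesgue {a..a+1} (\<lambda>t. norm (f t))"
    by (rule absolutely_integrable_continuous_real)
      (intro continuous_intros twice_prim_continuous(1)[OF tp])
  have gi: "set_integrable lebesgue {a..a+1} (\<lambda>t. norm (g t))"
    by (rule set_integrable_norm[OF L2_integral_interval_le(1)[OF g]]) simp
  have wi: "set_integrable lebesgue {a..a+1} (\<lambda>t. norm (w t))"
    using twice_prim_prim(2)[OF tp] by (intro set_integrable_norm) (simp add: prim_def)
  have "(LINT t:{a..a+1}|lebesgue. norm (w t)) \<le> (LINT t:{a..a+1}|lebesgue. M * norm (f t) + norm (g t))"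
    unfolding set_lebesgue_integral_def
  proof (rule integral_mono_AE)
    show "integrable lebesgue (\<lambda>x. indicat_real {a..a + 1} x *\<^sub>R (M * norm (f x) + norm (g x)))"
      using set_integral_add(1)[OF set_integrable_mult_right[OF fi, of M] gi] by (simp add: set_integrable_def)
    show "AE x in lebesgue. indicat_real {a..a + 1} x *\<^sub>R norm (w x) \<le> indicat_real {a..a + 1} x *\<^sub>R (M * norm (f x) + norm (g x))"
      using eq
    proof eventually_elim
      case (elim x)
      show ?case
      proof (cases "x \<in> {a..a+1}")
        case True
        then have "norm (w x) \<le> norm (Q x * f x) + norm (g x)" using elim norm_triangle_ineq4 by simp
        also have "norm (Q x * f x) \<le> M * norm (f x)" using M[OF True] by (simp add: norm_mult mult_right_mono)
        finally show ?thesis using True by simp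
      qed simp
    qed
  qed (use wi in \<open>simp add: set_integrable_def\<close>)
  also have "\<dots> = M * (LINT t:{a..a+1}|lebesgue. norm (f t)) + (LINT t:{a..a+1}|lebesgue. norm (g t))"
    using set_integral_add(2)[OF set_integrable_mult_right[OF fi, of M] gi] by simp
  also have "\<dots> \<le> M * N + L2norm g"
    using A M0 L2_integral_interval_le(2)[OF g, of a "a+1"] by (intro add_mono mult_left_mono) auto
  finally show B: "(LINT t:{a..a+1}|lebesgue. norm (w t)) \<le> M * N + L2norm g" .
  show "norm (f y) \<le> (21 + 2 * M) * N + 2 * L2norm g"
    using local_Sobolev_bound(1)[OF tp y A B] by (simp add: algebra_simps)
  have "norm (f1 y) \<le> 18 * N + (M * N + L2norm g)" by (rule local_Sobolev_bound(2)[OF tp y A B])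
  moreover have "M * N \<ge> 0" using M0 N0 by simp
  ultimately show "norm (f1 y) \<le> (21 + 2 * M) * N + 2 * L2norm g"
    using N0 L2norm_nonneg[of g] unfolding distrib_right mult.assoc by linarith
qed

section \<open>The coupled problem on bounded intervals\<close>

text \<open>The coupling matrix with rows \<open>(\<alpha>, \<beta>)\<close> and
  \<open>(0, 1 / \<alpha>)\<close> is real with determinant 1, so it preserves the Lagrange bracket.
  This is the symmetry of \<open>S_ab\<close>.\<close>

lemma coupling_Im:
  assumes "\<alpha> \<noteq> 0"
  shows "Im ((d / of_real \<alpha>) * cnj (of_real \<alpha> * c + of_real \<beta> * d)) = Im (d * cnj c)"
  using assms by (simp add: field_simps power2_eq_square)

lemma Im_mult_cnj_self:
  "Im ((z * f + g) * cnj f) = Im z * (norm f)\<^sup>2 + Im (g * cnj f)"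
proof -
  have "(z * f + g) * cnj f = z * (f * cnj f) + g * cnj f" by (simp add: algebra_simps)
  also have "f * cnj f = of_real ((norm f)\<^sup>2)" by (rule complex_norm_square[symmetric])
  finally show ?thesis by simp
qed

text \<open>Young's inequality with weight \<open>\<bar>Im z\<bar>\<close>. The factor
  \<open>sgn (Im z)\<close> treats both half planes at once, and after integration the sharp
  constant \<open>1 / \<bar>Im z\<bar>\<close> results.\<close>

lemma Im_ge_Young:
  assumes y: "Im z \<noteq> 0"
  shows "sgn (Im z) * Im ((z * f + g) * cnj f) \<ge> \<bar>Im z\<bar> / 2 * (norm f)\<^sup>2 - (norm g)\<^sup>2 / (2 * \<bar>Im z\<bar>)"
proof -
  let ?y = "\<bar>Im z\<bar>"
  have "\<bar>Im (g * cnj f)\<bar> \<le> norm g * norm f"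
    using abs_Im_le_cmod[of "g * cnj f"] by (simp add: norm_mult)
  moreover have "norm g * norm f \<le> ?y / 2 * (norm f)\<^sup>2 + (norm g)\<^sup>2 / (2 * ?y)"
  proof -
    have "0 \<le> (?y * norm f - norm g)\<^sup>2 / (2 * ?y)" by simp
    also have "\<dots> = ?y / 2 * (norm f)\<^sup>2 + (norm g)\<^sup>2 / (2 * ?y) - norm g * norm f"
      using y by (simp add: field_simps power2_eq_square)
    finally show ?thesis by simp
  qed
  moreover have "sgn (Im z) * Im ((z * f + g) * cnj f) = ?y * (norm f)\<^sup>2 + sgn (Im z) * Im (g * cnj f)"
    unfolding Im_mult_cnj_self by (simp add: distrib_left mult.assoc[symmetric] abs_sgn[symmetric] mult.commute[of "sgn (Im z)"])
  moreover have "\<bar>sgn (Im z) * Im (g * cnj f)\<bar> = \<bar>Im (g * cnj f)\<bar>"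
    using y by (simp add: abs_mult abs_sgn_eq)
  ultimately show ?thesis by (simp add: abs_le_iff) linarith
qed

text \<open>In the sum of the energy identities of the two halves the brackets at the origin cancel
  by \<open>coupling_Im\<close>, and those at \<open>-n\<close> and \<open>n\<close> vanish by the
  Dirichlet conditions. The bound does not depend on \<open>n\<close>.\<close>

lemma Dirichlet_energy_bound:
  assumes z: "Im z \<noteq> 0" and n: "n \<ge> (0::real)" and \<alpha>: "\<alpha> \<noteq> 0" and g: "g \<in> L2"
    and f: "twice_prim f f1 (\<lambda>x. (of_real (W x) - z) * f x - g x)"
    and h: "twice_prim h h1 (\<lambda>x. (of_real (W x) - z) * h x - g x)"
    and c: "h 0 = of_real \<alpha> * f 0 + of_real \<beta> * f1 0" "h1 0 = f1 0 / of_real \<alpha>"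
    and D: "f (- n) = 0" "h n = 0"
  shows "L2norm (restr {-n..0} f) \<le> L2norm g / \<bar>Im z\<bar>" "L2norm (restr {0..n} h) \<le> L2norm g / \<bar>Im z\<bar>"
proof -
  let ?y = "\<bar>Im z\<bar>"
  have y: "?y > 0" using z by simp
  have eqf: "of_real (W x) * f x - ((of_real (W x) - z) * f x - g x) = z * f x + g x" for x
    by (simp add: algebra_simps)
  have eqh: "of_real (W x) * h x - ((of_real (W x) - z) * h x - g x) = z * h x + g x" for x
    by (simp add: algebra_simps)
  have F: "((\<lambda>t. Im ((z * f t + g t) * cnj (f t))) has_integral - Im (f1 0 * cnj (f 0))) {-n..0}"
    using Im_energy_identity[OF f, of "-n" 0 W] n D unfolding eqf by simp
  have H: "((\<lambda>t. Im ((z * h t + g t) * cnj (h t))) has_integral Im (h1 0 * cnj (h 0))) {0..n}"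
    using Im_energy_identity[OF h, of 0 n W] n D unfolding eqh by simp
  have bc: "Im (h1 0 * cnj (h 0)) = Im (f1 0 * cnj (f 0))"
    unfolding c by (rule coupling_Im[OF \<alpha>])
  have sq: "((\<lambda>t. (norm (u t))\<^sup>2) has_integral (L2norm (restr {a..b} u))\<^sup>2) {a..b}" if "restr {a..b} u \<in> L2" for u a b
  proof -
    have "(\<lambda>t. (norm (u t))\<^sup>2) absolutely_integrable_on {a..b}"
    proof -
      have "(\<lambda>x. (norm (restr {a..b} u x))\<^sup>2) = (\<lambda>x. indicat_real {a..b} x *\<^sub>R (norm (u x))\<^sup>2)"
        by (auto simp: indicator_def)
      then show ?thesis using L2D(2)[OF that] by (simp add: set_integrable_def)
    qed
    from has_integral_set_lebesgue[OF this] show ?thesis by (simp add: L2norm_sq_restr)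
  qed
  have low: "?y / 2 * (L2norm (restr {a..b} u))\<^sup>2 - (L2norm (restr {a..b} g))\<^sup>2 / (2 * ?y) \<le> sgn (Im z) * I"
    if I: "((\<lambda>t. Im ((z * u t + g t) * cnj (u t))) has_integral I) {a..b}"
      and u: "restr {a..b} u \<in> L2" for u a b I
  proof -
    have gL: "restr {a..b} g \<in> L2" by (rule L2_restr[OF g]) simp
    have "((\<lambda>t. ?y / 2 * (norm (u t))\<^sup>2 - (norm (g t))\<^sup>2 / (2 * ?y)) has_integral
        ?y / 2 * (L2norm (restr {a..b} u))\<^sup>2 - (L2norm (restr {a..b} g))\<^sup>2 / (2 * ?y)) {a..b}"
      by (intro has_integral_diff has_integral_mult_right has_integral_divide sq u gL)
    moreover have "((\<lambda>t. sgn (Im z) * Im ((z * u t + g t) * cnj (u t))) has_integral sgn (Im z) * I) {a..b}"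
      by (intro has_integral_mult_right I)
    ultimately show ?thesis by (rule has_integral_le) (rule Im_ge_Young[OF z])
  qed
  have fL: "restr {-n..0} f \<in> L2" by (rule restr_continuous_L2[OF twice_prim_continuous(1)[OF f]])
  have hL: "restr {0..n} h \<in> L2" by (rule restr_continuous_L2[OF twice_prim_continuous(1)[OF h]])
  have gg: "(L2norm (restr {-n..0} g))\<^sup>2 + (L2norm (restr {0..n} g))\<^sup>2 \<le> (L2norm g)\<^sup>2"
  proof -
    have i: "integrable lebesgue (\<lambda>x. (norm (restr S g x))\<^sup>2)" if "S \<in> sets lebesgue" for S
      using L2D(2)[OF L2_restr(1)[OF g that]] .
    have "(LINT x|lebesgue. (norm (restr {-n..0} g x))\<^sup>2) + (LINT x|lebesgue. (norm (restr {0..n} g x))\<^sup>2) =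
      (LINT x|lebesgue. (norm (restr {-n..0} g x))\<^sup>2 + (norm (restr {0..n} g x))\<^sup>2)"
      by (rule Bochner_Integration.integral_add[symmetric]; rule i; simp)
    also have "\<dots> \<le> (LINT x|lebesgue. (norm (g x))\<^sup>2)"
    proof (rule integral_mono_AE)
      have "AE x in lebesgue. x \<noteq> (0::real)"
        using AE_not_in[of "{0::real}" lebesgue] by (simp add: negligible_iff_null_sets[symmetric])
      then show "AE x in lebesgue. (norm (restr {-n..0} g x))\<^sup>2 + (norm (restr {0..n} g x))\<^sup>2 \<le> (norm (g x))\<^sup>2"
        by eventually_elim (auto simp: indicator_def)
    qed (use i L2D(2)[OF g] in auto)
    finally show ?thesis by (simp add: L2norm_sq)
  qed
  have tot: "?y / 2 * ((L2norm (restr {-n..0} f))\<^sup>2 + (L2norm (restr {0..n} h))\<^sup>2) \<le> (L2norm g)\<^sup>2 / (2 * ?y)"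
  proof -
    have "?y / 2 * ((L2norm (restr {-n..0} f))\<^sup>2 + (L2norm (restr {0..n} h))\<^sup>2)
        \<le> ((L2norm (restr {-n..0} g))\<^sup>2 + (L2norm (restr {0..n} g))\<^sup>2) / (2 * ?y)"
    proof -
      have "sgn (Im z) * (- Im (f1 0 * cnj (f 0))) + sgn (Im z) * Im (h1 0 * cnj (h 0)) = 0"
        unfolding bc by (simp only: mult_minus_right add.left_inverse)
      then show ?thesis
        using low[OF F fL] low[OF H hL] unfolding distrib_left add_divide_distrib by linarith
    qed
    also have "\<dots> \<le> (L2norm g)\<^sup>2 / (2 * ?y)" by (rule divide_right_mono[OF gg]) simp
    finally show ?thesis .
  qed
  have sum: "(L2norm (restr {-n..0} f))\<^sup>2 + (L2norm (restr {0..n} h))\<^sup>2 \<le> (L2norm g / ?y)\<^sup>2"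
  proof -
    have "S \<le> (G / v)\<^sup>2" if "v > 0" "v / 2 * S \<le> G\<^sup>2 / (2 * v)" for v S G :: real
      using that by (simp add: field_simps power2_eq_square)
    from this[OF y tot] show ?thesis .
  qed
  show "L2norm (restr {-n..0} f) \<le> L2norm g / ?y"
    by (rule power2_le_imp_le) (use sum zero_le_power2[of "L2norm (restr {0..n} h)"] in \<open>linarith, simp\<close>)
  show "L2norm (restr {0..n} h) \<le> L2norm g / ?y"
    by (rule power2_le_imp_le) (use sum zero_le_power2[of "L2norm (restr {-n..0} f)"] in \<open>linarith, simp\<close>)
qed

text \<open>Fatou's lemma along sets \<open>A n\<close> that eventually contain each point of
  \<open>S\<close>.\<close>

lemma L2_restr_limit:
  fixes F :: "nat \<Rightarrow> real \<Rightarrow> complex"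
  assumes Fm: "\<And>n. F n \<in> borel_measurable lebesgue" and fm: "f \<in> borel_measurable lebesgue"
    and S: "S \<in> sets lebesgue" "\<And>n. A n \<in> sets lebesgue"
    and lim: "\<And>x. x \<in> S \<Longrightarrow> (\<lambda>n. F n x) \<longlonglongrightarrow> f x"
    and A: "\<And>x. x \<in> S \<Longrightarrow> eventually (\<lambda>n. x \<in> A n) sequentially"
    and L: "\<And>n. restr (A n) (F n) \<in> L2" "\<And>n. L2norm (restr (A n) (F n)) \<le> K"
  shows "restr S f \<in> L2"
proof -
  define u where "u = (\<lambda>n x. ennreal ((norm (restr (A n) (F n) x))\<^sup>2))"
  have um: "u n \<in> borel_measurable lebesgue" for n
    unfolding u_def using L2D(1)[OF L(1)[of n]] by measurable
  have ui: "(\<integral>\<^sup>+x. u n x \<partial>lebesgue) \<le> ennreal (K\<^sup>2)" for n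
  proof -
    have "(\<integral>\<^sup>+x. u n x \<partial>lebesgue) = ennreal ((L2norm (restr (A n) (F n)))\<^sup>2)"
      unfolding u_def L2norm_sq by (rule nn_integral_eq_integral[OF L2D(2)[OF L(1)]]) simp
    also have "\<dots> \<le> ennreal (K\<^sup>2)"
      by (intro ennreal_leI power_mono L(2)) simp
    finally show ?thesis .
  qed
  have pt: "ennreal ((norm (restr S f x))\<^sup>2) \<le> liminf (\<lambda>n. u n x)" for x
  proof (cases "x \<in> S")
    case True
    have "(\<lambda>n. ennreal ((norm (F n x))\<^sup>2)) \<longlonglongrightarrow> ennreal ((norm (f x))\<^sup>2)"
      by (intro tendsto_ennrealI tendsto_intros lim[OF True])
    then have "(\<lambda>n. u n x) \<longlonglongrightarrow> ennreal ((norm (f x))\<^sup>2)"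
      by (rule Lim_transform_eventually) (use A[OF True] in eventually_elim, auto simp: u_def)
    then have "liminf (\<lambda>n. u n x) = ennreal ((norm (f x))\<^sup>2)"
      by (intro lim_imp_Liminf) auto
    then show ?thesis using True by simp
  qed simp
  have m: "restr S f \<in> borel_measurable lebesgue"
    by (rule restr_measurable[OF fm S(1)])
  have "(\<integral>\<^sup>+x. ennreal ((norm (restr S f x))\<^sup>2) \<partial>lebesgue) \<le> (\<integral>\<^sup>+x. liminf (\<lambda>n. u n x) \<partial>lebesgue)"
    by (rule nn_integral_mono) (rule pt)
  also have "\<dots> \<le> liminf (\<lambda>n. \<integral>\<^sup>+x. u n x \<partial>lebesgue)" by (rule nn_integral_liminf[OF um])
  also have "\<dots> \<le> ennreal (K\<^sup>2)"
    by (rule order_trans[OF Liminf_le_Limsup Limsup_bounded]) (use ui in auto)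
  also have "\<dots> < \<infinity>" by simp
  finally have fin: "(\<integral>\<^sup>+x. ennreal (norm ((norm (restr S f x))\<^sup>2)) \<partial>lebesgue) < \<infinity>" by simp
  have "(\<lambda>x. (norm (restr S f x))\<^sup>2) \<in> borel_measurable lebesgue"
    by (intro borel_measurable_power measurable_compose[OF m borel_measurable_norm])
  then have "integrable lebesgue (\<lambda>x. (norm (restr S f x))\<^sup>2)"
    using fin by (rule integrableI_bounded)
  with m show ?thesis by (simp add: L2_def)
qed

lemma real_coeff_loc_bounded:
  assumes "W \<in> borel_measurable lebesgue" "locally_bounded W"
  shows "loc_bounded_coeff (\<lambda>x. of_real (W x) - z)"
  unfolding loc_bounded_coeff_def
proof (intro conjI allI)
  show "(\<lambda>x. complex_of_real (W x) - z) \<in> borel_measurable lebesgue" using assms(1) by measurable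
  fix K :: real
  have "bounded (W ` {-K..K})" using assms(2) by (simp add: locally_bounded_def)
  then obtain M where "\<forall>v\<in>W ` {-K..K}. norm v \<le> M" unfolding bounded_iff by blast
  then have M: "\<bar>W x\<bar> \<le> M" if "x \<in> {-K..K}" for x using that by (metis image_eqI real_norm_def)
  show "\<exists>M. \<forall>x. \<bar>x\<bar> \<le> K \<longrightarrow> norm (complex_of_real (W x) - z) \<le> M"
  proof (intro exI allI impI)
    fix x assume "\<bar>x\<bar> \<le> K"
    then have "x \<in> {-K..K}" by auto
    from M[OF this] show "norm (complex_of_real (W x) - z) \<le> M + norm z"
      using norm_triangle_ineq4[of "complex_of_real (W x)" z] by simp
  qed
qed

text \<open>
  Limit of the problems with Dirichlet conditions at \<open>-n\<close> and \<open>n\<close>. The last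
  conclusion serves the case of trivial coupling, where the two halves form one solution.
\<close>

theorem coupled_problem_solvable:
  assumes Wm: "W \<in> borel_measurable lebesgue" and Wb: "locally_bounded W"
    and z: "Im z \<noteq> 0" and \<alpha>: "\<alpha> \<noteq> 0" and g: "g \<in> L2"
  obtains f f1 h h1 where
    "twice_prim f f1 (\<lambda>x. (of_real (W x) - z) * f x - g x)"
    "twice_prim h h1 (\<lambda>x. (of_real (W x) - z) * h x - g x)"
    "restr {..0} f \<in> L2" "restr {0..} h \<in> L2"
    "h 0 = of_real \<alpha> * f 0 + of_real \<beta> * f1 0" "h1 0 = f1 0 / of_real \<alpha>"
    "f 0 = h 0 \<Longrightarrow> f1 0 = h1 0 \<Longrightarrow> f = h"
proof -
  define Q where "Q = (\<lambda>x. complex_of_real (W x) - z)"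
  have Q: "loc_bounded_coeff Q" unfolding Q_def by (rule real_coeff_loc_bounded[OF Wm Wb])
  obtain P P1 where P: "twice_prim P P1 (\<lambda>x. Q x * P x - g x)" "P 0 = 0" "P1 0 = 0"
    using initial_value_problem[OF Q L2_loc_integrable[OF g]] by blast
  have z0: "loc_integrable (\<lambda>x. 0)" by (rule continuous_loc_integrable) simp
  obtain \<theta> \<theta>1 where \<theta>: "twice_prim \<theta> \<theta>1 (\<lambda>x. Q x * \<theta> x - 0)" "\<theta> 0 = 1" "\<theta>1 0 = 0"
    using initial_value_problem[OF Q z0] by blast
  obtain \<phi> \<phi>1 where \<phi>: "twice_prim \<phi> \<phi>1 (\<lambda>x. Q x * \<phi> x - 0)" "\<phi> 0 = 0" "\<phi>1 0 = 1"
    using initial_value_problem[OF Q z0] by blast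
  \<comment> \<open>Solutions are parametrised by their Cauchy data \<open>c\<close>,
    \<open>d\<close> at the origin. The particular solution \<open>P\<close> has zero data, so
    \<open>F\<close> is affine in the data, and convergence of the data implies pointwise
    convergence.\<close>
  define H where "H = (\<lambda>c d x. c * \<theta> x + d * \<phi> x)"
  define H1 where "H1 = (\<lambda>c d x. c * \<theta>1 x + d * \<phi>1 x)"
  define F where "F = (\<lambda>c d x. P x + H c d x)"
  define F1 where "F1 = (\<lambda>c d x. P1 x + H1 c d x)"
  have Htp: "twice_prim (H c d) (H1 c d) (\<lambda>x. (of_real (W x) - z) * H c d x - 0)" for c d
  proof -
    have "twice_prim (\<lambda>x. c * \<theta> x + d * \<phi> x) (\<lambda>x. c * \<theta>1 x + d * \<phi>1 x) (\<lambda>x. c * (Q x * \<theta> x - 0) + d * (Q x * \<phi> x - 0))"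
      by (intro twice_prim_add twice_prim_cmult \<theta> \<phi>)
    moreover have "(\<lambda>x. c * (Q x * \<theta> x - 0) + d * (Q x * \<phi> x - 0)) = (\<lambda>x. (of_real (W x) - z) * H c d x - 0)"
      by (auto simp: Q_def H_def algebra_simps)
    ultimately show ?thesis by (simp only: H_def H1_def)
  qed
  have Ftp: "twice_prim (F c d) (F1 c d) (\<lambda>x. (of_real (W x) - z) * F c d x - g x)" for c d
  proof -
    have "twice_prim (\<lambda>x. P x + H c d x) (\<lambda>x. P1 x + H1 c d x) (\<lambda>x. (Q x * P x - g x) + ((of_real (W x) - z) * H c d x - 0))"
      by (intro twice_prim_add P Htp)
    moreover have "(\<lambda>x. (Q x * P x - g x) + ((of_real (W x) - z) * H c d x - 0)) = (\<lambda>x. (of_real (W x) - z) * F c d x - g x)"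
      by (auto simp: Q_def F_def algebra_simps)
    ultimately show ?thesis by (simp only: F_def F1_def)
  qed
  have at0: "H c d 0 = c" "H1 c d 0 = d" "F c d 0 = c" "F1 c d 0 = d" for c d
    by (auto simp: H_def H1_def F_def F1_def P \<theta> \<phi>)
  define a where "a = complex_of_real \<alpha>"
  define b where "b = complex_of_real \<beta>"
  have a0: "a \<noteq> 0" using \<alpha> by (simp add: a_def)
  obtain M where M: "\<And>x. \<bar>x\<bar> \<le> 1 \<Longrightarrow> norm (Q x) \<le> M"
    using Q by (auto simp: loc_bounded_coeff_def)
  \<comment> \<open>Every \<open>n\<close> at least 1 leaves room for the fixed interval from -1 to
    0, on which the energy bound controls the Cauchy data at the origin. For zero right-hand side
    this is uniqueness, otherwise it is compactness.\<close>
  have init_bound: "norm (u 0) \<le> (21 + 2 * M) * (L2norm k / \<bar>Im z\<bar>) + 2 * L2norm k"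
      "norm (u1 0) \<le> (21 + 2 * M) * (L2norm k / \<bar>Im z\<bar>) + 2 * L2norm k"
    if u: "twice_prim u u1 (\<lambda>x. (of_real (W x) - z) * u x - k x)" and k: "k \<in> L2"
      and le: "L2norm (restr {-n..0} u) \<le> L2norm k / \<bar>Im z\<bar>" and n: "n \<ge> 1" for u u1 k n
  proof -
    have "L2norm (restr {-1..-1+1} u) \<le> L2norm (restr {-n..0} u)"
    proof (rule L2_dominated(2))
      show "restr {-n..0} u \<in> L2" by (rule restr_continuous_L2[OF twice_prim_continuous(1)[OF u]])
      show "restr {-1..-1+1} u \<in> borel_measurable lebesgue"
        by (rule L2D(1)[OF restr_continuous_L2[OF twice_prim_continuous(1)[OF u]]])
    qed (use n in \<open>auto simp: indicator_def\<close>)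
    then have N: "L2norm (restr {-1..-1+1} u) \<le> L2norm k / \<bar>Im z\<bar>" using le by simp
    have eq: "AE t in lebesgue. t \<in> {-1..-1+1} \<longrightarrow> (of_real (W t) - z) * u t - k t = Q t * u t - k t"
      by (simp add: Q_def)
    have Mt: "norm (Q t) \<le> M" if "t \<in> {-1..-1+1}" for t using that by (intro M) auto
    have 0: "0 \<in> {-1..-1+1::real}" by simp
    show "norm (u 0) \<le> (21 + 2 * M) * (L2norm k / \<bar>Im z\<bar>) + 2 * L2norm k"
      "norm (u1 0) \<le> (21 + 2 * M) * (L2norm k / \<bar>Im z\<bar>) + 2 * L2norm k"
      using solution_local_bound(1,2)[OF u 0 eq Mt k N] by blast+
  qed
  have zL: "(\<lambda>x. 0::complex) \<in> L2" by (simp add: L2_def)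
  have z00: "L2norm (\<lambda>x. 0::complex) = 0" by (simp add: L2norm_def)
  define K where "K = L2norm g / \<bar>Im z\<bar>"
  define C where "C = (21 + 2 * M) * K + 2 * L2norm g"
  have ex: "\<exists>c d. L2norm (restr {-n..0} (F c d)) \<le> K \<and> L2norm (restr {0..n} (F (a * c + b * d) (d / a))) \<le> K
      \<and> norm c \<le> C \<and> norm d \<le> C" if n: "n \<ge> 1" for n :: real
  proof -
    \<comment> \<open>The two Dirichlet conditions as a linear system for the Cauchy data of the
      left half; the right half starts from the coupled data \<open>a * c + b * d\<close> and
      \<open>d / a\<close>.\<close>
    define A11 A12 A21 A22 where "A11 = \<theta> (-n)" and "A12 = \<phi> (-n)"
      and "A21 = a * \<theta> n" and "A22 = b * \<theta> n + \<phi> n / a"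
    have left: "H c d (-n) = A11 * c + A12 * d" and right: "H (a * c + b * d) (d / a) n = A21 * c + A22 * d" for c d
      using a0 by (auto simp: H_def A11_def A12_def A21_def A22_def field_simps)
    have inj: "c = 0 \<and> d = 0" if "A11 * c + A12 * d = 0" "A21 * c + A22 * d = 0" for c d
    proof -
      have D: "H c d (-n) = 0" "H (a * c + b * d) (d / a) n = 0" using that left right by auto
      have n0: "n \<ge> 0" using n by simp
      have "L2norm (restr {-n..0} (H c d)) \<le> L2norm (\<lambda>x. 0::complex) / \<bar>Im z\<bar>"
        using Dirichlet_energy_bound(1)[OF z n0 \<alpha> zL Htp Htp _ _ D, where \<beta> = \<beta>] by (simp add: at0 a_def b_def)
      then show ?thesis using init_bound[OF Htp zL _ n] unfolding z00 at0 by simp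
    qed
    define \<Delta> where "\<Delta> = A11 * A22 - A12 * A21"
    \<comment> \<open>If the determinant were zero, the columns of the adjugate matrix would lie in
      the kernel and hence vanish. The matrix would then be zero, which is not injective.\<close>
    have "\<Delta> \<noteq> 0"
    proof
      assume "\<Delta> = 0"
      then have "A22 = 0 \<and> A21 = 0" using inj[of A22 "- A21"] by (simp add: \<Delta>_def algebra_simps)
      moreover from this have "A12 = 0 \<and> A11 = 0" using inj[of A12 "- A11"] by (simp add: algebra_simps)
      ultimately show False using inj[of 1 0] by simp
    qed
    define c where "c = (A12 * P n - A22 * P (-n)) / \<Delta>"
    define d where "d = (A21 * P (-n) - A11 * P n) / \<Delta>"
    have s1: "A11 * c + A12 * d = - P (-n)" and s2: "A21 * c + A22 * d = - P n"
      using \<open>\<Delta> \<noteq> 0\<close> unfolding c_def d_def by (simp_all add: field_simps) (simp_all add: \<Delta>_def algebra_simps)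
    have D: "F c d (-n) = 0" "F (a * c + b * d) (d / a) n = 0"
      unfolding F_def left right s1 s2 by simp_all
    have n0: "n \<ge> 0" using n by simp
    note E = Dirichlet_energy_bound[OF z n0 \<alpha> g Ftp Ftp _ _ D, where \<beta> = \<beta>, unfolded at0, folded a_def b_def, OF refl refl]
    have "norm c \<le> C" "norm d \<le> C"
      using init_bound[OF Ftp g E(1) n] unfolding C_def K_def at0 by blast+
    then show ?thesis using E unfolding K_def by blast
  qed
  define R where "R = (\<lambda>n c d. L2norm (restr {-real (Suc n)..0} (F c d)) \<le> K \<and>
      L2norm (restr {0..real (Suc n)} (F (a * c + b * d) (d / a))) \<le> K \<and> norm c \<le> C \<and> norm d \<le> C)"
  have "\<exists>c d. R n c d" for n unfolding R_def by (rule ex) simp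
  then obtain cn dn where "\<And>n. R n (cn n) (dn n)" by metis
  then have cd: "\<And>n. L2norm (restr {-real (Suc n)..0} (F (cn n) (dn n))) \<le> K"
    "\<And>n. L2norm (restr {0..real (Suc n)} (F (a * cn n + b * dn n) (dn n / a))) \<le> K"
    "\<And>n. norm (cn n) \<le> C" "\<And>n. norm (dn n) \<le> C" unfolding R_def by blast+
  have "bounded (range (\<lambda>n. (cn n, dn n)))"
  proof -
    have "norm (cn n, dn n) \<le> C + C" for n
      using norm_Pair_le[of "cn n" "dn n"] cd(3,4)[of n] by linarith
    then show ?thesis unfolding bounded_iff by blast
  qed
  then obtain l r where r: "strict_mono (r :: nat \<Rightarrow> nat)" "((\<lambda>n. (cn n, dn n)) \<circ> r) \<longlonglongrightarrow> l"
    using bounded_imp_convergent_subsequence by blast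
  define c where "c = fst l"
  define d where "d = snd l"
  have lim: "(\<lambda>n. cn (r n)) \<longlonglongrightarrow> c" "(\<lambda>n. dn (r n)) \<longlonglongrightarrow> d"
    using tendsto_fst[OF r(2)] tendsto_snd[OF r(2)] by (auto simp: c_def d_def o_def)
  have Fm: "F c d \<in> borel_measurable lebesgue" for c d
    using twice_prim_continuous(1)[OF Ftp, of UNIV]
    by (intro measurable_completion) (simp add: borel_measurable_continuous_onI)
  have FL: "restr {x..y} (F c d) \<in> L2" for x y c d
    by (rule restr_continuous_L2[OF twice_prim_continuous(1)[OF Ftp]])
  have ev: "eventually (\<lambda>n. real (Suc (r n)) \<ge> x) sequentially" for x
  proof -
    obtain N where "x < real N" using reals_Archimedean2 by blast
    have "real (Suc (r n)) \<ge> x" if "n \<ge> N" for n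
    proof -
      have "real N \<le> real (r n)" using seq_suble[OF r(1), of n] that by linarith
      then show ?thesis using \<open>x < real N\<close> by simp
    qed
    then show ?thesis by (rule eventually_sequentiallyI)
  qed
  have L1: "restr {..0} (F c d) \<in> L2"
  proof (rule L2_restr_limit[where F = "\<lambda>n. F (cn (r n)) (dn (r n))" and A = "\<lambda>n. {-real (Suc (r n))..0}" and K = K])
    show "(\<lambda>n. F (cn (r n)) (dn (r n)) x) \<longlonglongrightarrow> F c d x" for x
      unfolding F_def H_def by (intro tendsto_intros lim)
    show "\<forall>\<^sub>F n in sequentially. x \<in> {- real (Suc (r n))..0}" if "x \<in> {..0}" for x
      using ev[of "- x"] by eventually_elim (use that in auto)
  qed (use Fm FL cd in auto)
  have L2': "restr {0..} (F (a * c + b * d) (d / a)) \<in> L2"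
  proof (rule L2_restr_limit[where F = "\<lambda>n. F (a * cn (r n) + b * dn (r n)) (dn (r n) / a)" and A = "\<lambda>n. {0..real (Suc (r n))}" and K = K])
    show "(\<lambda>n. F (a * cn (r n) + b * dn (r n)) (dn (r n) / a) x) \<longlonglongrightarrow> F (a * c + b * d) (d / a) x" for x
      unfolding F_def H_def using a0 by (intro tendsto_intros lim)
    show "\<forall>\<^sub>F n in sequentially. x \<in> {0..real (Suc (r n))}" if "x \<in> {0..}" for x
      using ev[of x] by eventually_elim (use that in auto)
  qed (use Fm FL cd in auto)
  show ?thesis
  proof (rule that[OF Ftp Ftp L1 L2'])
    show "F (a * c + b * d) (d / a) 0 = complex_of_real \<alpha> * F c d 0 + complex_of_real \<beta> * F1 c d 0"
      by (simp add: at0 a_def b_def)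
    show "F1 (a * c + b * d) (d / a) 0 = F1 c d 0 / complex_of_real \<alpha>"
      by (simp add: at0 a_def)
    show "F c d = F (a * c + b * d) (d / a)"
      if "F c d 0 = F (a * c + b * d) (d / a) 0" "F1 c d 0 = F1 (a * c + b * d) (d / a) 0"
      using that unfolding at0 by simp
  qed
qed

section \<open>Gluing solutions and extending them to the domain of \<open>S_0\<close>\<close>

lemma prim_unique: "prim F w \<Longrightarrow> prim G w \<Longrightarrow> F x - F 0 = G x - G 0"
proof -
  assume P: "prim F w" "prim G w"
  show ?thesis
  proof (cases "0 \<le> x")
    case True
    then have "(w has_integral F x - F 0) {0..x}" "(w has_integral G x - G 0) {0..x}"
      using P by (auto simp: prim_def)
    then show ?thesis by (rule has_integral_unique)
  next
    case False
    then have "(w has_integral F 0 - F x) {x..0}" "(w has_integral G 0 - G x) {x..0}"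
      using P by (auto simp: prim_def)
    then have "F 0 - F x = G 0 - G x" by (rule has_integral_unique)
    then show ?thesis by (metis minus_diff_eq)
  qed
qed

lemma prim_glue:
  fixes F G :: "real \<Rightarrow> complex"
  assumes F: "prim F v" and G: "prim G w" and eq: "F a = G a"
  shows "prim (\<lambda>x. if x \<le> a then F x else G x) (\<lambda>x. if x \<le> a then v x else w x)"
  unfolding prim_def
proof (intro allI impI)
  fix x y :: real assume xy: "x \<le> y"
  let ?u = "\<lambda>x. if x \<le> a then v x else w x"
  have L: "?u absolutely_integrable_on {s..t} \<and> (?u has_integral F t - F s) {s..t}" if "s \<le> t" "t \<le> a" for s t
  proof -
    have 1: "v absolutely_integrable_on {s..t}" "(v has_integral F t - F s) {s..t}"
      using F that by (auto simp: prim_def)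
    show ?thesis
      using absolutely_integrable_spike[OF 1(1) negligible_empty, of ?u] has_integral_spike[OF negligible_empty _ 1(2), of ?u] that
      by auto
  qed
  have R: "?u absolutely_integrable_on {s..t} \<and> (?u has_integral G t - G s) {s..t}" if "s \<le> t" "a \<le> s" for s t
  proof -
    have 1: "w absolutely_integrable_on {s..t}" "(w has_integral G t - G s) {s..t}"
      using G that by (auto simp: prim_def)
    have n: "negligible {a}" by simp
    show ?thesis
      using absolutely_integrable_spike[OF 1(1) n, of ?u] has_integral_spike[OF n _ 1(2), of ?u] that
      by auto
  qed
  consider "y \<le> a" | "a \<le> x" | "x \<le> a" "a \<le> y" by linarith
  then show "?u absolutely_integrable_on {x..y} \<and>
       (?u has_integral (if y \<le> a then F y else G y) - (if x \<le> a then F x else G x)) {x..y}"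
  proof cases
    case 1 then show ?thesis using L[of x y] xy by simp
  next
    case 2
    have "(if y \<le> a then F y else G y) = G y" "(if x \<le> a then F x else G x) = G x"
      using 2 xy eq by (metis antisym order_trans)+
    then show ?thesis using R[of x y] xy 2 by simp
  next
    case 3
    have y: "(if y \<le> a then F y else G y) = G y" using 3 eq by auto
    have "?u absolutely_integrable_on {x..a} \<union> {a..y}"
      using L[OF 3(1)] R[OF 3(2)] by (intro set_integrable_Un) auto
    then have "?u absolutely_integrable_on {x..y}" using 3 by (simp add: ivl_disj_un_two_touch)
    moreover have "(?u has_integral (F a - F x) + (G y - G a)) {x..y}"
      using L[OF 3(1)] R[OF 3(2)] by (intro has_integral_combine[OF 3]) auto
    ultimately show ?thesis using y 3 eq by simp
  qed
qed

text \<open>Gives differentiability at the junction of two glued functions without one-sided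
  derivatives.\<close>

lemma prim_continuous_has_vector_derivative:
  fixes F w :: "real \<Rightarrow> complex"
  assumes "prim F w" "continuous_on UNIV w"
  shows "(F has_vector_derivative w x) (at x)"
proof -
  have P: "prim (oriented_integral w) w" by (rule prim_oriented_integral[OF continuous_loc_integrable[OF assms(2)]])
  have eq: "F = (\<lambda>x. F 0 + oriented_integral w x)"
  proof
    fix x show "F x = F 0 + oriented_integral w x"
      using prim_unique[OF assms(1) P, of x] by (simp add: diff_eq_eq add.commute)
  qed
  have "((\<lambda>x. F 0 + oriented_integral w x) has_vector_derivative w x) (at x)"
    using has_vector_derivative_add[OF has_vector_derivative_const oriented_integral_has_vector_derivative[OF assms(2)]] by simp
  then show ?thesis by (subst eq)
qed

lemma twice_prim_glue:
  assumes f: "twice_prim f f1 v" and g: "twice_prim g g1 w" and eq: "f a = g a" "f1 a = g1 a"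
  shows "twice_prim (\<lambda>x. if x \<le> a then f x else g x) (\<lambda>x. if x \<le> a then f1 x else g1 x) (\<lambda>x. if x \<le> a then v x else w x)"
proof -
  note 1 = prim_glue[OF twice_prim_prim(1)[OF f] twice_prim_prim(1)[OF g] eq(1)]
  note 2 = prim_glue[OF twice_prim_prim(2)[OF f] twice_prim_prim(2)[OF g] eq(2)]
  show ?thesis
    unfolding twice_prim_def using 2 prim_continuous_has_vector_derivative[OF 1 prim_continuous_on[OF 2]] by blast
qed

lemma twice_prim_cubic:
  "twice_prim (\<lambda>x. a0 + a1 * of_real x + a2 * (of_real x * of_real x) + a3 * (of_real x * of_real x * of_real x))
     (\<lambda>x. a1 + 2 * a2 * of_real x + 3 * a3 * (of_real x * of_real x)) (\<lambda>x. 2 * a2 + 6 * a3 * of_real x)"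
proof -
  have 1: "((\<lambda>x. a0 + a1 * of_real x + a2 * (of_real x * of_real x) + a3 * (of_real x * of_real x * of_real x))
      has_vector_derivative (a1 + 2 * a2 * of_real x + 3 * a3 * (of_real x * of_real x))) (at x)" for x
    by (auto intro!: derivative_eq_intros simp: algebra_simps)
  have 2: "((\<lambda>x. a1 + 2 * a2 * of_real x + 3 * a3 * (of_real x * of_real x)) has_vector_derivative (2 * a2 + 6 * a3 * of_real x)) (at x)" for x
    by (auto intro!: derivative_eq_intros simp: algebra_simps)
  have "prim (\<lambda>x. a1 + 2 * a2 * of_real x + 3 * a3 * (of_real x * of_real x)) (\<lambda>x. 2 * a2 + 6 * a3 * of_real x)"
    by (rule prim_of_continuous_derivative[OF 2]) (intro continuous_intros)
  with 1 show ?thesis by (simp add: twice_prim_def)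
qed

lemma real_locally_boundedD:
  assumes "locally_bounded W" shows "\<exists>M\<ge>0. \<forall>x\<in>{a..b}. \<bar>W x\<bar> \<le> M"
proof -
  have "bounded (W ` {a..b})" using assms by (simp add: locally_bounded_def)
  then obtain M where M: "\<forall>v\<in>W ` {a..b}. norm v \<le> M" unfolding bounded_iff by blast
  have "\<bar>W x\<bar> \<le> max M 0" if "x \<in> {a..b}" for x
  proof -
    have "norm (W x) \<le> M" using M that by blast
    then show ?thesis by simp
  qed
  then show ?thesis by (intro exI[of _ "max M 0"]) simp
qed

lemma restr_coeff_continuous_L2:
  assumes Wm: "W \<in> borel_measurable lebesgue" and Wb: "locally_bounded W" and e: "continuous_on UNIV e"
  shows "restr {a..b} (\<lambda>x. of_real (W x) * e x) \<in> L2"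
proof -
  obtain M where M: "M \<ge> 0" "\<And>x. x \<in> {a..b} \<Longrightarrow> \<bar>W x\<bar> \<le> M" using real_locally_boundedD[OF Wb] by blast
  have em: "e \<in> borel_measurable lebesgue"
    using e by (intro measurable_completion) (simp add: borel_measurable_continuous_onI)
  show ?thesis
  proof (rule L2_dominated(1))
    show "(\<lambda>x. of_real M * restr {a..b} e x) \<in> L2" by (rule L2_cmult[OF restr_continuous_L2[OF e]])
    have "(\<lambda>x. complex_of_real (W x) * e x) \<in> borel_measurable lebesgue" using Wm em by measurable
    then show "restr {a..b} (\<lambda>x. of_real (W x) * e x) \<in> borel_measurable lebesgue"
      by (rule restr_measurable) simp
    fix x
    show "norm (restr {a..b} (\<lambda>x. of_real (W x) * e x) x) \<le> norm (of_real M * restr {a..b} e x)"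
      using M by (auto simp: indicator_def norm_mult mult_right_mono)
  qed
qed

text \<open>The cubic below continues the Cauchy data at the origin to zero Cauchy data at 1.\<close>

lemma extend_left_to_dom_S0:
  assumes Wm: "W \<in> borel_measurable lebesgue" and Wb: "locally_bounded W"
    and f: "twice_prim f f1 w" and fL: "restr {..0} f \<in> L2"
    and sL: "restr {..0} (\<lambda>x. of_real (W x) * f x - w x) \<in> L2"
  obtains F where "F \<in> dom_S0 W" "\<And>x. x \<le> 0 \<Longrightarrow> F x = f x" "deriv1 F 0 = f1 0"
    "AE x in lebesgue. x < 0 \<longrightarrow> schroedinger_expr W F x = of_real (W x) * f x - w x"
proof -
  define c where "c = f 0"
  define d where "d = f1 0"
  \<comment> \<open>Both \<open>e 1\<close> and \<open>e1 1\<close> evaluate to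
    \<open>2 * c + d - m\<close>, so this single choice makes the cubic end with zero value and zero
    slope.\<close>
  define m where "m = d + 2 * c"
  define e where "e = (\<lambda>x::real. c + d * of_real x + (c - 2 * m) * (of_real x * of_real x) + m * (of_real x * of_real x * of_real x))"
  define e1 where "e1 = (\<lambda>x::real. d + 2 * (c - 2 * m) * of_real x + 3 * m * (of_real x * of_real x))"
  define e2 where "e2 = (\<lambda>x::real. 2 * (c - 2 * m) + 6 * m * of_real x)"
  have e: "twice_prim e e1 e2" unfolding e_def e1_def e2_def by (rule twice_prim_cubic)
  have z: "twice_prim (\<lambda>x. 0) (\<lambda>x. 0) (\<lambda>x. 0)" using twice_prim_affine[of 0 0] by simp
  have e10: "e 1 = 0" "e1 1 = 0" by (auto simp: e_def e1_def m_def algebra_simps)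
  define G where "G = (\<lambda>x. if x \<le> 1 then e x else 0)"
  define G1 where "G1 = (\<lambda>x. if x \<le> 1 then e1 x else 0)"
  define G2 where "G2 = (\<lambda>x. if x \<le> 1 then e2 x else 0)"
  have G: "twice_prim G G1 G2"
    unfolding G_def G1_def G2_def by (rule twice_prim_glue[OF e z]) (simp_all add: e10)
  have G0: "f 0 = G 0" "f1 0 = G1 0" by (auto simp: G_def G1_def e_def e1_def c_def d_def)
  define F where "F = (\<lambda>x. if x \<le> 0 then f x else G x)"
  define F1 where "F1 = (\<lambda>x. if x \<le> 0 then f1 x else G1 x)"
  define F2 where "F2 = (\<lambda>x. if x \<le> 0 then w x else G2 x)"
  have F: "twice_prim F F1 F2"
    unfolding F_def F1_def F2_def by (rule twice_prim_glue[OF f G G0])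
  have AE0: "AE x in lebesgue. x \<noteq> (0::real)"
    using AE_not_in[of "{0::real}" lebesgue] by (simp add: negligible_iff_null_sets[symmetric])
  have ec: "continuous_on UNIV e" "continuous_on UNIV e2"
    using twice_prim_continuous[OF e] by (auto simp: e2_def intro!: continuous_intros)
  have "(\<lambda>x. restr {..0} f x + restr {0..1} e x) \<in> L2"
    by (rule L2_add[OF fL restr_continuous_L2[OF ec(1)]])
  then have FL: "F \<in> L2"
    by (rule L2_cong_AE(1)) (use AE0 in eventually_elim, auto simp: F_def G_def indicator_def)
  have "(\<lambda>x. restr {..0} (\<lambda>x. of_real (W x) * f x - w x) x +
      (restr {0..1} (\<lambda>x. of_real (W x) * e x) x - restr {0..1} e2 x)) \<in> L2"
    by (intro L2_add[OF sL] L2_diff restr_coeff_continuous_L2 Wm Wb ec restr_continuous_L2)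
  then have SL: "(\<lambda>x. of_real (W x) * F x - F2 x) \<in> L2"
    by (rule L2_cong_AE(1)) (use AE0 in eventually_elim, auto simp: F_def G_def F2_def G2_def indicator_def)
  note I = dom_S0_I[OF F FL SL]
  show ?thesis
  proof (rule that[OF I(1)])
    show "F x = f x" if "x \<le> 0" for x using that by (simp add: F_def)
    show "deriv1 F 0 = f1 0" using I(2) by (simp add: F1_def)
    show "AE x in lebesgue. x < 0 \<longrightarrow> schroedinger_expr W F x = of_real (W x) * f x - w x"
      using I(3) by eventually_elim (simp add: F_def F2_def)
  qed
qed

lemma restr_reflect_L2:
  assumes "restr {0..} f \<in> L2" shows "restr {..0} (\<lambda>x. f (- x)) \<in> L2"
  using L2_reflect[OF assms] by (simp add: indicator_def)

lemma AE_reflect: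
  assumes "AE x in lebesgue. P x" shows "AE x in lebesgue. P (- x :: real)"
proof -
  have N: "negligible {x. \<not> P x}"
    using assms by (simp add: completion.AE_iff_null_sets AE_iff_null_sets negligible_iff_null_sets)
  have "negligible (uminus ` {x. \<not> P x})"
    by (rule negligible_differentiable_image_negligible[OF _ N]) (auto intro!: derivative_intros)
  moreover have "uminus ` {x. \<not> P x} = {x. \<not> P (- x)}" by (force simp: image_iff)
  ultimately show ?thesis
    by (simp add: completion.AE_iff_null_sets AE_iff_null_sets negligible_iff_null_sets)
qed

lemma dom_S0_reflect:
  assumes "F \<in> dom_S0 W"
  shows "(\<lambda>x. F (- x)) \<in> dom_S0 (\<lambda>x. W (- x))" "deriv1 (\<lambda>x. F (- x)) x = - deriv1 F (- x)"
    "AE x in lebesgue. schroedinger_expr (\<lambda>x. W (- x)) (\<lambda>x. F (- x)) x = schroedinger_expr W F (- x)"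
proof -
  note D = dom_S0_D[OF assms]
  have "(\<lambda>x. of_real (W (- x)) * F (- x) - deriv1 (deriv1 F) (- x)) \<in> L2"
    using L2_reflect[OF D(3)] by (simp add: schroedinger_expr_def)
  note I = dom_S0_I[OF twice_prim_reflect[OF D(2)] L2_reflect[OF D(1)] this]
  show "(\<lambda>x. F (- x)) \<in> dom_S0 (\<lambda>x. W (- x))" by (rule I(1))
  show "deriv1 (\<lambda>x. F (- x)) x = - deriv1 F (- x)" using I(2) by simp
  show "AE x in lebesgue. schroedinger_expr (\<lambda>x. W (- x)) (\<lambda>x. F (- x)) x = schroedinger_expr W F (- x)"
    using I(3) by eventually_elim (simp add: schroedinger_expr_def)
qed

lemma extend_right_to_dom_S0:
  assumes Wm: "W \<in> borel_measurable lebesgue" and Wb: "locally_bounded W"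
    and f: "twice_prim f f1 w" and fL: "restr {0..} f \<in> L2"
    and sL: "restr {0..} (\<lambda>x. of_real (W x) * f x - w x) \<in> L2"
  obtains F where "F \<in> dom_S0 W" "\<And>x. 0 \<le> x \<Longrightarrow> F x = f x" "deriv1 F 0 = f1 0"
    "AE x in lebesgue. 0 < x \<longrightarrow> schroedinger_expr W F x = of_real (W x) * f x - w x"
proof -
  have Wm': "(\<lambda>x. W (- x)) \<in> borel_measurable lebesgue"
    using measurable_compose[OF lebesgue_measurable_scaling[of "-1"] Wm] by simp
  have Wb': "locally_bounded (\<lambda>x. W (- x))"
    unfolding locally_bounded_def
  proof (intro allI impI)
    fix K :: "real set" assume "compact K"
    then have "compact (uminus ` K)" by (intro compact_continuous_image continuous_intros)
    then have "bounded (W ` uminus ` K)" using Wb by (simp add: locally_bounded_def)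
    then show "bounded ((\<lambda>x. W (- x)) ` K)" by (simp add: image_image)
  qed
  obtain F where F: "F \<in> dom_S0 (\<lambda>x. W (- x))" "\<And>x. x \<le> 0 \<Longrightarrow> F x = f (- x)" "deriv1 F 0 = - f1 (- 0)"
    "AE x in lebesgue. x < 0 \<longrightarrow> schroedinger_expr (\<lambda>x. W (- x)) F x = of_real (W (- x)) * f (- x) - w (- x)"
    using extend_left_to_dom_S0[OF Wm' Wb' twice_prim_reflect[OF f] restr_reflect_L2[OF fL] restr_reflect_L2[OF sL]]
    by blast
  note R = dom_S0_reflect[OF F(1), simplified]
  show ?thesis
  proof (rule that[OF R(1)])
    show "F (- x) = f x" if "0 \<le> x" for x using F(2)[of "-x"] that by simp
    show "deriv1 (\<lambda>x. F (- x)) 0 = f1 0" using R(2)[of 0] F(3) by simp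
    show "AE x in lebesgue. 0 < x \<longrightarrow> schroedinger_expr W (\<lambda>x. F (- x)) x = of_real (W x) * f x - w x"
      using R(3) AE_reflect[OF F(4)] by eventually_elim simp
  qed
qed

lemma dom_S0_diff_cmult:
  assumes f: "f \<in> dom_S0 W" and g: "g \<in> dom_S0 W"
  shows "(\<lambda>x. f x - c * g x) \<in> dom_S0 W"
    "deriv1 (\<lambda>x. f x - c * g x) x = deriv1 f x - c * deriv1 g x"
    "AE x in lebesgue. schroedinger_expr W (\<lambda>x. f x - c * g x) x = schroedinger_expr W f x - c * schroedinger_expr W g x"
proof -
  note Df = dom_S0_D[OF f] and Dg = dom_S0_D[OF g]
  have "(\<lambda>x. schroedinger_expr W f x - c * schroedinger_expr W g x) \<in> L2"
    by (intro L2_diff L2_cmult Df Dg)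
  moreover have eq: "(\<lambda>x. schroedinger_expr W f x - c * schroedinger_expr W g x) =
      (\<lambda>x. of_real (W x) * (f x - c * g x) - (deriv1 (deriv1 f) x - c * deriv1 (deriv1 g) x))"
    by (auto simp: schroedinger_expr_def algebra_simps)
  ultimately have s: "(\<lambda>x. of_real (W x) * (f x - c * g x) - (deriv1 (deriv1 f) x - c * deriv1 (deriv1 g) x)) \<in> L2"
    by simp
  note I = dom_S0_I[OF twice_prim_diff[OF Df(2) twice_prim_cmult[OF Dg(2)]] L2_diff[OF Df(1) L2_cmult[OF Dg(1)]] s]
  show "(\<lambda>x. f x - c * g x) \<in> dom_S0 W" by (rule I(1))
  show "deriv1 (\<lambda>x. f x - c * g x) x = deriv1 f x - c * deriv1 g x" using I(2) by simp
  show "AE x in lebesgue. schroedinger_expr W (\<lambda>x. f x - c * g x) x = schroedinger_expr W f x - c * schroedinger_expr W g x"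
    using I(3) by eventually_elim (simp add: fun_cong[OF eq, symmetric])
qed

section \<open>Symmetry and the bound for the resolvent\<close>

text \<open>Adds the energy identities of the two half lines, whose brackets at the origin cancel.
  With \<open>f = h\<close> it expresses the symmetry of the uncoupled operator, so that it serves
  \<open>S_ab\<close> and the rank-one perturbations alike.\<close>

lemma coupled_symmetry:
  assumes f: "f \<in> dom_S0 W" and h: "h \<in> dom_S0 W" and W: "\<And>x. W x \<ge> - c"
    and bc: "Im (deriv1 h 0 * cnj (h 0)) = Im (deriv1 f 0 * cnj (f 0))"
    and k: "AE x in lebesgue. x < 0 \<longrightarrow> k x = Im (schroedinger_expr W f x * cnj (f x))"
      "AE x in lebesgue. 0 < x \<longrightarrow> k x = Im (schroedinger_expr W h x * cnj (h x))"
  shows "(LINT x|lebesgue. k x) = 0"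
proof -
  note Df = dom_S0_D[OF f] and Dh = dom_S0_D[OF h]
  have e: "of_real (W x) * u x - deriv1 (deriv1 u) x = schroedinger_expr W u x" for u x
    by (simp add: schroedinger_expr_def)
  have sf: "restr {..0} (\<lambda>x. of_real (W x) * f x - deriv1 (deriv1 f) x) \<in> L2"
    unfolding e by (rule L2_restr(1)[OF Df(3)]) simp
  have sh: "restr {0..} (\<lambda>x. of_real (W x) * h x - deriv1 (deriv1 h) x) \<in> L2"
    unfolding e by (rule L2_restr(1)[OF Dh(3)]) simp
  have rf: "restr {..0} f \<in> L2" by (rule L2_restr(1)[OF Df(1)]) simp
  have rh: "restr {0..} h \<in> L2" by (rule L2_restr(1)[OF Dh(1)]) simp
  note L = energy_left[OF Df(2) _ rf sf, of c, OF W, unfolded e]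
  note R = energy_right[OF Dh(2) _ rh sh, of c, OF W, unfolded e]
  let ?a = "\<lambda>x. indicat_real {..0} x *\<^sub>R Im (schroedinger_expr W f x * cnj (f x))"
  let ?b = "\<lambda>x. indicat_real {0..} x *\<^sub>R Im (schroedinger_expr W h x * cnj (h x))"
  have i: "integrable lebesgue ?a" "integrable lebesgue ?b"
    using L(1) R(1) by (auto simp: set_integrable_def)
  have AE0: "AE x in lebesgue. x \<noteq> (0::real)"
    using AE_not_in[of "{0::real}" lebesgue] by (simp add: negligible_iff_null_sets[symmetric])
  have AE: "AE x in lebesgue. ?a x + ?b x = k x"
    using AE0 k by eventually_elim (auto simp: indicator_def)
  have m: "(\<lambda>x. ?a x + ?b x) \<in> borel_measurable lebesgue"
    by (intro borel_measurable_add borel_measurable_integrable i)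
  have "(LINT x|lebesgue. k x) = (LINT x|lebesgue. ?a x + ?b x)"
    by (rule integral_cong_AE[OF borel_measurable_lebesgue_cong_AE[OF m AE] m]) (use AE in \<open>auto elim: AE_mp\<close>)
  also have "\<dots> = (LINT x|lebesgue. ?a x) + (LINT x|lebesgue. ?b x)" by (rule Bochner_Integration.integral_add[OF i])
  also have "\<dots> = 0" using L(2) R(2) bc by (simp add: set_lebesgue_integral_def)
  finally show ?thesis .
qed

text \<open>If the operator contributes no imaginary part, then testing \<open>z * f + g\<close>
  against \<open>f\<close> leaves only \<open>Im z\<close> times the squared norm and the pairing
  with \<open>g\<close>.\<close>

lemma L2norm_le_of_symmetry:
  assumes z: "Im z \<noteq> 0" and f: "f \<in> L2" and g: "g \<in> L2"
    and sym: "(LINT x|lebesgue. Im ((z * f x + g x) * cnj (f x))) = 0"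
  shows "L2norm f \<le> L2norm g / \<bar>Im z\<bar>"
proof -
  let ?y = "\<bar>Im z\<bar>"
  have y: "?y > 0" using z by simp
  have r: "restr UNIV u = u" for u by auto
  have "set_integrable lebesgue UNIV (\<lambda>x. (z * f x + g x) * cnj (f x))"
    by (rule set_integrable_restr_mult(1)) (simp_all only: r f L2_add[OF L2_cmult[OF f] g])
  then have "integrable lebesgue (\<lambda>x. (z * f x + g x) * cnj (f x))" by (simp add: set_integrable_def)
  then have i: "integrable lebesgue (\<lambda>x. Im ((z * f x + g x) * cnj (f x)))" by (rule integrable_Im)
  have "(LINT x|lebesgue. ?y / 2 * (norm (f x))\<^sup>2 - (norm (g x))\<^sup>2 / (2 * ?y)) \<le>
      (LINT x|lebesgue. sgn (Im z) * Im ((z * f x + g x) * cnj (f x)))"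
    by (rule integral_mono) (use L2D(2)[OF f] L2D(2)[OF g] i Im_ge_Young[OF z] in auto)
  also have "\<dots> = 0" using sym by simp
  also have "(LINT x|lebesgue. ?y / 2 * (norm (f x))\<^sup>2 - (norm (g x))\<^sup>2 / (2 * ?y)) =
      ?y / 2 * (L2norm f)\<^sup>2 - (L2norm g)\<^sup>2 / (2 * ?y)"
    using L2D(2)[OF f] L2D(2)[OF g] by (simp add: L2norm_sq)
  finally have "?y / 2 * (L2norm f)\<^sup>2 \<le> (L2norm g)\<^sup>2 / (2 * ?y)" by simp
  moreover have "S \<le> (G / v)\<^sup>2" if "v > 0" "v / 2 * S \<le> G\<^sup>2 / (2 * v)" for v S G :: real
    using that by (simp add: field_simps power2_eq_square)
  ultimately have "(L2norm f)\<^sup>2 \<le> (L2norm g / ?y)\<^sup>2" using y by blast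
  then show ?thesis by (rule power2_le_imp_le) simp
qed

section \<open>Resolvents of \<open>S_ab\<close> and of rank-one perturbations\<close>

lemma L2norm_zero_AE:
  fixes f :: "real \<Rightarrow> complex"
  assumes f: "f \<in> L2" and "L2norm f \<le> 0"
  shows "AE x in lebesgue. f x = 0"
proof -
  have "(LINT x|lebesgue. (norm (f x))\<^sup>2) = 0" using assms(2) L2norm_nonneg[of f] L2norm_sq[of f] by simp
  then have "AE x in lebesgue. (norm (f x))\<^sup>2 = 0"
    using integral_nonneg_eq_0_iff_AE[OF L2D(2)[OF f]] by simp
  then show ?thesis by eventually_elim simp
qed

lemma L2_zero: "(\<lambda>x. 0::complex) \<in> L2" "L2norm (\<lambda>x. 0::complex) = 0"
  by (simp_all add: L2_def L2norm_def)

lemma resolvent_solves: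
  assumes "z \<in> resolvent_set A" "g \<in> L2"
  shows "solves_resolvent_eq A z g (resolvent A z g)"
proof -
  have "\<exists>f. solves_resolvent_eq A z g f" using assms by (simp add: resolvent_set_def)
  then show ?thesis unfolding resolvent_def by (rule someI_ex)
qed

text \<open>The a priori bound holds for every solution, hence for the one selected by
  \<open>resolvent\<close>; applied to a difference of solutions, whose right-hand side is 0, it
  gives uniqueness.\<close>

lemma resolvent_setI:
  assumes ex: "\<And>g. g \<in> L2 \<Longrightarrow> \<exists>f. solves_resolvent_eq A z g f"
    and bd: "\<And>g f. g \<in> L2 \<Longrightarrow> solves_resolvent_eq A z g f \<Longrightarrow> f \<in> L2 \<and> L2norm f \<le> L2norm g / C"
    and diff: "\<And>g f1 f2. solves_resolvent_eq A z g f1 \<Longrightarrow> solves_resolvent_eq A z g f2 \<Longrightarrow>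
        solves_resolvent_eq A z (\<lambda>x. 0) (\<lambda>x. f1 x - f2 x)"
  shows "z \<in> resolvent_set A"
  unfolding resolvent_set_def
proof (intro CollectI conjI ballI allI impI)
  fix g :: "real \<Rightarrow> complex" assume g: "g \<in> L2"
  show "\<exists>f. solves_resolvent_eq A z g f" by (rule ex[OF g])
  fix f1 f2 assume f: "solves_resolvent_eq A z g f1 \<and> solves_resolvent_eq A z g f2"
  have "(\<lambda>x. f1 x - f2 x) \<in> L2 \<and> L2norm (\<lambda>x. f1 x - f2 x) \<le> L2norm (\<lambda>x. 0::complex) / C"
    using f by (intro bd L2_zero diff) auto
  then have "AE x in lebesgue. f1 x - f2 x = 0" by (intro L2norm_zero_AE) (auto simp: L2_zero)
  then show "AE x in lebesgue. f1 x = f2 x" by eventually_elim simp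
next
  show "\<exists>C. \<forall>g\<in>L2. L2norm (resolvent A z g) \<le> C * L2norm g"
  proof (intro exI ballI)
    fix g :: "real \<Rightarrow> complex" assume g: "g \<in> L2"
    have "solves_resolvent_eq A z g (resolvent A z g)"
      unfolding resolvent_def by (rule someI_ex[OF ex[OF g]])
    from bd[OF g this] show "L2norm (resolvent A z g) \<le> (1 / C) * L2norm g" by simp
  qed
qed

section \<open>Functions composed of two half-line pieces\<close>

lemma deriv1_cong_open:
  assumes "open S" "x \<in> S" "\<And>y. y \<in> S \<Longrightarrow> f y = g y"
  shows "deriv1 f x = deriv1 g x"
proof -
  have "(f has_vector_derivative d) (at x) \<longleftrightarrow> (g has_vector_derivative d) (at x)" for d
    using has_vector_derivative_transform_within_open[OF _ assms(1,2), of f d g]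
      has_vector_derivative_transform_within_open[OF _ assms(1,2), of g d f] assms(3) by auto
  then show ?thesis by (simp add: deriv1_def vector_derivative_def)
qed

lemma schroedinger_expr_cong_open:
  assumes S: "open S" "x \<in> S" and eq: "\<And>y. y \<in> S \<Longrightarrow> f y = g y"
  shows "schroedinger_expr V f x = schroedinger_expr V g x"
proof -
  have "deriv1 (deriv1 f) x = deriv1 (deriv1 g) x"
    by (rule deriv1_cong_open[OF S]) (rule deriv1_cong_open[OF S(1) _ eq])
  then show ?thesis using eq S(2) by (simp add: schroedinger_expr_def)
qed

lemma Lim_at_right_0:
  fixes f F :: "real \<Rightarrow> complex"
  assumes "isCont F 0" "\<And>x. 0 < x \<Longrightarrow> f x = F x"
  shows "Lim (at_right 0) f = F 0"
proof (rule tendsto_Lim)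
  have "(F \<longlongrightarrow> F 0) (at_right 0)" using assms(1) by (simp add: isCont_def filterlim_at_split)
  then show "(f \<longlongrightarrow> F 0) (at_right 0)"
    by (rule Lim_transform_eventually) (use assms(2) in \<open>auto simp: eventually_at_filter\<close>)
qed simp

lemma Lim_at_left_0:
  fixes f F :: "real \<Rightarrow> complex"
  assumes "isCont F 0" "\<And>x. x < 0 \<Longrightarrow> f x = F x"
  shows "Lim (at_left 0) f = F 0"
proof (rule tendsto_Lim)
  have "(F \<longlongrightarrow> F 0) (at_left 0)" using assms(1) by (simp add: isCont_def filterlim_at_split)
  then show "(f \<longlongrightarrow> F 0) (at_left 0)"
    by (rule Lim_transform_eventually) (use assms(2) in \<open>auto simp: eventually_at_filter\<close>)
qed simp

lemma dom_S0_isCont: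
  assumes "f \<in> dom_S0 V" shows "isCont f x" "isCont (deriv1 f) x"
  using twice_prim_continuous[OF dom_S0_D(2)[OF assms], of UNIV] by (auto simp: continuous_on_eq_continuous_at)

lemma piecewise_limits:
  assumes fm: "fm \<in> dom_S0 V" and fp: "fp \<in> dom_S0 V"
    and l: "\<And>x. x < 0 \<Longrightarrow> f x = fm x" and r: "\<And>x. 0 < x \<Longrightarrow> f x = fp x"
  shows "Lim (at_left 0) f = fm 0" "Lim (at_left 0) (deriv1 f) = deriv1 fm 0"
    "Lim (at_right 0) f = fp 0" "Lim (at_right 0) (deriv1 f) = deriv1 fp 0"
proof -
  show "Lim (at_left 0) f = fm 0" by (rule Lim_at_left_0[OF dom_S0_isCont(1)[OF fm] l])
  show "Lim (at_right 0) f = fp 0" by (rule Lim_at_right_0[OF dom_S0_isCont(1)[OF fp] r])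
  have "deriv1 f x = deriv1 fm x" if "x < 0" for x
    by (rule deriv1_cong_open[of "{..<0}"]) (use that l in auto)
  then show "Lim (at_left 0) (deriv1 f) = deriv1 fm 0" by (rule Lim_at_left_0[OF dom_S0_isCont(2)[OF fm]])
  have "deriv1 f x = deriv1 fp x" if "0 < x" for x
    by (rule deriv1_cong_open[of "{0<..}"]) (use that r in auto)
  then show "Lim (at_right 0) (deriv1 f) = deriv1 fp 0" by (rule Lim_at_right_0[OF dom_S0_isCont(2)[OF fp]])
qed

text \<open>Names extensions of both halves as witnesses. They are differentiable across the origin,
  so one-sided limits become values at 0 and the coupling conditions become algebraic.\<close>

definition glued_pair :: "(real \<Rightarrow> real) \<Rightarrow> real \<Rightarrow> real \<Rightarrow> (real \<Rightarrow> complex) \<Rightarrow> (real \<Rightarrow> complex) \<Rightarrow> (real \<Rightarrow> complex) \<Rightarrow> bool" where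
  "glued_pair V \<alpha> \<beta> f fm fp \<longleftrightarrow> fm \<in> dom_S0 V \<and> fp \<in> dom_S0 V \<and> f \<in> L2 \<and>
    (\<forall>x<0. f x = fm x) \<and> (\<forall>x>0. f x = fp x) \<and>
    fp 0 = of_real \<alpha> * fm 0 + of_real \<beta> * deriv1 fm 0 \<and> deriv1 fp 0 = deriv1 fm 0 / of_real \<alpha>"

lemma glued_pairD:
  assumes "glued_pair V \<alpha> \<beta> f fm fp"
  shows "fm \<in> dom_S0 V" "fp \<in> dom_S0 V" "f \<in> L2"
    "\<And>x. x < 0 \<Longrightarrow> f x = fm x" "\<And>x. 0 < x \<Longrightarrow> f x = fp x"
    "fp 0 = of_real \<alpha> * fm 0 + of_real \<beta> * deriv1 fm 0" "deriv1 fp 0 = deriv1 fm 0 / of_real \<alpha>"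
    "\<And>x. x < 0 \<Longrightarrow> schroedinger_expr V f x = schroedinger_expr V fm x"
    "\<And>x. 0 < x \<Longrightarrow> schroedinger_expr V f x = schroedinger_expr V fp x"
proof -
  show d: "fm \<in> dom_S0 V" "fp \<in> dom_S0 V" "f \<in> L2"
    and l: "\<And>x. x < 0 \<Longrightarrow> f x = fm x" and r: "\<And>x. 0 < x \<Longrightarrow> f x = fp x"
    and "fp 0 = of_real \<alpha> * fm 0 + of_real \<beta> * deriv1 fm 0" "deriv1 fp 0 = deriv1 fm 0 / of_real \<alpha>"
    using assms unfolding glued_pair_def by blast+
  show "schroedinger_expr V f x = schroedinger_expr V fm x" if "x < 0" for x
    by (rule schroedinger_expr_cong_open[of "{..<0}"]) (use that l in auto)
  show "schroedinger_expr V f x = schroedinger_expr V fp x" if "0 < x" for x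
    by (rule schroedinger_expr_cong_open[of "{0<..}"]) (use that r in auto)
qed

lemma S_ab_D:
  assumes "f \<in> fst (S_ab V \<alpha> \<beta>)"
  shows "\<exists>fm fp. glued_pair V \<alpha> \<beta> f fm fp"
proof -
  from assms obtain fm fp where d: "fm \<in> dom_S0 V" "fp \<in> dom_S0 V" and fL: "f \<in> L2"
    and l: "\<And>x. x < 0 \<Longrightarrow> f x = fm x" and r: "\<And>x. 0 < x \<Longrightarrow> f x = fp x"
    and bc: "Lim (at_right 0) f = of_real \<alpha> * Lim (at_left 0) f + of_real \<beta> * Lim (at_left 0) (deriv1 f)"
      "Lim (at_right 0) (deriv1 f) = of_real (1 / \<alpha>) * Lim (at_left 0) (deriv1 f)"
    by (auto simp: S_ab_def V_space_def)
  note L = piecewise_limits[OF d l r]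
  have "fp 0 = of_real \<alpha> * fm 0 + of_real \<beta> * deriv1 fm 0" using bc(1) by (simp add: L)
  moreover have "deriv1 fp 0 = deriv1 fm 0 / of_real \<alpha>" using bc(2) by (simp add: L field_simps)
  ultimately show ?thesis unfolding glued_pair_def using d fL l r by blast
qed

lemma S_ab_I:
  assumes P: "glued_pair V \<alpha> \<beta> f fm fp"
  shows "f \<in> fst (S_ab V \<alpha> \<beta>)"
proof -
  note D = glued_pairD[OF P]
  note L = piecewise_limits[OF D(1,2,4,5)]
  have "f \<in> V_space V" unfolding V_space_def using D(1-5) by blast
  then show ?thesis unfolding S_ab_def using D(6,7) by (simp add: L)
qed

lemma snd_S_ab [simp]: "snd (S_ab V \<alpha> \<beta>) = schroedinger_expr V"
  by (simp add: S_ab_def)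

lemma AE_nonzero: "AE x in lebesgue. x \<noteq> (0::real)"
  using AE_not_in[of "{0::real}" lebesgue] by (simp add: negligible_iff_null_sets[symmetric])

section \<open>Nonreal points in the resolvent set of \<open>S_ab\<close>\<close>

context
  fixes V :: "real \<Rightarrow> real" and c :: real and z :: complex
  assumes Vm: "V \<in> borel_measurable lebesgue" and Vb: "locally_bounded V" and Vc: "\<And>x. V x \<ge> - c"
    and z: "Im z \<noteq> 0"
begin

lemma S_ab_solution_bound:
  assumes \<alpha>: "\<alpha> \<noteq> 0" and g: "g \<in> L2" and f: "solves_resolvent_eq (S_ab V \<alpha> \<beta>) z g f"
  shows "f \<in> L2 \<and> L2norm f \<le> L2norm g / \<bar>Im z\<bar>"
proof -
  have fd: "f \<in> fst (S_ab V \<alpha> \<beta>)" and feq: "AE x in lebesgue. schroedinger_expr V f x - z * f x = g x"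
    using f by (auto simp: solves_resolvent_eq_def)
  obtain fm fp where "glued_pair V \<alpha> \<beta> f fm fp" using S_ab_D[OF fd] by blast
  note p = glued_pairD[OF this]
  have "(LINT x|lebesgue. Im ((z * f x + g x) * cnj (f x))) = 0"
  proof (rule coupled_symmetry[OF p(1,2) Vc])
    show "Im (deriv1 fp 0 * cnj (fp 0)) = Im (deriv1 fm 0 * cnj (fm 0))"
      unfolding p(6,7) by (rule coupling_Im[OF \<alpha>])
    show "AE x in lebesgue. x < 0 \<longrightarrow> Im ((z * f x + g x) * cnj (f x)) = Im (schroedinger_expr V fm x * cnj (fm x))"
      using feq
    proof eventually_elim
      case (elim x)
      then have e: "z * f x + g x = schroedinger_expr V f x" by (simp add: algebra_simps)
      show ?case unfolding e using p(4)[of x] p(8)[of x] by simp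
    qed
    show "AE x in lebesgue. 0 < x \<longrightarrow> Im ((z * f x + g x) * cnj (f x)) = Im (schroedinger_expr V fp x * cnj (fp x))"
      using feq
    proof eventually_elim
      case (elim x)
      then have e: "z * f x + g x = schroedinger_expr V f x" by (simp add: algebra_simps)
      show ?case unfolding e using p(5)[of x] p(9)[of x] by simp
    qed
  qed
  from L2norm_le_of_symmetry[OF z p(3) g this] p(3) show ?thesis by blast
qed

lemma S_ab_solvable:
  assumes \<alpha>: "\<alpha> \<noteq> 0" and g: "g \<in> L2"
  shows "\<exists>f. solves_resolvent_eq (S_ab V \<alpha> \<beta>) z g f"
proof -
  obtain f f1 h h1 where s: "twice_prim f f1 (\<lambda>x. (of_real (V x) - z) * f x - g x)"
    "twice_prim h h1 (\<lambda>x. (of_real (V x) - z) * h x - g x)"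
    "restr {..0} f \<in> L2" "restr {0..} h \<in> L2"
    "h 0 = of_real \<alpha> * f 0 + of_real \<beta> * f1 0" "h1 0 = f1 0 / of_real \<alpha>"
    by (rule coupled_problem_solvable[OF Vm Vb z \<alpha> g, of \<beta>])
  have e: "of_real (V x) * u x - ((of_real (V x) - z) * u x - g x) = z * u x + g x" for u x
    by (simp add: algebra_simps)
  have "(\<lambda>x. z * restr {..0} f x + restr {..0} g x) \<in> L2" "(\<lambda>x. z * restr {0..} h x + restr {0..} g x) \<in> L2"
    by (intro L2_add L2_cmult s L2_restr(1)[OF g]; simp)+
  then have sL: "restr {..0} (\<lambda>x. of_real (V x) * f x - ((of_real (V x) - z) * f x - g x)) \<in> L2"
    "restr {0..} (\<lambda>x. of_real (V x) * h x - ((of_real (V x) - z) * h x - g x)) \<in> L2"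
    unfolding e by (simp_all add: scaleR_add_right mult_scaleR_right)
  obtain F where F: "F \<in> dom_S0 V" "\<And>x. x \<le> 0 \<Longrightarrow> F x = f x" "deriv1 F 0 = f1 0"
    "AE x in lebesgue. x < 0 \<longrightarrow> schroedinger_expr V F x = z * f x + g x"
    using extend_left_to_dom_S0[OF Vm Vb s(1,3) sL(1)] unfolding e by blast
  obtain H where H: "H \<in> dom_S0 V" "\<And>x. 0 \<le> x \<Longrightarrow> H x = h x" "deriv1 H 0 = h1 0"
    "AE x in lebesgue. 0 < x \<longrightarrow> schroedinger_expr V H x = z * h x + g x"
    using extend_right_to_dom_S0[OF Vm Vb s(2,4) sL(2)] unfolding e by blast
  \<comment> \<open>The value at 0 is immaterial: \<open>glued_pair\<close> prescribes values off
    the origin and the equation is meant almost everywhere.\<close>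
  define k where "k = (\<lambda>x. if x < 0 then F x else H x)"
  have "(\<lambda>x. restr {..<0} F x + restr {0..} H x) \<in> L2"
    by (intro L2_add L2_restr(1) dom_S0_D(1)[OF F(1)] dom_S0_D(1)[OF H(1)]) auto
  moreover have "(\<lambda>x. restr {..<0} F x + restr {0..} H x) = k" by (auto simp: k_def indicator_def)
  ultimately have kL: "k \<in> L2" by simp
  have kF: "k x = F x" if "x < 0" for x using that by (simp add: k_def)
  have kH: "k x = H x" if "0 < x" for x using that by (simp add: k_def)
  have bc: "H 0 = of_real \<alpha> * F 0 + of_real \<beta> * deriv1 F 0" "deriv1 H 0 = deriv1 F 0 / of_real \<alpha>"
    using s(5,6) F(2)[of 0] H(2)[of 0] F(3) H(3) by auto
  have P: "glued_pair V \<alpha> \<beta> k F H" unfolding glued_pair_def using F(1) H(1) kL kF kH bc by blast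
  note I = S_ab_I[OF P] glued_pairD(8,9)[OF P]
  have "AE x in lebesgue. schroedinger_expr V k x - z * k x = g x"
    using AE_nonzero F(4) H(4)
  proof eventually_elim
    case (elim x)
    show ?case
    proof (cases "x < 0")
      case True then show ?thesis using elim(2) I(2) kF F(2)[of x] by simp
    next
      case False
      then have "0 < x" using elim(1) by simp
      then show ?thesis using elim(3) I(3) kH H(2)[of x] by simp
    qed
  qed
  then show ?thesis using I(1) by (auto simp: solves_resolvent_eq_def)
qed

lemma S_ab_diff:
  assumes f: "solves_resolvent_eq (S_ab V \<alpha> \<beta>) z g f" and h: "solves_resolvent_eq (S_ab V \<alpha> \<beta>) z g h"
  shows "solves_resolvent_eq (S_ab V \<alpha> \<beta>) z (\<lambda>x. 0) (\<lambda>x. f x - h x)"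
proof -
  have fd: "f \<in> fst (S_ab V \<alpha> \<beta>)" and feq: "AE x in lebesgue. schroedinger_expr V f x - z * f x = g x"
    using f by (auto simp: solves_resolvent_eq_def)
  have hd: "h \<in> fst (S_ab V \<alpha> \<beta>)" and heq: "AE x in lebesgue. schroedinger_expr V h x - z * h x = g x"
    using h by (auto simp: solves_resolvent_eq_def)
  obtain fm fp where "glued_pair V \<alpha> \<beta> f fm fp" using S_ab_D[OF fd] by blast
  note p = glued_pairD[OF this]
  obtain hm hp where "glued_pair V \<alpha> \<beta> h hm hp" using S_ab_D[OF hd] by blast
  note r = glued_pairD[OF this]
  note dm = dom_S0_diff_cmult[OF p(1) r(1), of 1, simplified]
  note dp = dom_S0_diff_cmult[OF p(2) r(2), of 1, simplified]
  have eqs: "f x - h x = fm x - hm x" if "x < 0" for x using that p(4) r(4) by simp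
  have eqs': "f x - h x = fp x - hp x" if "0 < x" for x using that p(5) r(5) by simp
  have bc: "fp 0 - hp 0 = of_real \<alpha> * (fm 0 - hm 0) + of_real \<beta> * deriv1 (\<lambda>x. fm x - hm x) 0"
    "deriv1 (\<lambda>x. fp x - hp x) 0 = deriv1 (\<lambda>x. fm x - hm x) 0 / of_real \<alpha>"
    unfolding dm(2) dp(2) p(6,7) r(6,7) by (simp_all add: algebra_simps diff_divide_distrib)
  have P: "glued_pair V \<alpha> \<beta> (\<lambda>x. f x - h x) (\<lambda>x. fm x - hm x) (\<lambda>x. fp x - hp x)"
    unfolding glued_pair_def using dm(1) dp(1) L2_diff[OF p(3) r(3)] eqs eqs' bc by blast
  note I = S_ab_I[OF P] glued_pairD(8,9)[OF P]
  have "AE x in lebesgue. schroedinger_expr V (\<lambda>x. f x - h x) x - z * (f x - h x) = 0"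
    using AE_nonzero feq heq dm(3) dp(3)
  proof eventually_elim
    case (elim x)
    have "schroedinger_expr V (\<lambda>x. f x - h x) x = schroedinger_expr V f x - schroedinger_expr V h x"
    proof (cases "x < 0")
      case True then show ?thesis using I(2) elim(4) p(8) r(8) by simp
    next
      case False
      then have "0 < x" using elim(1) by simp
      then show ?thesis using I(3) elim(5) p(9) r(9) by simp
    qed
    then show ?case using elim(2,3) by (simp add: algebra_simps)
  qed
  then show ?thesis using I(1) by (simp add: solves_resolvent_eq_def)
qed

lemma S_ab_resolvent_set: "\<alpha> \<noteq> 0 \<Longrightarrow> z \<in> resolvent_set (S_ab V \<alpha> \<beta>)"
  by (rule resolvent_setI[where C = "\<bar>Im z\<bar>"]) (use S_ab_solvable S_ab_solution_bound S_ab_diff in blast)+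

text \<open>For \<open>\<alpha> = 1\<close> and \<open>\<beta> = 0\<close> the halves have equal
  Cauchy data at the origin, so by the last conclusion of \<open>coupled_problem_solvable\<close>
  they are restrictions of one solution on the line.\<close>

lemma S0_solvable:
  assumes g: "g \<in> L2"
  shows "\<exists>f\<in>dom_S0 V. AE x in lebesgue. schroedinger_expr V f x - z * f x = g x"
proof -
  obtain f f1 h h1 where s: "twice_prim f f1 (\<lambda>x. (of_real (V x) - z) * f x - g x)"
    "restr {..0} f \<in> L2" "restr {0..} h \<in> L2"
    "h 0 = of_real 1 * f 0 + of_real 0 * f1 0" "h1 0 = f1 0 / of_real 1"
    "f 0 = h 0 \<Longrightarrow> f1 0 = h1 0 \<Longrightarrow> f = h"
    by (rule coupled_problem_solvable[OF Vm Vb z _ g, of 1 0]) simp_all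
  then have "f = h" by simp
  have "(\<lambda>x. restr {..0} f x + restr {0..} h x) \<in> L2" by (rule L2_add[OF s(2,3)])
  then have fL: "f \<in> L2"
    by (rule L2_cong_AE(1)) (use AE_nonzero in eventually_elim, auto simp: \<open>f = h\<close> indicator_def)
  have e: "of_real (V x) * f x - ((of_real (V x) - z) * f x - g x) = z * f x + g x" for x
    by (simp add: algebra_simps)
  have "(\<lambda>x. of_real (V x) * f x - ((of_real (V x) - z) * f x - g x)) \<in> L2"
    unfolding e by (intro L2_add L2_cmult fL g)
  note I = dom_S0_I[OF s(1) fL this]
  have "AE x in lebesgue. schroedinger_expr V f x - z * f x = g x"
    using I(3) by eventually_elim (simp add: algebra_simps)
  with I(1) show ?thesis by blast
qed

end

section \<open>Rank-one perturbations\<close>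

definition rank_one_perturbation :: "(real \<Rightarrow> real) \<Rightarrow> (real \<Rightarrow> real) \<Rightarrow> real \<Rightarrow> L2_operator" where
  "rank_one_perturbation W p k = (dom_S0 W,
     \<lambda>f x. schroedinger_expr W f x + of_real (k * p x) * (LINT s|lebesgue. of_real (p s) * f s))"

lemma L2_of_real: "p \<in> L2 \<Longrightarrow> (\<lambda>x. complex_of_real (p x)) \<in> L2"
  by (auto simp: L2_def)

lemma L2_scale:
  fixes p :: "real \<Rightarrow> real"
  assumes p: "p \<in> L2" and e: "e > 0"
  shows "(\<lambda>x. p (x / e)) \<in> L2"
proof -
  have "(\<lambda>x. p (x / e)) \<in> borel_measurable lebesgue"
    using measurable_compose[OF lebesgue_measurable_scaling[of "1 / e"] L2D(1)[OF p]] by simp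
  moreover have "integrable lebesgue (\<lambda>x. (norm (p (0 + (1 / e) * x)))\<^sup>2)"
    using lebesgue_integrable_real_affine_iff[of "1 / e" "\<lambda>x. (norm (p x))\<^sup>2" 0] L2D(2)[OF p] e by simp
  ultimately show ?thesis by (simp add: L2_def)
qed

text \<open>For proportional profiles the two terms of \<open>B_pert\<close> coincide, hence the
  factor 2. The bounded term with \<open>q\<close> maps L2 to itself, so absorbing it into the
  potential leaves the domain unchanged.\<close>

lemma S_eps_eq_rank_one:
  assumes q: "q \<in> borel_measurable lebesgue" and qb: "\<And>x. \<bar>q x\<bar> \<le> M" and e: "e > 0"
  shows "S_eps V p (\<lambda>t. c * p t) q e =
     rank_one_perturbation (\<lambda>x. V x + 1 / e * q (x / e)) (\<lambda>x. p (x / e)) (2 * c / e ^ 3)"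
proof -
  let ?W = "\<lambda>x. V x + 1 / e * q (x / e)"
  have sch: "schroedinger_expr ?W f x = schroedinger_expr V f x + of_real (1 / e * q (x / e)) * f x" for f x
    by (simp add: schroedinger_expr_def algebra_simps)
  have qe: "(\<lambda>x. 1 / e * q (x / e)) \<in> borel_measurable lebesgue"
    using measurable_compose[OF lebesgue_measurable_scaling[of "1 / e"] q] by simp
  have qL: "(\<lambda>x. of_real (1 / e * q (x / e)) * f x) \<in> L2" if f: "f \<in> L2" for f :: "real \<Rightarrow> complex"
  proof (rule L2_dominated(1)[OF L2_cmult[OF f, of "of_real (M / e)"]])
    show "(\<lambda>x. complex_of_real (1 / e * q (x / e)) * f x) \<in> borel_measurable lebesgue"
      using qe L2D(1)[OF f] by measurable
    fix x
    have "\<bar>1 / e * q (x / e)\<bar> \<le> M / e" using qb[of "x / e"] e by (simp add: abs_mult divide_right_mono)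
    also have "\<dots> \<le> \<bar>M / e\<bar>" by (rule abs_ge_self)
    finally show "norm (complex_of_real (1 / e * q (x / e)) * f x) \<le> norm (of_real (M / e) * f x)"
      unfolding norm_mult norm_of_real by (rule mult_right_mono) simp
  qed
  have "schroedinger_expr ?W f \<in> L2 \<longleftrightarrow> schroedinger_expr V f \<in> L2" if f: "f \<in> L2" for f
  proof
    assume "schroedinger_expr ?W f \<in> L2"
    from L2_diff[OF this qL[OF f]] show "schroedinger_expr V f \<in> L2"
      unfolding sch add_diff_cancel_right' .
  next
    assume "schroedinger_expr V f \<in> L2"
    from L2_add[OF this qL[OF f]] show "schroedinger_expr ?W f \<in> L2" unfolding sch[symmetric] .
  qed
  then have dom: "dom_S0 V = dom_S0 ?W" unfolding dom_S0_def by blast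
  have act: "schroedinger_expr V f x + complex_of_real (1 / e ^ 3) * B_pert p (\<lambda>t. c * p t) e f x
             + complex_of_real (1 / e * q (x / e)) * f x =
    schroedinger_expr ?W f x + of_real (2 * c / e ^ 3 * p (x / e)) * (LINT s|lebesgue. of_real (p (s / e)) * f s)" for f x
  proof -
    have "(LINT s|lebesgue. complex_of_real (c * p (s / e)) * f s) = of_real c * (LINT s|lebesgue. of_real (p (s / e)) * f s)"
      by (simp add: mult.assoc)
    then show ?thesis unfolding B_pert_def sch by (simp add: field_simps)
  qed
  show ?thesis unfolding S_eps_def rank_one_perturbation_def dom act ..
qed

lemma perturbed_potential:
  assumes Vm: "V \<in> borel_measurable lebesgue" and Vb: "locally_bounded V" and Vc: "\<And>x. V x \<ge> - c"
    and q: "q \<in> borel_measurable lebesgue" and qb: "\<And>x. \<bar>q x\<bar> \<le> M" and e: "e > 0"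
  shows "(\<lambda>x. V x + 1 / e * q (x / e)) \<in> borel_measurable lebesgue"
    "locally_bounded (\<lambda>x. V x + 1 / e * q (x / e))" "V x + 1 / e * q (x / e) \<ge> - (c + M / e)"
proof -
  have qe: "(\<lambda>x. 1 / e * q (x / e)) \<in> borel_measurable lebesgue"
    using measurable_compose[OF lebesgue_measurable_scaling[of "1 / e"] q] by simp
  show "(\<lambda>x. V x + 1 / e * q (x / e)) \<in> borel_measurable lebesgue" using Vm qe by (rule borel_measurable_add)
  have le: "\<bar>1 / e * q (x / e)\<bar> \<le> M / e" for x
    using qb[of "x / e"] e by (simp add: abs_mult divide_right_mono)
  show "V x + 1 / e * q (x / e) \<ge> - (c + M / e)"
    using Vc[of x] le[of x] by linarith
  show "locally_bounded (\<lambda>x. V x + 1 / e * q (x / e))"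
    unfolding locally_bounded_def
  proof (intro allI impI)
    fix K :: "real set" assume "compact K"
    then have "bounded (V ` K)" using Vb by (simp add: locally_bounded_def)
    then obtain B where B: "\<forall>v\<in>V ` K. norm v \<le> B" unfolding bounded_iff by blast
    show "bounded ((\<lambda>x. V x + 1 / e * q (x / e)) ` K)"
      unfolding bounded_iff
    proof (intro exI ballI)
      fix v assume "v \<in> (\<lambda>x. V x + 1 / e * q (x / e)) ` K"
      then obtain x where x: "x \<in> K" "v = V x + 1 / e * q (x / e)" by auto
      have "norm (V x) \<le> B" using B x(1) by blast
      then show "norm v \<le> B + M / e" using le[of x] unfolding x(2) real_norm_def by linarith
    qed
  qed
qed

context
  fixes W :: "real \<Rightarrow> real" and c :: real and z :: complex and p :: "real \<Rightarrow> real" and k :: real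
  assumes Wm: "W \<in> borel_measurable lebesgue" and Wb: "locally_bounded W" and Wc: "\<And>x. W x \<ge> - c"
    and z: "Im z \<noteq> 0" and p: "p \<in> L2"
begin

lemma L2_p_integrable: "f \<in> L2 \<Longrightarrow> integrable lebesgue (\<lambda>s. complex_of_real (p s) * f s)"
  by (rule L2_mult_integrable[OF L2_of_real[OF p]])

text \<open>The rank-one term contributes \<open>k\<close> times the imaginary part of
  \<open>I * cnj I\<close>, which is 0. The bound is therefore uniform in \<open>k\<close> and
  \<open>W\<close>, hence in the scaling parameter.\<close>

lemma rank_one_solution_bound:
  assumes g: "g \<in> L2" and f: "solves_resolvent_eq (rank_one_perturbation W p k) z g f"
  shows "f \<in> L2 \<and> L2norm f \<le> L2norm g / \<bar>Im z\<bar>"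
proof -
  define I where "I = (LINT s|lebesgue. of_real (p s) * f s)"
  have fd: "f \<in> dom_S0 W" and feq: "AE x in lebesgue. schroedinger_expr W f x + of_real (k * p x) * I - z * f x = g x"
    using f by (auto simp: solves_resolvent_eq_def rank_one_perturbation_def I_def)
  note D = dom_S0_D[OF fd]
  have AE: "AE x in lebesgue. Im ((z * f x + g x) * cnj (f x)) - k * Im (I * cnj (of_real (p x) * f x)) = Im (schroedinger_expr W f x * cnj (f x))"
    using feq
  proof eventually_elim
    case (elim x)
    then have s: "schroedinger_expr W f x = z * f x + g x - of_real k * of_real (p x) * I" by (simp add: algebra_simps)
    have e: "schroedinger_expr W f x * cnj (f x) = (z * f x + g x) * cnj (f x) - of_real k * (I * cnj (of_real (p x) * f x))"
      unfolding s by (simp add: algebra_simps)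
    show ?case unfolding e minus_complex.simps Im_complex_of_real by simp
  qed
  have sym: "(LINT x|lebesgue. Im ((z * f x + g x) * cnj (f x)) - k * Im (I * cnj (of_real (p x) * f x))) = 0"
    by (rule coupled_symmetry[OF fd fd Wc refl]) (use AE in \<open>auto elim: AE_mp\<close>)
  have r: "restr UNIV u = u" for u by auto
  have "set_integrable lebesgue UNIV (\<lambda>x. (z * f x + g x) * cnj (f x))"
    by (rule set_integrable_restr_mult(1)) (simp_all only: r D(1) L2_add[OF L2_cmult[OF D(1)] g])
  then have "integrable lebesgue (\<lambda>x. (z * f x + g x) * cnj (f x))" by (simp add: set_integrable_def)
  then have i1: "integrable lebesgue (\<lambda>x. Im ((z * f x + g x) * cnj (f x)))" by (rule integrable_Im)
  have ic: "integrable lebesgue (\<lambda>x. cnj (of_real (p x) * f x))"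
    by (rule integrable_cnj[OF L2_p_integrable[OF D(1)]])
  have i2: "integrable lebesgue (\<lambda>x. I * cnj (of_real (p x) * f x))" using ic by (rule integrable_mult_right)
  have "(LINT x|lebesgue. Im (I * cnj (of_real (p x) * f x))) = Im (LINT x|lebesgue. I * cnj (of_real (p x) * f x))"
    by (rule integral_Im[OF i2])
  also have "(LINT x|lebesgue. I * cnj (of_real (p x) * f x)) = I * (LINT x|lebesgue. cnj (of_real (p x) * f x))"
    by (rule integral_mult_right_zero)
  also have "(LINT x|lebesgue. cnj (of_real (p x) * f x)) = cnj I"
    unfolding I_def by (rule Bochner_Integration.integral_cnj)
  also have "Im (I * cnj I) = 0" by simp
  finally have I0: "(LINT x|lebesgue. Im (I * cnj (of_real (p x) * f x))) = 0" .
  have "(LINT x|lebesgue. Im ((z * f x + g x) * cnj (f x)) - k * Im (I * cnj (of_real (p x) * f x)))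
      = (LINT x|lebesgue. Im ((z * f x + g x) * cnj (f x))) - (LINT x|lebesgue. k * Im (I * cnj (of_real (p x) * f x)))"
    by (rule Bochner_Integration.integral_diff[OF i1 integrable_mult_right[OF integrable_Im[OF i2]]])
  then have "(LINT x|lebesgue. Im ((z * f x + g x) * cnj (f x))) = 0" unfolding sym using I0 by simp
  from L2norm_le_of_symmetry[OF z D(1) g this] D(1) show ?thesis by blast
qed

lemma rank_one_diff:
  assumes f: "solves_resolvent_eq (rank_one_perturbation W p k) z g f"
    and h: "solves_resolvent_eq (rank_one_perturbation W p k) z g h"
  shows "solves_resolvent_eq (rank_one_perturbation W p k) z (\<lambda>x. 0) (\<lambda>x. f x - h x)"
proof -
  define I where "I = (\<lambda>f :: real \<Rightarrow> complex. LINT s|lebesgue. of_real (p s) * f s)"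
  have fd: "f \<in> dom_S0 W" and feq: "AE x in lebesgue. schroedinger_expr W f x + of_real (k * p x) * I f - z * f x = g x"
    using f by (auto simp: solves_resolvent_eq_def rank_one_perturbation_def I_def)
  have hd: "h \<in> dom_S0 W" and heq: "AE x in lebesgue. schroedinger_expr W h x + of_real (k * p x) * I h - z * h x = g x"
    using h by (auto simp: solves_resolvent_eq_def rank_one_perturbation_def I_def)
  note d = dom_S0_diff_cmult[OF fd hd, of 1, simplified]
  have "I (\<lambda>x. f x - h x) = I f - I h"
    using Bochner_Integration.integral_diff[OF L2_p_integrable[OF dom_S0_D(1)[OF fd]] L2_p_integrable[OF dom_S0_D(1)[OF hd]]]
    by (simp add: I_def right_diff_distrib)
  moreover have "AE x in lebesgue. schroedinger_expr W (\<lambda>x. f x - h x) x + of_real (k * p x) * (I f - I h) - z * (f x - h x) = 0"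
    using feq heq d(3)
  proof eventually_elim
    case (elim x)
    have s: "schroedinger_expr W f x = g x + z * f x - of_real (k * p x) * I f"
      "schroedinger_expr W h x = g x + z * h x - of_real (k * p x) * I h"
      using elim(1,2) by (simp_all add: algebra_simps)
    show ?case unfolding elim(3) s by (simp add: algebra_simps)
  qed
  ultimately show ?thesis using d(1)
    by (simp add: solves_resolvent_eq_def rank_one_perturbation_def I_def)
qed

text \<open>Krein's formula: with \<open>u\<close> and \<open>r\<close> the unperturbed solutions
  for \<open>g\<close> and \<open>p\<close>, subtract a multiple of \<open>r\<close> from
  \<open>u\<close>. This fails only if \<open>1 + k * I r = 0\<close>, which would make
  \<open>I r\<close> real. But the imaginary part of \<open>I r\<close> is \<open>Im z\<close> times
  the squared norm of \<open>r\<close>, so \<open>r\<close> would vanish and \<open>I r\<close> with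
  it.\<close>

lemma rank_one_solvable:
  assumes g: "g \<in> L2"
  shows "\<exists>f. solves_resolvent_eq (rank_one_perturbation W p k) z g f"
proof -
  define I where "I = (\<lambda>f :: real \<Rightarrow> complex. LINT s|lebesgue. of_real (p s) * f s)"
  have pL: "(\<lambda>x. complex_of_real (p x)) \<in> L2" by (rule L2_of_real[OF p])
  obtain u where u: "u \<in> dom_S0 W" "AE x in lebesgue. schroedinger_expr W u x - z * u x = g x"
    using S0_solvable[OF Wm Wb Wc z g] by blast
  obtain r where r: "r \<in> dom_S0 W" "AE x in lebesgue. schroedinger_expr W r x - z * r x = of_real (p x)"
    using S0_solvable[OF Wm Wb Wc z pL] by blast
  have rL: "r \<in> L2" by (rule dom_S0_D(1)[OF r(1)])
  have nz: "1 + of_real k * I r \<noteq> 0"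
  proof
    assume 0: "1 + of_real k * I r = 0"
    then have k0: "k \<noteq> 0" by auto
    have "I r = - (1 / of_real k)" using 0 k0 by (simp add: field_simps add_eq_0_iff)
    then have Ir: "Im (I r) = 0" by simp
    have r': "restr UNIV u = u" for u by auto
    have "(LINT x|lebesgue. Im ((z * r x + of_real (p x)) * cnj (r x))) = 0"
    proof (rule coupled_symmetry[OF r(1) r(1) Wc refl])
      have AE: "AE x in lebesgue. Im ((z * r x + of_real (p x)) * cnj (r x)) = Im (schroedinger_expr W r x * cnj (r x))"
        using r(2)
      proof eventually_elim
        case (elim x)
        then have e: "z * r x + of_real (p x) = schroedinger_expr W r x" by (simp add: algebra_simps)
        show ?case unfolding e ..
      qed
      from AE show "AE x in lebesgue. x < 0 \<longrightarrow> Im ((z * r x + of_real (p x)) * cnj (r x)) = Im (schroedinger_expr W r x * cnj (r x))"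
        by eventually_elim simp
      from AE show "AE x in lebesgue. 0 < x \<longrightarrow> Im ((z * r x + of_real (p x)) * cnj (r x)) = Im (schroedinger_expr W r x * cnj (r x))"
        by eventually_elim simp
    qed
    moreover have "(LINT x|lebesgue. Im ((z * r x + of_real (p x)) * cnj (r x))) = Im z * (L2norm r)\<^sup>2 - Im (I r)"
    proof -
      have eq: "Im ((z * r x + of_real (p x)) * cnj (r x)) = Im z * (norm (r x))\<^sup>2 - Im (of_real (p x) * r x)" for x
        unfolding Im_mult_cnj_self by simp
      have "(LINT x|lebesgue. Im (of_real (p x) * r x)) = Im (I r)"
        unfolding I_def by (rule integral_Im[OF L2_p_integrable[OF rL]])
      then show ?thesis unfolding eq
        using L2D(2)[OF rL] integrable_Im[OF L2_p_integrable[OF rL]]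
        by (subst Bochner_Integration.integral_diff) (auto simp: L2norm_sq)
    qed
    ultimately have "L2norm r = 0" using z Ir by simp
    then have "AE x in lebesgue. r x = 0" using L2norm_zero_AE[OF rL] by simp
    then have "AE x in lebesgue. of_real (p x) * r x = 0" by eventually_elim simp
    then have "I r = (LINT x::real|lebesgue. 0)"
      unfolding I_def by (intro integral_cong_AE) (use L2_p_integrable[OF rL] in auto)
    then show False using 0 by simp
  qed
  \<comment> \<open>Inserting \<open>u - t * r\<close> into the equation leaves the multiple
    \<open>k * (I u - t * I r) - t\<close> of \<open>p\<close>; this is its zero.\<close>
  define t where "t = of_real k * I u / (1 + of_real k * I r)"
  have t: "t = of_real k * (I u - t * I r)"
  proof -
    have "t * (1 + of_real k * I r) = of_real k * I u" using nz by (simp add: t_def)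
    then show ?thesis by (simp add: algebra_simps)
  qed
  note d = dom_S0_diff_cmult[OF u(1) r(1), of t]
  have If: "I (\<lambda>x. u x - t * r x) = I u - t * I r"
  proof -
    have "I (\<lambda>x. u x - t * r x) = (LINT s|lebesgue. of_real (p s) * u s - t * (of_real (p s) * r s))"
      unfolding I_def by (rule Bochner_Integration.integral_cong) (auto simp: algebra_simps)
    also have "\<dots> = I u - t * I r"
      unfolding I_def using L2_p_integrable[OF dom_S0_D(1)[OF u(1)]] L2_p_integrable[OF rL]
      by (subst Bochner_Integration.integral_diff) auto
    finally show ?thesis .
  qed
  have "AE x in lebesgue. schroedinger_expr W (\<lambda>x. u x - t * r x) x + of_real (k * p x) * (I u - t * I r) - z * (u x - t * r x) = g x"
    using d(3) u(2) r(2)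
  proof eventually_elim
    case (elim x)
    have "of_real (k * p x) * (I u - t * I r) = of_real (p x) * (of_real k * (I u - t * I r))" by simp
    also have "\<dots> = of_real (p x) * t" using t by simp
    finally have e: "of_real (k * p x) * (I u - t * I r) = of_real (p x) * t" .
    have s: "schroedinger_expr W u x = g x + z * u x" "schroedinger_expr W r x = of_real (p x) + z * r x"
      using elim(2,3) by (simp_all add: algebra_simps)
    show ?case unfolding elim(1) e s by (simp add: algebra_simps)
  qed
  then have "solves_resolvent_eq (rank_one_perturbation W p k) z g (\<lambda>x. u x - t * r x)"
    using d(1) If by (simp add: solves_resolvent_eq_def rank_one_perturbation_def I_def)
  then show ?thesis by (rule exI[where x = "\<lambda>x. u x - t * r x"])
qed

lemma rank_one_resolvent_set: "z \<in> resolvent_set (rank_one_perturbation W p k)"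
  by (rule resolvent_setI[where C = "\<bar>Im z\<bar>"]) (use rank_one_solvable rank_one_solution_bound rank_one_diff in blast)+

end

section \<open>The interaction zone\<close>

text \<open>
  \<open>step 1\<close> is the half-bound state: its pairing with its second derivative is \<open>-2/3\<close>,
  whence the coupling constant \<open>-3/2\<close> of the rank-one term.
\<close>

definition step :: "real \<Rightarrow> real \<Rightarrow> real" where
  "step e x = (if x \<le> - e then 0 else if x \<le> 0 then 1/2 + x / e + x * x / (2 * e * e)
     else if x \<le> e then 1/2 + x / e - x * x / (2 * e * e) else 1)"

definition step1 :: "real \<Rightarrow> real \<Rightarrow> real" where
  "step1 e x = (if x \<le> - e then 0 else if x \<le> 0 then 1 / e + x / (e * e)
     else if x \<le> e then 1 / e - x / (e * e) else 0)"

definition step2 :: "real \<Rightarrow> real \<Rightarrow> real" where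
  "step2 e x = (if x \<le> - e then 0 else if x \<le> 0 then 1 / (e * e)
     else if x \<le> e then - 1 / (e * e) else 0)"

text \<open>The heights sit where the step function is 0 (\<open>A\<close>), where it is varying
  (\<open>C\<close>) and where it is 1 (\<open>B\<close>). For this reason the zone is twice as wide
  as the support of the rank-one profile.\<close>

definition three_steps :: "real \<Rightarrow> real \<Rightarrow> real \<Rightarrow> real \<Rightarrow> real" where
  "three_steps A B C t = (if t \<le> - 2 then 0 else if t \<le> - 1 then A else if t \<le> 0 then C
     else if t \<le> 1 then 0 else if t \<le> 2 then B else 0)"

lemma twice_prim_step:
  assumes e: "e > 0"
  shows "twice_prim (\<lambda>x. of_real (step e x)) (\<lambda>x. of_real (step1 e x)) (\<lambda>x. of_real (step2 e x))"
proof -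
  define E where "E = complex_of_real e"
  have E: "E \<noteq> 0" using e by (simp add: E_def)
  \<comment> \<open>The pieces carry unsimplified coefficients and a zero cubic term so as to be
    instances of \<open>twice_prim_cubic\<close>.\<close>
  define f1 where "f1 = (\<lambda>x::real. 1/2 + 1 / E * of_real x + 1 / (2 * E * E) * (of_real x * of_real x) + 0 * (of_real x * of_real x * of_real x))"
  define d1 where "d1 = (\<lambda>x::real. 1 / E + 2 * (1 / (2 * E * E)) * of_real x + 3 * 0 * (of_real x * of_real x))"
  define w1 where "w1 = (\<lambda>x::real. 2 * (1 / (2 * E * E)) + 6 * 0 * of_real x)"
  define f2 where "f2 = (\<lambda>x::real. 1/2 + 1 / E * of_real x + (- 1 / (2 * E * E)) * (of_real x * of_real x) + 0 * (of_real x * of_real x * of_real x))"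
  define d2 where "d2 = (\<lambda>x::real. 1 / E + 2 * (- 1 / (2 * E * E)) * of_real x + 3 * 0 * (of_real x * of_real x))"
  define w2 where "w2 = (\<lambda>x::real. 2 * (- 1 / (2 * E * E)) + 6 * 0 * of_real x)"
  have 1: "twice_prim f1 d1 w1" unfolding f1_def d1_def w1_def by (rule twice_prim_cubic)
  have 2: "twice_prim f2 d2 w2" unfolding f2_def d2_def w2_def by (rule twice_prim_cubic)
  have z: "twice_prim (\<lambda>x. 0) (\<lambda>x. 0) (\<lambda>x. 0)" using twice_prim_affine[of 0 0] by simp
  have o: "twice_prim (\<lambda>x. 1) (\<lambda>x. 0) (\<lambda>x. 0)" using twice_prim_affine[of 1 0] by simp
  note g1 = twice_prim_glue[OF 2 o, of e]
  have g1: "twice_prim (\<lambda>x. if x \<le> e then f2 x else 1) (\<lambda>x. if x \<le> e then d2 x else 0) (\<lambda>x. if x \<le> e then w2 x else 0)"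
    by (rule g1) (use E in \<open>simp_all add: f2_def d2_def E_def[symmetric] field_simps\<close>)
  note g2 = twice_prim_glue[OF 1 g1, of 0]
  have g2: "twice_prim (\<lambda>x. if x \<le> 0 then f1 x else if x \<le> e then f2 x else 1)
     (\<lambda>x. if x \<le> 0 then d1 x else if x \<le> e then d2 x else 0) (\<lambda>x. if x \<le> 0 then w1 x else if x \<le> e then w2 x else 0)"
    by (rule g2) (use e in \<open>simp_all add: f1_def d1_def f2_def d2_def\<close>)
  note g3 = twice_prim_glue[OF z g2, of "- e"]
  have g3: "twice_prim (\<lambda>x. if x \<le> - e then 0 else if x \<le> 0 then f1 x else if x \<le> e then f2 x else 1)
     (\<lambda>x. if x \<le> - e then 0 else if x \<le> 0 then d1 x else if x \<le> e then d2 x else 0)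
     (\<lambda>x. if x \<le> - e then 0 else if x \<le> 0 then w1 x else if x \<le> e then w2 x else 0)"
    by (rule g3) (use e E in \<open>simp_all add: f1_def d1_def E_def[symmetric] field_simps\<close>)
  have "(\<lambda>x. if x \<le> - e then 0 else if x \<le> 0 then f1 x else if x \<le> e then f2 x else 1) = (\<lambda>x. complex_of_real (step e x))"
    by (auto simp: step_def f1_def f2_def E_def)
  moreover have "(\<lambda>x. if x \<le> - e then 0 else if x \<le> 0 then d1 x else if x \<le> e then d2 x else 0) = (\<lambda>x. complex_of_real (step1 e x))"
    by (auto simp: step1_def d1_def d2_def E_def)
  moreover have "(\<lambda>x. if x \<le> - e then 0 else if x \<le> 0 then w1 x else if x \<le> e then w2 x else 0) = (\<lambda>x. complex_of_real (step2 e x))"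
    by (auto simp: step2_def w1_def w2_def E_def)
  ultimately show ?thesis using g3 by simp
qed

lemma step_range:
  assumes e: "e > 0" shows "0 \<le> step e x" "step e x \<le> 1"
proof -
  have 1: "1/2 + x / e + x * x / (2 * e * e) = (1 + x / e)\<^sup>2 / 2" "1/2 + x / e - x * x / (2 * e * e) = 1 - (1 - x / e)\<^sup>2 / 2"
    using e by (simp_all add: field_simps power2_eq_square)
  have 2: "(1 + x / e)\<^sup>2 \<le> 1" if "- e < x" "x \<le> 0"
  proof -
    have "\<bar>1 + x / e\<bar> \<le> 1" using that e by (simp add: field_simps abs_le_iff)
    then show ?thesis by (simp add: abs_square_le_1)
  qed
  have 3: "(1 - x / e)\<^sup>2 \<le> 1" if "0 < x" "x \<le> e"
  proof -
    have "\<bar>1 - x / e\<bar> \<le> 1" using that e by (simp add: field_simps abs_le_iff)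
    then show ?thesis by (simp add: abs_square_le_1)
  qed
  show "0 \<le> step e x" "step e x \<le> 1"
    unfolding step_def 1 using 2 3 by (auto simp: not_le)
qed

lemma step_ends:
  assumes "e > 0"
  shows "step e (- (2 * e)) = 0" "step e (2 * e) = 1" "step1 e (- (2 * e)) = 0" "step1 e (2 * e) = 0"
  using assms by (auto simp: step_def step1_def)

lemma step2_scale: "e > 0 \<Longrightarrow> step2 1 (x / e) = e * e * step2 e x"
  by (auto simp: step2_def field_simps)

section \<open>Moments of the explicit profiles\<close>

lemma has_integral_power_left:
  assumes e: "(e::real) > 0"
  shows "((\<lambda>x. (x + e) ^ n) has_integral e ^ Suc n / real (Suc n)) {-e..0}"
proof -
  have "((\<lambda>x. (x + e) ^ n) has_integral ((0 + e) ^ Suc n / real (Suc n) - (- e + e) ^ Suc n / real (Suc n))) {-e..0}"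
  proof (rule fundamental_theorem_of_calculus)
    fix x
    have "((\<lambda>x. 1 / real (Suc n) * (x + e) ^ Suc n) has_real_derivative 1 / real (Suc n) * ((1 + real n) * (1 * (x + e) ^ n))) (at x within {-e..0})"
      by (intro DERIV_cmult DERIV_power_Suc) (auto intro!: derivative_eq_intros)
    then show "((\<lambda>x. (x + e) ^ Suc n / real (Suc n)) has_vector_derivative (x + e) ^ n) (at x within {-e..0})"
      by (simp add: has_real_derivative_iff_has_vector_derivative)
  qed (use e in simp)
  then show ?thesis by simp
qed

lemma has_integral_power_right:
  assumes e: "(e::real) > 0"
  shows "((\<lambda>x. (e - x) ^ n) has_integral e ^ Suc n / real (Suc n)) {0..e}"
  using has_integral_reflect_real[where f = "\<lambda>x. (x + e) ^ n" and a = "- e" and b = 0 and i = "e ^ Suc n / real (Suc n)"]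
    has_integral_power_left[OF e, of n] by simp

lemma four_pieces:
  fixes F :: "real \<Rightarrow> real"
  assumes e: "e > 0"
    and 1: "(k1 has_integral i1) {-(2*e)..-e}" "\<And>x. -(2*e) < x \<Longrightarrow> x < - e \<Longrightarrow> F x = k1 x"
    and 2: "(k2 has_integral i2) {-e..0}" "\<And>x. - e < x \<Longrightarrow> x < 0 \<Longrightarrow> F x = k2 x"
    and 3: "(k3 has_integral i3) {0..e}" "\<And>x. 0 < x \<Longrightarrow> x < e \<Longrightarrow> F x = k3 x"
    and 4: "(k4 has_integral i4) {e..2*e}" "\<And>x. e < x \<Longrightarrow> x < 2 * e \<Longrightarrow> F x = k4 x"
  shows "(F has_integral i1 + i2 + i3 + i4) {-(2*e)..2*e}"
proof -
  have sp: "(F has_integral i) {a..b}" if "(k has_integral i) {a..b}" "\<And>x. a < x \<Longrightarrow> x < b \<Longrightarrow> F x = k x" for k i a b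
    by (rule has_integral_spike_interior[where a = a and b = b and f = k, unfolded cbox_interval]) (use that in \<open>auto simp: box_real\<close>)
  have a: "(F has_integral i1 + i2) {-(2*e)..0}"
    by (rule has_integral_combine[OF _ _ sp[OF 1] sp[OF 2]]) (use e in auto)
  have b: "(F has_integral (i1 + i2) + i3) {-(2*e)..e}"
    by (rule has_integral_combine[OF _ _ a sp[OF 3]]) (use e in auto)
  show ?thesis
    by (rule has_integral_combine[OF _ _ b sp[OF 4]]) (use e in auto)
qed

lemma step_left: "e > 0 \<Longrightarrow> - e < x \<Longrightarrow> x < 0 \<Longrightarrow> step e x = (x + e)\<^sup>2 * (1 / (2 * e * e))"
  by (auto simp: step_def field_simps power2_eq_square)

lemma step_right: "e > 0 \<Longrightarrow> 0 < x \<Longrightarrow> x < e \<Longrightarrow> step e x = 1 - (e - x)\<^sup>2 * (1 / (2 * e * e))"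
  by (auto simp: step_def field_simps power2_eq_square)

text \<open>By parts this is minus the integral of the squared derivative of the step. The exact
  value matters: multiplied by the coupling constant it cancels the large term in
  \<open>interior_estimate\<close>.\<close>

lemma integral_step_step2:
  assumes e: "e > 0"
  shows "((\<lambda>x. step e x * step2 e x) has_integral - 2 / (3 * e)) {-(2*e)..2*e}"
proof -
  have 0: "((\<lambda>x. 0) has_integral 0) {a..b}" for a b :: real by simp
  have c: "((\<lambda>x. c) has_integral e * c) {0..e}" for c :: real
    using has_integral_const_real[of c 0 e] e by simp
  have "((\<lambda>x. step e x * step2 e x) has_integral 0 + e ^ Suc 2 / real (Suc 2) * (1 / (2 * e * e) * (1 / (e * e)))
      + (e * (- 1 / (e * e)) - e ^ Suc 2 / real (Suc 2) * (1 / (2 * e * e) * (- 1 / (e * e)))) + 0) {-(2*e)..2*e}"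
  proof (rule four_pieces[OF e 0 _ has_integral_mult_left[OF has_integral_power_left[OF e]] _
      has_integral_diff[OF c has_integral_mult_left[OF has_integral_power_right[OF e]]] _ 0])
    show "step e x * step2 e x = 0" if "x < - e" for x using that by (simp add: step_def)
    show "step e x * step2 e x = 0" if "e < x" for x using that e by (simp add: step2_def)
    show "step e x * step2 e x = (x + e)\<^sup>2 * (1 / (2 * e * e) * (1 / (e * e)))" if "- e < x" "x < 0" for x
      using that by (simp add: step_left[OF e that] step2_def)
    show "step e x * step2 e x = - 1 / (e * e) - (e - x)\<^sup>2 * (1 / (2 * e * e) * (- 1 / (e * e)))" if "0 < x" "x < e" for x
      using that e by (simp add: step_right[OF e that] step2_def algebra_simps)
  qed
  moreover have "0 + e ^ Suc 2 / real (Suc 2) * (1 / (2 * e * e) * (1 / (e * e)))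
      + (e * (- 1 / (e * e)) - e ^ Suc 2 / real (Suc 2) * (1 / (2 * e * e) * (- 1 / (e * e)))) + 0 = - 2 / (3 * e)"
    using e by (simp add: field_simps eval_nat_numeral)
  ultimately show ?thesis by simp
qed

text \<open>The weights of \<open>C\<close> are the integrals over one unit of
  \<open>t\<^sup>2 / 2\<close> and \<open>t ^ 4 / 4\<close>, namely \<open>1/6\<close> and
  \<open>1/20\<close>. As they differ, the map from heights to moments is invertible.\<close>

lemma three_steps_moments:
  assumes e: "e > 0"
  shows "((\<lambda>x. three_steps A B C (x / e)) has_integral e * (A + B + C)) {-(2*e)..2*e}"
    "((\<lambda>x. three_steps A B C (x / e) * step e x) has_integral e * (B + C / 6)) {-(2*e)..2*e}"
    "((\<lambda>x. three_steps A B C (x / e) * (step e x * step e x)) has_integral e * (B + C / 20)) {-(2*e)..2*e}"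
proof -
  let ?q = "\<lambda>x. three_steps A B C (x / e)"
  have q: "-(2*e) < x \<Longrightarrow> x < - e \<Longrightarrow> ?q x = A" "- e < x \<Longrightarrow> x < 0 \<Longrightarrow> ?q x = C"
    "0 < x \<Longrightarrow> x < e \<Longrightarrow> ?q x = 0" "e < x \<Longrightarrow> x < 2 * e \<Longrightarrow> ?q x = B" for x
    using e by (auto simp: three_steps_def field_simps)
  have s: "x < - e \<Longrightarrow> step e x = 0" "e < x \<Longrightarrow> step e x = 1" for x using e by (auto simp: step_def)
  have 0: "((\<lambda>x. 0) has_integral 0) {a..b}" for a b :: real by simp
  have c1: "((\<lambda>x. c) has_integral e * c) {-(2*e)..-e}" for c :: real
    using has_integral_const_real[of c "-(2*e)" "-e"] e by simp
  have c2: "((\<lambda>x. c) has_integral e * c) {-e..0}" for c :: real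
    using has_integral_const_real[of c "-e" 0] e by simp
  have c4: "((\<lambda>x. c) has_integral e * c) {e..2*e}" for c :: real
    using has_integral_const_real[of c e "2*e"] e by simp
  have "(?q has_integral e * A + e * C + 0 + e * B) {-(2*e)..2*e}"
    by (rule four_pieces[OF e c1 _ c2 _ 0 _ c4]) (use q in auto)
  then show "(?q has_integral e * (A + B + C)) {-(2*e)..2*e}" by (simp add: algebra_simps)
  have "((\<lambda>x. ?q x * step e x) has_integral 0 + e ^ Suc 2 / real (Suc 2) * (1 / (2 * e * e) * C) + 0 + e * B) {-(2*e)..2*e}"
    by (rule four_pieces[OF e 0 _ has_integral_mult_left[OF has_integral_power_left[OF e]] _ 0 _ c4])
      (use q s step_left[OF e] in auto)
  moreover have "0 + e ^ Suc 2 / real (Suc 2) * (1 / (2 * e * e) * C) + 0 + e * B = e * (B + C / 6)"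
    using e by (simp add: field_simps eval_nat_numeral)
  ultimately show "((\<lambda>x. ?q x * step e x) has_integral e * (B + C / 6)) {-(2*e)..2*e}" by simp
  have "((\<lambda>x. ?q x * (step e x * step e x)) has_integral 0 + e ^ Suc 4 / real (Suc 4) * (1 / (4 * e * e * e * e) * C) + 0 + e * B) {-(2*e)..2*e}"
  proof (rule four_pieces[OF e 0 _ has_integral_mult_left[OF has_integral_power_left[OF e]] _ 0 _ c4])
    show "?q x * (step e x * step e x) = (x + e) ^ 4 * (1 / (4 * e * e * e * e) * C)" if "- e < x" "x < 0" for x
      unfolding q(2)[OF that] step_left[OF e that] by (simp add: power4_eq_xxxx power2_eq_square mult_ac)
  qed (use q s in auto)
  moreover have "0 + e ^ Suc 4 / real (Suc 4) * (1 / (4 * e * e * e * e) * C) + 0 + e * B = e * (B + C / 20)"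
    using e by (simp add: field_simps eval_nat_numeral)
  ultimately show "((\<lambda>x. ?q x * (step e x * step e x)) has_integral e * (B + C / 20)) {-(2*e)..2*e}" by simp
qed

section \<open>Solutions inside the interaction zone\<close>

lemma has_integral_norm_bound_AE:
  fixes D :: "real \<Rightarrow> complex"
  assumes D: "(D has_integral i) {a..b}" and B: "(B has_integral j) {a..b}"
    and le: "AE x in lebesgue. x \<in> {a..b} \<longrightarrow> norm (D x) \<le> B x"
  shows "norm i \<le> j"
proof -
  define N where "N = {x. \<not> (x \<in> {a..b} \<longrightarrow> norm (D x) \<le> B x)}"
  have N: "negligible N"
    using le by (simp add: N_def completion.AE_iff_null_sets AE_iff_null_sets negligible_iff_null_sets)
  have D': "((\<lambda>x. if x \<in> N then 0 else D x) has_integral i) {a..b}"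
    by (rule has_integral_spike[OF N _ D]) auto
  have B': "((\<lambda>x. if x \<in> N then 0 else B x) has_integral j) {a..b}"
    by (rule has_integral_spike[OF N _ B]) auto
  have "norm (integral {a..b} (\<lambda>x. if x \<in> N then 0 else D x)) \<le> integral {a..b} (\<lambda>x. if x \<in> N then 0 else B x)"
    by (rule Henstock_Kurzweil_Integration.integral_norm_bound_integral) (use D' B' in \<open>auto simp: N_def\<close>)
  then show ?thesis using D' B' by (simp add: integral_unique)
qed

lemma L2_norm_has_integral:
  fixes g :: "real \<Rightarrow> complex"
  assumes g: "g \<in> L2" and ab: "a \<le> b"
  shows "\<exists>j. ((\<lambda>x. norm (g x)) has_integral j) {a..b} \<and> j \<le> sqrt (b - a) * L2norm g"
  using has_integral_set_lebesgue[OF set_integrable_norm[OF L2_integral_interval_le(1)[OF g ab]]]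
    L2_integral_interval_le(2)[OF g ab] by blast

lemma has_integral_complex_of_real:
  "(h has_integral i) S \<Longrightarrow> ((\<lambda>x. complex_of_real (h x)) has_integral complex_of_real i) S"
  using has_integral_linear[OF _ bounded_linear_of_real, of h i S] by (simp add: o_def)

text \<open>Subtracting \<open>\<kappa>\<close> times the step removes the rank-one term. The
  remainder \<open>u\<close> has a second derivative of order \<open>1 / e\<close> on a zone of
  length \<open>4 * e\<close>, so its slope stays bounded and \<open>u\<close> is constant up to
  order \<open>e\<close>. Comparing the ends shows that \<open>\<kappa>\<close> is nearly the
  increment of \<open>f\<close>, hence \<open>f\<close> is nearly \<open>L\<close>, a constant plus
  that increment times the step. Integrating the second derivative of \<open>u\<close> against 1 and
  against the step gives the two jump relations.\<close>

theorem interior_estimate: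
  fixes f f1 w g Q :: "real \<Rightarrow> complex" and q :: "real \<Rightarrow> real"
  assumes e: "0 < e" "e \<le> 1/2" and K: "K = 2 * M + 4 * Mq" and small: "8 * e * K \<le> 1/2"
    and tp: "twice_prim f f1 w"
    and eq: "AE x in lebesgue. x \<in> {-(2*e)..2*e} \<longrightarrow>
        w x = (Q x + of_real (1 / e * q (x / e))) * f x + \<kappa> * of_real (step2 e x) - g x"
    and \<kappa>: "\<kappa> = - of_real (3 / (2 * e)) * I"
    and I: "((\<lambda>x. of_real (step2 e x) * f x) has_integral I / of_real (e * e)) {-(2*e)..2*e}"
    and Q: "\<And>x. \<bar>x\<bar> \<le> 1 \<Longrightarrow> norm (Q x) \<le> M" and q: "\<And>t. \<bar>q t\<bar> \<le> Mq"
    and m0: "((\<lambda>x. q (x / e)) has_integral e * q0) {-(2*e)..2*e}"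
    and m1: "((\<lambda>x. q (x / e) * step e x) has_integral e * q1) {-(2*e)..2*e}"
    and m2: "((\<lambda>x. q (x / e) * (step e x * step e x)) has_integral e * q2) {-(2*e)..2*e}"
    and N: "norm (f (-(2*e))) \<le> N" "norm (f (2*e)) \<le> N" "norm (f1 (-(2*e))) \<le> N"
    and g: "g \<in> L2" "L2norm g \<le> N"
    and C1: "C1 = 120 * M + 32 * Mq * (30 * K + 3) + 2"
  shows "\<And>x. x \<in> {-(2*e)..2*e} \<Longrightarrow> norm (f x) \<le> 30 * N"
    "norm (f1 (2*e) - f1 (-(2*e)) - (of_real q0 * f (-(2*e)) + of_real q1 * (f (2*e) - f (-(2*e))))) \<le> C1 * sqrt e * N"
    "norm (f1 (2*e) - (of_real q1 * f (-(2*e)) + of_real q2 * (f (2*e) - f (-(2*e))))) \<le> C1 * sqrt e * N"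
proof -
  define \<delta> where "\<delta> = 2 * e"
  have \<delta>: "\<delta> > 0" "\<delta> \<le> 1" using e by (auto simp: \<delta>_def)
  define s where "s = sqrt e"
  have s: "0 < s" "s \<le> 1" "e \<le> s" "s * s = e"
  proof -
    show "0 < s" "s * s = e" using e by (auto simp: s_def)
    show "s \<le> 1" using e by (simp add: s_def)
    then have "s * s \<le> s * 1" using \<open>0 < s\<close> by (intro mult_left_mono) auto
    then show "e \<le> s" using \<open>s * s = e\<close> by simp
  qed
  have M0: "M \<ge> 0" using order_trans[OF norm_ge_zero Q[of 0]] by simp
  have Mq0: "Mq \<ge> 0" using order_trans[OF abs_ge_zero q[of 0]] .
  have K0: "K \<ge> 0" using M0 Mq0 by (simp add: K)
  have N0: "N \<ge> 0" using order_trans[OF norm_ge_zero N(1)] .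
  define h where "h = step e"
  define h1 where "h1 = step1 e"
  define h2 where "h2 = step2 e"
  have h: "0 \<le> h x" "h x \<le> 1" for x using step_range[OF e(1)] by (auto simp: h_def)
  have hends: "h (- \<delta>) = 0" "h \<delta> = 1" "h1 (- \<delta>) = 0" "h1 \<delta> = 0"
    using step_ends[OF e(1)] by (auto simp: h_def h1_def \<delta>_def)
  have htp: "twice_prim (\<lambda>x. of_real (h x)) (\<lambda>x. of_real (h1 x)) (\<lambda>x. of_real (h2 x))"
    unfolding h_def h1_def h2_def by (rule twice_prim_step[OF e(1)])
  obtain x0 where x0: "x0 \<in> {-\<delta>..\<delta>}" "\<And>x. x \<in> {-\<delta>..\<delta>} \<Longrightarrow> norm (f x) \<le> norm (f x0)"
  proof -
    have "continuous_on {-\<delta>..\<delta>} (\<lambda>x. norm (f x))" by (intro continuous_intros twice_prim_continuous(1)[OF tp])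
    from continuous_attains_sup[OF compact_Icc _ this] \<delta> show ?thesis using that by auto
  qed
  define S where "S = norm (f x0)"
  have S: "norm (f x) \<le> S" if "x \<in> {-\<delta>..\<delta>}" for x using x0(2)[OF that] by (simp add: S_def)
  have S0: "S \<ge> 0" by (simp add: S_def)
  define u where "u = (\<lambda>x. f x - \<kappa> * of_real (h x))"
  define u1 where "u1 = (\<lambda>x. f1 x - \<kappa> * of_real (h1 x))"
  define \<rho> where "\<rho> = (\<lambda>x. w x - \<kappa> * of_real (h2 x))"
  have utp: "twice_prim u u1 \<rho>"
    unfolding u_def u1_def \<rho>_def by (rule twice_prim_diff[OF tp twice_prim_cmult[OF htp]])
  have \<rho>eq: "AE x in lebesgue. x \<in> {-\<delta>..\<delta>} \<longrightarrow> \<rho> x = (Q x + of_real (1 / e * q (x / e))) * f x - g x"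
    using eq by eventually_elim (simp add: \<rho>_def h2_def \<delta>_def)
  have Qx: "norm (Q x) \<le> M" if "x \<in> {-\<delta>..\<delta>}" for x using that \<delta> by (intro Q) auto
  have qx: "norm (complex_of_real (1 / e * q (x / e))) \<le> Mq / e" for x
    unfolding norm_of_real using q[of "x / e"] e by (simp add: abs_mult divide_right_mono)
  have sq: "sqrt (2 * \<delta>) = 2 * s" unfolding \<delta>_def s_def by (simp add: real_sqrt_mult)
  \<comment> \<open>Bounds the variation of \<open>u1\<close>: \<open>K\<close> majorises the zone
    length \<open>4 * e\<close> times the coefficient bound \<open>M + Mq / e\<close>, and the last
    term is Cauchy-Schwarz for \<open>g\<close>.\<close>
  define R where "R = K * S + 2 * s * N"
  have R: "norm (u1 x - u1 (-\<delta>)) \<le> R" if x: "x \<in> {-\<delta>..\<delta>}" for x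
  proof -
    have xd: "- \<delta> \<le> x" using x by simp
    have 1: "(\<rho> has_integral u1 x - u1 (-\<delta>)) {-\<delta>..x}"
      using twice_prim_prim(2)[OF utp] xd by (simp add: prim_def)
    obtain j where j: "((\<lambda>t. norm (g t)) has_integral j) {-\<delta>..x}" "j \<le> sqrt (x - - \<delta>) * L2norm g"
      using L2_norm_has_integral[OF g(1) xd] by blast
    have 2: "((\<lambda>t. (M + Mq / e) * S + norm (g t)) has_integral (x - - \<delta>) * ((M + Mq / e) * S) + j) {-\<delta>..x}"
      using has_integral_add[OF has_integral_const_real[of "(M + Mq / e) * S" "-\<delta>" x] j(1)] xd by simp
    have "AE t in lebesgue. t \<in> {-\<delta>..x} \<longrightarrow> norm (\<rho> t) \<le> (M + Mq / e) * S + norm (g t)"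
      using \<rho>eq
    proof eventually_elim
      case (elim t)
      show ?case
      proof
        assume "t \<in> {-\<delta>..x}"
        then have t: "t \<in> {-\<delta>..\<delta>}" using x by auto
        have "norm (\<rho> t) \<le> norm ((Q t + of_real (1 / e * q (t / e))) * f t) + norm (g t)"
          using elim t norm_triangle_ineq4 by simp
        also have "norm ((Q t + of_real (1 / e * q (t / e))) * f t) \<le> (M + Mq / e) * S"
          unfolding norm_mult
        proof (rule mult_mono[OF _ S[OF t]])
          show "norm (Q t + of_real (1 / e * q (t / e))) \<le> M + Mq / e"
            using norm_triangle_ineq[of "Q t" "of_real (1 / e * q (t / e))"] Qx[OF t] qx[of t] by linarith
        qed (use M0 Mq0 e in auto)
        finally show "norm (\<rho> t) \<le> (M + Mq / e) * S + norm (g t)" by simp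
      qed
    qed
    from has_integral_norm_bound_AE[OF 1 2 this]
    have "norm (u1 x - u1 (-\<delta>)) \<le> (x - - \<delta>) * ((M + Mq / e) * S) + j" .
    also have "(x - - \<delta>) * ((M + Mq / e) * S) \<le> (4 * e) * ((M + Mq / e) * S)"
      by (rule mult_right_mono) (use x M0 Mq0 S0 e in \<open>auto simp: \<delta>_def\<close>)
    also have "(4 * e) * ((M + Mq / e) * S) = (4 * e * M + 4 * Mq) * S" using e by (simp add: field_simps)
    also have "\<dots> \<le> K * S"
    proof (rule mult_right_mono[OF _ S0])
      have "4 * e * M \<le> 2 * M" by (rule mult_right_mono) (use e M0 in auto)
      then show "4 * e * M + 4 * Mq \<le> K" by (simp add: K)
    qed
    also have "j \<le> 2 * s * N"
    proof -
      have "sqrt (x - - \<delta>) * L2norm g \<le> sqrt (2 * \<delta>) * N"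
        by (intro mult_mono real_sqrt_le_mono g(2)) (use x \<delta> in auto)
      then show ?thesis using j(2) by (simp add: sq)
    qed
    finally show ?thesis by (simp add: R_def)
  qed
  have R0: "R \<ge> 0" using K0 S0 s N0 by (simp add: R_def)
  have u1m: "u1 (-\<delta>) = f1 (-\<delta>)" "u (-\<delta>) = f (-\<delta>)" by (simp_all add: u1_def u_def hends)
  \<comment> \<open>Zone length times the bound \<open>N + R\<close> for the slope of
    \<open>u\<close>.\<close>
  define E where "E = 4 * e * (N + R)"
  have E0: "E \<ge> 0" using e N0 R0 by (simp add: E_def)
  have uE: "norm (u x - f (-\<delta>)) \<le> E" if x: "x \<in> {-\<delta>..\<delta>}" for x
  proof -
    have xd: "- \<delta> \<le> x" using x by simp
    have "norm (u x - u (-\<delta>) - of_real (x - - \<delta>) * u1 (-\<delta>)) \<le> R * (x - - \<delta>)"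
      by (rule twice_prim_linear_error[OF utp xd]) (rule R, use x in auto)
    moreover have "norm (of_real (x - - \<delta>) * u1 (-\<delta>)) = (x - - \<delta>) * norm (u1 (-\<delta>))"
      using xd by (simp add: norm_mult del: of_real_diff of_real_add)
    moreover have "(x - - \<delta>) * norm (u1 (-\<delta>)) \<le> (x - - \<delta>) * N"
      unfolding u1m by (rule mult_left_mono) (use N(3) xd in \<open>auto simp: \<delta>_def\<close>)
    ultimately have "norm (u x - u (-\<delta>)) \<le> R * (x - - \<delta>) + (x - - \<delta>) * N"
      using norm_triangle_ineq[of "u x - u (-\<delta>) - of_real (x - - \<delta>) * u1 (-\<delta>)" "of_real (x - - \<delta>) * u1 (-\<delta>)"]
      by simp
    also have "\<dots> = (x - - \<delta>) * (N + R)" by (simp add: algebra_simps)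
    also have "\<dots> \<le> (4 * e) * (N + R)" by (rule mult_right_mono) (use x N0 R0 in \<open>auto simp: \<delta>_def\<close>)
    finally show ?thesis by (simp add: E_def u1m)
  qed
  define \<Delta> where "\<Delta> = f \<delta> - f (-\<delta>)"
  \<comment> \<open>At the right end the step equals 1, so there \<open>u - f (-\<delta>)\<close> is
    \<open>\<Delta> - \<kappa>\<close>.\<close>
  have \<kappa>\<Delta>: "norm (\<kappa> - \<Delta>) \<le> E"
    using uE[of \<delta>] \<delta> by (simp add: u_def hends \<Delta>_def norm_minus_commute algebra_simps)
  have Nd: "norm (f (-\<delta>)) \<le> N" "norm (f \<delta>) \<le> N" using N by (simp_all add: \<delta>_def)
  have \<Delta>N: "norm \<Delta> \<le> 2 * N" unfolding \<Delta>_def using norm_triangle_ineq4[of "f \<delta>" "f (-\<delta>)"] Nd by linarith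
  have fle: "norm (f x) \<le> 3 * N + 2 * E" if x: "x \<in> {-\<delta>..\<delta>}" for x
  proof -
    have "f x = (u x - f (-\<delta>)) + f (-\<delta>) + \<kappa> * of_real (h x)" by (simp add: u_def)
    also have "norm \<dots> \<le> norm (u x - f (-\<delta>)) + norm (f (-\<delta>)) + norm (\<kappa> * of_real (h x))"
      by (intro order_trans[OF norm_triangle_ineq] add_mono norm_triangle_ineq order_refl)
    finally have 1: "norm (f x) \<le> norm (u x - f (-\<delta>)) + norm (f (-\<delta>)) + norm (\<kappa> * of_real (h x))" .
    have "norm (\<kappa> * of_real (h x)) \<le> norm \<kappa> * 1"
      unfolding norm_mult by (rule mult_left_mono) (use h in auto)
    moreover have "norm \<kappa> \<le> norm \<Delta> + norm (\<kappa> - \<Delta>)" by (rule norm_triangle_sub)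
    ultimately show ?thesis using 1 uE[OF x] Nd \<kappa>\<Delta> \<Delta>N by linarith
  qed
  \<comment> \<open>The estimate of \<open>f\<close> involves its own maximum \<open>S\<close>
    through \<open>R\<close>; smallness of \<open>e\<close> makes that coefficient at most
    \<open>1/2\<close>, so it is absorbed. The other terms give \<open>3 + 4 + 8 = 15\<close>, which
    is doubled.\<close>
  have S30: "S \<le> 30 * N"
  proof -
    have "S \<le> 3 * N + 2 * E" using fle[OF x0(1)] by (simp add: S_def)
    also have "2 * E = 8 * e * N + (8 * e * K) * S + 16 * e * s * N"
      by (simp add: E_def R_def algebra_simps)
    also have "8 * e * N \<le> 4 * N" by (rule mult_right_mono) (use e N0 in auto)
    also have "(8 * e * K) * S \<le> 1/2 * S" by (rule mult_right_mono[OF small S0])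
    also have "16 * e * s * N \<le> 8 * N"
    proof (rule mult_right_mono[OF _ N0])
      have "16 * e * s \<le> 8 * 1" by (rule mult_mono) (use e s in auto)
      then show "16 * e * s \<le> 8" by simp
    qed
    finally show ?thesis by simp
  qed
  show "norm (f x) \<le> 30 * N" if "x \<in> {-(2*e)..2*e}" for x
    using S[of x] that S30 by (simp add: \<delta>_def)
  have ER: "E \<le> 4 * e * ((30 * K + 3) * N)"
  proof -
    have "K * S \<le> K * (30 * N)" by (rule mult_left_mono[OF S30 K0])
    moreover have "2 * s * N \<le> 2 * N" by (rule mult_right_mono) (use s N0 in auto)
    ultimately have "N + R \<le> (30 * K + 3) * N" by (simp add: R_def algebra_simps)
    then show ?thesis unfolding E_def by (rule mult_left_mono) (use e in auto)
  qed
  define L where "L = (\<lambda>x. f (-\<delta>) + \<Delta> * of_real (h x))"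
  have fL: "norm (f x - L x) \<le> 2 * E" if x: "x \<in> {-\<delta>..\<delta>}" for x
  proof -
    have "f x - L x = (u x - f (-\<delta>)) + (\<kappa> - \<Delta>) * of_real (h x)" by (simp add: u_def L_def algebra_simps)
    also have "norm \<dots> \<le> norm (u x - f (-\<delta>)) + norm ((\<kappa> - \<Delta>) * of_real (h x))" by (rule norm_triangle_ineq)
    also have "norm ((\<kappa> - \<Delta>) * of_real (h x)) \<le> norm (\<kappa> - \<Delta>) * 1"
      unfolding norm_mult by (rule mult_left_mono) (use h in auto)
    finally show ?thesis using uE[OF x] \<kappa>\<Delta> by linarith
  qed
  \<comment> \<open>Replaces \<open>f\<close> by \<open>L\<close> in the integral of
    \<open>\<rho>\<close> against a weight \<open>m\<close> between 0 and 1. The errors come from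
    \<open>Q\<close> over a short zone, from the difference of \<open>f\<close> and \<open>L\<close>
    multiplied by the large coefficient, and from \<open>g\<close>; they are the three terms of
    \<open>C1\<close>.\<close>
  have core: "norm (i - j) \<le> C1 * sqrt e * N"
    if m: "\<And>x. 0 \<le> m x" "\<And>x. m x \<le> 1"
      and i: "((\<lambda>x. \<rho> x * of_real (m x)) has_integral i) {-\<delta>..\<delta>}"
      and j: "((\<lambda>x. of_real (1 / e * q (x / e)) * L x * of_real (m x)) has_integral j) {-\<delta>..\<delta>}" for m :: "real \<Rightarrow> real" and i j
  proof -
    have dd: "- \<delta> \<le> \<delta>" using \<delta> by simp
    obtain k where k: "((\<lambda>t. norm (g t)) has_integral k) {-\<delta>..\<delta>}" "k \<le> sqrt (\<delta> - - \<delta>) * L2norm g"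
      using L2_norm_has_integral[OF g(1) dd] by blast
    have 2: "((\<lambda>t. (M * S + Mq / e * (2 * E)) + norm (g t)) has_integral (\<delta> - - \<delta>) * (M * S + Mq / e * (2 * E)) + k) {-\<delta>..\<delta>}"
      using has_integral_add[OF has_integral_const_real[of "M * S + Mq / e * (2 * E)" "-\<delta>" \<delta>] k(1)] dd by simp
    have "AE t in lebesgue. t \<in> {-\<delta>..\<delta>} \<longrightarrow>
        norm (\<rho> t * of_real (m t) - of_real (1 / e * q (t / e)) * L t * of_real (m t)) \<le> (M * S + Mq / e * (2 * E)) + norm (g t)"
      using \<rho>eq
    proof eventually_elim
      case (elim t)
      show ?case
      proof
        assume t: "t \<in> {-\<delta>..\<delta>}"
        let ?b = "complex_of_real (1 / e * q (t / e))"
        have rt: "\<rho> t = (Q t + ?b) * f t - g t" using elim t by blast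
        have "\<rho> t * of_real (m t) - ?b * L t * of_real (m t) = (Q t * f t + ?b * (f t - L t) - g t) * of_real (m t)"
          unfolding rt by (simp only: ring_distribs) simp
        also have "norm \<dots> \<le> norm (Q t * f t + ?b * (f t - L t) - g t) * 1"
          unfolding norm_mult by (rule mult_left_mono) (use m[of t] in auto)
        also have "\<dots> \<le> norm (Q t * f t) + norm (?b * (f t - L t)) + norm (g t)"
          using norm_triangle_ineq4[of "Q t * f t + ?b * (f t - L t)" "g t"] norm_triangle_ineq[of "Q t * f t" "?b * (f t - L t)"]
          by linarith
        also have "norm (Q t * f t) \<le> M * S"
          unfolding norm_mult by (rule mult_mono[OF Qx[OF t] S[OF t] M0]) simp
        also have "norm (?b * (f t - L t)) \<le> Mq / e * (2 * E)"
          unfolding norm_mult by (rule mult_mono[OF qx fL[OF t]]) (use Mq0 e in auto)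
        finally show "norm (\<rho> t * of_real (m t) - ?b * L t * of_real (m t)) \<le> (M * S + Mq / e * (2 * E)) + norm (g t)"
          by linarith
      qed
    qed
    from has_integral_norm_bound_AE[OF has_integral_diff[OF i j] 2 this]
    have "norm (i - j) \<le> (\<delta> - - \<delta>) * (M * S + Mq / e * (2 * E)) + k" .
    also have "(\<delta> - - \<delta>) * (M * S + Mq / e * (2 * E)) = 4 * e * M * S + 8 * Mq * E"
      using e by (simp add: \<delta>_def field_simps)
    also have "4 * e * M * S \<le> 4 * s * M * (30 * N)"
      by (intro mult_mono S30) (use s e M0 S0 in auto)
    also have "8 * Mq * E \<le> 8 * Mq * (4 * s * ((30 * K + 3) * N))"
    proof (rule mult_left_mono)
      have "4 * e * ((30 * K + 3) * N) \<le> 4 * s * ((30 * K + 3) * N)"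
        by (rule mult_right_mono) (use s K0 N0 in auto)
      then show "E \<le> 4 * s * ((30 * K + 3) * N)" using ER by simp
    qed (use Mq0 in simp)
    also have "k \<le> 2 * s * N"
    proof -
      have "sqrt (\<delta> - - \<delta>) * L2norm g \<le> sqrt (2 * \<delta>) * N"
        by (intro mult_mono real_sqrt_le_mono g(2)) (use \<delta> in auto)
      then show ?thesis using k(2) by (simp add: sq)
    qed
    finally show ?thesis unfolding C1 s_def[symmetric] by (simp add: algebra_simps)
  qed
  have eC: "complex_of_real e \<noteq> 0" using e by simp
  have L_moment: "((\<lambda>x. of_real (1 / e * q (x / e)) * L x * of_real (m x)) has_integral of_real a * f (-\<delta>) + of_real b * \<Delta>) {-\<delta>..\<delta>}"
    if a: "((\<lambda>x. q (x / e) * m x) has_integral e * a) {-\<delta>..\<delta>}"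
      and b: "((\<lambda>x. q (x / e) * (m x * h x)) has_integral e * b) {-\<delta>..\<delta>}" for m a b
  proof -
    have "((\<lambda>x. of_real (q (x / e) * m x) * (f (-\<delta>) / of_real e) + of_real (q (x / e) * (m x * h x)) * (\<Delta> / of_real e)) has_integral
        of_real (e * a) * (f (-\<delta>) / of_real e) + of_real (e * b) * (\<Delta> / of_real e)) {-\<delta>..\<delta>}"
      by (intro has_integral_add has_integral_mult_left has_integral_complex_of_real a b)
    then show ?thesis using eC by (simp add: L_def algebra_simps add_divide_distrib)
  qed
  \<comment> \<open>Weight 1: the slope of the step vanishes at both ends, so the increments of
    \<open>u1\<close> and \<open>f1\<close> agree.\<close>
  have r1: "((\<lambda>x. \<rho> x * of_real ((\<lambda>_. 1) x)) has_integral f1 \<delta> - f1 (-\<delta>)) {-\<delta>..\<delta>}"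
  proof -
    have "(\<rho> has_integral u1 \<delta> - u1 (-\<delta>)) {-\<delta>..\<delta>}"
      using twice_prim_prim(2)[OF utp] \<delta> by (simp add: prim_def)
    then show ?thesis by (simp add: u1_def hends)
  qed
  have "norm ((f1 \<delta> - f1 (-\<delta>)) - (of_real q0 * f (-\<delta>) + of_real q1 * \<Delta>)) \<le> C1 * sqrt e * N"
    by (rule core[OF _ _ r1 L_moment]) (use m0 m1 in \<open>auto simp: \<delta>_def h_def\<close>)
  then show "norm (f1 (2*e) - f1 (-(2*e)) - (of_real q0 * f (-(2*e)) + of_real q1 * (f (2*e) - f (-(2*e))))) \<le> C1 * sqrt e * N"
    by (simp add: \<delta>_def \<Delta>_def)
  \<comment> \<open>Weight \<open>h\<close>: Lagrange's identity exchanges \<open>w * h\<close> for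
    \<open>h2 * f\<close>. The latter integrates to \<open>I / e\<^sup>2\<close> and cancels against
    \<open>\<kappa>\<close> times the pairing of the step with its second derivative; this fixes the
    factor \<open>3 / (2 * e)\<close> in \<open>\<kappa>\<close>.\<close>
  have r2: "((\<lambda>x. \<rho> x * of_real (h x)) has_integral f1 \<delta>) {-\<delta>..\<delta>}"
  proof -
    have "prim (\<lambda>x. f1 x * of_real (h x) - f x * of_real (h1 x))
        (\<lambda>x. (f1 x * of_real (h1 x) + w x * of_real (h x)) - (f x * of_real (h2 x) + f1 x * of_real (h1 x)))"
      by (intro prim_diff prim_mult twice_prim_prim[OF tp] twice_prim_prim[OF htp])
    then have "((\<lambda>x. (f1 x * of_real (h1 x) + w x * of_real (h x)) - (f x * of_real (h2 x) + f1 x * of_real (h1 x))) has_integral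
       (f1 \<delta> * of_real (h \<delta>) - f \<delta> * of_real (h1 \<delta>)) - (f1 (-\<delta>) * of_real (h (-\<delta>)) - f (-\<delta>) * of_real (h1 (-\<delta>)))) {-\<delta>..\<delta>}"
      using \<delta> by (simp add: prim_def)
    then have 1: "((\<lambda>x. w x * of_real (h x) - of_real (h2 x) * f x) has_integral f1 \<delta>) {-\<delta>..\<delta>}"
      by (simp add: hends mult.commute)
    have 2: "((\<lambda>x. of_real (h x * h2 x) * \<kappa>) has_integral of_real (- 2 / (3 * e)) * \<kappa>) {-\<delta>..\<delta>}"
      unfolding h_def h2_def \<delta>_def
      by (intro has_integral_mult_left has_integral_complex_of_real integral_step_step2[OF e(1)])
    have I': "((\<lambda>x. of_real (h2 x) * f x) has_integral I / of_real (e * e)) {-\<delta>..\<delta>}"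
      using I by (simp add: h2_def \<delta>_def)
    have "((\<lambda>x. (w x * of_real (h x) - of_real (h2 x) * f x) + of_real (h2 x) * f x - of_real (h x * h2 x) * \<kappa>) has_integral
      f1 \<delta> + I / of_real (e * e) - of_real (- 2 / (3 * e)) * \<kappa>) {-\<delta>..\<delta>}"
      by (intro has_integral_diff has_integral_add 1 I' 2)
    moreover have "f1 \<delta> + I / of_real (e * e) - of_real (- 2 / (3 * e)) * \<kappa> = f1 \<delta>"
      using eC by (simp add: \<kappa> field_simps)
    ultimately show ?thesis by (simp add: \<rho>_def algebra_simps)
  qed
  have "norm (f1 \<delta> - (of_real q1 * f (-\<delta>) + of_real q2 * \<Delta>)) \<le> C1 * sqrt e * N"
    by (rule core[OF h(1) h(2) r2 L_moment]) (use m1 m2 in \<open>auto simp: \<delta>_def h_def\<close>)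
  then show "norm (f1 (2*e) - (of_real q1 * f (-(2*e)) + of_real q2 * (f (2*e) - f (-(2*e))))) \<le> C1 * sqrt e * N"
    by (simp add: \<delta>_def \<Delta>_def)
qed

section \<open>Comparison of the resolvents\<close>

lemma homogeneous_energy_right:
  assumes tp: "twice_prim D D1 D2" and V: "\<And>x. V x \<ge> - c" and L: "restr {a..} D \<in> L2"
    and eq: "AE x in lebesgue. a < x \<longrightarrow> D2 x = (of_real (V x) - z) * D x"
  shows "Im z * (L2norm (restr {a..} D))\<^sup>2 = Im (D1 a * cnj (D a))"
proof -
  have n: "AE x in lebesgue. x \<noteq> a"
    using AE_not_in[of "{a}" lebesgue] by (simp add: negligible_iff_null_sets[symmetric])
  have AE: "AE x in lebesgue. z * restr {a..} D x = restr {a..} (\<lambda>x. of_real (V x) * D x - D2 x) x"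
    using eq n by eventually_elim (auto simp: indicator_def algebra_simps)
  have sL: "restr {a..} (\<lambda>x. of_real (V x) * D x - D2 x) \<in> L2"
    by (rule L2_cong_AE(1)[OF L2_cmult[OF L] AE])
  note E = energy_right[OF tp _ L sL, of c, OF V]
  have i: "integrable lebesgue (\<lambda>x. indicat_real {a..} x *\<^sub>R Im ((of_real (V x) * D x - D2 x) * cnj (D x)))"
    using E(1) by (simp add: set_integrable_def)
  have "(LINT x|lebesgue. indicat_real {a..} x *\<^sub>R Im ((of_real (V x) * D x - D2 x) * cnj (D x))) =
      (LINT x|lebesgue. Im z * (norm (restr {a..} D x))\<^sup>2)"
  proof (rule integral_cong_AE)
    show "AE x in lebesgue. indicat_real {a..} x *\<^sub>R Im ((of_real (V x) * D x - D2 x) * cnj (D x)) = Im z * (norm (restr {a..} D x))\<^sup>2"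
      using eq n
    proof eventually_elim
      case (elim x)
      show ?case
      proof (cases "a < x")
        case True
        then have e: "of_real (V x) * D x - D2 x = z * D x + 0" using elim by (simp add: algebra_simps)
        show ?thesis unfolding e Im_mult_cnj_self using True by simp
      qed (use elim in auto)
    qed
  qed (use i L2D(2)[OF L] in auto)
  also have "\<dots> = Im z * (L2norm (restr {a..} D))\<^sup>2" by (simp add: L2norm_sq)
  finally show ?thesis using E(2) by (simp add: set_lebesgue_integral_def)
qed

lemma homogeneous_energy_left:
  assumes tp: "twice_prim D D1 D2" and V: "\<And>x. V x \<ge> - c" and L: "restr {..a} D \<in> L2"
    and eq: "AE x in lebesgue. x < a \<longrightarrow> D2 x = (of_real (V x) - z) * D x"
  shows "Im z * (L2norm (restr {..a} D))\<^sup>2 = - Im (D1 a * cnj (D a))"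
proof -
  have n: "AE x in lebesgue. x \<noteq> a"
    using AE_not_in[of "{a}" lebesgue] by (simp add: negligible_iff_null_sets[symmetric])
  have AE: "AE x in lebesgue. z * restr {..a} D x = restr {..a} (\<lambda>x. of_real (V x) * D x - D2 x) x"
    using eq n by eventually_elim (auto simp: indicator_def algebra_simps)
  have sL: "restr {..a} (\<lambda>x. of_real (V x) * D x - D2 x) \<in> L2"
    by (rule L2_cong_AE(1)[OF L2_cmult[OF L] AE])
  note E = energy_left[OF tp _ L sL, of c, OF V]
  have i: "integrable lebesgue (\<lambda>x. indicat_real {..a} x *\<^sub>R Im ((of_real (V x) * D x - D2 x) * cnj (D x)))"
    using E(1) by (simp add: set_integrable_def)
  have "(LINT x|lebesgue. indicat_real {..a} x *\<^sub>R Im ((of_real (V x) * D x - D2 x) * cnj (D x))) =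
      (LINT x|lebesgue. Im z * (norm (restr {..a} D x))\<^sup>2)"
  proof (rule integral_cong_AE)
    show "AE x in lebesgue. indicat_real {..a} x *\<^sub>R Im ((of_real (V x) * D x - D2 x) * cnj (D x)) = Im z * (norm (restr {..a} D x))\<^sup>2"
      using eq n
    proof eventually_elim
      case (elim x)
      show ?case
      proof (cases "x < a")
        case True
        then have e: "of_real (V x) * D x - D2 x = z * D x + 0" using elim by (simp add: algebra_simps)
        show ?thesis unfolding e Im_mult_cnj_self using True by simp
      qed (use elim in auto)
    qed
  qed (use i L2D(2)[OF L] in auto)
  also have "\<dots> = Im z * (L2norm (restr {..a} D))\<^sup>2" by (simp add: L2norm_sq)
  finally show ?thesis using E(2) by (simp add: set_lebesgue_integral_def)
qed

section \<open>Approximate coupling conditions\<close>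

text \<open>Stability of \<open>coupling_Im\<close>: data satisfying the coupling conditions up to
  small defects have nearly equal brackets, with an error linear in the defects.\<close>

lemma boundary_form_defect:
  fixes a a1 b b1 :: complex
  assumes \<alpha>: "\<alpha> \<noteq> 0" and E1: "norm (b - of_real \<alpha> * a - of_real \<beta> * a1) \<le> \<eta>1" and E2: "norm (b1 - a1 / of_real \<alpha>) \<le> \<eta>2"
    and a1: "norm a1 \<le> N" and b: "norm b \<le> N"
  shows "\<bar>Im (b1 * cnj b) - Im (a1 * cnj a)\<bar> \<le> N * \<eta>1 / \<bar>\<alpha>\<bar> + \<eta>2 * N"
proof -
  define r where "r = b - of_real \<alpha> * a - of_real \<beta> * a1"
  define t where "t = b1 - a1 / of_real \<alpha>"
  have "b1 * cnj b = (a1 / of_real \<alpha>) * cnj (of_real \<alpha> * a + of_real \<beta> * a1) + (a1 / of_real \<alpha>) * cnj r + t * cnj b"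
    by (simp add: r_def t_def algebra_simps)
  then have "Im (b1 * cnj b) - Im (a1 * cnj a) = Im ((a1 / of_real \<alpha>) * cnj r) + Im (t * cnj b)"
    by (simp only: plus_complex.simps coupling_Im[OF \<alpha>])
  moreover have "\<bar>Im ((a1 / of_real \<alpha>) * cnj r)\<bar> \<le> N * \<eta>1 / \<bar>\<alpha>\<bar>"
  proof -
    have "\<bar>Im ((a1 / of_real \<alpha>) * cnj r)\<bar> \<le> norm ((a1 / of_real \<alpha>) * cnj r)" by (rule abs_Im_le_cmod)
    also have "\<dots> = norm a1 * norm r / \<bar>\<alpha>\<bar>" by (simp add: norm_mult norm_divide)
    also have "\<dots> \<le> N * \<eta>1 / \<bar>\<alpha>\<bar>"
      by (intro divide_right_mono mult_mono a1) (use E1 order_trans[OF norm_ge_zero a1] in \<open>auto simp: r_def\<close>)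
    finally show ?thesis .
  qed
  moreover have "\<bar>Im (t * cnj b)\<bar> \<le> \<eta>2 * N"
  proof -
    have "\<bar>Im (t * cnj b)\<bar> \<le> norm t * norm b" using abs_Im_le_cmod[of "t * cnj b"] by (simp add: norm_mult)
    also have "\<dots> \<le> \<eta>2 * N"
      by (intro mult_mono b) (use E2 order_trans[OF norm_ge_zero E2] in \<open>auto simp: t_def\<close>)
    finally show ?thesis .
  qed
  ultimately show ?thesis by linarith
qed

text \<open>Solves the jump relations for the coupling conditions. Their defects are exact
  combinations of \<open>r\<close> and \<open>t\<close>: the choice of the moments removes all
  values of \<open>f\<close> and its derivative.\<close>

lemma coupling_from_jumps:
  fixes fm fp dm dp :: complex
  assumes \<alpha>: "\<alpha> \<noteq> 0" and \<beta>: "\<beta> \<noteq> 0"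
    and q: "q0 = (1 - \<alpha>)\<^sup>2 / (\<alpha> * \<beta>)" "q1 = (1 - \<alpha>) / (\<alpha> * \<beta>)" "q2 = 1 / (\<alpha> * \<beta>)"
    and r1: "norm (dp - dm - (of_real q0 * fm + of_real q1 * (fp - fm))) \<le> \<eta>"
    and r2: "norm (dp - (of_real q1 * fm + of_real q2 * (fp - fm))) \<le> \<eta>"
  shows "norm (fp - of_real \<alpha> * fm - of_real \<beta> * dm) \<le> 2 * \<bar>\<beta>\<bar> * \<eta>"
    "norm (dp - dm / of_real \<alpha>) \<le> (1 + 2 / \<bar>\<alpha>\<bar>) * \<eta>"
proof -
  define a where "a = complex_of_real \<alpha>"
  define b where "b = complex_of_real \<beta>"
  have a: "a \<noteq> 0" and b: "b \<noteq> 0" using \<alpha> \<beta> by (auto simp: a_def b_def)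
  define r where "r = dp - dm - (of_real q0 * fm + of_real q1 * (fp - fm))"
  define t where "t = dp - (of_real q1 * fm + of_real q2 * (fp - fm))"
  have q': "of_real q0 = (1 - a)\<^sup>2 / (a * b)" "of_real q1 = (1 - a) / (a * b)" "of_real q2 = 1 / (a * b)"
    by (simp_all add: q a_def b_def)
  have e1: "fp - a * fm - b * dm = - b * (t - r)"
    unfolding r_def t_def q' using a b by (simp add: field_simps power2_eq_square)
  have e2: "dp - dm / a = t - (t - r) / a"
    unfolding r_def t_def q' using a b by (simp add: field_simps power2_eq_square)
  have tr: "norm (t - r) \<le> 2 * \<eta>" using norm_triangle_ineq4[of t r] r1 r2 by (simp add: r_def t_def)
  have "norm (- b * (t - r)) = \<bar>\<beta>\<bar> * norm (t - r)" by (simp add: norm_mult b_def)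
  also have "\<dots> \<le> \<bar>\<beta>\<bar> * (2 * \<eta>)" by (rule mult_left_mono[OF tr]) simp
  finally show "norm (fp - of_real \<alpha> * fm - of_real \<beta> * dm) \<le> 2 * \<bar>\<beta>\<bar> * \<eta>"
    using e1 by (simp add: a_def b_def mult_ac)
  have "norm (t - (t - r) / a) \<le> norm t + norm ((t - r) / a)" by (rule norm_triangle_ineq4)
  also have "\<dots> \<le> \<eta> + 2 * \<eta> / \<bar>\<alpha>\<bar>"
    using r2 tr by (intro add_mono) (auto simp: t_def norm_divide a_def divide_right_mono)
  also have "\<dots> = (1 + 2 / \<bar>\<alpha>\<bar>) * \<eta>" by (simp add: algebra_simps)
  finally show "norm (dp - dm / of_real \<alpha>) \<le> (1 + 2 / \<bar>\<alpha>\<bar>) * \<eta>" using e2 by (simp add: a_def)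
qed

text \<open>Carries Cauchy data between the origin and the edge of the zone. The slope is only
  Hoelder continuous with exponent \<open>1/2\<close>, since its derivative contains the merely
  square-integrable \<open>g\<close>.\<close>

lemma one_sided_continuity:
  assumes tp: "twice_prim f f1 w" and s: "0 < s" "s * s = e" "2 * e \<le> 1" and x: "y = x + 2 * e"
    and f1: "\<And>t. t \<in> {x..y} \<Longrightarrow> norm (f t) \<le> N \<and> norm (f1 t) \<le> N"
    and eq: "AE t in lebesgue. t \<in> {x..y} \<longrightarrow> w t = Q t * f t - g t"
    and Q: "\<And>t. t \<in> {x..y} \<Longrightarrow> norm (Q t) \<le> M" and M: "M \<ge> 0" and g: "g \<in> L2" "L2norm g \<le> N"
  shows "norm (f y - f x) \<le> (2 * M + 2) * s * N" "norm (f1 y - f1 x) \<le> (2 * M + 2) * s * N"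
proof -
  have N0: "N \<ge> 0" using g(2) L2norm_nonneg order_trans by blast
  have e: "e > 0" using s by auto
  have es: "e \<le> s"
  proof -
    have "s \<le> 1"
    proof (rule ccontr)
      assume "\<not> s \<le> 1"
      then have "1 * 1 < s * s" by (intro mult_strict_mono) auto
      then show False using s by simp
    qed
    then have "s * s \<le> s * 1" using s(1) by (intro mult_left_mono) auto
    then show ?thesis using s(2) by simp
  qed
  have xy: "x \<le> y" using x e by simp
  have "norm (f y - f x - of_real (y - x) * 0) \<le> N * (y - x)"
    by (rule twice_prim_linear_error[OF tp xy]) (use f1 in simp)
  then have "norm (f y - f x) \<le> N * (2 * e)" using x by simp
  also have "\<dots> \<le> N * (2 * s)" using es N0 by (intro mult_left_mono) auto
  also have "\<dots> \<le> (2 * M + 2) * s * N" using M N0 s by (simp add: algebra_simps)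
  finally show "norm (f y - f x) \<le> (2 * M + 2) * s * N" .
  obtain j where j: "((\<lambda>t. norm (g t)) has_integral j) {x..y}" "j \<le> sqrt (y - x) * L2norm g"
    using L2_norm_has_integral[OF g(1) xy] by blast
  have 1: "(w has_integral f1 y - f1 x) {x..y}" using twice_prim_prim(2)[OF tp] xy by (simp add: prim_def)
  have 2: "((\<lambda>t. M * N + norm (g t)) has_integral (y - x) * (M * N) + j) {x..y}"
    using has_integral_add[OF has_integral_const_real[of "M * N" x y] j(1)] xy by simp
  have "AE t in lebesgue. t \<in> {x..y} \<longrightarrow> norm (w t) \<le> M * N + norm (g t)"
    using eq
  proof eventually_elim
    case (elim t)
    show ?case
    proof
      assume t: "t \<in> {x..y}"
      have "norm (w t) \<le> norm (Q t * f t) + norm (g t)" using elim t norm_triangle_ineq4 by simp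
      moreover have "norm (Q t * f t) \<le> M * N"
        unfolding norm_mult by (rule mult_mono[OF Q[OF t]]) (use f1[OF t] M in auto)
      ultimately show "norm (w t) \<le> M * N + norm (g t)" by linarith
    qed
  qed
  from has_integral_norm_bound_AE[OF 1 2 this]
  have a: "norm (f1 y - f1 x) \<le> (y - x) * (M * N) + j" .
  have b: "(y - x) * (M * N) \<le> (2 * s) * (M * N)"
    by (rule mult_right_mono) (use x es M N0 in auto)
  have "sqrt (y - x) \<le> 2 * s"
    by (rule real_le_lsqrt[THEN order_trans, OF _ _ order_refl]) (use x s e in \<open>auto simp: power2_eq_square\<close>)
  then have "sqrt (y - x) * L2norm g \<le> 2 * s * N"
    by (intro mult_mono g(2)) (use s in auto)
  then show "norm (f1 y - f1 x) \<le> (2 * M + 2) * s * N"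
    using a b j(2) by (simp add: algebra_simps)
qed

lemma L2norm_restr_le:
  assumes f: "f \<in> L2" and h: "h \<in> L2" and S: "S \<in> sets lebesgue" and eq: "\<And>x. x \<in> S \<Longrightarrow> x \<noteq> 0 \<Longrightarrow> h x = f x"
  shows "L2norm (restr S h) \<le> L2norm f"
proof -
  have "AE x in lebesgue. restr S f x = restr S h x"
    using AE_nonzero by eventually_elim (use eq in \<open>auto simp: indicator_def\<close>)
  from L2_cong_AE(2)[OF L2_restr(1)[OF f S] this] L2_restr(2)[OF f S] show ?thesis by simp
qed

text \<open>The limit solution satisfies the coupling conditions at the origin, the approximating
  one nearly satisfies them between the ends of the zone. Moving the former to the same ends makes
  the Cauchy data of the difference nearly coupled, and the homogeneous energy identities then
  control the difference outside; inside, boundedness and the short length suffice.\<close>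

theorem resolvent_difference_bound:
  fixes V :: "real \<Rightarrow> real" and z :: complex and \<alpha> \<beta> A B C :: real
  defines "q \<equiv> three_steps A B C"
  assumes Vm: "V \<in> borel_measurable lebesgue" and Vb: "locally_bounded V" and Vc: "\<And>x. V x \<ge> - c"
    and z: "Im z \<noteq> 0" and \<alpha>: "\<alpha> \<noteq> 0" and \<beta>: "\<beta> \<noteq> 0"
    and ABC: "A + B + C = (1 - \<alpha>)\<^sup>2 / (\<alpha> * \<beta>)" "B + C / 6 = (1 - \<alpha>) / (\<alpha> * \<beta>)" "B + C / 20 = 1 / (\<alpha> * \<beta>)"
  shows "\<exists>D e0. e0 > 0 \<and> (\<forall>e g f h. 0 < e \<and> e < e0 \<and> g \<in> L2 \<and>
      solves_resolvent_eq (rank_one_perturbation (\<lambda>x. V x + 1 / e * q (x / e)) (\<lambda>x. step2 1 (x / e)) (- 3 / (2 * e ^ 3))) z g f \<and>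
      solves_resolvent_eq (S_ab V \<alpha> \<beta>) z g h \<longrightarrow>
      (L2norm (\<lambda>x. f x - h x))\<^sup>2 \<le> D * sqrt e * (L2norm g)\<^sup>2)"
proof -
  define Q where "Q = (\<lambda>x. complex_of_real (V x) - z)"
  define y where "y = \<bar>Im z\<bar>"
  have y: "y > 0" using z by (simp add: y_def)
  \<comment> \<open>Radius 2 contains all unit intervals used for the local bounds, including those
    next to the zone.\<close>
  obtain M where M: "\<And>x. \<bar>x\<bar> \<le> 2 \<Longrightarrow> norm (Q x) \<le> M"
    using real_coeff_loc_bounded[OF Vm Vb, of z] by (auto simp: loc_bounded_coeff_def Q_def)
  have M0: "M \<ge> 0" using order_trans[OF norm_ge_zero M[of 0]] by simp
  define Mq where "Mq = \<bar>A\<bar> + \<bar>B\<bar> + \<bar>C\<bar>"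
  have q: "\<bar>q t\<bar> \<le> Mq" for t by (auto simp: q_def three_steps_def Mq_def)
  have Mq0: "Mq \<ge> 0" by (simp add: Mq_def)
  have qm: "q \<in> borel_measurable lebesgue"
    unfolding q_def three_steps_def[abs_def] by (intro measurable_completion) measurable
  \<comment> \<open>The constant of \<open>solution_local_bound\<close> when the norm of the
    solution is at most that of \<open>g\<close> divided by \<open>y\<close>.\<close>
  define c1 where "c1 = (21 + 2 * M) / y + 2"
  have c1: "c1 \<ge> 1" using M0 y by (simp add: c1_def)
  define K where "K = 2 * M + 4 * Mq"
  have K0: "K \<ge> 0" using M0 Mq0 by (simp add: K_def)
  define C1 where "C1 = 120 * M + 32 * Mq * (30 * K + 3) + 2"
  define C2 where "C2 = 2 * M + 2"
  define C3 where "C3 = 2 * \<bar>\<beta>\<bar> * C1 + (1 + \<bar>\<alpha>\<bar> + \<bar>\<beta>\<bar>) * C2"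
  define C4 where "C4 = (1 + 2 / \<bar>\<alpha>\<bar>) * C1 + (1 + 1 / \<bar>\<alpha>\<bar>) * C2"
  \<comment> \<open>The factors 2 arise because the Cauchy data of the difference are bounded by
    \<open>2 * N\<close>.\<close>
  define C5 where "C5 = (2 * C3 / \<bar>\<alpha>\<bar> + 2 * C4) / y"
  \<comment> \<open>Yields both \<open>8 * e * K \<le> 1/2\<close>, needed for absorption in the
    zone, and \<open>e \<le> 1/4\<close>.\<close>
  define e0 where "e0 = 1 / (16 * K + 4)"
  have e0: "e0 > 0" "e0 \<le> 1/4" using K0 by (auto simp: e0_def field_simps)
  \<comment> \<open>\<open>3844\<close> is the zone length factor 4 times the square of
    \<open>31 = 30 + 1\<close>, the bounds for the two solutions inside the zone.\<close>
  define D where "D = (C5 + 3844) * c1\<^sup>2"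
  have "(L2norm (\<lambda>x. f x - h x))\<^sup>2 \<le> D * sqrt e * (L2norm g)\<^sup>2"
    if e: "0 < e" "e < e0" and g: "g \<in> L2"
      and f: "solves_resolvent_eq (rank_one_perturbation (\<lambda>x. V x + 1 / e * q (x / e)) (\<lambda>x. step2 1 (x / e)) (- 3 / (2 * e ^ 3))) z g f"
      and h: "solves_resolvent_eq (S_ab V \<alpha> \<beta>) z g h" for e g f h
  proof -
    define W where "W = (\<lambda>x. V x + 1 / e * q (x / e))"
    define p where "p = (\<lambda>x. step2 1 (x / e))"
    define s where "s = sqrt e"
    have s: "0 < s" "s * s = e" using e by (auto simp: s_def)
    have e4: "e \<le> 1/4" using e e0 by simp
    define \<delta> where "\<delta> = 2 * e"
    have \<delta>: "0 < \<delta>" "\<delta> \<le> 1/2" using e e4 by (auto simp: \<delta>_def)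
    have small: "8 * e * K \<le> 1/2"
    proof -
      have "e * (16 * K + 4) \<le> 1" using e(2) K0 by (simp add: e0_def field_simps)
      then show ?thesis using e(1) by (simp add: algebra_simps)
    qed
    note P = perturbed_potential(1,2)[OF Vm Vb Vc qm q e(1), folded W_def]
    have Wc: "W x \<ge> - (c + Mq / e)" for x
      using perturbed_potential(3)[OF Vm Vb Vc qm q e(1), of x] by (simp add: W_def)
    have p_eq: "p x = e * e * step2 e x" for x unfolding p_def by (rule step2_scale[OF e(1)])
    have p2: "step2 e \<in> borel_measurable lebesgue"
      unfolding step2_def[abs_def] by (intro measurable_completion) measurable
    have pL: "p \<in> L2"
    proof -
      have "(\<lambda>x. complex_of_real (step2 e x)) \<in> L2"
      proof (rule L2_dominated(1)[OF L2_cmult[OF L2_indicator_interval(1)[of "-e" e], of "of_real (1 / (e * e))"]])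
        show "- e \<le> e" using e by simp
        show "(\<lambda>x. complex_of_real (step2 e x)) \<in> borel_measurable lebesgue" using p2 by measurable
      qed (use e in \<open>auto simp: step2_def indicator_def norm_mult norm_divide\<close>)
      then have "(\<lambda>x. of_real (e * e) * complex_of_real (step2 e x)) \<in> L2" by (rule L2_cmult)
      then have "(\<lambda>x. complex_of_real (p x)) \<in> L2" by (simp add: p_eq)
      moreover have "p \<in> borel_measurable lebesgue" unfolding p_eq[abs_def] using p2 by measurable
      ultimately show ?thesis by (simp add: L2_def)
    qed
    define G where "G = L2norm g"
    have G0: "G \<ge> 0" by (simp add: G_def)
    define N where "N = c1 * G"
    have N0: "N \<ge> 0" using c1 G0 by (simp add: N_def)
    have GN: "G \<le> N" using mult_right_mono[OF c1 G0] by (simp add: N_def)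
    have fb: "f \<in> L2" "L2norm f \<le> G / y"
      using rank_one_solution_bound[OF P Wc z pL g f[folded W_def p_def]] by (auto simp: G_def y_def)
    have hb: "h \<in> L2" "L2norm h \<le> G / y"
      using S_ab_solution_bound[OF Vm Vb Vc z \<alpha> g h] by (auto simp: G_def y_def)
    define f1 where "f1 = deriv1 f"
    define f2 where "f2 = deriv1 (deriv1 f)"
    define I where "I = (LINT s|lebesgue. of_real (p s) * f s)"
    define \<kappa> where "\<kappa> = - of_real (3 / (2 * e)) * I"
    have fd: "f \<in> dom_S0 W" and feq0: "AE x in lebesgue. schroedinger_expr W f x + of_real (- 3 / (2 * e ^ 3) * p x) * I - z * f x = g x"
      using f by (auto simp: solves_resolvent_eq_def rank_one_perturbation_def I_def W_def p_def)
    have ftp: "twice_prim f f1 f2" using dom_S0_D(2)[OF fd] by (simp add: f1_def f2_def)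
    have kp: "complex_of_real (- 3 / (2 * e ^ 3) * p x) * I = \<kappa> * of_real (step2 e x)" for x
    proof -
      have "- 3 / (2 * e ^ 3) * p x = - (3 / (2 * e)) * step2 e x"
        using e by (simp add: p_eq field_simps power3_eq_cube)
      then show ?thesis by (simp add: \<kappa>_def)
    qed
    have feq: "AE x in lebesgue. f2 x = (Q x + of_real (1 / e * q (x / e))) * f x + \<kappa> * of_real (step2 e x) - g x"
      using feq0
    proof eventually_elim
      case (elim x)
      then have "- f2 x + of_real (W x) * f x + \<kappa> * of_real (step2 e x) - z * f x = g x"
        unfolding kp by (simp add: schroedinger_expr_def f2_def)
      then have "f2 x = of_real (W x) * f x + \<kappa> * of_real (step2 e x) - z * f x - g x"
        by (simp add: algebra_simps)
      then show ?case unfolding W_def Q_def by (simp add: algebra_simps)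
    qed
    have outside: "q (x / e) = 0 \<and> step2 e x = 0" if "x < - \<delta> \<or> \<delta> < x" for x
      using that e by (auto simp: q_def three_steps_def step2_def \<delta>_def field_simps)
    have ne: "AE x in lebesgue. x \<noteq> a" for a :: real
      using AE_not_in[of "{a}" lebesgue] by (simp add: negligible_iff_null_sets[symmetric])
    have fout: "AE x in lebesgue. x < - \<delta> \<or> \<delta> < x \<longrightarrow> f2 x = Q x * f x - g x"
      using feq by eventually_elim (use outside in auto)
    obtain hm hp where "glued_pair V \<alpha> \<beta> h hm hp"
      using S_ab_D h unfolding solves_resolvent_eq_def by blast
    note H = glued_pairD[OF this]
    have heq0: "AE x in lebesgue. schroedinger_expr V h x - z * h x = g x"
      using h by (auto simp: solves_resolvent_eq_def)
    define m1 m2 where "m1 = deriv1 hm" and "m2 = deriv1 (deriv1 hm)"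
    define p1 p2 where "p1 = deriv1 hp" and "p2 = deriv1 (deriv1 hp)"
    have mtp: "twice_prim hm m1 m2" using dom_S0_D(2)[OF H(1)] by (simp add: m1_def m2_def)
    have ptp: "twice_prim hp p1 p2" using dom_S0_D(2)[OF H(2)] by (simp add: p1_def p2_def)
    have meq: "AE x in lebesgue. x < 0 \<longrightarrow> m2 x = Q x * hm x - g x"
      using heq0
    proof eventually_elim
      case (elim x)
      show ?case
      proof
        assume x: "x < 0"
        have "schroedinger_expr V hm x - z * hm x = g x" using elim H(4)[OF x] H(8)[OF x] by simp
        then show "m2 x = Q x * hm x - g x" by (simp add: schroedinger_expr_def m2_def Q_def algebra_simps)
      qed
    qed
    have peq: "AE x in lebesgue. 0 < x \<longrightarrow> p2 x = Q x * hp x - g x"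
      using heq0
    proof eventually_elim
      case (elim x)
      show ?case
      proof
        assume x: "0 < x"
        have "schroedinger_expr V hp x - z * hp x = g x" using elim H(5)[OF x] H(9)[OF x] by simp
        then show "p2 x = Q x * hp x - g x" by (simp add: schroedinger_expr_def p2_def Q_def algebra_simps)
      qed
    qed
    have cG: "(21 + 2 * M) * (G / y) + 2 * L2norm g = N"
      by (simp add: N_def c1_def G_def algebra_simps add_divide_distrib)
    \<comment> \<open>The unit interval has to avoid the interior of the zone when applied to
      \<open>f\<close>, whose coefficient there is of order \<open>1 / e\<close>; outside,
      \<open>M\<close> is a bound independent of \<open>e\<close>.\<close>
    have loc: "norm (u x) \<le> N" "norm (u1 x) \<le> N"
      if u: "twice_prim u u1 u2" and x: "x \<in> {a..a+1}" and a: "- 2 \<le> a" "a \<le> 1"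
        and eq: "AE t in lebesgue. a < t \<and> t < a + 1 \<longrightarrow> u2 t = Q t * u t - g t"
        and L: "L2norm (restr {a..a+1} u) \<le> G / y" for u u1 u2 x a
    proof -
      have eq': "AE t in lebesgue. t \<in> {a..a+1} \<longrightarrow> u2 t = Q t * u t - g t"
        using eq ne[of a] ne[of "a+1"] by eventually_elim auto
      have Mt: "norm (Q t) \<le> M" if "t \<in> {a..a+1}" for t by (rule M) (use that a in auto)
      show "norm (u x) \<le> N" "norm (u1 x) \<le> N"
        using solution_local_bound(1,2)[OF u x eq' Mt g L] unfolding cG by blast+
    qed
    have fR: "norm (f \<delta>) \<le> N" "norm (f1 \<delta>) \<le> N"
    proof -
      have eq: "AE t in lebesgue. \<delta> < t \<and> t < \<delta> + 1 \<longrightarrow> f2 t = Q t * f t - g t"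
        using fout by eventually_elim auto
      have "L2norm (restr {\<delta>..\<delta>+1} f) \<le> G / y" using L2_restr(2)[OF fb(1), of "{\<delta>..\<delta>+1}"] fb(2) by simp
      from loc[OF ftp _ _ _ eq this] \<delta> show "norm (f \<delta>) \<le> N" "norm (f1 \<delta>) \<le> N" by auto
    qed
    have fL: "norm (f (-\<delta>)) \<le> N" "norm (f1 (-\<delta>)) \<le> N"
    proof -
      have eq: "AE t in lebesgue. - \<delta> - 1 < t \<and> t < - \<delta> - 1 + 1 \<longrightarrow> f2 t = Q t * f t - g t"
        using fout by eventually_elim auto
      have "L2norm (restr {-\<delta>-1..-\<delta>-1+1} f) \<le> G / y" using L2_restr(2)[OF fb(1), of "{-\<delta>-1..-\<delta>-1+1}"] fb(2) by simp
      from loc[OF ftp _ _ _ eq this] \<delta> show "norm (f (-\<delta>)) \<le> N" "norm (f1 (-\<delta>)) \<le> N" by auto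
    qed
    have hpb: "norm (hp x) \<le> N \<and> norm (p1 x) \<le> N" if "x \<in> {0..1}" for x
    proof -
      have eq: "AE t in lebesgue. 0 < t \<and> t < 0 + 1 \<longrightarrow> p2 t = Q t * hp t - g t"
        using peq by eventually_elim auto
      have "L2norm (restr {0..0+1} hp) \<le> L2norm h"
        by (rule L2norm_restr_le[OF H(3) dom_S0_D(1)[OF H(2)]]) (use H(5) in auto)
      then have "L2norm (restr {0..0+1} hp) \<le> G / y" using hb(2) by simp
      from loc[OF ptp _ _ _ eq this] that show ?thesis by auto
    qed
    have hmb: "norm (hm x) \<le> N \<and> norm (m1 x) \<le> N" if "x \<in> {-1..0}" for x
    proof -
      have eq: "AE t in lebesgue. - 1 < t \<and> t < - 1 + 1 \<longrightarrow> m2 t = Q t * hm t - g t"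
        using meq by eventually_elim auto
      have "L2norm (restr {-1..-1+1} hm) \<le> L2norm h"
        by (rule L2norm_restr_le[OF H(3) dom_S0_D(1)[OF H(1)]]) (use H(4) in auto)
      then have "L2norm (restr {-1..-1+1} hm) \<le> G / y" using hb(2) by simp
      from loc[OF mtp _ _ _ eq this] that show ?thesis by auto
    qed
    \<comment> \<open>The profile is supported in the zone, so the pairing over the whole line is an
      integral over the zone; division by \<open>e * e\<close> passes from \<open>p\<close> to
      \<open>step2 e\<close>.\<close>
    have I_int: "((\<lambda>x. of_real (step2 e x) * f x) has_integral I / of_real (e * e)) {-(2*e)..2*e}"
    proof -
      have pi: "integrable lebesgue (\<lambda>s. complex_of_real (p s) * f s)"
        by (rule L2_p_integrable[OF P Wc z pL fb(1)])
      have ind: "indicat_real {-(2*e)..2*e} x *\<^sub>R (complex_of_real (p x) * f x) = complex_of_real (p x) * f x" for x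
        using outside[of x] by (auto simp: indicator_def p_eq \<delta>_def not_le)
      have "set_integrable lebesgue {-(2*e)..2*e} (\<lambda>s. complex_of_real (p s) * f s)"
        unfolding set_integrable_def ind by (rule pi)
      from has_integral_set_lebesgue[OF this]
      have "((\<lambda>s. complex_of_real (p s) * f s) has_integral I) {-(2*e)..2*e}"
        unfolding set_lebesgue_integral_def ind I_def .
      from has_integral_divide[OF this, of "of_real (e * e)"] show ?thesis
        using e(1) by (simp add: p_eq)
    qed
    have mom: "((\<lambda>x. q (x / e)) has_integral e * ((1 - \<alpha>)\<^sup>2 / (\<alpha> * \<beta>))) {-(2*e)..2*e}"
      "((\<lambda>x. q (x / e) * step e x) has_integral e * ((1 - \<alpha>) / (\<alpha> * \<beta>))) {-(2*e)..2*e}"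
      "((\<lambda>x. q (x / e) * (step e x * step e x)) has_integral e * (1 / (\<alpha> * \<beta>))) {-(2*e)..2*e}"
      using three_steps_moments[OF e(1), of A B C] unfolding ABC q_def by auto
    have eqJ: "AE x in lebesgue. x \<in> {-(2*e)..2*e} \<longrightarrow>
        f2 x = (Q x + of_real (1 / e * q (x / e))) * f x + \<kappa> * of_real (step2 e x) - g x"
      using feq by eventually_elim auto
    have e2: "e \<le> 1/2" using e4 by simp
    have Q1: "norm (Q x) \<le> M" if "\<bar>x\<bar> \<le> 1" for x using that by (intro M) auto
    define \<eta> where "\<eta> = C1 * s * N"
    define q0 q1 q2 where "q0 = (1 - \<alpha>)\<^sup>2 / (\<alpha> * \<beta>)" and "q1 = (1 - \<alpha>) / (\<alpha> * \<beta>)" and "q2 = 1 / (\<alpha> * \<beta>)"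
    note ends = fL(1)[unfolded \<delta>_def] fR(1)[unfolded \<delta>_def] fL(2)[unfolded \<delta>_def]
    have int: "\<And>x. x \<in> {-\<delta>..\<delta>} \<Longrightarrow> norm (f x) \<le> 30 * N"
      and jump: "norm (f1 \<delta> - f1 (-\<delta>) - (of_real q0 * f (-\<delta>) + of_real q1 * (f \<delta> - f (-\<delta>)))) \<le> \<eta>"
        "norm (f1 \<delta> - (of_real q1 * f (-\<delta>) + of_real q2 * (f \<delta> - f (-\<delta>)))) \<le> \<eta>"
      unfolding \<delta>_def \<eta>_def s_def
      by (rule interior_estimate[OF e(1) e2 K_def small ftp eqJ \<kappa>_def I_int Q1 q mom[folded q0_def q1_def q2_def] ends g
            GN[unfolded G_def] C1_def]; assumption)+
    note cp = coupling_from_jumps[OF \<alpha> \<beta> q0_def q1_def q2_def jump]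
    define \<zeta> where "\<zeta> = C2 * s * N"
    have Q1': "norm (Q x) \<le> M" if "x \<in> {-1..1}" for x using that by (intro M) auto
    have e21: "2 * e \<le> 1" using e4 by simp
    have osp: "norm (hp \<delta> - hp 0) \<le> \<zeta>" "norm (p1 \<delta> - p1 0) \<le> \<zeta>"
    proof -
      have eq: "AE t in lebesgue. t \<in> {0..\<delta>} \<longrightarrow> p2 t = Q t * hp t - g t"
        using peq AE_nonzero by eventually_elim auto
      have d: "\<delta> = 0 + 2 * e" by (simp add: \<delta>_def)
      have b: "norm (hp t) \<le> N \<and> norm (p1 t) \<le> N" if "t \<in> {0..\<delta>}" for t using hpb[of t] that \<delta> by auto
      have Qb: "norm (Q t) \<le> M" if "t \<in> {0..\<delta>}" for t by (rule Q1') (use that \<delta> in auto)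
      show "norm (hp \<delta> - hp 0) \<le> \<zeta>" "norm (p1 \<delta> - p1 0) \<le> \<zeta>"
        unfolding \<zeta>_def C2_def
        using one_sided_continuity[OF ptp s e21 d b eq Qb M0 g GN[unfolded G_def]] by auto
    qed
    have osm: "norm (hm 0 - hm (-\<delta>)) \<le> \<zeta>" "norm (m1 0 - m1 (-\<delta>)) \<le> \<zeta>"
    proof -
      have eq: "AE t in lebesgue. t \<in> {-\<delta>..0} \<longrightarrow> m2 t = Q t * hm t - g t"
        using meq AE_nonzero by eventually_elim auto
      have d: "0 = - \<delta> + 2 * e" by (simp add: \<delta>_def)
      have b: "norm (hm t) \<le> N \<and> norm (m1 t) \<le> N" if "t \<in> {-\<delta>..0}" for t using hmb[of t] that \<delta> by auto
      have Qb: "norm (Q t) \<le> M" if "t \<in> {-\<delta>..0}" for t by (rule Q1') (use that \<delta> in auto)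
      show "norm (hm 0 - hm (-\<delta>)) \<le> \<zeta>" "norm (m1 0 - m1 (-\<delta>)) \<le> \<zeta>"
        unfolding \<zeta>_def C2_def
        using one_sided_continuity[OF mtp s e21 d b eq Qb M0 g GN[unfolded G_def]] by auto
    qed
    \<comment> \<open>Cauchy data of the difference at the ends of the zone, compared with the left
      extension \<open>hm\<close> at one end and with the right extension \<open>hp\<close> at the
      other.\<close>
    define a a1 where "a = f (-\<delta>) - hm (-\<delta>)" and "a1 = f1 (-\<delta>) - m1 (-\<delta>)"
    define b b1 where "b = f \<delta> - hp \<delta>" and "b1 = f1 \<delta> - p1 \<delta>"
    have bc: "hp 0 = of_real \<alpha> * hm 0 + of_real \<beta> * m1 0" "p1 0 = m1 0 / of_real \<alpha>"
      using H(6,7) by (simp_all add: m1_def p1_def)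
    have D1: "norm (b - of_real \<alpha> * a - of_real \<beta> * a1) \<le> C3 * s * N"
    proof -
      have E: "b - of_real \<alpha> * a - of_real \<beta> * a1 = (f \<delta> - of_real \<alpha> * f (-\<delta>) - of_real \<beta> * f1 (-\<delta>))
          - ((hp \<delta> - hp 0) + of_real \<alpha> * (hm 0 - hm (-\<delta>)) + of_real \<beta> * (m1 0 - m1 (-\<delta>)))"
        by (simp add: a_def a1_def b_def bc algebra_simps)
      have "norm ((hp \<delta> - hp 0) + of_real \<alpha> * (hm 0 - hm (-\<delta>)) + of_real \<beta> * (m1 0 - m1 (-\<delta>)))
          \<le> norm (hp \<delta> - hp 0) + norm (complex_of_real \<alpha> * (hm 0 - hm (-\<delta>))) + norm (complex_of_real \<beta> * (m1 0 - m1 (-\<delta>)))"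
        by (intro order_trans[OF norm_triangle_ineq] add_mono norm_triangle_ineq order_refl)
      moreover have "norm (complex_of_real \<alpha> * (hm 0 - hm (-\<delta>))) \<le> \<bar>\<alpha>\<bar> * \<zeta>"
        unfolding norm_mult norm_of_real by (rule mult_left_mono[OF osm(1)]) simp
      moreover have "norm (complex_of_real \<beta> * (m1 0 - m1 (-\<delta>))) \<le> \<bar>\<beta>\<bar> * \<zeta>"
        unfolding norm_mult norm_of_real by (rule mult_left_mono[OF osm(2)]) simp
      ultimately have "norm (b - of_real \<alpha> * a - of_real \<beta> * a1) \<le> 2 * \<bar>\<beta>\<bar> * \<eta> + (\<zeta> + \<bar>\<alpha>\<bar> * \<zeta> + \<bar>\<beta>\<bar> * \<zeta>)"
        using norm_triangle_ineq4[of "f \<delta> - of_real \<alpha> * f (-\<delta>) - of_real \<beta> * f1 (-\<delta>)"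
            "(hp \<delta> - hp 0) + of_real \<alpha> * (hm 0 - hm (-\<delta>)) + of_real \<beta> * (m1 0 - m1 (-\<delta>))"] cp(1) osp(1) unfolding E
        by linarith
      also have "\<dots> = C3 * s * N" by (simp add: \<eta>_def \<zeta>_def C3_def algebra_simps)
      finally show ?thesis .
    qed
    have D2: "norm (b1 - a1 / of_real \<alpha>) \<le> C4 * s * N"
    proof -
      have E: "b1 - a1 / of_real \<alpha> = (f1 \<delta> - f1 (-\<delta>) / of_real \<alpha>) - ((p1 \<delta> - p1 0) + (m1 0 - m1 (-\<delta>)) / of_real \<alpha>)"
        by (simp add: a1_def b1_def bc algebra_simps diff_divide_distrib)
      have "norm ((p1 \<delta> - p1 0) + (m1 0 - m1 (-\<delta>)) / of_real \<alpha>) \<le> norm (p1 \<delta> - p1 0) + norm ((m1 0 - m1 (-\<delta>)) / complex_of_real \<alpha>)"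
        by (rule norm_triangle_ineq)
      moreover have "norm ((m1 0 - m1 (-\<delta>)) / complex_of_real \<alpha>) \<le> \<zeta> / \<bar>\<alpha>\<bar>"
        unfolding norm_divide norm_of_real by (rule divide_right_mono[OF osm(2)]) simp
      ultimately have "norm (b1 - a1 / of_real \<alpha>) \<le> (1 + 2 / \<bar>\<alpha>\<bar>) * \<eta> + (\<zeta> + \<zeta> / \<bar>\<alpha>\<bar>)"
        using norm_triangle_ineq4[of "f1 \<delta> - f1 (-\<delta>) / of_real \<alpha>" "(p1 \<delta> - p1 0) + (m1 0 - m1 (-\<delta>)) / of_real \<alpha>"] cp(2) osp(2) unfolding E
        by linarith
      also have "\<dots> = C4 * s * N" by (simp add: \<eta>_def \<zeta>_def C4_def algebra_simps add_divide_distrib)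
      finally show ?thesis .
    qed
    have a1N: "norm a1 \<le> 2 * N"
      using norm_triangle_ineq4[of "f1 (-\<delta>)" "m1 (-\<delta>)"] fL(2) hmb[of "-\<delta>"] \<delta> by (simp add: a1_def)
    have bN: "norm b \<le> 2 * N"
      using norm_triangle_ineq4[of "f \<delta>" "hp \<delta>"] fR(1) hpb[of \<delta>] \<delta> by (simp add: b_def)
    note form = boundary_form_defect[OF \<alpha> D1 D2 a1N bN]
    define R where "R = (\<lambda>x. f x - hp x)"
    define L where "L = (\<lambda>x. f x - hm x)"
    have hpL: "hp \<in> L2" "hm \<in> L2" by (rule dom_S0_D(1)[OF H(2)], rule dom_S0_D(1)[OF H(1)])
    have RL: "restr {\<delta>..} R \<in> L2" unfolding R_def by (rule L2_restr(1)[OF L2_diff[OF fb(1) hpL(1)]]) simp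
    have LL: "restr {..-\<delta>} L \<in> L2" unfolding L_def by (rule L2_restr(1)[OF L2_diff[OF fb(1) hpL(2)]]) simp
    have Rtp: "twice_prim R (\<lambda>x. f1 x - p1 x) (\<lambda>x. f2 x - p2 x)" unfolding R_def by (rule twice_prim_diff[OF ftp ptp])
    have Ltp: "twice_prim L (\<lambda>x. f1 x - m1 x) (\<lambda>x. f2 x - m2 x)" unfolding L_def by (rule twice_prim_diff[OF ftp mtp])
    have "AE x in lebesgue. \<delta> < x \<longrightarrow> f2 x - p2 x = Q x * R x"
      using fout peq by eventually_elim (use \<delta> in \<open>simp add: R_def right_diff_distrib\<close>)
    from homogeneous_energy_right[OF Rtp Vc RL this[unfolded Q_def]]
    have eR: "Im z * (L2norm (restr {\<delta>..} R))\<^sup>2 = Im (b1 * cnj b)" by (simp add: R_def b1_def b_def)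
    have "AE x in lebesgue. x < - \<delta> \<longrightarrow> f2 x - m2 x = Q x * L x"
      using fout meq by eventually_elim (use \<delta> in \<open>simp add: L_def right_diff_distrib\<close>)
    from homogeneous_energy_left[OF Ltp Vc LL this[unfolded Q_def]]
    have eL: "Im z * (L2norm (restr {..-\<delta>} L))\<^sup>2 = - Im (a1 * cnj a)" by (simp add: L_def a1_def a_def)
    \<comment> \<open>The two brackets enter with opposite signs, so that only their small
      difference remains.\<close>
    have outer: "(L2norm (restr {\<delta>..} R))\<^sup>2 + (L2norm (restr {..-\<delta>} L))\<^sup>2 \<le> C5 * s * N\<^sup>2"
    proof -
      let ?T = "(L2norm (restr {\<delta>..} R))\<^sup>2 + (L2norm (restr {..-\<delta>} L))\<^sup>2"
      have "Im z * ?T = Im (b1 * cnj b) - Im (a1 * cnj a)" using eR eL by (simp only: distrib_left)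
      then have "\<bar>Im z * ?T\<bar> \<le> 2 * N * (C3 * s * N) / \<bar>\<alpha>\<bar> + C4 * s * N * (2 * N)" using form by simp
      then have "y * ?T \<le> 2 * N * (C3 * s * N) / \<bar>\<alpha>\<bar> + C4 * s * N * (2 * N)" by (simp add: abs_mult y_def)
      also have "\<dots> = y * (C5 * s * N\<^sup>2)" using y by (simp add: C5_def algebra_simps power2_eq_square add_divide_distrib)
      finally show ?thesis using y by (rule mult_left_le_imp_le)
    qed
    have "(L2norm (\<lambda>x. f x - h x))\<^sup>2 \<le> (L2norm (restr {\<delta>..} R))\<^sup>2 + (L2norm (restr {..-\<delta>} L))\<^sup>2 + (4 * e) * (31 * N)\<^sup>2"
    proof -
      have "(LINT x|lebesgue. (norm (f x - h x))\<^sup>2) \<le>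
        (LINT x|lebesgue. (norm (restr {\<delta>..} R x))\<^sup>2 + (norm (restr {..-\<delta>} L x))\<^sup>2 + indicat_real {-\<delta>..\<delta>} x * (31 * N)\<^sup>2)"
      proof (rule integral_mono_AE)
        show "integrable lebesgue (\<lambda>x. (norm (f x - h x))\<^sup>2)" by (rule L2D(2)[OF L2_diff[OF fb(1) hb(1)]])
        show "integrable lebesgue (\<lambda>x. (norm (restr {\<delta>..} R x))\<^sup>2 + (norm (restr {..-\<delta>} L x))\<^sup>2 + indicat_real {-\<delta>..\<delta>} x * (31 * N)\<^sup>2)"
          by (intro Bochner_Integration.integrable_add L2D(2)[OF RL] L2D(2)[OF LL] integrable_mult_left integrable_real_indicator)
            (use \<delta> in auto)
        show "AE x in lebesgue. (norm (f x - h x))\<^sup>2 \<le> (norm (restr {\<delta>..} R x))\<^sup>2 + (norm (restr {..-\<delta>} L x))\<^sup>2 + indicat_real {-\<delta>..\<delta>} x * (31 * N)\<^sup>2"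
          using AE_nonzero
        proof eventually_elim
          case (elim x)
          consider "\<delta> < x" | "x < - \<delta>" | "x \<in> {-\<delta>..\<delta>}" by fastforce
          then show ?case
          proof cases
            case 1
            then have "h x = hp x" using H(5)[of x] \<delta> by simp
            then show ?thesis using 1 \<delta> by (simp add: R_def)
          next
            case 2
            then have "h x = hm x" using H(4)[of x] \<delta> by simp
            then show ?thesis using 2 \<delta> by (simp add: L_def)
          next
            case 3
            have "norm (h x) \<le> N"
            proof (cases "x < 0")
              case True
              then show ?thesis using H(4)[of x] hmb[of x] 3 \<delta> by auto
            next
              case False
              then have "0 < x" using elim by simp
              then show ?thesis using H(5)[of x] hpb[of x] 3 \<delta> by auto
            qed
            moreover have "norm (f x) \<le> 30 * N" by (rule int[OF 3])
            ultimately have "norm (f x - h x) \<le> 31 * N" using norm_triangle_ineq4[of "f x" "h x"] by linarith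
            then have "(norm (f x - h x))\<^sup>2 \<le> (31 * N)\<^sup>2" by (rule power_mono) simp
            also have "\<dots> \<le> (norm (restr {\<delta>..} R x))\<^sup>2 + (norm (restr {..-\<delta>} L x))\<^sup>2 + indicat_real {-\<delta>..\<delta>} x * (31 * N)\<^sup>2"
              using 3 by simp
            finally show ?thesis .
          qed
        qed
      qed
      also have "\<dots> = (L2norm (restr {\<delta>..} R))\<^sup>2 + (L2norm (restr {..-\<delta>} L))\<^sup>2 + (4 * e) * (31 * N)\<^sup>2"
      proof -
        have i: "integrable lebesgue (\<lambda>x. indicat_real {-\<delta>..\<delta>} x * (31 * N)\<^sup>2)"
          by (intro integrable_mult_left integrable_real_indicator) (use \<delta> in auto)
        have j: "(LINT x|lebesgue. indicat_real {-\<delta>..\<delta>} x * (31 * N)\<^sup>2) = (4 * e) * (31 * N)\<^sup>2"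
          using \<delta> by (simp add: \<delta>_def)
        show ?thesis
          unfolding Bochner_Integration.integral_add[OF Bochner_Integration.integrable_add[OF L2D(2)[OF RL] L2D(2)[OF LL]] i]
            Bochner_Integration.integral_add[OF L2D(2)[OF RL] L2D(2)[OF LL]] j L2norm_sq ..
      qed
      finally show ?thesis by (simp only: L2norm_sq)
    qed
    also have "\<dots> \<le> C5 * s * N\<^sup>2 + 3844 * s * N\<^sup>2"
    proof (rule add_mono[OF outer])
      have "s \<le> 1" using s e4 by (simp add: s_def)
      then have "s * s \<le> s * 1" using s(1) by (intro mult_left_mono) auto
      then have "e * (3844 * N\<^sup>2) \<le> s * (3844 * N\<^sup>2)" using s(2) by (intro mult_right_mono) auto
      then show "4 * e * (31 * N)\<^sup>2 \<le> 3844 * s * N\<^sup>2" by (simp add: power_mult_distrib mult_ac)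
    qed
    also have "\<dots> = D * sqrt e * (L2norm g)\<^sup>2"
      by (simp add: D_def N_def G_def s_def power_mult_distrib algebra_simps)
    finally show ?thesis .
  qed
  then show ?thesis using e0(1) by blast
qed

section \<open>Admissible profiles and passage to the limit\<close>

lemma L2_opnorm_bounds:
  assumes "\<And>g. g \<in> L2 \<Longrightarrow> L2norm g \<le> 1 \<Longrightarrow> L2norm (R g) \<le> B"
  shows "0 \<le> L2_opnorm R" "L2_opnorm R \<le> B"
proof -
  have z: "(\<lambda>x. 0 :: complex) \<in> {g \<in> L2. L2norm g \<le> 1}" by (simp add: L2_zero)
  have "bdd_above ((\<lambda>g. L2norm (R g)) ` {g \<in> L2. L2norm g \<le> 1})"
    by (rule bdd_aboveI[of _ B]) (use assms in auto)
  from cSUP_upper[OF z this] show "0 \<le> L2_opnorm R"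
    unfolding L2_opnorm_def using L2norm_nonneg order_trans by blast
  show "L2_opnorm R \<le> B"
    unfolding L2_opnorm_def by (rule cSUP_least) (use z assms in auto)
qed

lemma three_steps_admissible:
  "three_steps A B C \<in> borel_measurable lebesgue" "bounded (range (three_steps A B C))"
  "compactly_supported (three_steps A B C)"
proof -
  show "three_steps A B C \<in> borel_measurable lebesgue"
    unfolding three_steps_def[abs_def] by (intro measurable_completion) measurable
  have "norm (three_steps A B C t) \<le> \<bar>A\<bar> + \<bar>B\<bar> + \<bar>C\<bar>" for t by (auto simp: three_steps_def)
  then show "bounded (range (three_steps A B C))" unfolding bounded_iff by blast
  have "{x. three_steps A B C x \<noteq> 0} \<subseteq> {-2..2}" by (auto simp: three_steps_def split: if_splits)
  then show "compactly_supported (three_steps A B C)"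
    unfolding compactly_supported_def compact_closure
    by (rule bounded_subset[OF compact_imp_bounded[OF compact_Icc]])
qed

lemma step2_admissible:
  "(\<lambda>t. c * step2 1 t) \<in> L2" "compactly_supported (\<lambda>t. c * step2 1 t)" "zero_mean (\<lambda>t. c * step2 1 t)"
proof -
  have m: "(\<lambda>t. c * step2 1 t) \<in> borel_measurable lebesgue"
    unfolding step2_def[abs_def] by (intro measurable_completion) measurable
  have "integrable lebesgue (\<lambda>t::real. c\<^sup>2 * indicat_real {-1..1} t)"
    by (intro integrable_mult_right integrable_real_indicator) auto
  then have "integrable lebesgue (\<lambda>t. (norm (c * step2 1 t))\<^sup>2)"
  proof (rule Bochner_Integration.integrable_bound)
    show "(\<lambda>t. (norm (c * step2 1 t))\<^sup>2) \<in> borel_measurable lebesgue" using m by measurable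
    show "AE t in lebesgue. norm ((norm (c * step2 1 t))\<^sup>2) \<le> norm (c\<^sup>2 * indicat_real {-1..1} t)"
      by (rule AE_I2) (auto simp: step2_def indicator_def power_mult_distrib)
  qed
  with m show "(\<lambda>t. c * step2 1 t) \<in> L2" by (simp add: L2_def)
  have "{x. c * step2 1 x \<noteq> 0} \<subseteq> {-1..1}" by (auto simp: step2_def split: if_splits)
  then show "compactly_supported (\<lambda>t. c * step2 1 t)"
    unfolding compactly_supported_def compact_closure
    by (rule bounded_subset[OF compact_imp_bounded[OF compact_Icc]])
  have eq: "c * step2 1 t = c * indicat_real {-1<..0} t - c * indicat_real {0<..1} t" for t
    by (auto simp: step2_def indicator_def)
  have "integrable lebesgue (\<lambda>t::real. c * indicat_real {-1<..0} t)" "integrable lebesgue (\<lambda>t::real. c * indicat_real {0<..1} t)"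
    by (intro integrable_mult_right integrable_real_indicator; simp)+
  from Bochner_Integration.integral_diff[OF this] show "zero_mean (\<lambda>t. c * step2 1 t)"
    unfolding zero_mean_def eq by simp
qed

text \<open>Used for the trivial coupling, where every solution for \<open>S_0\<close> also solves
  the limit equation and uniqueness identifies the resolvents.\<close>

lemma dom_S0_subset_S_ab:
  assumes f: "f \<in> dom_S0 V"
  shows "f \<in> fst (S_ab V 1 0)"
proof (rule S_ab_I)
  show "glued_pair V 1 0 f f f" unfolding glued_pair_def using f dom_S0_D(1)[OF f] by simp
qed

theorem mainTheorem2:
  fixes V :: "real \<Rightarrow> real" and \<alpha> \<beta> :: real
  assumes "V \<in> borel_measurable lebesgue"
    and "locally_bounded V"
    and "bdd_below (range V)"
    and "\<alpha> \<noteq> 0"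
    and "\<not> (\<beta> = 0 \<and> \<alpha> \<noteq> 1)"
  shows "\<exists>\<phi>1 \<phi>2 q :: real \<Rightarrow> real.
           \<phi>1 \<in> L2 \<and> compactly_supported \<phi>1 \<and> zero_mean \<phi>1 \<and>
           \<phi>2 \<in> L2 \<and> compactly_supported \<phi>2 \<and> zero_mean \<phi>2 \<and>
           q \<in> borel_measurable lebesgue \<and> bounded (range q) \<and> compactly_supported q \<and>
           norm_resolvent_convergence (S_eps V \<phi>1 \<phi>2 q) (S_ab V \<alpha> \<beta>) (at_right 0)"
proof -
  obtain c0 where c0: "\<And>x. c0 \<le> V x" using assms(3) by (auto simp: bdd_below_def)
  define c where "c = - c0"
  have Vc: "V x \<ge> - c" for x using c0 by (simp add: c_def)
  have nz: "Im z \<noteq> 0" if "z \<notin> \<real>" for z using that by (simp add: complex_is_Real_iff)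
  have ab: "- \<real> \<subseteq> resolvent_set (S_ab V \<alpha> \<beta>)"
    using S_ab_resolvent_set[OF assms(1,2) Vc nz assms(4)] by blast
  \<comment> \<open>The scalars \<open>a\<close> and \<open>b\<close> cover both the zero
    perturbation and the actual one.\<close>
  have eps: "- \<real> \<subseteq> resolvent_set (S_eps V (\<lambda>t. b * step2 1 t) (\<lambda>t. a * (b * step2 1 t)) (three_steps A B C) e)"
    if e: "e > 0" for e a b A B C
  proof
    fix z :: complex assume "z \<in> - \<real>"
    then have z: "Im z \<noteq> 0" using nz by simp
    have qb: "\<bar>three_steps A B C t\<bar> \<le> \<bar>A\<bar> + \<bar>B\<bar> + \<bar>C\<bar>" for t by (auto simp: three_steps_def)
    note P = perturbed_potential[OF assms(1,2) Vc three_steps_admissible(1) qb e]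
    show "z \<in> resolvent_set (S_eps V (\<lambda>t. b * step2 1 t) (\<lambda>t. a * (b * step2 1 t)) (three_steps A B C) e)"
      unfolding S_eps_eq_rank_one[OF three_steps_admissible(1) qb e]
      by (rule rank_one_resolvent_set[OF P z L2_scale[OF step2_admissible(1) e]])
  qed
  have pos: "eventually (\<lambda>e::real. e > 0) (at_right 0)" by (simp add: eventually_at_right_less)
  show ?thesis
  proof (cases "\<beta> = 0")
    case True
    then have [simp]: "\<alpha> = 1" "\<beta> = 0" using assms(5) by auto
    \<comment> \<open>The zero functions are written as multiples of \<open>step2 1\<close> so that
      \<open>eps\<close> applies.\<close>
    let ?S = "S_eps V (\<lambda>t. 0 * step2 1 t) (\<lambda>t. 0 * (0 * step2 1 t)) (three_steps 0 0 0)"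
    have S: "solves_resolvent_eq (S_ab V 1 0) z g f" if "solves_resolvent_eq (?S e) z g f" for e z g f
      using that dom_S0_subset_S_ab[of f V]
      by (auto simp: solves_resolvent_eq_def S_eps_def B_pert_def three_steps_def)
    have conv: "norm_resolvent_convergence ?S (S_ab V \<alpha> \<beta>) (at_right 0)"
      unfolding norm_resolvent_convergence_def
    proof (intro conjI allI impI ab)
      show "\<forall>\<^sub>F e in at_right 0. - \<real> \<subseteq> resolvent_set (?S e)"
        using pos by eventually_elim (rule eps)
      fix z :: complex assume z: "z \<notin> \<real>"
      have "L2_opnorm (\<lambda>g x. resolvent (?S e) z g x - resolvent (S_ab V \<alpha> \<beta>) z g x) = 0" if e: "e > 0" for e
      proof -
        have "L2norm (\<lambda>x. resolvent (?S e) z g x - resolvent (S_ab V \<alpha> \<beta>) z g x) \<le> 0" if g: "g \<in> L2" for g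
        proof -
          have 1: "solves_resolvent_eq (S_ab V 1 0) z g (resolvent (?S e) z g)"
            by (rule S[OF resolvent_solves[OF _ g]]) (use eps[OF e] z in blast)
          have 2: "solves_resolvent_eq (S_ab V 1 0) z g (resolvent (S_ab V 1 0) z g)"
            by (rule resolvent_solves[OF _ g]) (use ab z in auto)
          have "L2norm (\<lambda>x. resolvent (?S e) z g x - resolvent (S_ab V 1 0) z g x) \<le> L2norm (\<lambda>x. 0::complex) / \<bar>Im z\<bar>"
            using S_ab_solution_bound[OF assms(1,2) Vc nz[OF z] one_neq_zero L2_zero(1) S_ab_diff[OF assms(1,2) Vc nz[OF z] 1 2]]
            by (rule conjunct2)
          then show ?thesis by (simp add: L2_zero)
        qed
        then show ?thesis using L2_opnorm_bounds[of "\<lambda>g x. resolvent (?S e) z g x - resolvent (S_ab V \<alpha> \<beta>) z g x" 0]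
          by (intro antisym) auto
      qed
      then have "\<forall>\<^sub>F e in at_right 0. L2_opnorm (\<lambda>g x. resolvent (?S e) z g x - resolvent (S_ab V \<alpha> \<beta>) z g x) = 0"
        using pos by (auto elim: eventually_mono)
      then show "((\<lambda>e. L2_opnorm (\<lambda>g x. resolvent (?S e) z g x - resolvent (S_ab V \<alpha> \<beta>) z g x)) \<longlongrightarrow> 0) (at_right 0)"
        by (rule tendsto_eventually)
    qed
    show ?thesis
      by (rule exI[of _ "\<lambda>t. 0 * step2 1 t"], rule exI[of _ "\<lambda>t. 0 * (0 * step2 1 t)"], rule exI[of _ "three_steps 0 0 0"])
        (use conv step2_admissible[of 0] three_steps_admissible[of 0 0 0] in simp)
  next
    case \<beta>: False
    define q0 where "q0 = (1 - \<alpha>)\<^sup>2 / (\<alpha> * \<beta>)"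
    define q1 where "q1 = (1 - \<alpha>) / (\<alpha> * \<beta>)"
    define q2 where "q2 = 1 / (\<alpha> * \<beta>)"
    \<comment> \<open>the solution of the linear system \<open>ABC\<close>\<close>
    define C where "C = 60 / 7 * (q1 - q2)"
    define B where "B = q1 - C / 6"
    define A where "A = q0 - B - C"
    have ABC: "A + B + C = q0" "B + C / 6 = q1" "B + C / 20 = q2"
      by (simp_all add: A_def B_def C_def field_simps)
    let ?\<phi> = "\<lambda>t. 1 * step2 1 t"
    \<comment> \<open>The two equal terms of \<open>B_pert\<close> double \<open>-3/4\<close> to the
      coupling constant \<open>-3/2\<close>.\<close>
    let ?S = "S_eps V ?\<phi> (\<lambda>t. - (3 / 4) * ?\<phi> t) (three_steps A B C)"
    let ?q = "three_steps A B C"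
    have qb: "\<bar>three_steps A B C t\<bar> \<le> \<bar>A\<bar> + \<bar>B\<bar> + \<bar>C\<bar>" for t by (auto simp: three_steps_def)
    have Seq: "?S e = rank_one_perturbation (\<lambda>x. V x + 1 / e * ?q (x / e)) (\<lambda>x. step2 1 (x / e)) (- 3 / (2 * e ^ 3))" if "e > 0" for e
      unfolding S_eps_eq_rank_one[OF three_steps_admissible(1) qb that] by simp
    have conv: "norm_resolvent_convergence ?S (S_ab V \<alpha> \<beta>) (at_right 0)"
      unfolding norm_resolvent_convergence_def
    proof (intro conjI allI impI ab)
      show "\<forall>\<^sub>F e in at_right 0. - \<real> \<subseteq> resolvent_set (?S e)"
        using pos by eventually_elim (rule eps)
      fix z :: complex assume z: "z \<notin> \<real>"
      obtain D e0 where e0: "e0 > 0" and D: "\<And>e g f h. 0 < e \<Longrightarrow> e < e0 \<Longrightarrow> g \<in> L2 \<Longrightarrow>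
          solves_resolvent_eq (rank_one_perturbation (\<lambda>x. V x + 1 / e * ?q (x / e)) (\<lambda>x. step2 1 (x / e)) (- 3 / (2 * e ^ 3))) z g f \<Longrightarrow>
          solves_resolvent_eq (S_ab V \<alpha> \<beta>) z g h \<Longrightarrow> (L2norm (\<lambda>x. f x - h x))\<^sup>2 \<le> D * sqrt e * (L2norm g)\<^sup>2"
        using resolvent_difference_bound[OF assms(1,2) Vc nz[OF z] assms(4) \<beta> ABC[unfolded q0_def q1_def q2_def]] by blast
      let ?d = "\<lambda>e. L2_opnorm (\<lambda>g x. resolvent (?S e) z g x - resolvent (S_ab V \<alpha> \<beta>) z g x)"
      \<comment> \<open>The estimate is for squared norms, so the operator norm is of order
        \<open>e\<close> to the power \<open>1/4\<close>; the modulus of \<open>D\<close> keeps the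
        square root meaningful for either sign.\<close>
      have bound: "0 \<le> ?d e \<and> ?d e \<le> sqrt (\<bar>D\<bar> * sqrt e)" if e: "0 < e" "e < e0" for e
      proof -
        have "L2norm (\<lambda>x. resolvent (?S e) z g x - resolvent (S_ab V \<alpha> \<beta>) z g x) \<le> sqrt (\<bar>D\<bar> * sqrt e)"
          if g: "g \<in> L2" "L2norm g \<le> 1" for g
        proof -
          have 1: "solves_resolvent_eq (?S e) z g (resolvent (?S e) z g)"
            by (rule resolvent_solves[OF _ g(1)]) (use eps[OF e(1)] z in blast)
          have 2: "solves_resolvent_eq (S_ab V \<alpha> \<beta>) z g (resolvent (S_ab V \<alpha> \<beta>) z g)"
            by (rule resolvent_solves[OF _ g(1)]) (use ab z in auto)
          have "(L2norm (\<lambda>x. resolvent (?S e) z g x - resolvent (S_ab V \<alpha> \<beta>) z g x))\<^sup>2 \<le> D * sqrt e * (L2norm g)\<^sup>2"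
            by (rule D[OF e g(1) _ 2]) (use 1 in \<open>simp only: Seq[OF e(1)]\<close>)
          also have "\<dots> \<le> \<bar>D\<bar> * sqrt e * 1"
          proof (rule mult_mono)
            show "(L2norm g)\<^sup>2 \<le> 1" using g(2) by (simp add: power_le_one)
          qed (use e in \<open>auto intro: mult_right_mono\<close>)
          finally show ?thesis by (intro real_le_rsqrt) simp
        qed
        then show ?thesis
          using L2_opnorm_bounds[of "\<lambda>g x. resolvent (?S e) z g x - resolvent (S_ab V \<alpha> \<beta>) z g x" "sqrt (\<bar>D\<bar> * sqrt e)"]
          by blast
      qed
      have ev: "\<forall>\<^sub>F e in at_right 0. 0 < e \<and> e < e0"
        using e0 by (auto simp: eventually_at_right_field)
      show "(?d \<longlongrightarrow> 0) (at_right 0)"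
      proof (rule tendsto_sandwich)
        show "\<forall>\<^sub>F e in at_right 0. 0 \<le> ?d e" using ev by eventually_elim (use bound in blast)
        show "\<forall>\<^sub>F e in at_right 0. ?d e \<le> sqrt (\<bar>D\<bar> * sqrt e)" using ev by eventually_elim (use bound in blast)
        have "((\<lambda>e. sqrt (\<bar>D\<bar> * sqrt e)) \<longlongrightarrow> sqrt (\<bar>D\<bar> * sqrt 0)) (at_right 0)"
          by (intro tendsto_intros)
        then show "((\<lambda>e. sqrt (\<bar>D\<bar> * sqrt e)) \<longlongrightarrow> 0) (at_right 0)" by simp
      qed simp
    qed
    show ?thesis
      by (rule exI[of _ ?\<phi>], rule exI[of _ "\<lambda>t. - (3 / 4) * ?\<phi> t"], rule exI[of _ ?q])
        (use conv step2_admissible[of 1] step2_admissible[of "- (3/4)"] three_steps_admissible[of A B C] in simp)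
  qed
qed



end
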